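(* Let $u_{in}\in H^7(\mathbb{T}\times\mathbb{R}\times\mathbb{T})$ be a divergence-free vector field. Then the solution $u(t)$ to the linearized Euler equations $$\partial_t u + y\partial_x u = (-u^2,0,0)^T - \nabla p^L,\qquad \Delta p^L = -2\partial_x u^2,\qquad \nabla\cdot u = 0$$ with initial data $u_{in}$ satisfies, for some final state $u_\infty = (u^1_\infty,0,u^3_\infty)$, $$\|u^2_{\neq}(t)\|_{L^2} + \|u^2_{\neq}(t,x+ty,y,z)\|_{H^3} \lesssim \langle t\rangle^{-2}\|u^2_{in}\|_{H^7},$$ $$\|u^1_{\neq}(t,x+ty,y,z) - u^1_\infty(x,y,z)\|_{H^1} \lesssim \langle t\rangle^{-1}\|u_{in}\|_{H^7},$$ $$\|u^3_{\neq}(t,x+ty,y,z) - u^3_\infty(x,y,z)\|_{H^1} \lesssim \langle t\rangle^{-3}\|u_{in}\|_{H^7},$$ and the formulas $$u^1_0(t,y,z) = u^1_{in\,0}(y,z) - t\,u^2_{in\,0}(y,z),\qquad u^2_0(t,y,z) = u^2_{in\,0}(y,z),\qquad u^3_0(t,y,z) = u^3_{in\,0}(y,z).$$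
   Context: Domain $(x,y,z)\in\mathbb{T}\times\mathbb{R}\times\mathbb{T}$, $\mathbb{T}=\mathbb{R}/2\pi\mathbb{Z}$; $u=(u^1,u^2,u^3)$ and $t\ge 0$. $f_0(y,z)=\frac{1}{2\pi}\int f\,dx$ is the $x$-average, $f_{\neq}=f-f_0$, and $u^i_{in\,0}$ is the $x$-average of $u^i_{in}$. $\langle t\rangle=(1+t^2)^{1/2}$. $H^\sigma$ is the $L^2$-based Sobolev space of order $\sigma$. $A\lesssim B$ means $A\le CB$ with $C$ independent of $t$ and $u_{in}$. *)

theory Defs
  imports "HOL-Analysis.Analysis"
begin

text \<open>
  The domain \<open>\<bbbT> \<times> \<real> \<times> \<bbbT>\<close> with \<open>\<bbbT> = \<real>/2\<pi>\<int>\<close> is represented by \<open>\<real>\<^sup>3\<close>: a function on it is a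
  function of \<open>(x, y, z)\<close> that is \<open>2\<pi>\<close>-periodic in \<open>x\<close> and in \<open>z\<close>, and integrals are taken over one
  period cell.
\<close>

type_synonym point = "real \<times> real \<times> real"
type_synonym scalar_field = "point \<Rightarrow> real"
type_synonym vector_field = "point \<Rightarrow> real ^ 3"

definition periodic_xz :: "scalar_field \<Rightarrow> bool" where
  "periodic_xz f \<longleftrightarrow> (\<forall>x y z. f (x + 2 * pi, y, z) = f (x, y, z) \<and> f (x, y, z + 2 * pi) = f (x, y, z))"

definition cell :: "point set" where
  "cell = {0..2 * pi} \<times> UNIV \<times> {0..2 * pi}"

abbreviation component :: "vector_field \<Rightarrow> 3 \<Rightarrow> scalar_field" where
  "component v i \<equiv> (\<lambda>X. v X $ i)"


subsection \<open>Classical derivatives and test functions\<close>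

text \<open>The coordinates \<open>x, y, z\<close> carry the indices \<open>1, 2, 3\<close>; in the index type, \<open>3 = 0\<close>.\<close>

definition pd :: "3 \<Rightarrow> scalar_field \<Rightarrow> scalar_field" where
  "pd i f = (\<lambda>(x, y, z).
     if i = 1 then deriv (\<lambda>s. f (s, y, z)) x
     else if i = 2 then deriv (\<lambda>s. f (x, s, z)) y
     else deriv (\<lambda>s. f (x, y, s)) z)"

type_synonym multi_index = "nat \<times> nat \<times> nat"

definition order_of :: "multi_index \<Rightarrow> nat" where
  "order_of = (\<lambda>(a, b, c). a + b + c)"

definition pd_multi :: "multi_index \<Rightarrow> scalar_field \<Rightarrow> scalar_field" where
  "pd_multi = (\<lambda>(a, b, c) f. (pd 1 ^^ a) ((pd 2 ^^ b) ((pd 3 ^^ c) f)))"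

text \<open>
  Smoothness: every \<open>\<partial>\<^sub>x\<^sup>a \<partial>\<^sub>y\<^sup>b \<partial>\<^sub>z\<^sup>c \<phi>\<close> is (Frechet) differentiable everywhere; other orderings of
  the partial derivatives need not be listed, as mixed partials then commute. Compact support in
  \<open>\<bbbT> \<times> \<real> \<times> \<bbbT>\<close> restricts only the \<open>y\<close> variable.
\<close>

definition test_function :: "scalar_field \<Rightarrow> bool" where
  "test_function \<phi> \<longleftrightarrow>
     (\<forall>\<alpha>. pd_multi \<alpha> \<phi> differentiable_on UNIV) \<and> periodic_xz \<phi> \<and>
     (\<exists>R. \<forall>x y z. \<bar>y\<bar> > R \<longrightarrow> \<phi> (x, y, z) = 0)"


subsection \<open>Sobolev spaces of integer order\<close>

definition L2_space :: "scalar_field set" where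
  "L2_space = {f. f \<in> borel_measurable borel \<and> periodic_xz f \<and>
                  set_integrable lborel cell (\<lambda>X. (f X)\<^sup>2)}"

definition L2_norm :: "scalar_field \<Rightarrow> real" where
  "L2_norm f = sqrt (LINT X:cell|lborel. (f X)\<^sup>2)"

definition has_weak_deriv :: "scalar_field \<Rightarrow> multi_index \<Rightarrow> scalar_field \<Rightarrow> bool" where
  "has_weak_deriv f \<alpha> g \<longleftrightarrow>
     (\<forall>\<phi>. test_function \<phi> \<longrightarrow>
        (LINT X:cell|lborel. f X * pd_multi \<alpha> \<phi> X) =
        (-1) ^ order_of \<alpha> * (LINT X:cell|lborel. g X * \<phi> X))"

text \<open>
  An \<open>L\<^sup>2\<close> weak derivative is unique up to a null set; \<open>weak_deriv\<close> picks a representative.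
  It is meaningful only if an \<open>L\<^sup>2\<close> weak derivative exists, so \<open>sobolev_norm m f\<close> is meaningful
  only for \<open>f \<in> sobolev m\<close>.
\<close>

definition weak_deriv :: "multi_index \<Rightarrow> scalar_field \<Rightarrow> scalar_field" where
  "weak_deriv \<alpha> f = (SOME g. g \<in> L2_space \<and> has_weak_deriv f \<alpha> g)"

definition sobolev :: "nat \<Rightarrow> scalar_field set" where
  "sobolev m = {f \<in> L2_space. \<forall>\<alpha>. order_of \<alpha> \<le> m \<longrightarrow> (\<exists>g \<in> L2_space. has_weak_deriv f \<alpha> g)}"

definition sobolev_norm :: "nat \<Rightarrow> scalar_field \<Rightarrow> real" where
  "sobolev_norm m f = sqrt (\<Sum>\<alpha> | order_of \<alpha> \<le> m. (L2_norm (weak_deriv \<alpha> f))\<^sup>2)"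

lemma finite_multi_indices: "finite {\<alpha>. order_of \<alpha> \<le> m}"
  by (rule finite_subset[of _ "{..m} \<times> {..m} \<times> {..m}"]) (auto simp: order_of_def)

definition sobolev_vec :: "nat \<Rightarrow> vector_field set" where
  "sobolev_vec m = {v. \<forall>i. component v i \<in> sobolev m}"

definition sobolev_vec_norm :: "nat \<Rightarrow> vector_field \<Rightarrow> real" where
  "sobolev_vec_norm m v = sqrt (\<Sum>i\<in>UNIV. (sobolev_norm m (component v i))\<^sup>2)"


subsection \<open>Averages in \<open>x\<close>, moving frame\<close>

definition x_average :: "scalar_field \<Rightarrow> real \<times> real \<Rightarrow> real" where
  "x_average f = (\<lambda>(y, z). (1 / (2 * pi)) * (LINT x:{0..2 * pi}|lborel. f (x, y, z)))"

definition x_nonzero :: "scalar_field \<Rightarrow> scalar_field" where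
  "x_nonzero f = (\<lambda>(x, y, z). f (x, y, z) - x_average f (y, z))"

definition moving_frame :: "real \<Rightarrow> scalar_field \<Rightarrow> scalar_field" where
  "moving_frame t f = (\<lambda>(x, y, z). f (x + t * y, y, z))"

definition japanese_bracket :: "real \<Rightarrow> real" where
  "japanese_bracket t = sqrt (1 + t\<^sup>2)"


subsection \<open>The linearized Euler equations\<close>

definition unit_index :: "3 \<Rightarrow> multi_index" where
  "unit_index i = (if i = 1 then (1, 0, 0) else if i = 2 then (0, 1, 0) else (0, 0, 1))"

definition double_index :: "3 \<Rightarrow> multi_index" where
  "double_index i = (if i = 1 then (2, 0, 0) else if i = 2 then (0, 2, 0) else (0, 0, 2))"

definition divergence_free :: "vector_field \<Rightarrow> bool" where
  "divergence_free v \<longleftrightarrow>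
     (AE X in lborel. (\<Sum>i\<in>UNIV. weak_deriv (unit_index i) (component v i) X) = 0)"

text \<open>
  Time derivative at \<open>t \<ge> 0\<close> (one-sided at \<open>t = 0\<close>) of a curve of functions, as the limit of
  difference quotients in \<open>L\<^sup>2\<close> of every slab \<open>\<bar>y\<bar> \<le> R\<close>. The localisation is needed because
  \<open>y \<partial>\<^sub>x u\<close> need not be square integrable over the unbounded domain.
\<close>

definition has_time_deriv :: "(real \<Rightarrow> scalar_field) \<Rightarrow> scalar_field \<Rightarrow> real \<Rightarrow> bool" where
  "has_time_deriv f g t \<longleftrightarrow>
     (\<forall>R. ((\<lambda>s. LINT X:(cell \<inter> {(x, y, z). \<bar>y\<bar> \<le> R})|lborel.
               ((f s X - f t X) / (s - t) - g X)\<^sup>2) \<longlongrightarrow> 0) (at t within {0..}))"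

text \<open>
  Solutions are taken in \<open>C([0,\<infinity>); H\<^sup>7)\<close>; the pressure is the one in \<open>H\<^sup>2\<close>. The momentum equation
  is solved for \<open>\<partial>\<^sub>t u\<close>.
\<close>

definition linearized_euler_solution ::
    "vector_field \<Rightarrow> (real \<Rightarrow> vector_field) \<Rightarrow> (real \<Rightarrow> scalar_field) \<Rightarrow> bool" where
  "linearized_euler_solution u_in u p \<longleftrightarrow>
     (\<forall>t\<ge>0. u t \<in> sobolev_vec 7 \<and> p t \<in> sobolev 2) \<and>
     (\<forall>t\<ge>0. ((\<lambda>s. sobolev_vec_norm 7 (\<lambda>X. u s X - u t X)) \<longlongrightarrow> 0) (at t within {0..})) \<and>
     (AE X in lborel. u 0 X = u_in X) \<and>
     (\<forall>t\<ge>0. \<forall>i.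
        has_time_deriv (\<lambda>s. component (u s) i)
          (\<lambda>(x, y, z). - y * weak_deriv (unit_index 1) (component (u t) i) (x, y, z)
                       - (if i = 1 then u t (x, y, z) $ 2 else 0)
                       - weak_deriv (unit_index i) (p t) (x, y, z)) t) \<and>
     (\<forall>t\<ge>0. AE X in lborel.
        (\<Sum>i\<in>UNIV. weak_deriv (double_index i) (p t) X) =
        - 2 * weak_deriv (unit_index 1) (component (u t) 2) X) \<and>
     (\<forall>t\<ge>0. divergence_free (u t))"

end

theory Submission
  imports Defs "HOL-Computational_Algebra.Polynomial"
begin

text \<open>
  In the sheared frequencies \<open>(k, \<eta> - k t, l)\<close> of the moving frame the transport term disappears,
  and the Laplacian of \<open>u\<^sup>2\<close> is conserved, because its commutator with \<open>y \<partial>\<^sub>x\<close> is cancelled by the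
  pressure. Hence \<open>u\<^sup>2\<close> has the Fourier transform \<open>(k\<^sup>2 + \<eta>\<^sup>2 + l\<^sup>2) / (k\<^sup>2 + (\<eta> - k t)\<^sup>2 + l\<^sup>2)\<close> times
  the initial one, and \<open>1 + t\<^sup>2 \<le> 2 (k\<^sup>2 + \<eta>\<^sup>2 + l\<^sup>2) (k\<^sup>2 + (\<eta> - k t)\<^sup>2 + l\<^sup>2)\<close> for \<open>k \<noteq> 0\<close> trades
  regularity for decay. The pressure gains another factor of this kind, so in the moving frame the time
  derivatives of \<open>u\<^sup>1\<close> and \<open>u\<^sup>3\<close> are \<open>O(t\<^sup>-\<^sup>2)\<close> and \<open>O(t\<^sup>-\<^sup>4)\<close>, and integrating them to infinity gives
  the final state. At \<open>k = 0\<close> the pressure vanishes, and the averages solve trivial equations.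
\<close>

section \<open>Square integrable functions\<close>

text \<open>A field in \<open>L2_space\<close> has a Fourier transform only up to null sets,
  \<open>y \<partial>\<^sub>x u\<close> may fail to be square integrable, and the time derivative
  exists only in L2 of slabs, so the equation cannot be transformed as it stands. Everything is
  therefore first paired with plane waves times a compactly supported function of y. Such a
  localised coefficient is an absolutely convergent integral at every single frequency, and it
  satisfies an ordinary differential equation in t there. Since the shear fixes y, the localisation
  commutes with the moving frame and with x-averages; it does not commute with
  \<open>\<partial>\<^sub>y\<close>, and the extra terms are the same coefficients with a derivative
  of the bump in place of the bump. Conservation laws thus hold exactly for each bump, and the
  cutoff is removed at one fixed time, so no limit is exchanged with a time derivative. Integration
  in time is done by duality: pairings with finite trigonometric sums are scalar functions of t, to
  which a mean value inequality applies. The order 7 is 3 + 4 for u2 (two factors 1 + |\<xi>|^2) and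
  1 + 6 for u1 and u3 (three factors).\<close>

definition sqint :: "'a measure \<Rightarrow> ('a \<Rightarrow> 'b::{banach,second_countable_topology}) \<Rightarrow> bool" where
  "sqint M f \<longleftrightarrow> f \<in> borel_measurable M \<and> integrable M (\<lambda>x. (norm (f x))\<^sup>2)"

text \<open>Stated through \<open>norm\<close>, so that real fields and complex transforms share one
  theory. The value is 0 by default when the square is not integrable, which is why most statements
  about \<open>l2n\<close> come with \<open>sqint\<close>.\<close>

definition l2n :: "'a measure \<Rightarrow> ('a \<Rightarrow> 'b::{banach,second_countable_topology}) \<Rightarrow> real" where
  "l2n M f = sqrt (\<integral>x. (norm (f x))\<^sup>2 \<partial>M)"

lemma sqint_measurable: "sqint M f \<Longrightarrow> f \<in> borel_measurable M"
  and sqint_integrable: "sqint M f \<Longrightarrow> integrable M (\<lambda>x. (norm (f x))\<^sup>2)"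
  by (auto simp: sqint_def)

lemma sqintI_nn:
  assumes [measurable]: "f \<in> borel_measurable M" and "(\<integral>\<^sup>+x. ennreal ((norm (f x))\<^sup>2) \<partial>M) < \<infinity>"
  shows "sqint M f"
  unfolding sqint_def by (intro conjI integrableI_bounded) (use assms in auto)

lemma l2n_nonneg [simp]: "0 \<le> l2n M f"
  by (simp add: l2n_def)

lemma l2n_sq: "(l2n M f)\<^sup>2 = (\<integral>x. (norm (f x))\<^sup>2 \<partial>M)"
  by (simp add: l2n_def)

lemma nn_l2n: "sqint M f \<Longrightarrow> (\<integral>\<^sup>+x. ennreal ((norm (f x))\<^sup>2) \<partial>M) = ennreal ((l2n M f)\<^sup>2)"
  unfolding l2n_sq by (rule nn_integral_eq_integral) (auto simp: sqint_def)

lemma l2n_cong_AE: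
  assumes "AE x in M. norm (f x) = norm (g x)" "f \<in> borel_measurable M" "g \<in> borel_measurable M"
  shows "l2n M f = l2n M g"
  unfolding l2n_def by (intro arg_cong[where f=sqrt] integral_cong_AE) (use assms in auto)

lemma l2n_minus_commute: "l2n M (\<lambda>x. f x - g x) = l2n M (\<lambda>x. g x - f x)"
  by (simp add: l2n_def norm_minus_commute)

lemma sqint_bound:
  assumes "sqint M f" "g \<in> borel_measurable M" "AE x in M. norm (g x) \<le> C * norm (f x)"
  shows "sqint M g"
  unfolding sqint_def
proof
  show "integrable M (\<lambda>x. (norm (g x))\<^sup>2)"
  proof (rule Bochner_Integration.integrable_bound)
    show "integrable M (\<lambda>x. C\<^sup>2 * (norm (f x))\<^sup>2)"
      using assms(1) by (auto simp: sqint_def)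
    show "AE x in M. norm ((norm (g x))\<^sup>2) \<le> norm (C\<^sup>2 * (norm (f x))\<^sup>2)"
      using assms(3)
    proof eventually_elim
      case (elim x)
      then have "(norm (g x))\<^sup>2 \<le> (C * norm (f x))\<^sup>2" by (intro power_mono) auto
      then show ?case by (simp add: power_mult_distrib)
    qed
  qed (use assms(2) in auto)
qed (use assms in auto)

lemma l2n_bound:
  assumes "sqint M f" "g \<in> borel_measurable M" "AE x in M. norm (g x) \<le> C * norm (f x)" "0 \<le> C"
  shows "l2n M g \<le> C * l2n M f"
proof -
  have "(l2n M g)\<^sup>2 \<le> (\<integral>x. C\<^sup>2 * (norm (f x))\<^sup>2 \<partial>M)"
    unfolding l2n_sq
  proof (rule integral_mono_AE)
    show "integrable M (\<lambda>x. (norm (g x))\<^sup>2)"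
      using sqint_bound[OF assms(1-3)] by (auto simp: sqint_def)
    show "AE x in M. (norm (g x))\<^sup>2 \<le> C\<^sup>2 * (norm (f x))\<^sup>2"
      using assms(3)
    proof eventually_elim
      case (elim x)
      then have "(norm (g x))\<^sup>2 \<le> (C * norm (f x))\<^sup>2" by (intro power_mono) auto
      then show ?case by (simp add: power_mult_distrib)
    qed
  qed (use assms(1) in \<open>auto simp: sqint_def\<close>)
  also have "\<dots> = (C * l2n M f)\<^sup>2"
    by (simp add: power_mult_distrib l2n_sq)
  finally show ?thesis by (rule power2_le_imp_le) (use assms(4) in simp)
qed

lemma sqint_scaleR: "sqint M f \<Longrightarrow> sqint M (\<lambda>x. c *\<^sub>R f x)"
  by (rule sqint_bound[where C="\<bar>c\<bar>" and f=f]) (auto simp: sqint_def)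

lemma l2n_scaleR: "l2n M (\<lambda>x. c *\<^sub>R f x) = \<bar>c\<bar> * l2n M f"
  by (simp add: l2n_def power_mult_distrib real_sqrt_mult)

lemma sqint_minus: "sqint M f \<Longrightarrow> sqint M (\<lambda>x. - f x)"
  using sqint_scaleR[of M f "-1"] by simp

lemma sqint_add:
  assumes "sqint M f" "sqint M g"
  shows "sqint M (\<lambda>x. f x + g x)"
  unfolding sqint_def
proof
  show "integrable M (\<lambda>x. (norm (f x + g x))\<^sup>2)"
  proof (rule Bochner_Integration.integrable_bound)
    show "integrable M (\<lambda>x. 2 * (norm (f x))\<^sup>2 + 2 * (norm (g x))\<^sup>2)"
      using assms by (auto simp: sqint_def)
    have "(norm (f x + g x))\<^sup>2 \<le> 2 * (norm (f x))\<^sup>2 + 2 * (norm (g x))\<^sup>2" for x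
    proof -
      have "(norm (f x + g x))\<^sup>2 \<le> (norm (f x) + norm (g x))\<^sup>2"
        by (intro power_mono norm_triangle_ineq) auto
      also have "\<dots> \<le> 2 * (norm (f x))\<^sup>2 + 2 * (norm (g x))\<^sup>2"
        using zero_le_power2[of "norm (f x) - norm (g x)"] by (simp add: power2_eq_square algebra_simps)
      finally show ?thesis .
    qed
    then show "AE x in M. norm ((norm (f x + g x))\<^sup>2) \<le> norm (2 * (norm (f x))\<^sup>2 + 2 * (norm (g x))\<^sup>2)"
      by (intro AE_I2) auto
  qed (use assms in \<open>auto simp: sqint_def\<close>)
qed (use assms in \<open>auto simp: sqint_def\<close>)

lemma sqint_diff: "sqint M f \<Longrightarrow> sqint M g \<Longrightarrow> sqint M (\<lambda>x. f x - g x)"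
  using sqint_add[of M f "\<lambda>x. - g x"] sqint_minus[of M g] by simp

lemma sqint_zero [simp]: "sqint M (\<lambda>x. 0)"
  by (simp add: sqint_def)

lemma sqint_sum: "(\<And>i. i \<in> I \<Longrightarrow> sqint M (f i)) \<Longrightarrow> sqint M (\<lambda>x. \<Sum>i\<in>I. f i x)"
  by (induction I rule: infinite_finite_induct) (auto intro: sqint_add)

lemma integrable_mult_sqint:
  assumes "sqint M f" "sqint M g"
  shows "integrable M (\<lambda>x. norm (f x) * norm (g x))"
proof (rule Bochner_Integration.integrable_bound)
  show "integrable M (\<lambda>x. (norm (f x))\<^sup>2 + (norm (g x))\<^sup>2)"
    using assms by (auto simp: sqint_def)
  have "norm (f x) * norm (g x) \<le> (norm (f x))\<^sup>2 + (norm (g x))\<^sup>2" for x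
    using zero_le_power2[of "norm (f x) - norm (g x)"] zero_le_power2[of "norm (f x)"] zero_le_power2[of "norm (g x)"]
    by (simp add: power2_eq_square algebra_simps) (use mult_nonneg_nonneg[OF norm_ge_zero[of "f x"] norm_ge_zero[of "g x"]] in linarith)
  then show "AE x in M. norm (norm (f x) * norm (g x)) \<le> norm ((norm (f x))\<^sup>2 + (norm (g x))\<^sup>2)"
    by (intro AE_I2) auto
qed (use assms in \<open>auto simp: sqint_def\<close>)

lemma l2n_eq_0_iff: "sqint M f \<Longrightarrow> l2n M f = 0 \<longleftrightarrow> (AE x in M. f x = 0)"
  unfolding l2n_def by (simp add: integral_nonneg_eq_0_iff_AE sqint_def)

lemma cauchy_schwarz_l2n:
  assumes "sqint M f" "sqint M g"
  shows "(\<integral>x. norm (f x) * norm (g x) \<partial>M) \<le> l2n M f * l2n M g"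
proof -
  note int = integrable_mult_sqint[OF assms]
  let ?a = "l2n M f" and ?b = "l2n M g"
  consider "?a = 0" | "?b = 0" | "?a > 0" "?b > 0"
    using l2n_nonneg[of M f] l2n_nonneg[of M g] by linarith
  then show ?thesis
  proof cases
    case 1
    then have "AE x in M. f x = 0" using assms by (simp add: l2n_eq_0_iff)
    then have "(\<integral>x. norm (f x) * norm (g x) \<partial>M) = (\<integral>x. 0 \<partial>M)"
      using int by (intro integral_cong_AE) auto
    then show ?thesis by simp
  next
    case 2
    then have "AE x in M. g x = 0" using assms by (simp add: l2n_eq_0_iff)
    then have "(\<integral>x. norm (f x) * norm (g x) \<partial>M) = (\<integral>x. 0 \<partial>M)"
      using int by (intro integral_cong_AE) auto
    then show ?thesis by simp
  next
    \<comment> \<open>Young's inequality with the weights b/(2a) and a/(2b), for which both terms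
      integrate to ab/2.\<close>
    case 3
    have "(\<integral>x. norm (f x) * norm (g x) \<partial>M) \<le>
        (\<integral>x. ?b / (2 * ?a) * (norm (f x))\<^sup>2 + ?a / (2 * ?b) * (norm (g x))\<^sup>2 \<partial>M)"
    proof (rule integral_mono[OF int])
      fix x
      have "0 \<le> (?b * norm (f x) - ?a * norm (g x))\<^sup>2" by simp
      then show "norm (f x) * norm (g x) \<le> ?b / (2 * ?a) * (norm (f x))\<^sup>2 + ?a / (2 * ?b) * (norm (g x))\<^sup>2"
        using 3 by (simp add: field_simps power2_eq_square)
    qed (use assms in \<open>auto simp: sqint_def\<close>)
    also have "\<dots> = ?b / (2 * ?a) * ?a\<^sup>2 + ?a / (2 * ?b) * ?b\<^sup>2"
      using assms by (simp add: l2n_sq sqint_def)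
    also have "\<dots> = ?a * ?b" using 3 by (simp add: field_simps power2_eq_square)
    finally show ?thesis .
  qed
qed

lemma l2n_triangle:
  assumes "sqint M f" "sqint M g"
  shows "l2n M (\<lambda>x. f x + g x) \<le> l2n M f + l2n M g"
proof -
  have "(l2n M (\<lambda>x. f x + g x))\<^sup>2 \<le> (\<integral>x. (norm (f x))\<^sup>2 + 2 * (norm (f x) * norm (g x)) + (norm (g x))\<^sup>2 \<partial>M)"
    unfolding l2n_sq
  proof (rule integral_mono)
    show "integrable M (\<lambda>x. (norm (f x + g x))\<^sup>2)" using sqint_add[OF assms] by (simp add: sqint_def)
    show "integrable M (\<lambda>x. (norm (f x))\<^sup>2 + 2 * (norm (f x) * norm (g x)) + (norm (g x))\<^sup>2)"
      using assms integrable_mult_sqint[OF assms] by (auto simp: sqint_def)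
    fix x
    have "(norm (f x + g x))\<^sup>2 \<le> (norm (f x) + norm (g x))\<^sup>2"
      by (intro power_mono norm_triangle_ineq) auto
    then show "(norm (f x + g x))\<^sup>2 \<le> (norm (f x))\<^sup>2 + 2 * (norm (f x) * norm (g x)) + (norm (g x))\<^sup>2"
      by (simp add: power2_eq_square algebra_simps)
  qed
  also have "\<dots> = (l2n M f)\<^sup>2 + 2 * (\<integral>x. norm (f x) * norm (g x) \<partial>M) + (l2n M g)\<^sup>2"
    using assms integrable_mult_sqint[OF assms] by (simp add: l2n_sq sqint_def)
  also have "\<dots> \<le> (l2n M f + l2n M g)\<^sup>2"
    using cauchy_schwarz_l2n[OF assms] by (simp add: power2_eq_square algebra_simps)
  finally show ?thesis by (rule power2_le_imp_le) simp
qed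

lemma l2n_triangle_diff:
  assumes "sqint M f" "sqint M g" "sqint M h"
  shows "l2n M (\<lambda>x. f x - h x) \<le> l2n M (\<lambda>x. f x - g x) + l2n M (\<lambda>x. g x - h x)"
  using l2n_triangle[OF sqint_diff[OF assms(1,2)] sqint_diff[OF assms(2,3)]] by simp

lemma l2n_diff_ge:
  assumes "sqint M f" "sqint M g"
  shows "\<bar>l2n M f - l2n M g\<bar> \<le> l2n M (\<lambda>x. f x - g x)"
  using l2n_triangle[OF sqint_diff[OF assms] assms(2)] l2n_triangle[OF sqint_diff[OF assms(2,1)] assms(1)]
    l2n_minus_commute[of M f g] by simp

lemma l2n_tendsto:
  assumes "\<And>n. sqint M (f n)" "sqint M g" "(\<lambda>n. l2n M (\<lambda>x. f n x - g x)) \<longlonglongrightarrow> 0"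
  shows "(\<lambda>n. l2n M (f n)) \<longlonglongrightarrow> l2n M g"
proof -
  have "(\<lambda>n. l2n M (f n) - l2n M g) \<longlonglongrightarrow> 0"
    by (rule Lim_null_comparison[OF _ assms(3)]) (use l2n_diff_ge[OF assms(1,2)] in auto)
  then show ?thesis by (simp add: LIM_zero_iff)
qed

lemma l2_limit_unique:
  assumes "\<And>n. sqint M (f n)" "sqint M g" "sqint M h"
    "(\<lambda>n. l2n M (\<lambda>x. f n x - g x)) \<longlonglongrightarrow> 0" "(\<lambda>n. l2n M (\<lambda>x. f n x - h x)) \<longlonglongrightarrow> 0"
  shows "AE x in M. g x = h x"
proof -
  have "l2n M (\<lambda>x. g x - h x) \<le> l2n M (\<lambda>x. f n x - g x) + l2n M (\<lambda>x. f n x - h x)" for n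
    using l2n_triangle_diff[OF assms(2,1,3), of n] by (simp add: l2n_minus_commute)
  moreover have "(\<lambda>n. l2n M (\<lambda>x. f n x - g x) + l2n M (\<lambda>x. f n x - h x)) \<longlonglongrightarrow> 0"
    using tendsto_add[OF assms(4,5)] by simp
  ultimately have "l2n M (\<lambda>x. g x - h x) \<le> 0"
    by (intro LIMSEQ_le_const) auto
  then have "l2n M (\<lambda>x. g x - h x) = 0" using l2n_nonneg[of M "\<lambda>x. g x - h x"] by linarith
  then show ?thesis using l2n_eq_0_iff[OF sqint_diff[OF assms(2,3)]] by simp
qed

text \<open>Fatou's lemma for the squared norms. The bound is asked for only eventually, which is
  what a Cauchy sequence offers.\<close>

lemma l2n_le_of_AE_limit:
  assumes [measurable]: "\<And>n. f n \<in> borel_measurable M" "g \<in> borel_measurable M"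
    and lim: "AE x in M. (\<lambda>n. f n x) \<longlonglongrightarrow> g x"
    and "\<And>n. sqint M (f n)" "eventually (\<lambda>n. l2n M (f n) \<le> C) sequentially"
  shows "sqint M g \<and> l2n M g \<le> C"
proof -
  have C: "0 \<le> C"
    using assms(5) l2n_nonneg order_trans unfolding eventually_sequentially by blast
  have "(\<integral>\<^sup>+x. ennreal ((norm (g x))\<^sup>2) \<partial>M) = (\<integral>\<^sup>+x. liminf (\<lambda>n. ennreal ((norm (f n x))\<^sup>2)) \<partial>M)"
  proof (rule nn_integral_cong_AE, use lim in eventually_elim)
    case (elim x)
    have "(\<lambda>n. ennreal ((norm (f n x))\<^sup>2)) \<longlonglongrightarrow> ennreal ((norm (g x))\<^sup>2)"
      by (intro tendsto_intros tendsto_ennrealI elim)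
    then show ?case by (metis lim_imp_Liminf trivial_limit_sequentially)
  qed
  also have "\<dots> \<le> liminf (\<lambda>n. \<integral>\<^sup>+x. ennreal ((norm (f n x))\<^sup>2) \<partial>M)"
    by (rule nn_integral_liminf) simp
  also have "\<dots> \<le> ennreal (C\<^sup>2)"
  proof -
    have "liminf (\<lambda>n. \<integral>\<^sup>+x. ennreal ((norm (f n x))\<^sup>2) \<partial>M) \<le> liminf (\<lambda>n. ennreal (C\<^sup>2))"
      by (rule Liminf_mono) (use assms(5) in eventually_elim, auto simp: nn_l2n[OF assms(4)] intro!: ennreal_leI power_mono)
    then show ?thesis by (simp add: Liminf_const)
  qed
  finally have *: "(\<integral>\<^sup>+x. ennreal ((norm (g x))\<^sup>2) \<partial>M) \<le> ennreal (C\<^sup>2)" .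
  then have sq: "sqint M g" by (intro sqintI_nn) (auto simp: less_top[symmetric] top_unique)
  have "(l2n M g)\<^sup>2 \<le> C\<^sup>2"
    using * unfolding nn_l2n[OF sq] by (simp add: ennreal_le_iff)
  then show ?thesis using sq C power2_le_imp_le by auto
qed

text \<open>Riesz-Fischer, with the limit written out as a pointwise \<open>lim\<close> along a
  subsequence: this form lets \<open>L2_space_complete\<close> see that periodicity survives, even
  at points where the subsequence diverges.\<close>

lemma l2_complete:
  fixes f :: "nat \<Rightarrow> 'a \<Rightarrow> 'b::{banach,second_countable_topology}"
  assumes sq: "\<And>n. sqint M (f n)"
    and cauchy: "\<And>e. e > 0 \<Longrightarrow> \<exists>N. \<forall>m\<ge>N. \<forall>n\<ge>N. l2n M (\<lambda>x. f m x - f n x) < e"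
  obtains r :: "nat \<Rightarrow> nat" where "strict_mono r"
    "sqint M (\<lambda>x. lim (\<lambda>i. f (r i) x))"
    "(\<lambda>n. l2n M (\<lambda>x. f n x - lim (\<lambda>i. f (r i) x))) \<longlonglongrightarrow> 0"
proof -
  have [measurable]: "f n \<in> borel_measurable M" for n using sq by (simp add: sqint_def)
  obtain N where N: "\<And>i m n. m \<ge> N i \<Longrightarrow> n \<ge> N i \<Longrightarrow> l2n M (\<lambda>x. f m x - f n x) < (1/4)^i"
    using cauchy[of "(1/4)^i" for i] by (metis zero_less_divide_1_iff zero_less_numeral zero_less_power)
  define r where "r = rec_nat (N 0) (\<lambda>i ri. max (Suc ri) (N (Suc i)))"
  have r_Suc: "r (Suc i) = max (Suc (r i)) (N (Suc i))" for i by (simp add: r_def)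
  have r0: "r 0 = N 0" by (simp add: r_def)
  have r: "strict_mono r" by (rule strict_monoI_Suc) (auto simp: r_Suc)
  have rN: "r i \<ge> N i" for i by (cases i) (auto simp: r_Suc r0)
  have step: "l2n M (\<lambda>x. f (r (Suc i)) x - f (r i) x) \<le> (1/4)^i" for i
    by (rule less_imp_le, rule N) (use rN[of i] strict_mono_less_eq[OF r, of i "Suc i"] in simp_all)
  \<comment> \<open>The increments have norm at most (1/4)^i, so the weighted squares 4^i s_i^2 have
    integrals at most (1/4)^i and a finite sum almost everywhere. This forces s_i to be at most a
    constant times (1/2)^i there, hence absolute convergence.\<close>
  define s where "s i x = norm (f (r (Suc i)) x - f (r i) x)" for i x
  have [measurable]: "s i \<in> borel_measurable M" for i unfolding s_def by measurable
  have "(\<integral>\<^sup>+x. (\<Sum>i. ennreal (4^i * (s i x)\<^sup>2)) \<partial>M) = (\<Sum>i. \<integral>\<^sup>+x. ennreal (4^i * (s i x)\<^sup>2) \<partial>M)"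
    by (rule nn_integral_suminf) simp
  also have "\<dots> \<le> (\<Sum>i. ennreal ((1/4)^i))"
  proof (rule suminf_le)
    fix i
    have "(\<integral>\<^sup>+x. ennreal (4^i * (s i x)\<^sup>2) \<partial>M) = ennreal (4^i) * (\<integral>\<^sup>+x. ennreal ((s i x)\<^sup>2) \<partial>M)"
      by (subst nn_integral_cmult[symmetric]) (auto simp: ennreal_mult)
    also have "\<dots> = ennreal (4^i) * ennreal ((l2n M (\<lambda>x. f (r (Suc i)) x - f (r i) x))\<^sup>2)"
      unfolding s_def by (subst nn_l2n[OF sqint_diff[OF sq sq]]) simp
    also have "\<dots> \<le> ennreal (4^i) * ennreal (((1/4)^i)\<^sup>2)"
      by (intro mult_left_mono ennreal_leI power_mono step) auto
    also have "\<dots> = ennreal (4^i * ((1/4)^i)\<^sup>2)"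
      by (simp add: ennreal_mult)
    also have "(4::real)^i * ((1/4)^i)\<^sup>2 = (4^i * (1/4)^i) * (1/4)^i"
      by (simp only: power2_eq_square mult.assoc)
    also have "\<dots> = (1/4)^i"
      by (simp only: power_mult_distrib[symmetric]) simp
    finally show "(\<integral>\<^sup>+x. ennreal (4^i * (s i x)\<^sup>2) \<partial>M) \<le> ennreal ((1/4)^i)" .
  qed auto
  also have "\<dots> = ennreal (\<Sum>i. (1/4)^i)"
    by (rule suminf_ennreal2) (auto intro: summable_geometric)
  also have "\<dots> < \<infinity>" by simp
  finally have "AE x in M. (\<Sum>i. ennreal (4^i * (s i x)\<^sup>2)) \<noteq> \<infinity>"
    by (intro nn_integral_PInf_AE) auto
  then have conv: "AE x in M. convergent (\<lambda>i. f (r i) x)"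
  proof eventually_elim
    case (elim x)
    define C where "C = enn2real (\<Sum>i. ennreal (4^i * (s i x)\<^sup>2))"
    have C: "C \<ge> 0" "(\<Sum>i. ennreal (4^i * (s i x)\<^sup>2)) = ennreal C"
      using elim unfolding C_def by (simp_all only: enn2real_nonneg infinity_ennreal_def less_top ennreal_enn2real)
    have "s i x \<le> sqrt C * (1/2)^i" for i
    proof -
      have "(\<Sum>j\<in>{i}. ennreal (4^j * (s j x)\<^sup>2)) \<le> (\<Sum>i. ennreal (4^i * (s i x)\<^sup>2))"
        by (rule sum_le_suminf) (rule summableI, simp, simp)
      then have "ennreal (4^i * (s i x)\<^sup>2) \<le> ennreal C"
        by (simp only: C(2)) simp
      then have "4^i * (s i x)\<^sup>2 \<le> C" using C(1) by (simp add: ennreal_le_iff)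
      moreover have four: "((2::real)^i)\<^sup>2 = 4^i"
        by (simp only: power2_eq_square power_mult_distrib[symmetric]) simp
      ultimately have "(2^i * s i x)\<^sup>2 \<le> (sqrt C)\<^sup>2"
        using C(1) four by (simp add: power_mult_distrib)
      then have "2^i * s i x \<le> sqrt C" by (rule power2_le_imp_le) (use C(1) in auto)
      then show ?thesis by (simp add: power_divide field_simps)
    qed
    then have le: "norm (s i x) \<le> sqrt C * (1/2)^i" for i by (simp add: s_def)
    have "summable (\<lambda>i. sqrt C * (1/2)^i)"
      by (rule summable_mult, rule summable_geometric) simp
    then have "summable (\<lambda>i. s i x)"
      by (rule summable_comparison_test'[where N=0]) (rule le)
    then have "summable (\<lambda>i. f (r (Suc i)) x - f (r i) x)"
      unfolding s_def by (rule summable_norm_cancel)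
    then have "convergent (\<lambda>n. \<Sum>i<n. f (r (Suc i)) x - f (r i) x)"
      by (simp add: summable_iff_convergent)
    then have "convergent (\<lambda>n. f (r n) x - f (r 0) x)"
      by (simp add: sum_lessThan_telescope[of "\<lambda>i. f (r i) x"])
    then have "convergent (\<lambda>n. (f (r n) x - f (r 0) x) + f (r 0) x)"
      by (intro convergent_add convergent_const)
    then show ?case by simp
  qed
  define g where "g x = lim (\<lambda>i. f (r i) x)" for x
  have [measurable]: "g \<in> borel_measurable M" unfolding g_def by measurable
  have main: "sqint M (\<lambda>x. f n x - g x) \<and> l2n M (\<lambda>x. f n x - g x) \<le> (1/4)^j" if "n \<ge> N j" for n j
  proof (rule l2n_le_of_AE_limit[where f="\<lambda>i x. f n x - f (r i) x"])
    show "AE x in M. (\<lambda>i. f n x - f (r i) x) \<longlonglongrightarrow> f n x - g x"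
      using conv by eventually_elim (auto simp: g_def convergent_LIMSEQ_iff intro: tendsto_intros)
    show "\<forall>\<^sub>F i in sequentially. l2n M (\<lambda>x. f n x - f (r i) x) \<le> (1/4)^j"
      using eventually_ge_at_top[of "N j"]
    proof eventually_elim
      case (elim i)
      then have "r i \<ge> N j" using seq_suble[OF r, of i] by linarith
      then show ?case using N[of j n "r i"] that by simp
    qed
  qed (auto intro: sqint_diff sq)
  have "sqint M (\<lambda>x. f (N 0) x - (f (N 0) x - g x))"
    by (rule sqint_diff[OF sq conjunct1[OF main[OF order_refl]]])
  then have "sqint M g" by simp
  moreover have "(\<lambda>n. l2n M (\<lambda>x. f n x - g x)) \<longlonglongrightarrow> 0"
  proof (rule LIMSEQ_I)
    fix e :: real assume "e > 0"
    then obtain j where "(1/4)^j < e" using real_arch_pow_inv[of e "1/4"] by auto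
    then show "\<exists>no. \<forall>n\<ge>no. norm (l2n M (\<lambda>x. f n x - g x) - 0) < e"
      using main[of j] by (intro exI[of _ "N j"]) (auto intro: le_less_trans)
  qed
  ultimately show ?thesis using that[OF r] by (simp add: g_def[abs_def])
qed

lemma integrable_of_sqint_finite:
  assumes "finite_measure M" "sqint M f"
  shows "integrable M f"
proof -
  interpret finite_measure M by fact
  have "integrable M (\<lambda>x. norm (f x) * norm (1::real))"
    by (rule integrable_mult_sqint[OF assms(2)]) (simp add: sqint_def)
  then show ?thesis using sqint_measurable[OF assms(2)] by (simp add: integrable_norm_iff)
qed

lemma integrable_mult_sqint':
  fixes f g :: "'a \<Rightarrow> 'b::{real_normed_algebra,banach,second_countable_topology}"
  assumes "sqint M f" "sqint M g"
  shows "integrable M (\<lambda>x. f x * g x)"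
  by (rule Bochner_Integration.integrable_bound[OF integrable_mult_sqint[OF assms]])
     (use assms in \<open>auto simp: sqint_def norm_mult_ineq\<close>)

lemma cauchy_schwarz_l2n':
  fixes f g :: "'a \<Rightarrow> 'b::{real_normed_algebra,banach,second_countable_topology}"
  assumes "sqint M f" "sqint M g"
  shows "norm (\<integral>x. f x * g x \<partial>M) \<le> l2n M f * l2n M g"
proof -
  have "norm (\<integral>x. f x * g x \<partial>M) \<le> (\<integral>x. norm (f x * g x) \<partial>M)"
    by (rule integral_norm_bound)
  also have "\<dots> \<le> (\<integral>x. norm (f x) * norm (g x) \<partial>M)"
    by (intro integral_mono integrable_norm integrable_mult_sqint' integrable_mult_sqint assms norm_mult_ineq)
  also have "\<dots> \<le> l2n M f * l2n M g" by (rule cauchy_schwarz_l2n[OF assms])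
  finally show ?thesis .
qed

section \<open>Parseval identities on tensor products\<close>

text \<open>One notion for Fourier series, with \<open>N\<close> a counting measure, and for the
  Fourier integral, with \<open>N\<close> Lebesgue measure, so that
  \<open>parseval_kernel_tensor\<close> yields every three-dimensional identity needed. A finite
  \<open>M\<close> makes each transform of a square integrable function absolutely
  convergent.\<close>

definition parseval_kernel :: "'a measure \<Rightarrow> 'k measure \<Rightarrow> ('k \<times> 'a \<Rightarrow> complex) \<Rightarrow> real \<Rightarrow> bool" where
  "parseval_kernel M N e c \<longleftrightarrow> finite_measure M \<and> sigma_finite_measure N \<and> e \<in> borel_measurable (N \<Otimes>\<^sub>M M) \<and>
     (\<forall>p. norm (e p) \<le> 1) \<and> 0 \<le> c \<and>
     (\<forall>g. sqint M g \<longrightarrow>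
        (\<integral>\<^sup>+k. ennreal ((norm (\<integral>x. g x * e (k, x) \<partial>M))\<^sup>2) \<partial>N) = ennreal (c * (l2n M g)\<^sup>2))"

lemma sqint_mult_bounded:
  fixes g h :: "'a \<Rightarrow> complex"
  assumes "sqint M g" "h \<in> borel_measurable M" "\<And>x. norm (h x) \<le> C"
  shows "sqint M (\<lambda>x. g x * h x)"
proof (rule sqint_bound[OF assms(1), where C=C])
  show "AE x in M. norm (g x * h x) \<le> C * norm (g x)"
    using assms(3) by (intro AE_I2) (simp add: norm_mult mult.commute[of "norm (g _)"] mult_right_mono)
qed (use assms in \<open>auto simp: sqint_def\<close>)

text \<open>Transform in the first variable, then in the second, with Tonelli between the two.
  Slices of \<open>g\<close> and of its partial transform are square integrable only almost
  everywhere, which is all that the integral over the remaining variable sees.\<close>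

lemma parseval_kernel_tensor:
  assumes "parseval_kernel M1 N1 e1 c1" "parseval_kernel M2 N2 e2 c2"
  shows "parseval_kernel (M1 \<Otimes>\<^sub>M M2) (N1 \<Otimes>\<^sub>M N2) (\<lambda>((k1, k2), (x1, x2)). e1 (k1, x1) * e2 (k2, x2)) (c1 * c2)"
proof -
  interpret M1: finite_measure M1 using assms(1) by (simp add: parseval_kernel_def)
  interpret M2: finite_measure M2 using assms(2) by (simp add: parseval_kernel_def)
  interpret N1: sigma_finite_measure N1 using assms(1) by (simp add: parseval_kernel_def)
  interpret N2: sigma_finite_measure N2 using assms(2) by (simp add: parseval_kernel_def)
  interpret M: pair_sigma_finite M1 M2 ..
  interpret N: pair_sigma_finite N1 N2 ..
  interpret NM: pair_sigma_finite N1 M2 ..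
  interpret MM: finite_measure "M1 \<Otimes>\<^sub>M M2"
    by (rule finite_measure_pair_measure) unfold_locales
  note [measurable] = assms(1)[unfolded parseval_kernel_def, THEN conjunct2, THEN conjunct2, THEN conjunct1]
    assms(2)[unfolded parseval_kernel_def, THEN conjunct2, THEN conjunct2, THEN conjunct1]
  have b1: "norm (e1 p) \<le> 1" for p using assms(1) unfolding parseval_kernel_def by blast
  have b2: "norm (e2 p) \<le> 1" for p using assms(2) unfolding parseval_kernel_def by blast
  have c: "0 \<le> c1" "0 \<le> c2" using assms by (auto simp: parseval_kernel_def)
  have P1: "(\<integral>\<^sup>+k. ennreal ((norm (\<integral>x. g x * e1 (k, x) \<partial>M1))\<^sup>2) \<partial>N1) = ennreal (c1 * (l2n M1 g)\<^sup>2)"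
    if "sqint M1 g" for g using assms(1) that by (auto simp: parseval_kernel_def)
  have P2: "(\<integral>\<^sup>+k. ennreal ((norm (\<integral>x. g x * e2 (k, x) \<partial>M2))\<^sup>2) \<partial>N2) = ennreal (c2 * (l2n M2 g)\<^sup>2)"
    if "sqint M2 g" for g using assms(2) that by (auto simp: parseval_kernel_def)
  let ?e = "\<lambda>((k1, k2), (x1, x2)). e1 (k1, x1) * e2 (k2, x2)"
  have main: "(\<integral>\<^sup>+k. ennreal ((norm (\<integral>x. g x * ?e (k, x) \<partial>(M1 \<Otimes>\<^sub>M M2)))\<^sup>2) \<partial>(N1 \<Otimes>\<^sub>M N2)) =
      ennreal (c1 * c2 * (l2n (M1 \<Otimes>\<^sub>M M2) g)\<^sup>2)" if g: "sqint (M1 \<Otimes>\<^sub>M M2) g" for g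
  proof -
    have [measurable]: "g \<in> borel_measurable (M1 \<Otimes>\<^sub>M M2)" using g by (rule sqint_measurable)
    define lfourier where "lfourier k1 x2 = (\<integral>x1. g (x1, x2) * e1 (k1, x1) \<partial>M1)" for k1 x2
    have [measurable]: "(\<lambda>p. lfourier (fst p) (snd p)) \<in> borel_measurable (N1 \<Otimes>\<^sub>M M2)"
      unfolding lfourier_def by measurable
    have fin: "(\<integral>\<^sup>+x2. (\<integral>\<^sup>+x1. ennreal ((norm (g (x1, x2)))\<^sup>2) \<partial>M1) \<partial>M2) = ennreal ((l2n (M1 \<Otimes>\<^sub>M M2) g)\<^sup>2)"
      by (subst M.nn_integral_snd) (auto simp: nn_l2n[OF g])
    have "AE x2 in M2. (\<integral>\<^sup>+x1. ennreal ((norm (g (x1, x2)))\<^sup>2) \<partial>M1) \<noteq> \<infinity>"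
      by (rule nn_integral_PInf_AE) (use fin in auto)
    then have "AE x2 in M2. (\<integral>\<^sup>+k1. ennreal ((norm (lfourier k1 x2))\<^sup>2) \<partial>N1) =
        ennreal c1 * (\<integral>\<^sup>+x1. ennreal ((norm (g (x1, x2)))\<^sup>2) \<partial>M1)"
      using AE_space
    proof eventually_elim
      case (elim x2)
      have "sqint M1 (\<lambda>x1. g (x1, x2))"
        by (rule sqintI_nn) (use elim in \<open>auto simp: less_top\<close>)
      from P1[OF this] nn_l2n[OF this] show ?case
        by (simp add: lfourier_def ennreal_mult c)
    qed
    then have "(\<integral>\<^sup>+x2. (\<integral>\<^sup>+k1. ennreal ((norm (lfourier k1 x2))\<^sup>2) \<partial>N1) \<partial>M2) =
        (\<integral>\<^sup>+x2. ennreal c1 * (\<integral>\<^sup>+x1. ennreal ((norm (g (x1, x2)))\<^sup>2) \<partial>M1) \<partial>M2)"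
      by (rule nn_integral_cong_AE)
    also have "\<dots> = ennreal (c1 * (l2n (M1 \<Otimes>\<^sub>M M2) g)\<^sup>2)"
      by (subst nn_integral_cmult) (auto simp: fin ennreal_mult c)
    also have "(\<integral>\<^sup>+x2. (\<integral>\<^sup>+k1. ennreal ((norm (lfourier k1 x2))\<^sup>2) \<partial>N1) \<partial>M2) =
        (\<integral>\<^sup>+k1. (\<integral>\<^sup>+x2. ennreal ((norm (lfourier k1 x2))\<^sup>2) \<partial>M2) \<partial>N1)"
      by (rule NM.Fubini') (simp add: split_beta')
    finally have fin2: "(\<integral>\<^sup>+k1. (\<integral>\<^sup>+x2. ennreal ((norm (lfourier k1 x2))\<^sup>2) \<partial>M2) \<partial>N1) =
        ennreal (c1 * (l2n (M1 \<Otimes>\<^sub>M M2) g)\<^sup>2)" by simp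
    have Gm2: "(\<lambda>x2. lfourier k1 x2) \<in> borel_measurable M2" if "k1 \<in> space N1" for k1
      using measurable_compose[OF measurable_Pair1'[OF that] \<open>(\<lambda>p. lfourier (fst p) (snd p)) \<in> borel_measurable (N1 \<Otimes>\<^sub>M M2)\<close>]
      by simp
    have "AE k1 in N1. (\<integral>\<^sup>+x2. ennreal ((norm (lfourier k1 x2))\<^sup>2) \<partial>M2) \<noteq> \<infinity>"
      by (rule nn_integral_PInf_AE) (use fin2 in auto)
    then have "AE k1 in N1. (\<integral>\<^sup>+k2. ennreal ((norm (\<integral>x2. lfourier k1 x2 * e2 (k2, x2) \<partial>M2))\<^sup>2) \<partial>N2) =
        ennreal c2 * (\<integral>\<^sup>+x2. ennreal ((norm (lfourier k1 x2))\<^sup>2) \<partial>M2)"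
      using AE_space
    proof eventually_elim
      case (elim k1)
      have "sqint M2 (\<lambda>x2. lfourier k1 x2)"
        by (rule sqintI_nn) (use elim Gm2 in \<open>auto simp: less_top\<close>)
      from P2[OF this] nn_l2n[OF this] show ?case
        by (simp add: ennreal_mult c)
    qed
    then have "(\<integral>\<^sup>+k1. (\<integral>\<^sup>+k2. ennreal ((norm (\<integral>x2. lfourier k1 x2 * e2 (k2, x2) \<partial>M2))\<^sup>2) \<partial>N2) \<partial>N1) =
        (\<integral>\<^sup>+k1. ennreal c2 * (\<integral>\<^sup>+x2. ennreal ((norm (lfourier k1 x2))\<^sup>2) \<partial>M2) \<partial>N1)"
      by (rule nn_integral_cong_AE)
    also have "\<dots> = ennreal (c1 * c2 * (l2n (M1 \<Otimes>\<^sub>M M2) g)\<^sup>2)"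
      by (subst nn_integral_cmult) (auto simp: fin2 ennreal_mult[symmetric] c mult_ac)
    also have "(\<integral>\<^sup>+k1. (\<integral>\<^sup>+k2. ennreal ((norm (\<integral>x2. lfourier k1 x2 * e2 (k2, x2) \<partial>M2))\<^sup>2) \<partial>N2) \<partial>N1) =
        (\<integral>\<^sup>+k1. (\<integral>\<^sup>+k2. ennreal ((norm (\<integral>x. g x * ?e ((k1, k2), x) \<partial>(M1 \<Otimes>\<^sub>M M2)))\<^sup>2) \<partial>N2) \<partial>N1)"
    proof (intro nn_integral_cong)
      fix k1 k2 assume k: "k1 \<in> space N1" "k2 \<in> space N2"
      have [measurable]: "(\<lambda>x. e1 (k1, x)) \<in> borel_measurable M1" "(\<lambda>x. e2 (k2, x)) \<in> borel_measurable M2"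
        using k by auto
      have "sqint (M1 \<Otimes>\<^sub>M M2) (\<lambda>x. g x * (e1 (k1, fst x) * e2 (k2, snd x)))"
        by (rule sqint_mult_bounded[OF g, where C=1])
           (auto simp: norm_mult intro!: mult_le_one b1 b2)
      then have int: "integrable (M1 \<Otimes>\<^sub>M M2) (\<lambda>x. g x * (e1 (k1, fst x) * e2 (k2, snd x)))"
        by (intro integrable_of_sqint_finite) unfold_locales
      have "(\<integral>x2. lfourier k1 x2 * e2 (k2, x2) \<partial>M2) = (\<integral>x2. (\<integral>x1. g (x1, x2) * (e1 (k1, x1) * e2 (k2, x2)) \<partial>M1) \<partial>M2)"
        by (simp add: lfourier_def mult.assoc[symmetric])
      also have "\<dots> = (\<integral>x. g x * (e1 (k1, fst x) * e2 (k2, snd x)) \<partial>(M1 \<Otimes>\<^sub>M M2))"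
        using M.integral_snd[of "\<lambda>x1 x2. g (x1, x2) * (e1 (k1, x1) * e2 (k2, x2))"] int
        by (simp add: split_beta')
      finally show "ennreal ((norm (\<integral>x2. lfourier k1 x2 * e2 (k2, x2) \<partial>M2))\<^sup>2) =
          ennreal ((norm (\<integral>x. g x * ?e ((k1, k2), x) \<partial>(M1 \<Otimes>\<^sub>M M2)))\<^sup>2)"
        by (simp add: split_beta')
    qed
    also have "\<dots> = (\<integral>\<^sup>+k. ennreal ((norm (\<integral>x. g x * ?e (k, x) \<partial>(M1 \<Otimes>\<^sub>M M2)))\<^sup>2) \<partial>(N1 \<Otimes>\<^sub>M N2))"
      by (subst N2.nn_integral_fst[symmetric]) (auto simp: split_beta')
    finally show ?thesis .
  qed
  show ?thesis
    unfolding parseval_kernel_def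
  proof (intro conjI allI impI)
    show "sigma_finite_measure (N1 \<Otimes>\<^sub>M N2)" ..
    show "finite_measure (M1 \<Otimes>\<^sub>M M2)" by (rule MM.finite_measure_axioms)
    show "0 \<le> c1 * c2" using c by simp
    show "?e \<in> borel_measurable ((N1 \<Otimes>\<^sub>M N2) \<Otimes>\<^sub>M (M1 \<Otimes>\<^sub>M M2))"
      by (simp add: split_beta')
    show "norm (?e p) \<le> 1" for p
      by (auto simp: split_beta' norm_mult intro!: mult_le_one b1 b2)
  qed (rule main)
qed

section \<open>Integration over one period, and uniqueness of Fourier coefficients\<close>

definition per_meas :: "real measure" where
  "per_meas = density lborel (indicator {0..2 * pi})"

lemma sets_per_meas [measurable_cong, simp]: "sets per_meas = sets borel"
  and space_per_meas [simp]: "space per_meas = UNIV"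
  by (simp_all add: per_meas_def)

lemma density_indicator_as_density:
  "density lborel (indicator A :: 'a::euclidean_space \<Rightarrow> ennreal) = density lborel (\<lambda>x. ennreal (indicator A x))"
  by (simp add: ennreal_indicator)

lemma integral_density_indicator:
  fixes f :: "'a::euclidean_space \<Rightarrow> 'b::{banach,second_countable_topology}"
  assumes "A \<in> sets borel" "f \<in> borel_measurable borel"
  shows "(\<integral>x. f x \<partial>(density lborel (indicator A))) = (\<integral>x. indicator A x *\<^sub>R f x \<partial>lborel)"
  unfolding density_indicator_as_density by (subst integral_density) (use assms in auto)

lemma integrable_density_indicator:
  fixes f :: "'a::euclidean_space \<Rightarrow> 'b::{banach,second_countable_topology}"
  assumes "A \<in> sets borel" "f \<in> borel_measurable borel"
  shows "integrable (density lborel (indicator A)) f \<longleftrightarrow> integrable lborel (\<lambda>x. indicator A x *\<^sub>R f x)"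
  unfolding density_indicator_as_density by (subst integrable_density) (use assms in auto)

lemma nn_integral_density_indicator:
  fixes f :: "'a::euclidean_space \<Rightarrow> ennreal"
  assumes "A \<in> sets borel" "f \<in> borel_measurable borel"
  shows "(\<integral>\<^sup>+x. f x \<partial>(density lborel (indicator A))) = (\<integral>\<^sup>+x. indicator A x * f x \<partial>lborel)"
  by (subst nn_integral_density) (use assms in auto)

lemma finite_per_meas: "finite_measure per_meas"
  by (rule finite_measureI) (simp add: per_meas_def emeasure_density)

lemma measure_per_meas: "measure per_meas UNIV = 2 * pi"
  by (simp add: per_meas_def measure_def emeasure_density)

lemma cis_measurable [measurable]: "cis \<in> borel_measurable borel"
  by (intro borel_measurable_continuous_onI continuous_intros)

lemma integrable_bounded_mult_left:
  fixes g h :: "'a \<Rightarrow> complex"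
  assumes "integrable M g" "h \<in> borel_measurable M" "\<And>x. norm (h x) \<le> C"
  shows "integrable M (\<lambda>x. g x * h x)"
proof (rule Bochner_Integration.integrable_bound[OF integrable_mult_right[OF integrable_norm[OF assms(1)], of C]])
  show "AE x in M. norm (g x * h x) \<le> norm (C * norm (g x))"
  proof (intro AE_I2)
    fix x
    have "norm (g x * h x) \<le> C * norm (g x)"
      using assms(3)[of x] by (simp add: norm_mult mult.commute[of "norm (g _)"] mult_right_mono)
    also have "\<dots> \<le> norm (C * norm (g x))" by simp
    finally show "norm (g x * h x) \<le> norm (C * norm (g x))" .
  qed
qed (use assms in auto)

definition zero_coeffs :: "(real \<Rightarrow> complex) \<Rightarrow> bool" where
  "zero_coeffs g \<longleftrightarrow> integrable per_meas g \<and> (\<forall>k::int. (\<integral>x. g x * cis (- (of_int k * x)) \<partial>per_meas) = 0)"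

lemma zero_coeffs_cis:
  assumes "zero_coeffs g"
  shows "zero_coeffs (\<lambda>x. g x * cis (of_int j * x))"
  unfolding zero_coeffs_def
proof (intro conjI allI)
  show "integrable per_meas (\<lambda>x. g x * cis (of_int j * x))"
    by (rule integrable_bounded_mult_left[where C=1]) (use assms in \<open>auto simp: zero_coeffs_def\<close>)
  fix k :: int
  have "(\<integral>x. g x * cis (of_int j * x) * cis (- (of_int k * x)) \<partial>per_meas) =
      (\<integral>x. g x * cis (- (of_int (k - j) * x)) \<partial>per_meas)"
    by (intro Bochner_Integration.integral_cong) (simp_all add: mult.assoc cis_mult algebra_simps)
  then show "(\<integral>x. g x * cis (of_int j * x) * cis (- (of_int k * x)) \<partial>per_meas) = 0"
    using assms unfolding zero_coeffs_def by metis
qed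

lemma zero_coeffs_add: "zero_coeffs g \<Longrightarrow> zero_coeffs h \<Longrightarrow> zero_coeffs (\<lambda>x. g x + h x)"
  unfolding zero_coeffs_def
proof (intro conjI allI, goal_cases)
  case (2 k)
  have "integrable per_meas (\<lambda>x. g x * cis (- (of_int k * x)))" "integrable per_meas (\<lambda>x. h x * cis (- (of_int k * x)))"
    using 2 by (auto intro!: integrable_bounded_mult_left[where C=1])
  then show ?case using 2 by (simp add: distrib_right)
qed auto

lemma zero_coeffs_cmult: "zero_coeffs g \<Longrightarrow> zero_coeffs (\<lambda>x. c * g x)"
  unfolding zero_coeffs_def by (auto simp: mult.assoc)

text \<open>On the circle a real linear function of \<open>cis x\<close> is a combination of e^(ix)
  and e^(-ix), and multiplying by these only moves the coefficients. Keeping \<open>g\<close>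
  arbitrary lets the induction treat a product as two successive multiplications.\<close>

lemma zero_coeffs_polynomial:
  assumes "real_polynomial_function p" "zero_coeffs g"
  shows "zero_coeffs (\<lambda>x. g x * of_real (p (cis x)))"
  using assms
proof (induction p arbitrary: g rule: real_polynomial_function.induct)
  case (linear f)
  then interpret bounded_linear f by simp
  have "f (cis x) = cos x * f 1 + sin x * f \<i>" for x
  proof -
    have "cis x = cos x *\<^sub>R 1 + sin x *\<^sub>R \<i>" by (simp add: complex_eq_iff)
    then have "f (cis x) = f (cos x *\<^sub>R 1 + sin x *\<^sub>R \<i>)" by (rule arg_cong)
    then show ?thesis by (simp only: add scaleR real_scaleR_def)
  qed
  then have "complex_of_real (f (cis x)) = (of_real (f 1) / 2 - \<i> * of_real (f \<i>) / 2) * cis (of_int 1 * x)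
     + (of_real (f 1) / 2 + \<i> * of_real (f \<i>) / 2) * cis (of_int (-1) * x)" for x
    by (simp add: complex_eq_iff field_simps)
  then obtain a b where ab: "\<And>x. complex_of_real (f (cis x)) = a * cis (of_int 1 * x) + b * cis (of_int (-1) * x)"
    by blast
  have "(\<lambda>x. g x * of_real (f (cis x))) = (\<lambda>x. a * (g x * cis (of_int 1 * x)) + b * (g x * cis (of_int (-1) * x)))"
    by (rule ext) (simp only: ab, simp only: algebra_simps)
  then show ?case
    using zero_coeffs_add[OF zero_coeffs_cmult[OF zero_coeffs_cis[OF linear.prems, of 1], of a]
        zero_coeffs_cmult[OF zero_coeffs_cis[OF linear.prems, of "-1"], of b]]
    by (simp only:)
next
  case (const c)
  then show ?case using zero_coeffs_cmult[OF const, of "of_real c"] by (simp add: mult.commute)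
next
  case (add f g)
  then show ?case using zero_coeffs_add[OF add.IH(1) add.IH(2)] by (simp add: distrib_left)
next
  case (mult f g h)
  show ?case using mult.IH(2)[OF mult.IH(1)[OF mult.prems]] by (simp add: mult.assoc)
qed

text \<open>Stone-Weierstrass on the unit circle reduces continuous \<open>h\<close> to the
  polynomials already settled.\<close>

lemma zero_coeffs_continuous:
  assumes "continuous_on (sphere 0 1) h" "zero_coeffs g"
  shows "(\<integral>x. g x * of_real (h (cis x)) \<partial>per_meas) = 0"
proof (rule ccontr)
  assume ne: "(\<integral>x. g x * of_real (h (cis x)) \<partial>per_meas) \<noteq> 0"
  let ?I = "norm (\<integral>x. g x * of_real (h (cis x)) \<partial>per_meas)"
  let ?J = "(\<integral>x. norm (g x) \<partial>per_meas)"
  have J: "?J \<ge> 0" by simp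
  \<comment> \<open>With this tolerance the approximation error is at most half of the integral in
    question, so a nonzero integral would be smaller than itself. The summand 1 keeps the quotient
    defined when \<open>g\<close> vanishes.\<close>
  define e where "e = ?I / (2 * (?J + 1))"
  have I: "?I > 0" by (rule zero_less_norm_iff[THEN iffD2, OF ne])
  have "2 * (?J + 1) > 0" by (rule mult_pos_pos[OF zero_less_numeral add_nonneg_pos[OF J zero_less_one]])
  with I have e: "e > 0" unfolding e_def by (rule divide_pos_pos)
  obtain p where p: "real_polynomial_function p" "\<And>z. z \<in> sphere 0 1 \<Longrightarrow> \<bar>h z - p z\<bar> < e"
    using Stone_Weierstrass_real_polynomial_function[OF compact_sphere assms(1) e] by blast
  have g: "integrable per_meas g" using assms(2) by (simp add: zero_coeffs_def)
  have hc: "continuous_on UNIV (\<lambda>x. h (cis x))"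
    by (rule continuous_on_compose2[OF assms(1)]) (auto intro!: continuous_intros)
  have pc: "continuous_on UNIV (\<lambda>x. p (cis x))"
    by (rule continuous_on_compose2[OF continuous_on_polymonial_function[of p UNIV]])
       (use p(1) in \<open>auto intro!: continuous_intros simp: real_polynomial_function_eq\<close>)
  have [measurable]: "(\<lambda>x. h (cis x)) \<in> borel_measurable borel" "(\<lambda>x. p (cis x)) \<in> borel_measurable borel"
    using hc pc by (auto intro: borel_measurable_continuous_onI)
  have d: "norm (complex_of_real (h (cis x) - p (cis x))) \<le> e" for x
    using p(2)[of "cis x"] by (simp only: norm_of_real) simp
  have i1: "integrable per_meas (\<lambda>x. g x * of_real (h (cis x) - p (cis x)))"
    by (rule integrable_bounded_mult_left[OF g _ d]) measurable
  have i2: "integrable per_meas (\<lambda>x. g x * of_real (p (cis x)))"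
    using zero_coeffs_polynomial[OF p(1) assms(2)] by (simp add: zero_coeffs_def)
  have z: "(\<integral>x. g x * of_real (p (cis x)) \<partial>per_meas) = 0"
    using zero_coeffs_polynomial[OF p(1) assms(2)] unfolding zero_coeffs_def by (auto dest: spec[of _ 0])
  have "(\<integral>x. g x * of_real (h (cis x)) \<partial>per_meas) = (\<integral>x. g x * of_real (h (cis x) - p (cis x)) + g x * of_real (p (cis x)) \<partial>per_meas)"
    by (simp add: algebra_simps)
  also have "\<dots> = (\<integral>x. g x * of_real (h (cis x) - p (cis x)) \<partial>per_meas)"
    using i1 i2 z by simp
  finally have "?I = norm (\<integral>x. g x * of_real (h (cis x) - p (cis x)) \<partial>per_meas)" by simp
  also have "\<dots> \<le> (\<integral>x. norm (g x * of_real (h (cis x) - p (cis x))) \<partial>per_meas)" by (rule integral_norm_bound)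
  also have "\<dots> \<le> (\<integral>x. e * norm (g x) \<partial>per_meas)"
    by (intro integral_mono integrable_norm i1 integrable_mult_right g)
       (use d in \<open>simp add: norm_mult mult.commute[of "norm (g _)"] mult_right_mono del: of_real_diff\<close>)
  also have "\<dots> = e * ?J" by simp
  also have "\<dots> \<le> e * (?J + 1)" using e by simp
  also have "\<dots> = ?I / 2"
  proof -
    have "y > 0 \<Longrightarrow> x / (2 * y) * y = x / 2" for x y :: real by simp
    from this[OF add_nonneg_pos[OF J zero_less_one]] show ?thesis unfolding e_def .
  qed
  finally show False using ne by simp
qed

text \<open>Orthogonality to continuous functions passes to indicators of closed arcs by dominated
  convergence. Half lines generate the Borel sets, so \<open>g\<close> integrates to 0 over every
  Borel set.\<close>

lemma zero_coeffs_AE_zero: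
  assumes "zero_coeffs g"
  shows "AE x in per_meas. g x = 0"
proof -
  interpret finite_measure per_meas by (rule finite_per_meas)
  have g: "integrable per_meas g" using assms by (simp add: zero_coeffs_def)
  have [measurable]: "g \<in> borel_measurable borel" using borel_measurable_integrable[OF g] by simp
  have tot: "(\<integral>x. g x \<partial>per_meas) = 0" using assms unfolding zero_coeffs_def by (auto dest: spec[of _ 0])
  have basic_atMost: "set_lebesgue_integral per_meas {..b} g = 0" for b
  proof (cases "b < 0")
    case True
    have "AE x in per_meas. indicator {..b} x *\<^sub>R g x = 0"
      unfolding per_meas_def by (subst AE_density) (use True in \<open>auto simp: indicator_def\<close>)
    then show ?thesis unfolding set_lebesgue_integral_def by (intro integral_eq_zero_AE)
  next
    case False
    \<comment> \<open>The arc swept by the angles up to \<open>b\<close>. It is closed, so the tent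
      functions \<open>h n\<close> around it converge pointwise to its indicator.\<close>
    define C where "C = cis ` {0..min b (2 * pi)}"
    have C: "compact C" unfolding C_def by (intro compact_continuous_image continuous_intros) auto
    have "0 \<in> {0..min b (2 * pi)}" using False by simp
    then have C0: "C \<noteq> {}" unfolding C_def by blast
    have cc: "closed C" using C by (rule compact_imp_closed)
    have [measurable]: "C \<in> sets borel" using cc by (rule borel_closed)
    define h where "h n z = max 0 (1 - real n * infdist z C)" for n z
    have hc: "continuous_on A (h n)" for n A unfolding h_def by (intro continuous_intros)
    have [measurable]: "h n \<in> borel_measurable borel" for n
      using hc by (intro borel_measurable_continuous_onI)
    have hlim: "(\<lambda>n. h n z) \<longlonglongrightarrow> indicator C z" for z
    proof (cases "z \<in> C")
      case True
      then show ?thesis by (simp add: h_def)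
    next
      case False
      then have pos: "infdist z C > 0"
        using in_closed_iff_infdist_zero[OF cc C0, of z] infdist_nonneg[of z C] by linarith
      obtain N where N: "1 < real N * infdist z C" using reals_Archimedean3[OF pos] by blast
      have "h n z = 0" if "n \<ge> N" for n
      proof -
        have "real N * infdist z C \<le> real n * infdist z C" using that pos by (intro mult_right_mono) auto
        then show ?thesis using N by (simp add: h_def)
      qed
      then have "\<forall>\<^sub>F n in sequentially. h n z = 0" by (auto simp: eventually_sequentially)
      then show ?thesis using False by (simp add: tendsto_eventually)
    qed
    have hb: "\<bar>h n z\<bar> \<le> 1" for n z by (simp add: h_def infdist_nonneg)
    have "(\<lambda>n. \<integral>x. g x * of_real (h n (cis x)) \<partial>per_meas) \<longlonglongrightarrow> (\<integral>x. g x * of_real (indicator C (cis x)) \<partial>per_meas)"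
    proof (rule integral_dominated_convergence[where w="\<lambda>x. norm (g x)"])
      show "(\<lambda>x. g x * complex_of_real (indicator C (cis x))) \<in> borel_measurable per_meas"
        by measurable
      show "AE x in per_meas. (\<lambda>n. g x * complex_of_real (h n (cis x))) \<longlonglongrightarrow> g x * complex_of_real (indicator C (cis x))"
        by (intro AE_I2 tendsto_intros hlim)
      show "AE x in per_meas. norm (g x * complex_of_real (h n (cis x))) \<le> norm (g x)" for n
        using hb by (intro AE_I2) (simp add: norm_mult mult_left_le)
    qed (use g in auto)
    moreover have "(\<integral>x. g x * of_real (h n (cis x)) \<partial>per_meas) = 0" for n
      by (rule zero_coeffs_continuous[OF hc assms])
    ultimately have "(\<integral>x. g x * of_real (indicator C (cis x)) \<partial>per_meas) = 0"
      by (simp add: LIMSEQ_const_iff)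
    moreover have "(\<integral>x. g x * of_real (indicator C (cis x)) \<partial>per_meas) = (\<integral>x. indicator {..b} x *\<^sub>R g x \<partial>per_meas)"
    proof (rule integral_cong_AE)
      \<comment> \<open>Strict bounds on x: \<open>cis\<close> identifies 0 with 2 pi, so the point
        2 pi lies on the arc even when it exceeds \<open>b\<close>. The two endpoints form a null
        set.\<close>
      have eq: "indicator C (cis x) = (indicator {..b} x :: real)" if x: "0 < x" "x < 2 * pi" for x
      proof -
        have "cis x \<in> C \<longleftrightarrow> x \<le> b"
        proof
          assume "cis x \<in> C"
          then obtain y where y: "0 \<le> y" "y \<le> b" "y \<le> 2 * pi" "cis x = cis y" by (auto simp: C_def)
          then have "sin x = sin y \<and> cos x = cos y" by (metis cis.sel)
          then obtain n :: int where n: "x = y + 2 * pi * n" by (auto simp: sin_cos_eq_iff)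
          have "2 * pi * (real_of_int n) < 2 * pi * 1" "2 * pi * (-1) < 2 * pi * real_of_int n" using n x y by linarith+
          moreover have "0 < 2 * pi" by simp
          ultimately have "real_of_int n < 1" "-1 < real_of_int n" by (simp_all only: mult_less_cancel_left_pos)
          then have "n = 0" by linarith
          then show "x \<le> b" using n y by simp
        next
          assume "x \<le> b"
          then show "cis x \<in> C" using x by (auto simp: C_def)
        qed
        then show ?thesis by (simp add: indicator_def)
      qed
      have ae: "AE x in lborel. x \<noteq> (0::real) \<and> x \<noteq> 2 * pi"
        using AE_lborel_singleton[of "0::real"] AE_lborel_singleton[of "2*pi"] by eventually_elim auto
      then show "AE x in per_meas. g x * complex_of_real (indicator C (cis x)) = indicator {..b} x *\<^sub>R g x"
      proof (unfold per_meas_def, subst AE_density)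
        show "AE x in lborel. 0 < (indicator {0..2 * pi} x :: ennreal) \<longrightarrow>
            g x * complex_of_real (indicator C (cis x)) = indicator {..b} x *\<^sub>R g x"
          using ae
        proof eventually_elim
          case (elim x)
          then show ?case using eq[of x] by (auto simp: indicator_def less_le split: if_splits)
        qed
      qed simp
    qed measurable
    ultimately show ?thesis by (simp add: set_lebesgue_integral_def)
  qed
  have intA: "set_integrable per_meas A g" if "A \<in> sets borel" for A
    unfolding set_integrable_def using that g by (intro integrable_mult_indicator) auto
  \<comment> \<open>Dynkin's argument: half lines are stable under intersection, and complements are
    handled because the total integral, the coefficient at 0, vanishes.\<close>
  have "set_lebesgue_integral per_meas A g = 0" if "A \<in> sets borel" for A
  proof -
    have sb: "A \<in> sets borel" if "A \<in> sigma_sets UNIV (range (\<lambda>b::real. {..b}))" for A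
      using that by (simp add: borel_eq_atMost)
    have "Int_stable (range (\<lambda>b::real. {..b}))"
      by (auto simp: Int_stable_def)
    moreover have "range (\<lambda>b::real. {..b}) \<subseteq> Pow UNIV" by simp
    moreover have "A \<in> sigma_sets UNIV (range (\<lambda>b::real. {..b}))" using that by (simp add: borel_eq_atMost)
    ultimately show ?thesis
    proof (induction rule: sigma_sets_induct_disjoint[where A=A])
      case (basic A)
      then show ?case using basic_atMost by auto
    next
      case empty
      then show ?case by (simp add: set_lebesgue_integral_def)
    next
      case (compl A)
      have "set_lebesgue_integral per_meas (A \<union> (UNIV - A)) g = set_lebesgue_integral per_meas A g + set_lebesgue_integral per_meas (UNIV - A) g"
        using compl sb[of A] by (intro set_integral_Un intA) (auto intro: borel_comp simp: Compl_eq_Diff_UNIV[symmetric])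
      then show ?case using compl tot by (simp add: set_lebesgue_integral_def)
    next
      case (union A)
      have [simp]: "A i \<in> sets borel" for i using union sb by auto
      have "set_lebesgue_integral per_meas (\<Union>i. A i) g = (\<Sum>i. set_lebesgue_integral per_meas (A i) g)"
        using union by (intro lebesgue_integral_countable_add intA) (auto simp: disjoint_family_on_def)
      then show ?case using union by simp
    qed
  qed
  then show ?thesis by (intro density_zero[OF g]) simp
qed

section \<open>Fourier series and the Fourier integral\<close>

lemma has_vector_derivative_cis:
  "((\<lambda>x. cis (a * x + b)) has_vector_derivative (\<i> * of_real a * cis (a * x + b))) (at x within S)"
proof -
  have "((\<lambda>z. exp (\<i> * (of_real a * z + of_real b))) has_field_derivative (\<i> * of_real a * exp (\<i> * (of_real a * of_real x + of_real b)))) (at (of_real x))"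
    by (auto intro!: derivative_eq_intros)
  from has_vector_derivative_real_field[OF this] show ?thesis
    by (simp add: cis_conv_exp)
qed

lemma cnj_measurable [measurable]: "cnj \<in> borel_measurable borel"
  by (intro borel_measurable_continuous_onI continuous_intros)

lemma integral_cis_per_meas:
  "(\<integral>x. cis (of_int j * x) \<partial>per_meas) = (if j = 0 then 2 * pi else 0)"
proof (cases "j = 0")
  case True
  then show ?thesis using measure_per_meas by (simp add: scaleR_conv_of_real)
next
  case False
  have "(\<integral>x. indicator {0..2 * pi} x *\<^sub>R cis (of_int j * x) \<partial>lborel) =
      cis (of_int j * (2 * pi)) / (\<i> * of_int j) - cis (of_int j * 0) / (\<i> * of_int j)"
  proof (rule integral_FTC_Icc)
    fix x :: real
    have "((\<lambda>x. cis (of_int j * x)) has_vector_derivative (of_int j * (\<i> * cis (of_int j * x)))) (at x within {0..2 * pi})"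
      using has_vector_derivative_cis[of "of_int j" 0 x] by (simp add: mult_ac)
    from has_vector_derivative_divide[OF this, of "\<i> * of_int j"]
    show "((\<lambda>x. cis (of_int j * x) / (\<i> * of_int j)) has_vector_derivative cis (of_int j * x)) (at x within {0..2 * pi})"
      using False by (simp add: field_simps)
  qed (auto intro!: continuous_intros)
  also have "cis (of_int j * (2 * pi)) = 1"
    using cis_multiple_2pi[of "of_int j"] by (simp add: mult_ac)
  finally show ?thesis
    using False by (simp add: per_meas_def integral_density_indicator)
qed

text \<open>Orthogonality of the exponentials: the pairings of \<open>g\<close> and of
  \<open>S\<close> with \<open>S\<close> coincide, so the cross term in the expanded square is twice
  the squared norm of \<open>S\<close>.\<close>

lemma bessel_identity:
  fixes g :: "real \<Rightarrow> complex"
  assumes g: "sqint per_meas g" and K: "finite (K :: int set)"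
  defines "c \<equiv> \<lambda>k. (\<integral>x. g x * cis (- (of_int k * x)) \<partial>per_meas)"
  defines "S \<equiv> \<lambda>x. \<Sum>k\<in>K. c k / (2 * pi) * cis (of_int k * x)"
  shows "sqint per_meas S"
    and "(l2n per_meas (\<lambda>x. g x - S x))\<^sup>2 = (l2n per_meas g)\<^sup>2 - (\<Sum>k\<in>K. (norm (c k))\<^sup>2) / (2 * pi)"
    and "(l2n per_meas S)\<^sup>2 = (\<Sum>k\<in>K. (norm (c k))\<^sup>2) / (2 * pi)"
    and "(\<integral>x. S x * cis (- (of_int k * x)) \<partial>per_meas) = (if k \<in> K then c k else 0)"
proof -
  interpret finite_measure per_meas by (rule finite_per_meas)
  have sq1: "sqint per_meas (\<lambda>x. 1 :: complex)" by (simp add: sqint_def)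
  have sqc: "sqint per_meas (\<lambda>x. a * cis (of_int k * x))" for a k
    by (rule sqint_bound[OF sq1, where C="norm a"]) (auto simp: norm_mult)
  show S: "sqint per_meas S" unfolding S_def by (intro sqint_sum sqc)
  have bd: "integrable per_meas (\<lambda>x. f x * cis (- (of_int k * x)))" if "sqint per_meas f" for f k
    using integrable_of_sqint_finite[OF finite_per_meas that]
    by (intro integrable_bounded_mult_left[where C=1]) auto
  show coef: "(\<integral>x. S x * cis (- (of_int k * x)) \<partial>per_meas) = (if k \<in> K then c k else 0)" for k
  proof -
    have "(\<integral>x. S x * cis (- (of_int k * x)) \<partial>per_meas) = (\<integral>x. (\<Sum>j\<in>K. c j / (2 * pi) * cis (of_int j * x) * cis (- (of_int k * x))) \<partial>per_meas)"
      unfolding S_def by (simp only: sum_distrib_right)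
    also have "\<dots> = (\<Sum>j\<in>K. \<integral>x. c j / (2 * pi) * cis (of_int j * x) * cis (- (of_int k * x)) \<partial>per_meas)"
      by (intro Bochner_Integration.integral_sum bd sqc)
    also have "\<dots> = (\<Sum>j\<in>K. \<integral>x. c j / (2 * pi) * cis (of_int (j - k) * x) \<partial>per_meas)"
      by (simp add: mult.assoc cis_mult algebra_simps)
    also have "\<dots> = (\<Sum>j\<in>K. if j = k then c j else 0)"
      by (intro sum.cong refl) (subst integral_mult_right_zero, subst integral_cis_per_meas, auto)
    also have "\<dots> = (if k \<in> K then c k else 0)" using K by simp
    finally show ?thesis .
  qed
  have inner: "(\<integral>x. f x * cnj (S x) \<partial>per_meas) = (\<Sum>k\<in>K. cnj (c k) / (2 * pi) * (\<integral>x. f x * cis (- (of_int k * x)) \<partial>per_meas))"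
    if f: "sqint per_meas f" for f
  proof -
    have "(\<integral>x. f x * cnj (S x) \<partial>per_meas) = (\<integral>x. (\<Sum>k\<in>K. cnj (c k) / (2 * pi) * (f x * cis (- (of_int k * x)))) \<partial>per_meas)"
      unfolding S_def by (simp add: sum_distrib_left cis_cnj mult_ac)
    also have "\<dots> = (\<Sum>k\<in>K. \<integral>x. cnj (c k) / (2 * pi) * (f x * cis (- (of_int k * x))) \<partial>per_meas)"
      by (intro Bochner_Integration.integral_sum integrable_mult_right bd f)
    also have "\<dots> = (\<Sum>k\<in>K. cnj (c k) / (2 * pi) * (\<integral>x. f x * cis (- (of_int k * x)) \<partial>per_meas))"
      by (simp only: integral_mult_right_zero)
    finally show ?thesis .
  qed
  have SS: "(\<integral>x. S x * cnj (S x) \<partial>per_meas) = of_real ((\<Sum>k\<in>K. (norm (c k))\<^sup>2) / (2 * pi))"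
  proof -
    have "(\<integral>x. S x * cnj (S x) \<partial>per_meas) = (\<Sum>k\<in>K. cnj (c k) / (2 * pi) * c k)"
      unfolding inner[OF S] coef by (intro sum.cong) auto
    also have "\<dots> = (\<Sum>k\<in>K. of_real ((norm (c k))\<^sup>2 / (2 * pi)))"
      by (intro sum.cong refl) (simp add: mult.commute[of "cnj _"] flip: complex_norm_square)
    finally show ?thesis by (simp add: sum_divide_distrib)
  qed
  have gS: "(\<integral>x. g x * cnj (S x) \<partial>per_meas) = of_real ((\<Sum>k\<in>K. (norm (c k))\<^sup>2) / (2 * pi))"
  proof -
    have "(\<integral>x. g x * cnj (S x) \<partial>per_meas) = (\<Sum>k\<in>K. cnj (c k) / (2 * pi) * c k)"
      unfolding inner[OF g] by (simp add: c_def)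
    also have "\<dots> = (\<Sum>k\<in>K. of_real ((norm (c k))\<^sup>2 / (2 * pi)))"
      by (intro sum.cong refl) (simp add: mult.commute[of "cnj _"] flip: complex_norm_square)
    finally show ?thesis by (simp add: sum_divide_distrib)
  qed
  have cnjS: "sqint per_meas (\<lambda>x. cnj (S x))"
    by (rule sqint_bound[OF S, where C=1]) (use sqint_measurable[OF S] in auto)
  have nS: "(norm (S x))\<^sup>2 = Re (S x * cnj (S x))" for x
    by (simp add: complex_mult_cnj cmod_power2)
  show l2S: "(l2n per_meas S)\<^sup>2 = (\<Sum>k\<in>K. (norm (c k))\<^sup>2) / (2 * pi)"
    unfolding l2n_sq nS using integral_Re[OF integrable_mult_sqint'[OF S cnjS]] by (simp add: SS)
  have ngS: "(norm (g x - S x))\<^sup>2 = (norm (g x))\<^sup>2 - 2 * Re (g x * cnj (S x)) + (norm (S x))\<^sup>2" for x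
    unfolding cmod_power2 by (simp add: power2_eq_square algebra_simps)
  have int: "integrable per_meas (\<lambda>x. Re (g x * cnj (S x)))"
    by (rule integrable_Re[OF integrable_mult_sqint'[OF g cnjS]])
  have "(l2n per_meas (\<lambda>x. g x - S x))\<^sup>2 = (\<integral>x. (norm (g x))\<^sup>2 - 2 * Re (g x * cnj (S x)) + (norm (S x))\<^sup>2 \<partial>per_meas)"
    unfolding l2n_sq ngS ..
  also have "\<dots> = (\<integral>x. (norm (g x))\<^sup>2 \<partial>per_meas) - 2 * (\<integral>x. Re (g x * cnj (S x)) \<partial>per_meas) + (\<integral>x. (norm (S x))\<^sup>2 \<partial>per_meas)"
    using sqint_integrable[OF g] sqint_integrable[OF S] int
    by (simp only: Bochner_Integration.integral_add Bochner_Integration.integral_diff integrable_mult_right Bochner_Integration.integrable_diff integral_mult_right_zero)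
  also have "(\<integral>x. Re (g x * cnj (S x)) \<partial>per_meas) = (\<Sum>k\<in>K. (norm (c k))\<^sup>2) / (2 * pi)"
    using integral_Re[OF integrable_mult_sqint'[OF g cnjS]] by (simp add: gS)
  finally show "(l2n per_meas (\<lambda>x. g x - S x))\<^sup>2 = (l2n per_meas g)\<^sup>2 - (\<Sum>k\<in>K. (norm (c k))\<^sup>2) / (2 * pi)"
    unfolding l2n_sq[symmetric] l2S by simp
qed

text \<open>The symmetric ranges increase to all integers, so monotone convergence applies.\<close>

lemma nn_integral_int_limit:
  fixes f :: "int \<Rightarrow> real"
  assumes "\<And>k. 0 \<le> f k" "(\<lambda>N. \<Sum>k\<in>{- int N..int N}. f k) \<longlonglongrightarrow> L"
  shows "(\<integral>\<^sup>+k. ennreal (f k) \<partial>count_space UNIV) = ennreal L"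
proof -
  let ?g = "\<lambda>N k. ennreal (f k) * indicator {- int N..int N} k"
  have "(\<integral>\<^sup>+k. ennreal (f k) \<partial>count_space UNIV) = (\<integral>\<^sup>+k. (SUP N. ?g N k) \<partial>count_space UNIV)"
  proof (intro nn_integral_cong antisym)
    fix k
    have "k \<in> {- int (nat \<bar>k\<bar>)..int (nat \<bar>k\<bar>)}" by auto
    then have "ennreal (f k) = ?g (nat \<bar>k\<bar>) k" by (simp only: indicator_simps mult_1_right)
    also have "\<dots> \<le> (SUP N. ?g N k)" by (intro SUP_upper) simp
    finally show "ennreal (f k) \<le> (SUP N. ?g N k)" .
    show "(SUP N. ?g N k) \<le> ennreal (f k)" by (intro SUP_least) (simp add: indicator_def)
  qed
  also have "\<dots> = (SUP N. \<integral>\<^sup>+k. ?g N k \<partial>count_space UNIV)"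
    by (rule nn_integral_monotone_convergence_SUP) (auto simp: incseq_def le_fun_def indicator_def)
  also have "\<dots> = (SUP N. ennreal (\<Sum>k\<in>{- int N..int N}. f k))"
  proof (intro SUP_cong refl)
    fix N
    have "(\<integral>\<^sup>+k. ?g N k \<partial>count_space UNIV) = (\<integral>\<^sup>+k. ennreal (f k) \<partial>count_space {- int N..int N})"
      by (simp add: nn_integral_count_space_indicator)
    then show "(\<integral>\<^sup>+k. ?g N k \<partial>count_space UNIV) = ennreal (\<Sum>k\<in>{- int N..int N}. f k)"
      using assms(1) by (simp add: nn_integral_count_space_finite)
  qed
  also have "\<dots> = ennreal L"
  proof (rule LIMSEQ_unique[OF LIMSEQ_SUP])
    show "incseq (\<lambda>N. ennreal (\<Sum>k\<in>{- int N..int N}. f k))"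
      using assms(1) by (intro incseq_SucI ennreal_leI sum_mono2) auto
    show "(\<lambda>N. ennreal (\<Sum>k\<in>{- int N..int N}. f k)) \<longlonglongrightarrow> ennreal L"
      by (intro tendsto_ennrealI assms)
  qed
  finally show ?thesis .
qed

text \<open>Bessel's identity makes the partial sums Cauchy. Their limit has the same coefficients
  as \<open>g\<close>, hence equals \<open>g\<close> almost everywhere by
  \<open>zero_coeffs_AE_zero\<close>, and the defect in Bessel's identity tends to 0.\<close>

lemma parseval_circle:
  fixes g :: "real \<Rightarrow> complex"
  assumes g: "sqint per_meas g"
  defines "c \<equiv> \<lambda>k::int. (\<integral>x. g x * cis (- (of_int k * x)) \<partial>per_meas)"
  shows "(\<integral>\<^sup>+k. ennreal ((norm (c k))\<^sup>2) \<partial>count_space UNIV) = ennreal (2 * pi * (l2n per_meas g)\<^sup>2)"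
proof (rule nn_integral_int_limit)
  interpret finite_measure per_meas by (rule finite_per_meas)
  define S where "S N x = (\<Sum>k\<in>{- int N..int N}. c k / (2 * pi) * cis (of_int k * x))" for N x
  define a where "a N = (\<Sum>k\<in>{- int N..int N}. (norm (c k))\<^sup>2)" for N
  have S: "sqint per_meas (S N)" for N
    using bessel_identity(1)[OF g finite_atLeastAtMost_int, of "- int N" "int N"] by (simp add: S_def[abs_def] c_def)
  have dist: "(l2n per_meas (\<lambda>x. g x - S N x))\<^sup>2 = (l2n per_meas g)\<^sup>2 - a N / (2 * pi)" for N
    using bessel_identity(2)[OF g finite_atLeastAtMost_int, of "- int N" "int N"] by (simp add: S_def a_def c_def)
  have coef: "(\<integral>x. S N x * cis (- (of_int k * x)) \<partial>per_meas) = (if k \<in> {- int N..int N} then c k else 0)" for N k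
    using bessel_identity(4)[OF g finite_atLeastAtMost_int, of "- int N" "int N"] by (simp add: S_def c_def)
  have Sdiff: "(l2n per_meas (\<lambda>x. S N x - S M x))\<^sup>2 = (a N - a M) / (2 * pi)" if "M \<le> N" for M N
  proof -
    let ?K = "{- int N..int N} - {- int M..int M}"
    have sub: "{- int M..int M} \<subseteq> {- int N..int N}" using that by auto
    have "S N x - S M x = (\<Sum>k\<in>?K. c k / (2 * pi) * cis (of_int k * x))" for x
      unfolding S_def using sub by (simp add: sum_diff)
    moreover have "a N - a M = (\<Sum>k\<in>?K. (norm (c k))\<^sup>2)"
      unfolding a_def using sub by (simp add: sum_diff)
    ultimately show ?thesis
      using bessel_identity(3)[OF g, of ?K] by (simp add: c_def)
  qed
  have mono: "incseq a" unfolding a_def by (intro incseq_SucI sum_mono2) auto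
  have bound: "a N \<le> 2 * pi * (l2n per_meas g)\<^sup>2" for N
  proof -
    have "a N / (2 * pi) \<le> (l2n per_meas g)\<^sup>2"
      using dist[of N] zero_le_power2[of "l2n per_meas (\<lambda>x. g x - S N x)"] by linarith
    then show ?thesis by (simp add: divide_le_eq mult_ac)
  qed
  obtain L where L: "a \<longlonglongrightarrow> L"
    using incseq_convergent[OF mono, of "2 * pi * (l2n per_meas g)\<^sup>2"] bound by blast
  have aL: "a N \<le> L" for N using incseq_le[OF mono L] .
  have cau: "\<exists>N. \<forall>m\<ge>N. \<forall>n\<ge>N. l2n per_meas (\<lambda>x. S m x - S n x) < e" if "e > 0" for e
  proof -
    have "\<exists>N. \<forall>n\<ge>N. L - a n < 2 * pi * e\<^sup>2"
    proof -
      have "2 * pi * e\<^sup>2 > 0" using \<open>e > 0\<close> by simp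
      then obtain N where N: "\<forall>n\<ge>N. norm (a n - L) < 2 * pi * e\<^sup>2" using LIMSEQ_D[OF L] by blast
      have "L - a n < 2 * pi * e\<^sup>2" if "n \<ge> N" for n
      proof -
        have "\<bar>a n - L\<bar> < 2 * pi * e\<^sup>2" using N that by simp
        then show ?thesis by linarith
      qed
      then show ?thesis by blast
    qed
    then obtain N where N: "\<And>n. n \<ge> N \<Longrightarrow> L - a n < 2 * pi * e\<^sup>2" by blast
    have *: "l2n per_meas (\<lambda>x. S m x - S n x) < e" if "m \<ge> n" "n \<ge> N" for m n
    proof -
      have "(l2n per_meas (\<lambda>x. S m x - S n x))\<^sup>2 < e\<^sup>2"
      proof -
        have "a m - a n < e\<^sup>2 * (2 * pi)" using N[OF that(2)] aL[of m] by (simp add: mult.commute)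
        then show ?thesis unfolding Sdiff[OF that(1)] by (simp add: divide_less_eq)
      qed
      then show ?thesis using \<open>e > 0\<close> by (simp add: power2_less_imp_less)
    qed
    have "l2n per_meas (\<lambda>x. S m x - S n x) < e" if "m \<ge> N" "n \<ge> N" for m n
      using *[of n m] *[of m n] that l2n_minus_commute[of per_meas "S m" "S n"] by (cases "n \<le> m") auto
    then show ?thesis by blast
  qed
  obtain r :: "nat \<Rightarrow> nat" where r: "sqint per_meas (\<lambda>x. lim (\<lambda>i. S (r i) x))"
    "(\<lambda>n. l2n per_meas (\<lambda>x. S n x - lim (\<lambda>i. S (r i) x))) \<longlonglongrightarrow> 0"
    using l2_complete[OF S cau] by blast
  define h where "h x = lim (\<lambda>i. S (r i) x)" for x
  have h: "sqint per_meas h" and hlim: "(\<lambda>n. l2n per_meas (\<lambda>x. S n x - h x)) \<longlonglongrightarrow> 0"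
    using r by (auto simp: h_def[abs_def])
  have bd: "integrable per_meas (\<lambda>x. f x * cis (- (of_int k * x)))" if "sqint per_meas f" for f and k :: int
    using integrable_of_sqint_finite[OF finite_per_meas that]
    by (intro integrable_bounded_mult_left[where C=1]) auto
  have hc: "(\<integral>x. h x * cis (- (of_int k * x)) \<partial>per_meas) = c k" for k
  proof -
    have sqc: "sqint per_meas (\<lambda>x. cis (- (of_int k * x)))"
      by (rule sqint_bound[of per_meas "\<lambda>x. 1::complex" _ 1]) (auto simp: sqint_def)
    have "norm ((\<integral>x. S n x * cis (- (of_int k * x)) \<partial>per_meas) - (\<integral>x. h x * cis (- (of_int k * x)) \<partial>per_meas))
        \<le> l2n per_meas (\<lambda>x. S n x - h x) * l2n per_meas (\<lambda>x. cis (- (of_int k * x)))" for n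
      using cauchy_schwarz_l2n'[OF sqint_diff[OF S[of n] h] sqc] bd[OF S[of n], of k] bd[OF h, of k]
      by (simp add: left_diff_distrib)
    moreover have "(\<lambda>n. l2n per_meas (\<lambda>x. S n x - h x) * l2n per_meas (\<lambda>x. cis (- (of_int k * x)))) \<longlonglongrightarrow> 0"
      using tendsto_mult_right[OF hlim] by simp
    ultimately have "(\<lambda>n. (\<integral>x. S n x * cis (- (of_int k * x)) \<partial>per_meas) - (\<integral>x. h x * cis (- (of_int k * x)) \<partial>per_meas)) \<longlonglongrightarrow> 0"
      by (rule Lim_null_comparison[OF always_eventually[OF allI]])
    then have "(\<lambda>n. \<integral>x. S n x * cis (- (of_int k * x)) \<partial>per_meas) \<longlonglongrightarrow> (\<integral>x. h x * cis (- (of_int k * x)) \<partial>per_meas)"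
      by (simp add: LIM_zero_iff)
    moreover have "\<forall>\<^sub>F n in sequentially. (\<integral>x. S n x * cis (- (of_int k * x)) \<partial>per_meas) = c k"
      using eventually_ge_at_top[of "nat \<bar>k\<bar>"] by eventually_elim (auto simp: coef)
    ultimately show ?thesis
      by (rule LIMSEQ_unique[OF _ tendsto_eventually])
  qed
  have "zero_coeffs (\<lambda>x. g x - h x)"
    unfolding zero_coeffs_def
  proof (intro conjI allI)
    show "integrable per_meas (\<lambda>x. g x - h x)"
      using integrable_of_sqint_finite[OF finite_per_meas] g h by auto
    fix k
    show "(\<integral>x. (g x - h x) * cis (- (of_int k * x)) \<partial>per_meas) = 0"
      using bd[OF g, of k] bd[OF h, of k] hc[of k] by (simp add: left_diff_distrib c_def)
  qed
  then have "AE x in per_meas. g x - h x = 0" by (rule zero_coeffs_AE_zero)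
  then have eq: "AE x in per_meas. g x = h x" by eventually_elim simp
  have "l2n per_meas (\<lambda>x. g x - S n x) = l2n per_meas (\<lambda>x. S n x - h x)" for n
    by (rule l2n_cong_AE) (use eq in eventually_elim, auto simp: norm_minus_commute sqint_measurable g h S
          intro!: borel_measurable_diff sqint_measurable[OF g] sqint_measurable[OF h] sqint_measurable[OF S])
  with hlim have "(\<lambda>n. (l2n per_meas (\<lambda>x. g x - S n x))\<^sup>2) \<longlonglongrightarrow> 0\<^sup>2"
    by (intro tendsto_power) simp
  then have "(\<lambda>n. (l2n per_meas g)\<^sup>2 - a n / (2 * pi)) \<longlonglongrightarrow> 0" unfolding dist by simp
  then have "(\<lambda>n. 2 * pi * (l2n per_meas g)\<^sup>2 - 2 * pi * ((l2n per_meas g)\<^sup>2 - a n / (2 * pi))) \<longlonglongrightarrow> 2 * pi * (l2n per_meas g)\<^sup>2 - 2 * pi * 0"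
    by (intro tendsto_intros)
  then show "(\<lambda>N. \<Sum>k\<in>{- int N..int N}. (norm (c k))\<^sup>2) \<longlonglongrightarrow> 2 * pi * (l2n per_meas g)\<^sup>2"
    by (simp add: right_diff_distrib a_def)
qed auto

lemma sigma_finite_count_int: "sigma_finite_measure (count_space (UNIV :: int set))"
  by (rule sigma_finite_measure_count_space)

lemma parseval_kernel_circle:
  "parseval_kernel per_meas (count_space (UNIV :: int set)) (\<lambda>(k, x). cis (- (of_int k * x))) (2 * pi)"
  unfolding parseval_kernel_def
proof (intro conjI allI impI)
  show "(\<lambda>(k, x). cis (- (of_int k * x))) \<in> borel_measurable (count_space (UNIV :: int set) \<Otimes>\<^sub>M per_meas)"
    by measurable
  fix g :: "real \<Rightarrow> complex" assume "sqint per_meas g"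
  from parseval_circle[OF this]
  show "(\<integral>\<^sup>+ k. ennreal ((cmod (CLINT x|per_meas. g x * (case (k, x) of (k, x) \<Rightarrow> cis (- (real_of_int k * x)))))\<^sup>2) \<partial>count_space UNIV) =
         ennreal (2 * pi * (l2n per_meas g)\<^sup>2)" by simp
qed (auto simp: finite_per_meas sigma_finite_count_int)

section \<open>Intervals of length 2 pi L, and the passage from series to integral\<close>

definition box_meas :: "real \<Rightarrow> real measure" where
  "box_meas L = density lborel (indicator {- (pi * L)..pi * L})"

lemma sets_box_meas [measurable_cong, simp]: "sets (box_meas L) = sets borel"
  and space_box_meas [simp]: "space (box_meas L) = UNIV"
  by (simp_all add: box_meas_def)

lemma finite_box_meas: "finite_measure (box_meas L)"
  by (rule finite_measureI) (simp add: box_meas_def emeasure_density emeasure_lborel_Icc_eq)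

lemma integral_box_meas:
  fixes f :: "real \<Rightarrow> complex"
  assumes L: "L > 0" and f: "f \<in> borel_measurable borel"
  shows "(\<integral>y. f y \<partial>box_meas L) = L * (\<integral>x. f (L * (x - pi)) \<partial>per_meas)"
proof -
  have ind: "indicator {- (pi * L)..pi * L} (- (L * pi) + L * x) = (indicator {0..2 * pi} x :: real)" for x
    using L by (auto simp: indicator_def mult.commute[of L] simp flip: distrib_right)
       (simp_all add: field_simps zero_le_mult_iff)
  have "(\<integral>y. f y \<partial>box_meas L) = \<bar>L\<bar> *\<^sub>R (\<integral>x. indicator {- (pi * L)..pi * L} (- (L * pi) + L * x) *\<^sub>R f (- (L * pi) + L * x) \<partial>lborel)"
  proof -
    have "(\<integral>y. f y \<partial>box_meas L) = (\<integral>y. indicator {- (pi * L)..pi * L} y *\<^sub>R f y \<partial>lborel)"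
      unfolding box_meas_def by (rule integral_density_indicator) (use f in auto)
    also have "\<dots> = \<bar>L\<bar> *\<^sub>R (\<integral>x. indicator {- (pi * L)..pi * L} (- (L * pi) + L * x) *\<^sub>R f (- (L * pi) + L * x) \<partial>lborel)"
      by (rule lborel_integral_real_affine) (use L in simp)
    finally show ?thesis .
  qed
  also have "\<dots> = L * (\<integral>x. f (L * (x - pi)) \<partial>per_meas)"
    using L f unfolding ind per_meas_def
    by (subst integral_density_indicator) (auto simp: scaleR_conv_of_real algebra_simps)
  finally show ?thesis .
qed

lemma nn_integral_box_meas:
  fixes f :: "real \<Rightarrow> ennreal"
  assumes L: "L > 0" and f: "f \<in> borel_measurable borel"
  shows "(\<integral>\<^sup>+y. f y \<partial>box_meas L) = ennreal L * (\<integral>\<^sup>+x. f (L * (x - pi)) \<partial>per_meas)"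
proof -
  have ind: "indicator {- (pi * L)..pi * L} (- (L * pi) + L * x) = (indicator {0..2 * pi} x :: ennreal)" for x
    using L by (auto simp: indicator_def mult.commute[of L] simp flip: distrib_right)
       (simp_all add: field_simps zero_le_mult_iff)
  have "(\<integral>\<^sup>+y. f y \<partial>box_meas L) = ennreal \<bar>L\<bar> * (\<integral>\<^sup>+x. indicator {- (pi * L)..pi * L} (- (L * pi) + L * x) * f (- (L * pi) + L * x) \<partial>lborel)"
  proof -
    have "(\<integral>\<^sup>+y. f y \<partial>box_meas L) = (\<integral>\<^sup>+y. indicator {- (pi * L)..pi * L} y * f y \<partial>lborel)"
      unfolding box_meas_def by (rule nn_integral_density_indicator) (use f in auto)
    also have "\<dots> = ennreal \<bar>L\<bar> * (\<integral>\<^sup>+x. indicator {- (pi * L)..pi * L} (- (L * pi) + L * x) * f (- (L * pi) + L * x) \<partial>lborel)"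
      by (rule nn_integral_real_affine) (use f L in auto)
    finally show ?thesis .
  qed
  also have "\<dots> = ennreal L * (\<integral>\<^sup>+x. f (L * (x - pi)) \<partial>per_meas)"
    using L f unfolding ind per_meas_def
    by (subst nn_integral_density_indicator) (auto simp: algebra_simps)
  finally show ?thesis .
qed

text \<open>The substitution y = L (x - pi) carries the interval to one period. The shift by pi only
  multiplies the k-th coefficient by e^(ik pi), of modulus 1, and the Jacobian turns the constant 2
  pi into 2 pi L.\<close>

lemma parseval_kernel_box:
  assumes L: "L > 0"
  shows "parseval_kernel (box_meas L) (count_space (UNIV :: int set)) (\<lambda>(k, y). cis (- (of_int k / L * y))) (2 * pi * L)"
  unfolding parseval_kernel_def
proof (intro conjI allI impI)
  show "(\<lambda>(k, y). cis (- (of_int k / L * y))) \<in> borel_measurable (count_space (UNIV :: int set) \<Otimes>\<^sub>M box_meas L)"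
    by measurable
  fix g :: "real \<Rightarrow> complex" assume g: "sqint (box_meas L) g"
  have [measurable]: "g \<in> borel_measurable borel" using sqint_measurable[OF g] by simp
  define g' where "g' x = g (L * (x - pi))" for x
  have [measurable]: "g' \<in> borel_measurable borel" unfolding g'_def by measurable
  have nn: "ennreal L * (\<integral>\<^sup>+x. ennreal ((norm (g' x))\<^sup>2) \<partial>per_meas) = ennreal ((l2n (box_meas L) g)\<^sup>2)"
    unfolding g'_def nn_l2n[OF g, symmetric] by (rule nn_integral_box_meas[symmetric, OF L]) measurable
  have g': "sqint per_meas g'"
  proof (rule sqintI_nn)
    show "(\<integral>\<^sup>+x. ennreal ((norm (g' x))\<^sup>2) \<partial>per_meas) < \<infinity>"
      using nn L by (metis ennreal_eq_0_iff ennreal_less_top ennreal_mult_eq_top_iff infinity_ennreal_def less_top not_le)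
  qed measurable
  have eq: "L * (l2n per_meas g')\<^sup>2 = (l2n (box_meas L) g)\<^sup>2"
    using nn L unfolding nn_l2n[OF g'] by (simp add: ennreal_mult[symmetric] ennreal_inj)
  have c: "norm (\<integral>y. g y * cis (- (of_int k / L * y)) \<partial>box_meas L) = L * norm (\<integral>x. g' x * cis (- (of_int k * x)) \<partial>per_meas)" for k :: int
  proof -
    have "(\<integral>y. g y * cis (- (of_int k / L * y)) \<partial>box_meas L) = L * (\<integral>x. g (L * (x - pi)) * cis (- (of_int k / L * (L * (x - pi)))) \<partial>per_meas)"
      by (rule integral_box_meas[OF L]) measurable
    also have "(\<integral>x. g (L * (x - pi)) * cis (- (of_int k / L * (L * (x - pi)))) \<partial>per_meas) =
        (\<integral>x. cis (of_int k * pi) * (g' x * cis (- (of_int k * x))) \<partial>per_meas)"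
    proof (rule Bochner_Integration.integral_cong[OF refl])
      fix x
      have "- (of_int k / L * (L * (x - pi))) = of_int k * pi + - (of_int k * x)"
        using L by (simp add: field_simps)
      then show "g (L * (x - pi)) * cis (- (of_int k / L * (L * (x - pi)))) = cis (of_int k * pi) * (g' x * cis (- (of_int k * x)))"
        by (simp only: cis_mult[symmetric] g'_def mult_ac)
    qed
    also have "\<dots> = cis (of_int k * pi) * (\<integral>x. g' x * cis (- (of_int k * x)) \<partial>per_meas)" by simp
    finally show ?thesis using L by (simp add: norm_mult)
  qed
  have "(\<integral>\<^sup>+ k. ennreal ((cmod (\<integral>y. g y * cis (- (of_int k / L * y)) \<partial>box_meas L))\<^sup>2) \<partial>count_space UNIV) =
      (\<integral>\<^sup>+ k. ennreal (L\<^sup>2) * ennreal ((norm (\<integral>x. g' x * cis (- (of_int k * x)) \<partial>per_meas))\<^sup>2) \<partial>count_space (UNIV :: int set))"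
    unfolding c by (simp add: power_mult_distrib ennreal_mult)
  also have "\<dots> = ennreal (L\<^sup>2) * ennreal (2 * pi * (l2n per_meas g')\<^sup>2)"
    by (subst nn_integral_cmult) (auto simp: parseval_circle[OF g'])
  also have "\<dots> = ennreal (2 * pi * L * (L * (l2n per_meas g')\<^sup>2))"
    by (simp add: ennreal_mult[symmetric] power2_eq_square mult_ac)
  finally show "(\<integral>\<^sup>+ k. ennreal ((cmod (CLINT x|box_meas L. g x * (case (k, x) of (k, y) \<Rightarrow> cis (- (real_of_int k / L * y)))))\<^sup>2) \<partial>count_space UNIV) =
         ennreal (2 * pi * L * (l2n (box_meas L) g)\<^sup>2)" unfolding eq by simp
qed (use L in \<open>auto simp: finite_box_meas sigma_finite_count_int\<close>)

text \<open>Averaging the Parseval identity for \<open>g(y) e\<^sup>-\<^sup>i\<^sup>\<theta>\<^sup>y\<close> over \<open>0 \<le> \<theta> < 1/L\<close> turns the lattice sum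
  into an integral over the line.\<close>

lemma plancherel_line_box:
  fixes g :: "real \<Rightarrow> complex"
  assumes L: "L > 0" and g: "sqint (box_meas L) g"
  shows "(\<integral>\<^sup>+\<eta>. ennreal ((norm (\<integral>y. g y * cis (- (\<eta> * y)) \<partial>box_meas L))\<^sup>2) \<partial>lborel) = ennreal (2 * pi * (l2n (box_meas L) g)\<^sup>2)"
proof -
  have [measurable]: "g \<in> borel_measurable borel" using sqint_measurable[OF g] by simp
  define F where "F \<eta> = ennreal ((norm (\<integral>y. g y * cis (- (\<eta> * y)) \<partial>box_meas L))\<^sup>2)" for \<eta>
  interpret B: finite_measure "box_meas L" by (rule finite_box_meas)
  have [measurable]: "F \<in> borel_measurable borel" unfolding F_def by measurable
  interpret C: sigma_finite_measure "count_space (UNIV :: int set)" by (rule sigma_finite_count_int)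
  interpret CL: pair_sigma_finite lborel "count_space (UNIV :: int set)" ..
  \<comment> \<open>Multiplying \<open>g\<close> by a unimodular factor changes neither its square
    integrability nor its norm, so every shifted lattice satisfies Parseval with the same
    constant.\<close>
  have shift: "(\<integral>\<^sup>+k. F (\<theta> + of_int k / L) \<partial>count_space (UNIV :: int set)) = ennreal (2 * pi * L * (l2n (box_meas L) g)\<^sup>2)" for \<theta>
  proof -
    have g': "sqint (box_meas L) (\<lambda>y. g y * cis (- (\<theta> * y)))"
      by (rule sqint_mult_bounded[OF g, where C=1]) auto
    have n: "l2n (box_meas L) (\<lambda>y. g y * cis (- (\<theta> * y))) = l2n (box_meas L) g"
      by (rule l2n_cong_AE) (auto simp: norm_mult)
    have "F (\<theta> + of_int k / L) = ennreal ((norm (\<integral>y. g y * cis (- (\<theta> * y)) * cis (- (of_int k / L * y)) \<partial>box_meas L))\<^sup>2)" for k :: int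
    proof -
      have "g y * cis (- ((\<theta> + of_int k / L) * y)) = g y * cis (- (\<theta> * y)) * cis (- (of_int k / L * y))" for y
      proof -
        have "- ((\<theta> + of_int k / L) * y) = - (\<theta> * y) + - (of_int k / L * y)" by (simp add: algebra_simps)
        then show ?thesis by (simp only: cis_mult[symmetric] mult.assoc)
      qed
      then show ?thesis by (simp only: F_def)
    qed
    then show ?thesis
      using parseval_kernel_box[OF L] g' unfolding parseval_kernel_def by (auto simp: n)
  qed
  have "(\<integral>\<^sup>+\<eta>. F \<eta> \<partial>lborel) = (\<integral>\<^sup>+\<eta>. (\<integral>\<^sup>+k. indicator {0..<1/L} (\<eta> - of_int k / L) * F \<eta> \<partial>count_space (UNIV :: int set)) \<partial>lborel)"
  proof (intro nn_integral_cong)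
    fix \<eta>
    \<comment> \<open>Exactly one translate of the half-open window contains \<eta>; with closed
      windows the lattice points would be counted twice.\<close>
    have "indicator {0..<1/L} (\<eta> - of_int k / L) = (indicator {\<lfloor>\<eta> * L\<rfloor>} k :: ennreal)" for k
    proof -
      have "\<eta> - of_int k / L \<in> {0..<1/L} \<longleftrightarrow> of_int k \<le> \<eta> * L \<and> \<eta> * L < of_int k + 1"
      proof -
        have e: "\<eta> - of_int k / L = (\<eta> * L - of_int k) / L" using L by (simp add: field_simps)
        show "\<eta> - of_int k / L \<in> {0..<1/L} \<longleftrightarrow> of_int k \<le> \<eta> * L \<and> \<eta> * L < of_int k + 1" unfolding e using L by (auto simp: zero_le_divide_iff divide_less_cancel)
      qed
      also have "\<dots> \<longleftrightarrow> k = \<lfloor>\<eta> * L\<rfloor>" using floor_eq_iff by metis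
      finally show ?thesis by (auto simp: indicator_def)
    qed
    then show "F \<eta> = (\<integral>\<^sup>+k. indicator {0..<1/L} (\<eta> - of_int k / L) * F \<eta> \<partial>count_space (UNIV :: int set))"
      by (simp add: nn_integral_multc)
  qed
  also have "\<dots> = (\<integral>\<^sup>+k. (\<integral>\<^sup>+\<eta>. indicator {0..<1/L} (\<eta> - of_int k / L) * F \<eta> \<partial>lborel) \<partial>count_space (UNIV :: int set))"
    by (rule CL.Fubini'[symmetric]) measurable
  also have "\<dots> = (\<integral>\<^sup>+k. (\<integral>\<^sup>+\<theta>. indicator {0..<1/L} \<theta> * F (\<theta> + of_int k / L) \<partial>lborel) \<partial>count_space (UNIV :: int set))"
  proof (rule nn_integral_cong)
    fix k :: int
    show "(\<integral>\<^sup>+\<eta>. indicator {0..<1/L} (\<eta> - of_int k / L) * F \<eta> \<partial>lborel) = (\<integral>\<^sup>+\<theta>. indicator {0..<1/L} \<theta> * F (\<theta> + of_int k / L) \<partial>lborel)"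
      using nn_integral_real_affine[of "\<lambda>\<eta>. indicator {0..<1/L} (\<eta> - of_int k / L) * F \<eta>" 1 "of_int k / L"]
      by (simp add: add.commute)
  qed
  also have "\<dots> = (\<integral>\<^sup>+\<theta>. (\<integral>\<^sup>+k. indicator {0..<1/L} \<theta> * F (\<theta> + of_int k / L) \<partial>count_space (UNIV :: int set)) \<partial>lborel)"
    by (rule CL.Fubini') measurable
  also have "\<dots> = (\<integral>\<^sup>+\<theta>. ennreal (2 * pi * L * (l2n (box_meas L) g)\<^sup>2) * indicator {0..<1/L} \<theta> \<partial>lborel)"
  proof (rule nn_integral_cong)
    fix \<theta> :: real
    have "(\<integral>\<^sup>+k. indicator {0..<1/L} \<theta> * F (\<theta> + of_int k / L) \<partial>count_space (UNIV :: int set)) =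
        indicator {0..<1/L} \<theta> * (\<integral>\<^sup>+k. F (\<theta> + of_int k / L) \<partial>count_space (UNIV :: int set))"
      by (rule nn_integral_cmult) simp
    then show "(\<integral>\<^sup>+k. indicator {0..<1/L} \<theta> * F (\<theta> + of_int k / L) \<partial>count_space (UNIV :: int set)) =
        ennreal (2 * pi * L * (l2n (box_meas L) g)\<^sup>2) * indicator {0..<1/L} \<theta>"
      by (simp only: shift mult.commute)
  qed
  also have "\<dots> = ennreal (2 * pi * L * (l2n (box_meas L) g)\<^sup>2) * ennreal (1 / L)"
    using L by (subst nn_integral_cmult_indicator) auto
  also have "\<dots> = ennreal (2 * pi * (l2n (box_meas L) g)\<^sup>2)"
    using L by (subst ennreal_mult[symmetric]) (auto simp: field_simps)
  finally show ?thesis unfolding F_def .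
qed

lemma parseval_kernel_line:
  assumes L: "L > 0"
  shows "parseval_kernel (box_meas L) lborel (\<lambda>(\<eta>, y). cis (- (\<eta> * y))) (2 * pi)"
  unfolding parseval_kernel_def
proof (intro conjI allI impI)
  show "(\<lambda>(\<eta>, y). cis (- (\<eta> * y))) \<in> borel_measurable (lborel \<Otimes>\<^sub>M box_meas L)"
    by measurable
  fix g :: "real \<Rightarrow> complex" assume "sqint (box_meas L) g"
  from plancherel_line_box[OF L this]
  show "(\<integral>\<^sup>+ k. ennreal ((cmod (CLINT x|box_meas L. g x * (case (k, x) of (\<eta>, y) \<Rightarrow> cis (- (\<eta> * y)))))\<^sup>2) \<partial>lborel) =
         ennreal (2 * pi * (l2n (box_meas L) g)\<^sup>2)" by simp
qed (auto simp: finite_box_meas lborel.sigma_finite_measure_axioms)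

section \<open>The Fourier transform on the cell\<close>

type_synonym frequency = "int \<times> real \<times> int"

lemma fst_borel_measurable [measurable]:
    "fst \<in> borel_measurable (borel :: ('a::second_countable_topology \<times> 'b::second_countable_topology) measure)"
  and snd_borel_measurable [measurable]:
    "snd \<in> borel_measurable (borel :: ('a::second_countable_topology \<times> 'b::second_countable_topology) measure)"
  by (intro borel_measurable_continuous_onI continuous_intros)+

definition cell_meas :: "point measure" where
  "cell_meas = density lborel (indicator cell)"

definition slab_meas :: "real \<Rightarrow> point measure" where
  "slab_meas L = density lborel (indicator ({0..2 * pi} \<times> {- (pi * L)..pi * L} \<times> {0..2 * pi}))"

definition freq_meas :: "frequency measure" where
  "freq_meas = count_space UNIV \<Otimes>\<^sub>M (lborel \<Otimes>\<^sub>M count_space UNIV)"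

definition wave :: "frequency \<Rightarrow> point \<Rightarrow> complex" where
  "wave = (\<lambda>(k, \<eta>, l) (x, y, z). cis (- (of_int k * x + \<eta> * y + of_int l * z)))"

text \<open>The integral is 0 by default where the integrand is not integrable. Square integrability
  does not suffice on the unbounded cell; together with bounded support in y it does
  (\<open>integrable_y_supp\<close>).\<close>

definition fourier :: "(point \<Rightarrow> complex) \<Rightarrow> frequency \<Rightarrow> complex" where
  "fourier h \<xi> = (\<integral>X. h X * wave \<xi> X \<partial>cell_meas)"

lemma sets_cell_meas [measurable_cong, simp]: "sets cell_meas = sets borel"
  and space_cell_meas [simp]: "space cell_meas = UNIV"
  by (simp_all add: cell_meas_def)

lemma sets_slab_meas [measurable_cong, simp]: "sets (slab_meas L) = sets borel"
  and space_slab_meas [simp]: "space (slab_meas L) = UNIV"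
  by (simp_all add: slab_meas_def)

lemma cell_borel [measurable]: "cell \<in> sets borel"
  unfolding cell_def by (intro borel_closed closed_Times) auto

lemma slab_borel: "{0..2 * pi} \<times> {- (pi * L)..pi * L} \<times> {0..2 * pi} \<in> sets (borel :: point measure)"
  by (intro borel_closed closed_Times) auto

lemma norm_wave [simp]: "norm (wave \<xi> X) = 1"
  by (simp add: wave_def split_beta)

lemma wave_measurable [measurable]: "wave \<xi> \<in> borel_measurable borel"
  unfolding wave_def split_beta by measurable

lemma sigma_finite_density_indicator:
  "A \<in> sets borel \<Longrightarrow> sigma_finite_measure (density lborel (indicator A :: 'a::euclidean_space \<Rightarrow> ennreal))"
  by (subst sigma_finite_measure.sigma_finite_iff_density_finite[OF sigma_finite_lborel]) (auto simp: indicator_def)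

lemma pair_density_indicator:
  fixes A :: "'a::euclidean_space set" and B :: "'b::euclidean_space set"
  assumes [measurable]: "A \<in> sets borel" "B \<in> sets borel"
  shows "density lborel (indicator A) \<Otimes>\<^sub>M density lborel (indicator B) = density lborel (indicator (A \<times> B))"
proof -
  have "density lborel (indicator A) \<Otimes>\<^sub>M density lborel (indicator B) =
      density (lborel \<Otimes>\<^sub>M lborel) (\<lambda>(x, y). indicator A x * indicator B y)"
    by (rule pair_measure_density) (auto simp: lborel.sigma_finite_measure_axioms sigma_finite_density_indicator)
  also have "(\<lambda>(x, y). indicator A x * indicator B y :: ennreal) = indicator (A \<times> B)"
    by (auto simp: fun_eq_iff indicator_def)
  finally show ?thesis by (simp only: lborel_prod)
qed

lemma slab_meas_eq: "slab_meas L = per_meas \<Otimes>\<^sub>M (box_meas L \<Otimes>\<^sub>M per_meas)"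
  unfolding slab_meas_def per_meas_def box_meas_def
proof -
  have *: "density lborel (indicator {- (pi * L)..pi * L}) \<Otimes>\<^sub>M density lborel (indicator {0..2 * pi}) =
      density lborel (indicator ({- (pi * L)..pi * L} \<times> {0..2 * pi}))"
    by (rule pair_density_indicator) auto
  show "density lborel (indicator ({0..2 * pi} \<times> {- (pi * L)..pi * L} \<times> {0..2 * pi})) =
      density lborel (indicator {0..2 * pi}) \<Otimes>\<^sub>M (density lborel (indicator {- (pi * L)..pi * L}) \<Otimes>\<^sub>M density lborel (indicator {0..2 * pi}))"
    unfolding * by (rule pair_density_indicator[symmetric]) (auto intro!: borel_closed closed_Times)
qed

lemma cell_meas_eq: "cell_meas = per_meas \<Otimes>\<^sub>M (lborel \<Otimes>\<^sub>M per_meas)"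
proof -
  have "indicator UNIV = (\<lambda>x::real. 1 :: ennreal)" by (auto simp: fun_eq_iff)
  then have "lborel = density lborel (indicator (UNIV :: real set))"
    by (simp only: density_1)
  then have "(lborel :: real measure) \<Otimes>\<^sub>M per_meas = density lborel (indicator UNIV) \<Otimes>\<^sub>M per_meas" by (rule arg_cong)
  also have "\<dots> = density lborel (indicator (UNIV \<times> {0..2*pi}))"
    unfolding per_meas_def by (rule pair_density_indicator) auto
  finally have *: "(lborel :: real measure) \<Otimes>\<^sub>M per_meas = density lborel (indicator (UNIV \<times> {0..2*pi}))" .
  show ?thesis
    unfolding * unfolding cell_meas_def cell_def per_meas_def
    by (rule pair_density_indicator[symmetric]) (auto intro!: borel_closed closed_Times)
qed

lemma parseval_kernel_wave_line:
  assumes "L > 0"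
  shows "parseval_kernel (slab_meas L) freq_meas (\<lambda>(\<xi>, X). wave \<xi> X) ((2 * pi) ^ 3)"
proof -
  have "(\<lambda>(\<xi>, X). wave \<xi> X) = (\<lambda>((k1, k2), (x1, x2)). (\<lambda>(k, x). cis (- (of_int k * x))) (k1, x1) *
      (\<lambda>((k1, k2), (x1, x2)). (\<lambda>(\<eta>, y). cis (- (\<eta> * y))) (k1, x1) * (\<lambda>(k, x). cis (- (of_int k * x))) (k2, x2)) (k2, x2))"
    by (auto simp: fun_eq_iff wave_def cis_mult intro!: arg_cong[where f=cis])
  moreover have "2 * pi * (2 * pi * (2 * pi)) = (2 * pi) ^ 3" by (simp add: power3_eq_cube)
  ultimately show ?thesis
    using parseval_kernel_tensor[OF parseval_kernel_circle parseval_kernel_tensor[OF parseval_kernel_line[OF assms] parseval_kernel_circle]]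
    unfolding slab_meas_eq freq_meas_def by (simp only:)
qed

definition lattice :: "real \<Rightarrow> int \<times> int \<times> int \<Rightarrow> frequency" where
  "lattice L = (\<lambda>(k, j, l). (k, of_int j / L, l))"

text \<open>On a slab of finite height the vertical frequencies may be restricted to multiples of
  1/L. Counting measure on the frequencies is what makes finite sums of waves usable as test
  functions in \<open>l2n_le_by_trig_tests\<close>.\<close>

lemma parseval_kernel_wave_lattice:
  assumes "L > 0"
  shows "parseval_kernel (slab_meas L) (count_space UNIV) (\<lambda>(\<xi>, X). wave (lattice L \<xi>) X) ((2 * pi) ^ 3 * L)"
proof -
  have "(\<lambda>(\<xi>, X). wave (lattice L \<xi>) X) = (\<lambda>((k1, k2), (x1, x2)). (\<lambda>(k, x). cis (- (of_int k * x))) (k1, x1) *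
      (\<lambda>((k1, k2), (x1, x2)). (\<lambda>(k, y). cis (- (of_int k / L * y))) (k1, x1) * (\<lambda>(k, x). cis (- (of_int k * x))) (k2, x2)) (k2, x2))"
    by (auto simp: fun_eq_iff wave_def lattice_def cis_mult intro!: arg_cong[where f=cis])
  moreover have "2 * pi * (2 * pi * L * (2 * pi)) = (2 * pi) ^ 3 * L" by (simp add: power3_eq_cube)
  moreover have "count_space (UNIV :: (int \<times> int \<times> int) set) = count_space UNIV \<Otimes>\<^sub>M (count_space UNIV \<Otimes>\<^sub>M count_space UNIV)"
    by (simp add: pair_measure_countable)
  ultimately show ?thesis
    using parseval_kernel_tensor[OF parseval_kernel_circle parseval_kernel_tensor[OF parseval_kernel_box[OF assms] parseval_kernel_circle]]
    unfolding slab_meas_eq by (simp only:)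
qed

definition y_supp :: "real \<Rightarrow> (point \<Rightarrow> 'b::zero) \<Rightarrow> bool" where
  "y_supp R h \<longleftrightarrow> (\<forall>x y z. \<bar>y\<bar> > R \<longrightarrow> h (x, y, z) = 0)"

lemma indicator_cell_slab:
  fixes h :: "point \<Rightarrow> 'b::real_vector"
  assumes "y_supp (pi * L) h"
  shows "indicator cell X *\<^sub>R h X = indicator ({0..2 * pi} \<times> {- (pi * L)..pi * L} \<times> {0..2 * pi}) X *\<^sub>R h X"
proof (cases X)
  case (fields x y z)
  show ?thesis
  proof (cases "\<bar>y\<bar> > pi * L")
    case True
    then show ?thesis using assms fields by (auto simp: y_supp_def)
  next
    case False
    then have "y \<in> {- (pi * L)..pi * L}" by auto
    then show ?thesis unfolding fields cell_def by (simp add: indicator_def)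
  qed
qed

lemma integral_cell_slab:
  fixes h :: "point \<Rightarrow> 'b::{banach,second_countable_topology}"
  assumes "y_supp (pi * L) h" and [measurable]: "h \<in> borel_measurable borel"
  shows "(\<integral>X. h X \<partial>cell_meas) = (\<integral>X. h X \<partial>slab_meas L)"
  unfolding cell_meas_def slab_meas_def
  using slab_borel[of L]
  by (simp only: integral_density_indicator[OF cell_borel assms(2)] integral_density_indicator[OF slab_borel assms(2)]
      indicator_cell_slab[OF assms(1)])

lemma integrable_cell_slab:
  fixes h :: "point \<Rightarrow> 'b::{banach,second_countable_topology}"
  assumes "y_supp (pi * L) h" and [measurable]: "h \<in> borel_measurable borel"
  shows "integrable cell_meas h \<longleftrightarrow> integrable (slab_meas L) h"
  unfolding cell_meas_def slab_meas_def
  by (simp only: integrable_density_indicator[OF cell_borel assms(2)] integrable_density_indicator[OF slab_borel assms(2)]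
      indicator_cell_slab[OF assms(1)])

lemma sqint_cell_slab:
  assumes "y_supp (pi * L) h" "sqint cell_meas h"
  shows "sqint (slab_meas L) h" "l2n (slab_meas L) h = l2n cell_meas h"
proof -
  have [measurable]: "h \<in> borel_measurable borel" using sqint_measurable[OF assms(2)] by simp
  have s: "y_supp (pi * L) (\<lambda>X. (norm (h X))\<^sup>2)" using assms(1) by (simp add: y_supp_def)
  show "sqint (slab_meas L) h"
    using assms(2) integrable_cell_slab[OF s] by (simp add: sqint_def)
  show "l2n (slab_meas L) h = l2n cell_meas h"
    unfolding l2n_def by (subst integral_cell_slab[OF s]) auto
qed

lemma finite_slab_meas: "L > 0 \<Longrightarrow> finite_measure (slab_meas L)"
  using parseval_kernel_wave_line by (auto simp: parseval_kernel_def)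

lemma integrable_y_supp:
  assumes "y_supp R h" "sqint cell_meas h"
  shows "integrable cell_meas h"
proof -
  define L where "L = max 1 (R / pi)"
  have "R / pi \<le> L" "L > 0" by (auto simp: L_def)
  then have "R \<le> pi * L" by (simp add: field_simps)
  then have s: "y_supp (pi * L) h" using assms(1) by (auto simp: y_supp_def)
  have "integrable (slab_meas L) h"
    by (rule integrable_of_sqint_finite[OF finite_slab_meas[OF \<open>L > 0\<close>] sqint_cell_slab(1)[OF s assms(2)]])
  then show ?thesis
    using integrable_cell_slab[OF s] sqint_measurable[OF assms(2)] by simp
qed

lemma fourier_slab:
  assumes "y_supp (pi * L) h" "sqint cell_meas h"
  shows "fourier h \<xi> = (\<integral>X. h X * wave \<xi> X \<partial>slab_meas L)"
  unfolding fourier_def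
  by (rule integral_cell_slab) (use assms sqint_measurable[OF assms(2)] in \<open>auto simp: y_supp_def\<close>)

lemma y_supp_pi:
  assumes "y_supp R h"
  obtains L where "L > 0" "y_supp (pi * L) h"
proof
  show "max 1 (R / pi) > 0" by simp
  have "R / pi \<le> max 1 (R / pi)" by simp
  then have "R \<le> pi * max 1 (R / pi)" by (simp only: pos_divide_le_eq[OF pi_gt_zero] mult.commute)
  then show "y_supp (pi * max 1 (R / pi)) h" using assms unfolding y_supp_def by fastforce
qed

text \<open>Any slab that contains the support serves, because the constant (2 pi)^3 of the line
  version is independent of its height.\<close>

lemma plancherel:
  assumes "y_supp R h" "sqint cell_meas h"
  shows "sqint freq_meas (fourier h)" "l2n freq_meas (fourier h) = sqrt ((2 * pi) ^ 3) * l2n cell_meas h"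
proof -
  obtain L where L: "L > 0" "y_supp (pi * L) h" using y_supp_pi[OF assms(1)] .
  note sl = sqint_cell_slab[OF L(2) assms(2)]
  note P = parseval_kernel_wave_line[OF L(1), unfolded parseval_kernel_def]
  interpret finite_measure "slab_meas L" using P by simp
  have [measurable]: "h \<in> borel_measurable (slab_meas L)" using sqint_measurable[OF assms(2)] by simp
  have [measurable]: "(\<lambda>(\<xi>, X). wave \<xi> X) \<in> borel_measurable (freq_meas \<Otimes>\<^sub>M slab_meas L)" using P by blast
  have eq: "fourier h = (\<lambda>\<xi>. \<integral>X. h X * (\<lambda>(\<xi>, X). wave \<xi> X) (\<xi>, X) \<partial>slab_meas L)"
    using fourier_slab[OF L(2) assms(2)] by auto
  have [measurable]: "fourier h \<in> borel_measurable freq_meas"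
    unfolding eq by measurable
  have nn: "(\<integral>\<^sup>+\<xi>. ennreal ((norm (fourier h \<xi>))\<^sup>2) \<partial>freq_meas) = ennreal ((2 * pi) ^ 3 * (l2n cell_meas h)\<^sup>2)"
    using P sl unfolding eq by simp
  show sq: "sqint freq_meas (fourier h)"
    by (rule sqintI_nn) (simp_all add: nn)
  have "(l2n freq_meas (fourier h))\<^sup>2 = (2 * pi) ^ 3 * (l2n cell_meas h)\<^sup>2"
    using nn unfolding nn_l2n[OF sq] by (subst (asm) ennreal_inj) auto
  then have "sqrt ((l2n freq_meas (fourier h))\<^sup>2) = sqrt ((2 * pi) ^ 3 * (l2n cell_meas h)\<^sup>2)" by simp
  then show "l2n freq_meas (fourier h) = sqrt ((2 * pi) ^ 3) * l2n cell_meas h"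
    by (simp add: real_sqrt_mult)
qed

lemma plancherel_lattice:
  assumes "L > 0" "y_supp (pi * L) h" "sqint cell_meas h"
  shows "(\<integral>\<^sup>+\<xi>. ennreal ((norm (fourier h (lattice L \<xi>)))\<^sup>2) \<partial>count_space UNIV) = ennreal ((2 * pi) ^ 3 * L * (l2n cell_meas h)\<^sup>2)"
proof -
  have "(\<integral>\<^sup>+\<xi>. ennreal ((norm (\<integral>X. h X * (\<lambda>(\<xi>, X). wave (lattice L \<xi>) X) (\<xi>, X) \<partial>slab_meas L))\<^sup>2) \<partial>count_space UNIV) =
      ennreal ((2 * pi) ^ 3 * L * (l2n (slab_meas L) h)\<^sup>2)"
    using parseval_kernel_wave_lattice[OF assms(1)] sqint_cell_slab(1)[OF assms(2,3)] unfolding parseval_kernel_def by blast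
  then show ?thesis using sqint_cell_slab(2)[OF assms(2,3)] fourier_slab[OF assms(2,3)] by simp
qed

lemma L2_space_iff: "f \<in> L2_space \<longleftrightarrow> sqint cell_meas f \<and> periodic_xz f"
proof (cases "f \<in> borel_measurable borel")
  case True
  then have "integrable cell_meas (\<lambda>X. (f X)\<^sup>2) \<longleftrightarrow> set_integrable lborel cell (\<lambda>X. (f X)\<^sup>2)"
    unfolding cell_meas_def set_integrable_def by (intro integrable_density_indicator) auto
  then show ?thesis using True by (auto simp: L2_space_def sqint_def)
next
  case False
  then show ?thesis by (auto simp: L2_space_def sqint_def)
qed

lemma L2_space_sqint: "f \<in> L2_space \<Longrightarrow> sqint cell_meas f"
  and L2_spaceI: "sqint cell_meas f \<Longrightarrow> periodic_xz f \<Longrightarrow> f \<in> L2_space"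
  by (simp_all add: L2_space_iff)

lemma L2_space_measurable: "f \<in> L2_space \<Longrightarrow> f \<in> borel_measurable borel"
  by (simp add: L2_space_def)

lemma set_integral_cell:
  fixes f :: "point \<Rightarrow> 'b::{banach,second_countable_topology}"
  shows "f \<in> borel_measurable borel \<Longrightarrow> (LINT X:cell|lborel. f X) = (\<integral>X. f X \<partial>cell_meas)"
  unfolding cell_meas_def by (simp add: integral_density_indicator[OF cell_borel] set_lebesgue_integral_def)

lemma L2_norm_eq: "f \<in> L2_space \<Longrightarrow> L2_norm f = l2n cell_meas f"
  unfolding L2_norm_def l2n_def using L2_space_measurable[of f] by (simp add: set_integral_cell)

section \<open>Smooth cutoffs\<close>

text \<open>A function carried along with all its derivatives, so that differentiation is an index
  shift (\<open>bump_shift\<close>) and one radius bounds all the supports.\<close>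

definition bump :: "(nat \<Rightarrow> real \<Rightarrow> real) \<Rightarrow> bool" where
  "bump b \<longleftrightarrow> (\<forall>j y. (b j has_real_derivative b (Suc j) y) (at y)) \<and> (\<exists>R. \<forall>j y. \<bar>y\<bar> > R \<longrightarrow> b j y = 0)"

lemma bump_deriv: "bump b \<Longrightarrow> (b j has_real_derivative b (Suc j) y) (at y)"
  by (simp add: bump_def)

lemma bump_cont: "bump b \<Longrightarrow> continuous_on A (b j)"
  by (meson bump_def DERIV_isCont continuous_at_imp_continuous_on)

lemma bump_supp: "bump b \<Longrightarrow> \<exists>R>0. \<forall>j y. \<bar>y\<bar> > R \<longrightarrow> b j y = 0"
proof -
  assume "bump b"
  then obtain R where "\<forall>j y. \<bar>y\<bar> > R \<longrightarrow> b j y = 0" by (auto simp: bump_def)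
  then show ?thesis by (intro exI[of _ "max R 1"]) auto
qed

lemma bump_bounded: assumes "bump b" obtains B where "\<And>y. \<bar>b j y\<bar> \<le> B" "B \<ge> 0"
proof -
  obtain R where R: "\<And>j y. \<bar>y\<bar> > R \<Longrightarrow> b j y = 0" "R > 0" using bump_supp[OF assms] by blast
  have "compact (b j ` {-R..R})" using bump_cont[OF assms] by (intro compact_continuous_image) auto
  then obtain B where B: "\<And>y. y \<in> {-R..R} \<Longrightarrow> \<bar>b j y\<bar> \<le> B"
    using compact_imp_bounded bounded_iff by (metis imageI real_norm_def)
  have "\<bar>b j y\<bar> \<le> max B 0" for y
  proof (cases "\<bar>y\<bar> > R")
    case False
    then have "y \<in> {-R..R}" by auto
    then show ?thesis using B[of y] by auto
  qed (simp add: R)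
  then show ?thesis using that[of "max B 0"] by auto
qed

lemma bump_shift: "bump b \<Longrightarrow> bump (\<lambda>j. b (j + m))"
  unfolding bump_def by (metis add_Suc)

lemma bump_scale:
  assumes "bump b" "c \<noteq> 0"
  shows "bump (\<lambda>j y. c ^ j * b j (c * y))"
proof -
  obtain R where R: "\<And>j y. \<bar>y\<bar> > R \<Longrightarrow> b j y = 0" "R > 0" using bump_supp[OF assms(1)] by blast
  have "((\<lambda>y. c ^ j * b j (c * y)) has_real_derivative c ^ Suc j * b (Suc j) (c * y)) (at y)" for j y
  proof -
    have "((\<lambda>y. b j (c * y)) has_real_derivative b (Suc j) (c * y) * c) (at y)"
      by (rule DERIV_chain2[OF bump_deriv[OF assms(1)]]) (auto intro!: derivative_eq_intros)
    from DERIV_cmult[OF this, of "c ^ j"] show ?thesis by (simp add: mult_ac)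
  qed
  moreover have "c ^ j * b j (c * y) = 0" if "\<bar>y\<bar> > R / \<bar>c\<bar>" for j y
    using that assms(2) R(1)[of "c * y" j] by (simp add: abs_mult field_simps)
  ultimately show ?thesis unfolding bump_def by blast
qed

text \<open>Leibniz: the j-th derivative of y b(y) is y b_j + j b_(j-1). For j = 0 the index j - 1
  truncates to 0, but its factor is 0. The factor y is the one in the transport term.\<close>

lemma bump_mult_y:
  assumes "bump b"
  shows "bump (\<lambda>j y. y * b j y + real j * b (j - 1) y)"
proof -
  obtain R where R: "\<And>j y. \<bar>y\<bar> > R \<Longrightarrow> b j y = 0" "R > 0" using bump_supp[OF assms(1)] by blast
  have "((\<lambda>y. y * b j y + real j * b (j - 1) y) has_real_derivative
      y * b (Suc j) y + real (Suc j) * b (Suc j - 1) y) (at y)" for j y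
  proof (cases j)
    case 0
    then show ?thesis using bump_deriv[OF assms, of 0 y] by (auto intro!: derivative_eq_intros)
  next
    case (Suc i)
    then show ?thesis using bump_deriv[OF assms, of j y] bump_deriv[OF assms, of i y]
      by (auto intro!: derivative_eq_intros simp: algebra_simps)
  qed
  then show ?thesis unfolding bump_def using R by (intro conjI allI exI[of _ R]) auto
qed

text \<open>A single term of the exponential series.\<close>

lemma power_le_exp:
  fixes x :: real assumes "0 \<le> x" shows "x ^ n \<le> fact n * exp x"
proof -
  have "(\<Sum>i\<in>{n}. x ^ i /\<^sub>R fact i) \<le> exp x"
    unfolding exp_def by (rule sum_le_suminf) (use assms in \<open>auto simp: summable_exp\<close>)
  then show ?thesis by (simp add: field_simps)
qed

text \<open>Differentiating \<open>P(y) (1 - y\<^sup>2)\<^sup>-\<^sup>m exp(-1/(1 - y\<^sup>2))\<close> reproduces this form with \<open>m + 2\<close> in place of \<open>m\<close>.\<close>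

fun std_poly :: "nat \<Rightarrow> real poly" where
  "std_poly 0 = 1"
| "std_poly (Suc j) = pderiv (std_poly j) * [:1, 0, -1:]^2 + smult (4 * real j) ([:0, 1:] * [:1, 0, -1:] * std_poly j)
     - smult 2 ([:0, 1:] * std_poly j)"

text \<open>The summand 1 in the exponent makes the value at 0 equal to 1 for \<open>j = 0\<close>,
  which is also the maximum.\<close>

definition std_bump :: "nat \<Rightarrow> real \<Rightarrow> real" where
  "std_bump j y = (if \<bar>y\<bar> < 1 then poly (std_poly j) y / (1 - y\<^sup>2) ^ (2 * j) * exp (1 - 1 / (1 - y\<^sup>2)) else 0)"

text \<open>The exponential beats every power of 1/(1 - y^2). Second order vanishing at |y| = 1 is
  what the difference quotients at these two points require.\<close>

lemma std_bump_bound: "\<exists>C. \<forall>y. \<bar>std_bump j y\<bar> \<le> C * (1 - y\<^sup>2)\<^sup>2"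
proof -
  have "compact (poly (std_poly j) ` {-1..1})" by (intro compact_continuous_image continuous_intros) auto
  then obtain B where B: "\<And>y. y \<in> {-1..1} \<Longrightarrow> \<bar>poly (std_poly j) y\<bar> \<le> B"
    using compact_imp_bounded bounded_iff by (metis imageI real_norm_def)
  have B0: "0 \<le> B" using B[of 0] by auto
  define C where "C = B * exp 1 * fact (2 * j + 2)"
  have "\<bar>std_bump j y\<bar> \<le> C * (1 - y\<^sup>2)\<^sup>2" for y
  proof (cases "\<bar>y\<bar> < 1")
    case True
    define s where "s = 1 - y\<^sup>2"
    have s: "s > 0" using True by (simp add: s_def abs_square_less_1)
    have "(1 / s) ^ (2 * j + 2) \<le> fact (2 * j + 2) * exp (1 / s)" by (rule power_le_exp) (use s in simp)
    then have e: "exp (- (1 / s)) / s ^ (2 * j) \<le> fact (2 * j + 2) * s\<^sup>2"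
      using s by (simp add: exp_minus field_simps power_add power2_eq_square)
    have ex: "exp (1 - 1 / s) = exp 1 * exp (- (1 / s))" by (simp flip: exp_add)
    have "\<bar>std_bump j y\<bar> = \<bar>poly (std_poly j) y\<bar> * exp 1 * (exp (- (1 / s)) / s ^ (2 * j))"
      using True s unfolding std_bump_def s_def[symmetric] ex by (simp add: abs_mult)
    also have "\<dots> \<le> B * exp 1 * (fact (2 * j + 2) * s\<^sup>2)"
    proof (intro mult_mono e)
      have "y \<in> {-1..1}" using True by auto
      then show "\<bar>poly (std_poly j) y\<bar> \<le> B" by (rule B)
    qed (use B0 s in auto)
    finally show ?thesis by (simp add: C_def s_def mult_ac)
  next
    case False
    then show ?thesis using B0 by (simp add: std_bump_def C_def)
  qed
  then show ?thesis by blast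
qed

lemma std_bump_deriv: "(std_bump j has_real_derivative std_bump (Suc j) y) (at y)"
proof -
  consider "\<bar>y\<bar> < 1" | "\<bar>y\<bar> > 1" | "\<bar>y\<bar> = 1" by linarith
  then show ?thesis
  proof cases
    case 1
    then have s: "1 - y\<^sup>2 > 0" by (simp add: abs_square_less_1)
    have "((\<lambda>y. poly (std_poly j) y / (1 - y\<^sup>2) ^ (2 * j) * exp (1 - 1 / (1 - y\<^sup>2))) has_real_derivative std_bump (Suc j) y) (at y)"
    proof (cases j)
      case 0
      then show ?thesis using s 1
        by (auto intro!: derivative_eq_intros simp: std_bump_def pderiv_1 power2_eq_square field_simps)
    next
      case (Suc i)
      have D1: "((\<lambda>y. 1 - y\<^sup>2) has_real_derivative - (2 * y)) (at y)"
        by (auto intro!: derivative_eq_intros)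
      have D2: "((\<lambda>y. exp (1 - 1 / (1 - y\<^sup>2))) has_real_derivative exp (1 - 1 / (1 - y\<^sup>2)) * (- (2 * y) / (1 - y\<^sup>2)\<^sup>2)) (at y)"
        using s by (auto intro!: derivative_eq_intros simp: power2_eq_square)
      have nz: "(1 - y\<^sup>2) ^ (2 * j) \<noteq> 0" using s by simp
      show ?thesis
      proof (rule DERIV_cong[OF DERIV_mult[OF DERIV_divide[OF poly_DERIV DERIV_power[OF D1] nz] D2]])
        show "(poly (pderiv (std_poly j)) y * (1 - y\<^sup>2) ^ (2 * j) - poly (std_poly j) y * (real (2 * j) * (- (2 * y) * (1 - y\<^sup>2) ^ (2 * j - Suc 0)))) / ((1 - y\<^sup>2) ^ (2 * j) * (1 - y\<^sup>2) ^ (2 * j)) * exp (1 - 1 / (1 - y\<^sup>2))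
         + exp (1 - 1 / (1 - y\<^sup>2)) * (- (2 * y) / (1 - y\<^sup>2)\<^sup>2) * (poly (std_poly j) y / (1 - y\<^sup>2) ^ (2 * j)) = std_bump (Suc j) y"
      proof -
        define s where "s = 1 - y\<^sup>2"
        define q where "q = s ^ (2 * j - Suc 0)"
        define E where "E = exp (1 - 1 / s)"
        have s0: "s \<noteq> 0" using s by (simp add: s_def)
        have q0: "q \<noteq> 0" using s0 by (simp add: q_def)
        have p1: "s ^ (2 * j) = q * s" using Suc by (simp add: q_def)
        have p2: "s ^ (2 * Suc j) = q * s * s\<^sup>2" using p1 by (simp add: power2_eq_square)
        have P: "poly (std_poly (Suc j)) y = poly (pderiv (std_poly j)) y * s\<^sup>2 + 4 * real j * (y * s * poly (std_poly j) y) - 2 * (y * poly (std_poly j) y)"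
          by (simp add: s_def power2_eq_square algebra_simps)
        show ?thesis
          using 1 unfolding std_bump_def s_def[symmetric] E_def[symmetric] p1 p2 q_def[symmetric] P
          using s0 q0 by (simp add: field_simps power2_eq_square)
      qed
    qed
    qed
    then show ?thesis
      by (rule has_field_derivative_transform_within_open[where S="{-1<..<1}"]) (use 1 in \<open>auto simp: std_bump_def\<close>)
  next
    case 2
    have "((\<lambda>y. 0) has_real_derivative std_bump (Suc j) y) (at y)" using 2 by (simp add: std_bump_def)
    then show ?thesis
      by (rule has_field_derivative_transform_within_open[where S="- {-1..1}"]) (use 2 in \<open>auto simp: std_bump_def\<close>)
  next
    case 3
    \<comment> \<open>At |y| = 1 the inside and the outside are treated at once: 1 - (y + h)^2 = -h
      (2y + h), so the bound by its square makes the difference quotient O(|h|).\<close>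
    obtain C where C: "\<And>y. \<bar>std_bump j y\<bar> \<le> C * (1 - y\<^sup>2)\<^sup>2" using std_bump_bound by blast
    have z: "std_bump j y = 0" "std_bump (Suc j) y = 0" using 3 by (auto simp: std_bump_def)
    have y2: "y\<^sup>2 = 1" using 3 by (metis one_power2 power2_abs)
    have "((\<lambda>h. (std_bump j (y + h) - std_bump j y) / h) \<longlongrightarrow> 0) (at 0)"
    proof (rule Lim_null_comparison)
      show "\<forall>\<^sub>F h in at 0. norm ((std_bump j (y + h) - std_bump j y) / h) \<le> C * \<bar>h\<bar> * (2 * y + h)\<^sup>2"
      proof (rule eventually_mono[OF eventually_at_filter[THEN iffD2, OF always_eventually]])
        show "\<forall>h. h \<noteq> 0 \<longrightarrow> h \<in> UNIV \<longrightarrow> h \<noteq> (0::real)" by simp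
        fix h :: real assume h: "h \<noteq> 0"
        have "1 - (y + h)\<^sup>2 = - h * (2 * y + h)" using y2 by (simp add: power2_eq_square algebra_simps)
        then have "\<bar>std_bump j (y + h)\<bar> \<le> C * (h\<^sup>2 * (2 * y + h)\<^sup>2)"
          using C[of "y + h"] by (simp add: power_mult_distrib)
        then have "\<bar>std_bump j (y + h)\<bar> / \<bar>h\<bar> \<le> C * (h\<^sup>2 * (2 * y + h)\<^sup>2) / \<bar>h\<bar>" by (rule divide_right_mono) simp
        also have "\<dots> = C * \<bar>h\<bar> * (2 * y + h)\<^sup>2"
          using h by (simp add: power2_eq_square[of h] abs_mult_self_eq[symmetric, of h] del: abs_mult_self_eq)
        finally show "norm ((std_bump j (y + h) - std_bump j y) / h) \<le> C * \<bar>h\<bar> * (2 * y + h)\<^sup>2"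
          using z by (simp add: abs_mult)
      qed
      have "((\<lambda>h. C * \<bar>h\<bar> * (2 * y + h)\<^sup>2) \<longlongrightarrow> C * \<bar>0\<bar> * (2 * y + 0)\<^sup>2) (at 0)" by (intro tendsto_intros)
      then show "((\<lambda>h. C * \<bar>h\<bar> * (2 * y + h)\<^sup>2) \<longlongrightarrow> 0) (at 0)" by simp
    qed
    then show ?thesis using z by (simp add: DERIV_def)
  qed
qed

lemma bump_std: "bump std_bump"
  unfolding bump_def using std_bump_deriv by (intro conjI allI exI[of _ 1]) (auto simp: std_bump_def)

lemma std_bump_0: "std_bump 0 0 = 1"
  and std_bump_0_nonneg: "0 \<le> std_bump 0 y"
  and std_bump_0_le: "std_bump 0 y \<le> 1"
proof -
  show "std_bump 0 0 = 1" by (simp add: std_bump_def)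
  show "0 \<le> std_bump 0 y" by (simp add: std_bump_def)
  show "std_bump 0 y \<le> 1"
  proof (cases "\<bar>y\<bar> < 1")
    case True
    then have s: "1 - y\<^sup>2 > 0" "1 - y\<^sup>2 \<le> 1" by (auto simp: abs_square_less_1)
    then have "1 \<le> 1 / (1 - y\<^sup>2)" by simp
    then show ?thesis using True by (simp add: std_bump_def)
  qed (simp add: std_bump_def)
qed

text \<open>Dilation by n + 1: each derivative gains a factor 1/(n + 1), so the corrections produced
  by differentiating the cutoff disappear in the limit.\<close>

definition cutoff :: "nat \<Rightarrow> nat \<Rightarrow> real \<Rightarrow> real" where
  "cutoff n j y = (1 / real (Suc n)) ^ j * std_bump j (1 / real (Suc n) * y)"

lemma bump_cut: "bump (cutoff n)"
  unfolding cutoff_def[abs_def] by (rule bump_scale[OF bump_std]) simp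

lemma cut_0_nonneg: "0 \<le> cutoff n 0 y" and cut_0_le: "cutoff n 0 y \<le> 1"
  by (simp_all add: cutoff_def std_bump_0_nonneg std_bump_0_le)

lemma cut_0_tendsto: "(\<lambda>n. cutoff n 0 y) \<longlonglongrightarrow> 1"
proof -
  have "(\<lambda>n. 1 / real (Suc n) * y) \<longlonglongrightarrow> 0 * y"
    using LIMSEQ_inverse_real_of_nat by (intro tendsto_mult_right) (simp add: inverse_eq_divide)
  moreover have "isCont (std_bump 0) 0" using std_bump_deriv DERIV_isCont by blast
  ultimately have "(\<lambda>n. std_bump 0 (1 / real (Suc n) * y)) \<longlonglongrightarrow> std_bump 0 0"
    using isCont_tendsto_compose by fastforce
  then show ?thesis by (simp add: cutoff_def std_bump_0)
qed

lemma cut_supp: "\<bar>y\<bar> > real (Suc n) \<Longrightarrow> cutoff n j y = 0"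
  by (simp add: cutoff_def std_bump_def field_simps)

section \<open>Localised Fourier coefficients and weak derivatives\<close>

text \<open>
  The coefficients of \<open>p\<close> weigh the successive derivatives \<open>b 0, b 1, \<dots>\<close> of a bump, so that
  differentiating the test functions \<open>bump_wave\<close> amounts to an operation on polynomials.
\<close>

definition bump_comb :: "(nat \<Rightarrow> real \<Rightarrow> real) \<Rightarrow> complex poly \<Rightarrow> real \<Rightarrow> complex" where
  "bump_comb b p y = (\<Sum>j\<le>degree p. coeff p j * of_real (b j y))"

lemma borel_measurable_cell [simp]: "borel_measurable cell_meas = borel_measurable borel"
  by (rule measurable_cong_sets) auto

lemma bump_comb_upto: "degree p \<le> N \<Longrightarrow> bump_comb b p y = (\<Sum>j\<le>N. coeff p j * of_real (b j y))"
  unfolding bump_comb_def by (rule sum.mono_neutral_left) (auto simp: coeff_eq_0)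

lemma bump_comb_add: "bump_comb b (p + q) y = bump_comb b p y + bump_comb b q y"
proof -
  let ?N = "max (degree p) (degree q)"
  have "bump_comb b (p + q) y = (\<Sum>j\<le>?N. coeff (p + q) j * of_real (b j y))"
    by (rule bump_comb_upto) (rule degree_add_le_max)
  then show ?thesis
    by (simp only: bump_comb_upto[of p ?N, OF max.cobounded1] bump_comb_upto[of q ?N, OF max.cobounded2] coeff_add
        distrib_right sum.distrib)
qed

lemma bump_comb_smult: "bump_comb b (smult c p) y = c * bump_comb b p y"
  by (subst bump_comb_upto[of "smult c p" "degree p"]) (auto simp: bump_comb_def sum_distrib_left mult_ac degree_smult_le)

lemma bump_comb_one: "bump_comb b 1 y = of_real (b 0 y)"
  by (simp add: bump_comb_def)

lemma bump_comb_pCons_0: "bump_comb b (pCons 0 p) y = bump_comb (\<lambda>j. b (Suc j)) p y"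
proof -
  have "bump_comb b (pCons 0 p) y = (\<Sum>j\<le>Suc (degree p). coeff (pCons 0 p) j * of_real (b j y))"
    by (rule bump_comb_upto) (rule degree_pCons_le)
  also have "\<dots> = (\<Sum>j\<le>degree p. coeff p j * of_real (b (Suc j) y))"
    by (simp only: sum.atMost_Suc_shift coeff_pCons_0 coeff_pCons_Suc mult_zero_left add_0)
  finally show ?thesis by (simp only: bump_comb_def)
qed

lemma bump_comb_deriv:
  assumes "bump b"
  shows "(bump_comb b p has_vector_derivative bump_comb b (pCons 0 p) y) (at y within S)"
proof -
  have "((\<lambda>y. \<Sum>j\<le>degree p. coeff p j * complex_of_real (b j y)) has_vector_derivative
      (\<Sum>j\<le>degree p. coeff p j * complex_of_real (b (Suc j) y))) (at y within S)"
  proof (intro has_vector_derivative_sum has_vector_derivative_mult_right)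
    fix j
    have "(b j has_vector_derivative b (Suc j) y) (at y within S)"
      using bump_deriv[OF assms, of j y] has_real_derivative_iff_has_vector_derivative has_vector_derivative_at_within by blast
    then show "((\<lambda>x. complex_of_real (b j x)) has_vector_derivative complex_of_real (b (Suc j) y)) (at y within S)"
      by (rule bounded_linear.has_vector_derivative[OF bounded_linear_of_real])
  qed
  then show ?thesis unfolding bump_comb_pCons_0 unfolding bump_comb_def[abs_def] .
qed

lemma bump_comb_cont: "bump b \<Longrightarrow> continuous_on A (bump_comb b p)"
  unfolding bump_comb_def[abs_def] by (intro continuous_intros bump_cont)

lemma bump_comb_y_measurable: "bump b \<Longrightarrow> (\<lambda>X::point. bump_comb b p (fst (snd X))) \<in> borel_measurable borel"
  by (rule borel_measurable_continuous_onI, rule continuous_on_compose2[OF bump_comb_cont[of b UNIV]])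
     (auto intro!: continuous_intros)

lemma bump_comb_measurable: "bump b \<Longrightarrow> bump_comb b p \<in> borel_measurable borel"
  by (intro borel_measurable_continuous_onI bump_comb_cont)

lemma bump_comb_supp: "bump b \<Longrightarrow> \<exists>R>0. \<forall>p y. \<bar>y\<bar> > R \<longrightarrow> bump_comb b p y = 0"
proof -
  assume "bump b"
  then obtain R where "R > 0" "\<forall>j y. \<bar>y\<bar> > R \<longrightarrow> b j y = 0" using bump_supp by blast
  then show ?thesis by (intro exI[of _ R]) (simp add: bump_comb_def)
qed

lemma bump_comb_bounded:
  assumes "bump b" obtains B where "\<And>y. norm (bump_comb b p y) \<le> B"
proof -
  obtain R where R: "R > 0" "\<And>y. \<bar>y\<bar> > R \<Longrightarrow> bump_comb b p y = 0" using bump_comb_supp[OF assms] by blast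
  have "compact (bump_comb b p ` {-R..R})" using bump_comb_cont[OF assms] by (intro compact_continuous_image) auto
  then obtain B where B: "\<forall>z\<in>bump_comb b p ` {-R..R}. norm z \<le> B"
    using compact_imp_bounded bounded_iff by blast
  have "norm (bump_comb b p y) \<le> max B 0" for y
  proof (cases "\<bar>y\<bar> > R")
    case False
    then have "y \<in> {-R..R}" by auto
    then have "norm (bump_comb b p y) \<le> B" using B by blast
    then show ?thesis by simp
  qed (simp add: R)
  then show ?thesis using that by blast
qed

text \<open>The real part is taken because fields and test functions are real valued; replacing
  \<open>p\<close> by \<open>smult \<i> p\<close> gives access to the imaginary part.\<close>

definition bump_wave :: "(nat \<Rightarrow> real \<Rightarrow> real) \<Rightarrow> frequency \<Rightarrow> complex poly \<Rightarrow> scalar_field" where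
  "bump_wave b \<xi> p X = Re (bump_comb b p (fst (snd X)) * wave \<xi> X)"

text \<open>The effect of a partial derivative on the polynomial. In y the product rule applies:
  \<open>pCons 0\<close> raises the order of the bump derivatives, and the other term differentiates
  the wave.\<close>

definition psym :: "3 \<Rightarrow> frequency \<Rightarrow> complex poly \<Rightarrow> complex poly" where
  "psym i \<xi> p = (if i = 1 then smult (- (\<i> * of_int (fst \<xi>))) p
     else if i = 2 then pCons 0 p + smult (- (\<i> * of_real (fst (snd \<xi>)))) p
     else smult (- (\<i> * of_int (snd (snd \<xi>)))) p)"

lemma Re_has_real_derivative:
  "(f has_vector_derivative f') (at x) \<Longrightarrow> ((\<lambda>x. Re (f x)) has_real_derivative Re f') (at x)"
  unfolding has_real_derivative_iff_has_vector_derivative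
  by (rule bounded_linear.has_vector_derivative[OF bounded_linear_Re])

lemma index3_neq: "(2::3) \<noteq> 1" "(3::3) \<noteq> 1" "(3::3) \<noteq> 2" "(1::3) \<noteq> 2"
  by simp_all

lemma pd_bump_wave:
  assumes "bump b"
  shows "pd i (bump_wave b \<xi> p) = bump_wave b \<xi> (psym i \<xi> p)"
proof (rule ext)
  fix X :: point
  obtain x y z where X: "X = (x, y, z)" by (cases X)
  obtain k \<eta> l where \<xi>: "\<xi> = (k, \<eta>, l)" by (cases \<xi>)
  let ?c = "\<lambda>x y z. cis (- (of_int k * x + \<eta> * y + of_int l * z))"
  have T: "bump_wave b \<xi> q (x, y, z) = Re (bump_comb b q y * ?c x y z)" for q x y z
    by (simp add: bump_wave_def wave_def \<xi>)
  have c1: "((\<lambda>s. ?c s y z) has_vector_derivative (- (\<i> * of_int k) * ?c x y z)) (at x)"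
    using has_vector_derivative_cis[of "- of_int k" "- (\<eta> * y + of_int l * z)" x UNIV] by (simp add: algebra_simps)
  have c2: "((\<lambda>s. ?c x s z) has_vector_derivative (- (\<i> * of_real \<eta>) * ?c x y z)) (at y)"
    using has_vector_derivative_cis[of "- \<eta>" "- (of_int k * x + of_int l * z)" y UNIV] by (simp add: algebra_simps)
  have c3: "((\<lambda>s. ?c x y s) has_vector_derivative (- (\<i> * of_int l) * ?c x y z)) (at z)"
    using has_vector_derivative_cis[of "- of_int l" "- (of_int k * x + \<eta> * y)" z UNIV] by (simp add: algebra_simps)
  have d1: "deriv (\<lambda>s. bump_wave b \<xi> p (s, y, z)) x = Re (bump_comb b p y * (- (\<i> * of_int k) * ?c x y z))"
    unfolding T by (intro DERIV_imp_deriv Re_has_real_derivative has_vector_derivative_mult_right c1)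
  have d3: "deriv (\<lambda>s. bump_wave b \<xi> p (x, y, s)) z = Re (bump_comb b p y * (- (\<i> * of_int l) * ?c x y z))"
    unfolding T by (intro DERIV_imp_deriv Re_has_real_derivative has_vector_derivative_mult_right c3)
  have d2: "deriv (\<lambda>s. bump_wave b \<xi> p (x, s, z)) y = Re (bump_comb b p y * (- (\<i> * of_real \<eta>) * ?c x y z) + bump_comb b (pCons 0 p) y * ?c x y z)"
    unfolding T by (intro DERIV_imp_deriv Re_has_real_derivative has_vector_derivative_mult bump_comb_deriv assms c2)
  consider "i = 1" | "i = 2" | "i \<noteq> 1" "i \<noteq> 2" by blast
  then show "pd i (bump_wave b \<xi> p) X = bump_wave b \<xi> (psym i \<xi> p) X"
  proof cases
    case 1
    show ?thesis unfolding 1 pd_def psym_def X prod.case if_P[OF refl] unfolding d1 unfolding T bump_comb_smult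
      by (simp only: \<xi> fst_conv snd_conv mult_ac)
  next
    case 2
    show ?thesis unfolding 2 pd_def psym_def X prod.case if_not_P[OF index3_neq(1)] if_P[OF refl] unfolding d2 unfolding T bump_comb_smult bump_comb_add
      by (rule arg_cong[where f=Re]) (simp add: \<xi> algebra_simps)
  next
    case 3
    show ?thesis unfolding pd_def psym_def X prod.case if_not_P[OF 3(1)] if_not_P[OF 3(2)] unfolding d3 unfolding T bump_comb_smult
      by (simp only: \<xi> fst_conv snd_conv mult_ac)
  qed
qed

text \<open>The iterated \<open>psym\<close> in closed form: derivatives in x and z are scalars, and
  a derivative in y is multiplication by the linear polynomial X - \<i>\<eta>, whose powers expand
  binomially.\<close>

definition bump_wave_symbol :: "multi_index \<Rightarrow> frequency \<Rightarrow> complex poly \<Rightarrow> complex poly" where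
  "bump_wave_symbol = (\<lambda>(a, b, c) (k, \<eta>, l) p. smult ((- (\<i> * of_int k)) ^ a * (- (\<i> * of_int l)) ^ c) ([:- (\<i> * of_real \<eta>), 1:] ^ b * p))"

lemma pd_funpow_bump_wave: "bump b \<Longrightarrow> (pd i ^^ n) (bump_wave b \<xi> p) = bump_wave b \<xi> ((psym i \<xi> ^^ n) p)"
  by (induction n arbitrary: p) (simp_all add: pd_bump_wave funpow_swap1 del: funpow.simps(2) flip: funpow.simps(2), simp_all add: pd_bump_wave)

lemma pd_multi_bump_wave:
  assumes "bump b"
  shows "pd_multi \<alpha> (bump_wave b \<xi> p) = bump_wave b \<xi> (bump_wave_symbol \<alpha> \<xi> p)"
proof -
  obtain a m c where \<alpha>: "\<alpha> = (a, m, c)" by (cases \<alpha>)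
  obtain k \<eta> l where \<xi>: "\<xi> = (k, \<eta>, l)" by (cases \<xi>)
  have 1: "(psym 1 \<xi> ^^ n) q = smult ((- (\<i> * of_int k)) ^ n) q" for n q
    by (induction n) (simp_all add: psym_def \<xi>)
  have 2: "(psym 2 \<xi> ^^ n) q = [:- (\<i> * of_real \<eta>), 1:] ^ n * q" for n q
    by (induction n) (simp_all add: psym_def \<xi> index3_neq mult.assoc left_diff_distrib)
  have 3: "(psym 3 \<xi> ^^ n) q = smult ((- (\<i> * of_int l)) ^ n) q" for n q
    by (induction n) (simp_all add: psym_def \<xi> index3_neq)
  show ?thesis
    unfolding \<alpha> pd_multi_def prod.case pd_funpow_bump_wave[OF assms] 1 2 3 unfolding bump_wave_symbol_def \<xi> by (simp add: mult.commute)
qed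

lemma differentiable_bump_wave: "bump b \<Longrightarrow> bump_wave b \<xi> p differentiable_on UNIV"
proof -
  assume b: "bump b"
  obtain k \<eta> l where \<xi>: "\<xi> = (k, \<eta>, l)" by (cases \<xi>)
  have e: "bump_comb b p differentiable at y" for y
    using bump_comb_deriv[OF b, of p y UNIV] by (auto simp: has_vector_derivative_def differentiable_def)
  have c: "cis differentiable at t" for t
    using has_vector_derivative_cis[of 1 0 t UNIV] by (auto simp: has_vector_derivative_def differentiable_def)
  have 1: "(\<lambda>X::point. bump_comb b p (fst (snd X))) differentiable at X" for X
    by (rule differentiable_compose[OF e]) (intro linear_imp_differentiable linear_compose[unfolded o_def, of snd fst] bounded_linear.linear bounded_linear_fst bounded_linear_snd)
  have 2: "(\<lambda>X::point. - (of_int k * fst X + \<eta> * fst (snd X) + of_int l * snd (snd X))) differentiable at X" for X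
    by (intro linear_imp_differentiable linearI) (auto simp: algebra_simps)
  have w: "(\<lambda>X. wave \<xi> X) = (\<lambda>X. cis (- (of_int k * fst X + \<eta> * fst (snd X) + of_int l * snd (snd X))))"
    by (auto simp: wave_def \<xi> fun_eq_iff)
  have "(\<lambda>X. wave \<xi> X) differentiable at X" for X
    unfolding w by (rule differentiable_compose[OF c 2])
  then have "(\<lambda>X. bump_comb b p (fst (snd X)) * wave \<xi> X) differentiable at X" for X
    by (intro differentiable_mult 1)
  then have "(\<lambda>X. Re (bump_comb b p (fst (snd X)) * wave \<xi> X)) differentiable at X" for X
    using differentiable_compose[of Re "\<lambda>X. bump_comb b p (fst (snd X)) * wave \<xi> X" X UNIV]
      bounded_linear_imp_differentiable[OF bounded_linear_Re] by blast
  then show ?thesis unfolding bump_wave_def[abs_def] differentiable_on_def by (simp add: differentiable_at_withinI)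
qed

lemma wave_periodic:
  "wave \<xi> (x + 2 * pi, y, z) = wave \<xi> (x, y, z)" "wave \<xi> (x, y, z + 2 * pi) = wave \<xi> (x, y, z)"
proof -
  obtain k \<eta> l where \<xi>: "\<xi> = (k, \<eta>, l)" by (cases \<xi>)
  have "- (of_int k * (x + 2 * pi) + \<eta> * y + of_int l * z) = - (of_int k * x + \<eta> * y + of_int l * z) + 2 * pi * of_int (- k)"
    "- (of_int k * x + \<eta> * y + of_int l * (z + 2 * pi)) = - (of_int k * x + \<eta> * y + of_int l * z) + 2 * pi * of_int (- l)"
    by (simp_all add: algebra_simps)
  then show "wave \<xi> (x + 2 * pi, y, z) = wave \<xi> (x, y, z)" "wave \<xi> (x, y, z + 2 * pi) = wave \<xi> (x, y, z)"
    unfolding \<xi> wave_def prod.case by (simp_all only: cis_mult[symmetric] cis_multiple_2pi[OF Ints_of_int] mult_1_right)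
qed

lemma test_function_bump_wave: "bump b \<Longrightarrow> test_function (bump_wave b \<xi> p)"
  unfolding test_function_def
proof (intro conjI allI)
  assume b: "bump b"
  show "pd_multi \<alpha> (bump_wave b \<xi> p) differentiable_on UNIV" for \<alpha>
    unfolding pd_multi_bump_wave[OF b] by (rule differentiable_bump_wave[OF b])
  show "periodic_xz (bump_wave b \<xi> p)"
    by (simp add: periodic_xz_def bump_wave_def wave_periodic)
  show "\<exists>R. \<forall>x y z. R < \<bar>y\<bar> \<longrightarrow> bump_wave b \<xi> p (x, y, z) = 0"
  proof -
    obtain R where R: "\<And>p y. \<bar>y\<bar> > R \<Longrightarrow> bump_comb b p y = 0" using bump_comb_supp[OF b] by blast
    show ?thesis by (intro exI[of _ R]) (simp add: bump_wave_def R)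
  qed
qed

definition modulate :: "(nat \<Rightarrow> real \<Rightarrow> real) \<Rightarrow> complex poly \<Rightarrow> scalar_field \<Rightarrow> point \<Rightarrow> complex" where
  "modulate b p f X = of_real (f X) * bump_comb b p (fst (snd X))"

text \<open>Available at every single frequency, unlike the transform of an L2 function, so that a
  differential equation in time makes sense for each \<xi> separately.\<close>

definition lfourier :: "(nat \<Rightarrow> real \<Rightarrow> real) \<Rightarrow> complex poly \<Rightarrow> scalar_field \<Rightarrow> frequency \<Rightarrow> complex" where
  "lfourier b p f = fourier (modulate b p f)"

lemma sqint_of_real: "sqint M f \<Longrightarrow> sqint M (\<lambda>x. complex_of_real (f x))"
  and l2n_of_real: "l2n M (\<lambda>x. complex_of_real (f x)) = l2n M f"
  by (auto simp: sqint_def l2n_def)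

lemma sqint_modulate:
  assumes "bump b" "sqint cell_meas f"
  shows "sqint cell_meas (modulate b p f)"
proof -
  obtain B where B: "\<And>y. norm (bump_comb b p y) \<le> B" using bump_comb_bounded[OF assms(1), of p] by blast
  show ?thesis
    unfolding modulate_def[abs_def]
    by (rule sqint_mult_bounded[OF sqint_of_real[OF assms(2)] _ B]) (simp add: bump_comb_y_measurable[OF assms(1)])
qed

lemma y_supp_modulate: "bump b \<Longrightarrow> \<exists>R. \<forall>p f. y_supp R (modulate b p f)"
  using bump_comb_supp[of b] by (auto simp: y_supp_def modulate_def)

lemma integrable_modulate:
  assumes "bump b" "sqint cell_meas f"
  shows "integrable cell_meas (modulate b p f)"
  using integrable_y_supp sqint_modulate[OF assms] y_supp_modulate[OF assms(1)] by blast

lemma integrable_modulate_wave: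
  assumes "bump b" "sqint cell_meas f"
  shows "integrable cell_meas (\<lambda>X. modulate b p f X * wave \<xi> X)"
  by (rule integrable_bounded_mult_left[OF integrable_modulate[OF assms], where C=1]) auto

lemma lfourier_eq: "lfourier b p f \<xi> = (\<integral>X. of_real (f X) * (bump_comb b p (fst (snd X)) * wave \<xi> X) \<partial>cell_meas)"
  by (simp add: lfourier_def fourier_def modulate_def mult.assoc)

lemma lfourier_smult_poly: "lfourier b (smult c p) f \<xi> = c * lfourier b p f \<xi>"
  unfolding lfourier_def fourier_def modulate_def bump_comb_smult
  by (subst integral_mult_right_zero[symmetric]) (simp add: mult_ac)

lemma lfourier_add:
  assumes "bump b" "sqint cell_meas f" "sqint cell_meas g"
  shows "lfourier b p (\<lambda>X. f X + g X) \<xi> = lfourier b p f \<xi> + lfourier b p g \<xi>"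
proof -
  have "modulate b p (\<lambda>X. f X + g X) X * wave \<xi> X = modulate b p f X * wave \<xi> X + modulate b p g X * wave \<xi> X" for X
    by (simp add: modulate_def algebra_simps)
  then show ?thesis
    unfolding lfourier_def fourier_def
    by (simp only: Bochner_Integration.integral_add[OF integrable_modulate_wave[OF assms(1,2)] integrable_modulate_wave[OF assms(1,3)]])
qed

lemma lfourier_cmult: "lfourier b p (\<lambda>X. c * f X) \<xi> = of_real c * lfourier b p f \<xi>"
  unfolding lfourier_def fourier_def modulate_def
  by (subst integral_mult_right_zero[symmetric]) (simp add: mult_ac)

lemma lfourier_cong_AE:
  assumes "bump b" "f \<in> borel_measurable borel" "g \<in> borel_measurable borel" "AE X in cell_meas. f X = g X"
  shows "lfourier b p f \<xi> = lfourier b p g \<xi>"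
proof -
  define w where "w X = bump_comb b p (fst (snd X)) * wave \<xi> X" for X
  have [measurable]: "w \<in> borel_measurable borel"
    unfolding w_def[abs_def] using bump_comb_y_measurable[OF assms(1)] by (intro borel_measurable_times wave_measurable)
  note [measurable] = assms(2,3)
  show ?thesis unfolding lfourier_eq w_def[symmetric]
  proof (rule integral_cong_AE)
    show "AE X in cell_meas. of_real (f X) * w X = of_real (g X) * w X"
      using assms(4) by eventually_elim simp
  qed measurable
qed

lemma Re_lfourier:
  assumes "bump b" "sqint cell_meas f"
  shows "Re (lfourier b p f \<xi>) = (LINT X:cell|lborel. f X * bump_wave b \<xi> p X)"
proof -
  have [measurable]: "bump_comb b p \<in> borel_measurable borel" by (rule bump_comb_measurable[OF assms(1)])
  have [measurable]: "f \<in> borel_measurable borel" using sqint_measurable[OF assms(2)] by simp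
  have "Re (lfourier b p f \<xi>) = (\<integral>X. Re (modulate b p f X * wave \<xi> X) \<partial>cell_meas)"
    unfolding lfourier_def fourier_def by (rule integral_Re[symmetric, OF integrable_modulate_wave[OF assms]])
  also have "\<dots> = (\<integral>X. f X * bump_wave b \<xi> p X \<partial>cell_meas)"
    by (simp add: modulate_def bump_wave_def mult.assoc)
  also have "\<dots> = (LINT X:cell|lborel. f X * bump_wave b \<xi> p X)"
    by (rule set_integral_cell[symmetric])
       (use bump_comb_y_measurable[OF assms(1), of p] in \<open>auto simp: bump_wave_def[abs_def] intro!: borel_measurable_times borel_measurable_Re\<close>)
  finally show ?thesis .
qed

lemma bump_wave_symbol_smult: "bump_wave_symbol \<alpha> \<xi> (smult c p) = smult c (bump_wave_symbol \<alpha> \<xi> p)"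
  by (simp add: bump_wave_symbol_def split_beta mult.commute)

text \<open>By \<open>Re_lfourier\<close> the real part of a coefficient is a pairing with the test
  function \<open>bump_wave\<close>, to which the definition of the weak derivative applies. The
  same for \<open>smult \<i> p\<close> gives the imaginary parts.\<close>

lemma weak_deriv_lfourier:
  assumes b: "bump b" and f: "f \<in> L2_space" and h: "h \<in> L2_space" and w: "has_weak_deriv f \<alpha> h"
  shows "lfourier b p h \<xi> = (-1) ^ order_of \<alpha> * lfourier b (bump_wave_symbol \<alpha> \<xi> p) f \<xi>"
proof -
  note f' = L2_space_sqint[OF f] note h' = L2_space_sqint[OF h]
  have re: "Re (lfourier b q h \<xi>) = (-1) ^ order_of \<alpha> * Re (lfourier b (bump_wave_symbol \<alpha> \<xi> q) f \<xi>)" for q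
    using w test_function_bump_wave[OF b, of \<xi> q]
    unfolding has_weak_deriv_def Re_lfourier[OF b f'] Re_lfourier[OF b h'] pd_multi_bump_wave[OF b, symmetric]
    by (cases "even (order_of \<alpha>)") auto
  have "Re (\<i> * lfourier b p h \<xi>) = (-1) ^ order_of \<alpha> * Re (\<i> * lfourier b (bump_wave_symbol \<alpha> \<xi> p) f \<xi>)"
    using re[of "smult \<i> p"] by (simp only: bump_wave_symbol_smult lfourier_smult_poly)
  with re[of p] show ?thesis
    by (cases "even (order_of \<alpha>)") (auto simp: complex_eq_iff)
qed

section \<open>The Fourier transform on \<open>L\<^sup>2\<close>\<close>

abbreviation parseval_const :: real where
  "parseval_const \<equiv> sqrt ((2 * pi) ^ 3)"

lemma tendsto_0_le:
  fixes a b :: "nat \<Rightarrow> real"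
  assumes "\<And>n. a n \<le> b n" "\<And>n. 0 \<le> a n" "b \<longlonglongrightarrow> 0"
  shows "a \<longlonglongrightarrow> 0"
  by (rule tendsto_sandwich[OF always_eventually[OF allI] always_eventually[OF allI] tendsto_const assms(3)])
     (fact assms)+

lemma parseval_const_pos: "parseval_const > 0"
  by simp

lemma fourier_add:
  assumes "integrable cell_meas g" "integrable cell_meas h"
  shows "fourier (\<lambda>X. g X + h X) \<xi> = fourier g \<xi> + fourier h \<xi>"
proof -
  have i: "integrable cell_meas (\<lambda>X. g X * wave \<xi> X)" "integrable cell_meas (\<lambda>X. h X * wave \<xi> X)"
    by (rule integrable_bounded_mult_left[where C=1]; use assms in simp)+
  show ?thesis unfolding fourier_def distrib_right by (rule Bochner_Integration.integral_add[OF i])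
qed

lemma fourier_cmult: "fourier (\<lambda>X. c * g X) \<xi> = c * fourier g \<xi>"
  by (simp add: fourier_def mult.assoc)

lemma fourier_diff:
  assumes "integrable cell_meas g" "integrable cell_meas h"
  shows "fourier (\<lambda>X. g X - h X) \<xi> = fourier g \<xi> - fourier h \<xi>"
  using fourier_add[OF assms(1) integrable_minus[OF assms(2)]] fourier_cmult[of "-1" h] by simp

lemma y_supp_diff: "y_supp R g \<Longrightarrow> y_supp S h \<Longrightarrow> y_supp (max R S) (\<lambda>X. g X - h X :: 'b::ab_group_add)"
  by (auto simp: y_supp_def)

lemma l2n_fourier_diff:
  assumes "y_supp R g" "y_supp S h" "sqint cell_meas g" "sqint cell_meas h"
  shows "l2n freq_meas (\<lambda>\<xi>. fourier g \<xi> - fourier h \<xi>) = parseval_const * l2n cell_meas (\<lambda>X. g X - h X)"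
proof -
  have "(\<lambda>\<xi>. fourier g \<xi> - fourier h \<xi>) = fourier (\<lambda>X. g X - h X)"
    using fourier_diff[OF integrable_y_supp[OF assms(1,3)] integrable_y_supp[OF assms(2,4)]] by auto
  then show ?thesis using plancherel(2)[OF y_supp_diff[OF assms(1,2)] sqint_diff[OF assms(3,4)]] by simp
qed

lemma sqint_lfourier: "bump b \<Longrightarrow> sqint cell_meas f \<Longrightarrow> sqint freq_meas (lfourier b p f)"
  unfolding lfourier_def using plancherel(1) y_supp_modulate sqint_modulate by blast

lemma l2n_lfourier: "bump b \<Longrightarrow> sqint cell_meas f \<Longrightarrow> l2n freq_meas (lfourier b p f) = parseval_const * l2n cell_meas (modulate b p f)"
  unfolding lfourier_def using plancherel(2) y_supp_modulate sqint_modulate by blast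

text \<open>The cutoffs lie between 0 and 1 and tend to 1, so dominated convergence applies to the
  squares.\<close>

lemma cut_tendsto_l2:
  assumes "sqint cell_meas f"
  shows "(\<lambda>n. l2n cell_meas (\<lambda>X. modulate (cutoff n) 1 f X - of_real (f X))) \<longlonglongrightarrow> 0"
proof -
  have [measurable]: "f \<in> borel_measurable borel" using sqint_measurable[OF assms] by simp
  have m: "modulate (cutoff n) 1 f \<in> borel_measurable borel" for n
    using sqint_measurable[OF sqint_modulate[OF bump_cut assms]] by simp
  have "(\<lambda>n. \<integral>X. (norm (modulate (cutoff n) 1 f X - of_real (f X)))\<^sup>2 \<partial>cell_meas) \<longlonglongrightarrow> (\<integral>X. 0 \<partial>cell_meas)"
  proof (rule integral_dominated_convergence[where w="\<lambda>X. (norm (f X))\<^sup>2"])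
    show "integrable cell_meas (\<lambda>X. (norm (f X))\<^sup>2)" using assms by (simp add: sqint_def)
    show "(\<lambda>X. (norm (modulate (cutoff n) 1 f X - of_real (f X)))\<^sup>2) \<in> borel_measurable cell_meas" for n
      using m[of n] by simp
    have eq: "norm (modulate (cutoff n) 1 f X - of_real (f X)) = \<bar>f X\<bar> * \<bar>cutoff n 0 (fst (snd X)) - 1\<bar>" for n X
    proof -
      have "modulate (cutoff n) 1 f X - of_real (f X) = of_real (f X * (cutoff n 0 (fst (snd X)) - 1))"
        by (simp add: modulate_def bump_comb_one algebra_simps)
      then show ?thesis by (simp only: norm_of_real abs_mult)
    qed
    show "AE X in cell_meas. (\<lambda>n. (norm (modulate (cutoff n) 1 f X - of_real (f X)))\<^sup>2) \<longlonglongrightarrow> 0"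
    proof (intro AE_I2)
      fix X :: point
      have "(\<lambda>n. (\<bar>f X\<bar> * \<bar>cutoff n 0 (fst (snd X)) - 1\<bar>)\<^sup>2) \<longlonglongrightarrow> (\<bar>f X\<bar> * \<bar>1 - 1\<bar>)\<^sup>2"
        by (intro tendsto_intros cut_0_tendsto)
      then show "(\<lambda>n. (norm (modulate (cutoff n) 1 f X - of_real (f X)))\<^sup>2) \<longlonglongrightarrow> 0" unfolding eq by simp
    qed
    show "AE X in cell_meas. norm ((norm (modulate (cutoff n) 1 f X - of_real (f X)))\<^sup>2) \<le> (norm (f X))\<^sup>2" for n
    proof (intro AE_I2)
      fix X :: point
      have "\<bar>cutoff n 0 (fst (snd X)) - 1\<bar> \<le> 1"
        using cut_0_nonneg[of n "fst (snd X)"] cut_0_le[of n "fst (snd X)"] by linarith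
      then have "\<bar>f X\<bar> * \<bar>cutoff n 0 (fst (snd X)) - 1\<bar> \<le> norm (f X)" by (simp add: mult_left_le)
      then have "(norm (modulate (cutoff n) 1 f X - of_real (f X)))\<^sup>2 \<le> (norm (f X))\<^sup>2"
        unfolding eq by (intro power_mono) auto
      then show "norm ((norm (modulate (cutoff n) 1 f X - of_real (f X)))\<^sup>2) \<le> (norm (f X))\<^sup>2" by simp
    qed
  qed simp
  then have "(\<lambda>n. sqrt (\<integral>X. (norm (modulate (cutoff n) 1 f X - of_real (f X)))\<^sup>2 \<partial>cell_meas)) \<longlonglongrightarrow> sqrt 0"
    by (intro tendsto_real_sqrt) simp
  then show ?thesis by (simp add: l2n_def)
qed

definition is_hat :: "scalar_field \<Rightarrow> (frequency \<Rightarrow> complex) \<Rightarrow> bool" where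
  "is_hat f F \<longleftrightarrow> sqint freq_meas F \<and> (\<lambda>n. l2n freq_meas (\<lambda>\<xi>. lfourier (cutoff n) 1 f \<xi> - F \<xi>)) \<longlonglongrightarrow> 0"

lemma is_hat_sqint: "is_hat f F \<Longrightarrow> sqint freq_meas F"
  by (simp add: is_hat_def)

text \<open>Plancherel for bounded support turns the L2 convergence of the cut off functions into a
  Cauchy sequence of transforms.\<close>

lemma hat_exists:
  assumes f: "sqint cell_meas f"
  shows "\<exists>F. is_hat f F"
proof -
  let ?m = "\<lambda>n. modulate (cutoff n) 1 f"
  let ?d = "\<lambda>n. l2n cell_meas (\<lambda>X. ?m n X - of_real (f X))"
  note sm = sqint_modulate[OF bump_cut f, of _ 1]
  have le: "l2n freq_meas (\<lambda>\<xi>. lfourier (cutoff m) 1 f \<xi> - lfourier (cutoff n) 1 f \<xi>) \<le> parseval_const * (?d m + ?d n)" for m n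
  proof -
    obtain R S where "y_supp R (?m m)" "y_supp S (?m n)" using y_supp_modulate[OF bump_cut] by blast
    then have "l2n freq_meas (\<lambda>\<xi>. lfourier (cutoff m) 1 f \<xi> - lfourier (cutoff n) 1 f \<xi>) = parseval_const * l2n cell_meas (\<lambda>X. ?m m X - ?m n X)"
      unfolding lfourier_def by (rule l2n_fourier_diff) (rule sm)+
    also have "l2n cell_meas (\<lambda>X. ?m m X - ?m n X) \<le> ?d m + ?d n"
      using l2n_triangle_diff[OF sm[of m] sqint_of_real[OF f] sm[of n]]
      by (simp add: l2n_minus_commute[of cell_meas "\<lambda>X. complex_of_real (f X)"])
    finally show ?thesis by (simp add: mult_left_mono)
  qed
  have "\<exists>N. \<forall>m\<ge>N. \<forall>n\<ge>N. l2n freq_meas (\<lambda>\<xi>. lfourier (cutoff m) 1 f \<xi> - lfourier (cutoff n) 1 f \<xi>) < e" if "e > 0" for e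
  proof -
    have "e / (2 * parseval_const) > 0" using that parseval_const_pos by simp
    from LIMSEQ_D[OF cut_tendsto_l2[OF f] this]
    obtain N where "\<forall>n\<ge>N. norm (?d n - 0) < e / (2 * parseval_const)" by blast
    then have N: "?d n < e / (2 * parseval_const)" if "n \<ge> N" for n using that by simp
    have "l2n freq_meas (\<lambda>\<xi>. lfourier (cutoff m) 1 f \<xi> - lfourier (cutoff n) 1 f \<xi>) < e" if "m \<ge> N" "n \<ge> N" for m n
    proof -
      have "parseval_const * (?d m + ?d n) < parseval_const * (e / (2 * parseval_const) + e / (2 * parseval_const))"
        by (intro mult_strict_left_mono add_strict_mono N that parseval_const_pos)
      also have "\<dots> = e" using parseval_const_pos by (simp add: field_simps)
      finally show ?thesis using le[of m n] by linarith
    qed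
    then show ?thesis by blast
  qed
  from l2_complete[OF sqint_lfourier[OF bump_cut f] this]
  show ?thesis unfolding is_hat_def by blast
qed

lemma hat_norm:
  assumes "is_hat f F" "sqint cell_meas f"
  shows "l2n freq_meas F = parseval_const * l2n cell_meas f"
proof (rule LIMSEQ_unique)
  show "(\<lambda>n. l2n freq_meas (lfourier (cutoff n) 1 f)) \<longlonglongrightarrow> l2n freq_meas F"
    using assms by (intro l2n_tendsto sqint_lfourier bump_cut) (auto simp: is_hat_def)
  have "(\<lambda>n. l2n cell_meas (modulate (cutoff n) 1 f)) \<longlonglongrightarrow> l2n cell_meas (\<lambda>X. complex_of_real (f X))"
    by (intro l2n_tendsto sqint_modulate bump_cut assms sqint_of_real cut_tendsto_l2)
  then show "(\<lambda>n. l2n freq_meas (lfourier (cutoff n) 1 f)) \<longlonglongrightarrow> parseval_const * l2n cell_meas f"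
    unfolding l2n_lfourier[OF bump_cut assms(2)] l2n_of_real by (intro tendsto_mult_left)
qed

lemma hat_unique: "is_hat f F \<Longrightarrow> is_hat f F' \<Longrightarrow> sqint cell_meas f \<Longrightarrow> AE \<xi> in freq_meas. F \<xi> = F' \<xi>"
  by (rule l2_limit_unique[where f="\<lambda>n. lfourier (cutoff n) 1 f"]) (auto simp: is_hat_def intro: sqint_lfourier bump_cut)

lemma hat_cong_AE:
  assumes "is_hat f F" "AE \<xi> in freq_meas. F \<xi> = F' \<xi>" "F' \<in> borel_measurable freq_meas" "sqint cell_meas f"
  shows "is_hat f F'"
proof -
  have F: "sqint freq_meas F" using assms(1) by (simp add: is_hat_def)
  have "sqint freq_meas F'"
    by (rule sqint_bound[OF F assms(3), where C=1]) (use assms(2) in eventually_elim, simp)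
  moreover have "l2n freq_meas (\<lambda>\<xi>. lfourier (cutoff n) 1 f \<xi> - F \<xi>) = l2n freq_meas (\<lambda>\<xi>. lfourier (cutoff n) 1 f \<xi> - F' \<xi>)" for n
  proof (rule l2n_cong_AE)
    show "AE \<xi> in freq_meas. norm (lfourier (cutoff n) 1 f \<xi> - F \<xi>) = norm (lfourier (cutoff n) 1 f \<xi> - F' \<xi>)"
      using assms(2) by eventually_elim simp
  qed (intro borel_measurable_diff sqint_measurable[OF sqint_lfourier[OF bump_cut assms(4)]] sqint_measurable[OF F] assms(3))+
  ultimately show ?thesis using assms(1) by (simp add: is_hat_def)
qed

lemma hat_add:
  assumes "is_hat f F" "is_hat g H" "sqint cell_meas f" "sqint cell_meas g"
  shows "is_hat (\<lambda>X. f X + g X) (\<lambda>\<xi>. F \<xi> + H \<xi>)"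
  unfolding is_hat_def
proof
  show "sqint freq_meas (\<lambda>\<xi>. F \<xi> + H \<xi>)" using assms by (auto simp: is_hat_def intro: sqint_add)
  have s: "sqint freq_meas (\<lambda>\<xi>. lfourier (cutoff n) 1 f \<xi> - F \<xi>)" "sqint freq_meas (\<lambda>\<xi>. lfourier (cutoff n) 1 g \<xi> - H \<xi>)" for n
    using assms by (auto simp: is_hat_def intro!: sqint_diff sqint_lfourier bump_cut)
  have "l2n freq_meas (\<lambda>\<xi>. lfourier (cutoff n) 1 (\<lambda>X. f X + g X) \<xi> - (F \<xi> + H \<xi>)) \<le>
      l2n freq_meas (\<lambda>\<xi>. lfourier (cutoff n) 1 f \<xi> - F \<xi>) + l2n freq_meas (\<lambda>\<xi>. lfourier (cutoff n) 1 g \<xi> - H \<xi>)" for n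
    using l2n_triangle[OF s, of n n] by (simp add: lfourier_add[OF bump_cut assms(3,4)] algebra_simps)
  moreover have "(\<lambda>n. l2n freq_meas (\<lambda>\<xi>. lfourier (cutoff n) 1 f \<xi> - F \<xi>) + l2n freq_meas (\<lambda>\<xi>. lfourier (cutoff n) 1 g \<xi> - H \<xi>)) \<longlonglongrightarrow> 0"
    using assms(1,2) tendsto_add[of _ 0 _ _ 0] by (auto simp: is_hat_def)
  ultimately show "(\<lambda>n. l2n freq_meas (\<lambda>\<xi>. lfourier (cutoff n) 1 (\<lambda>X. f X + g X) \<xi> - (F \<xi> + H \<xi>))) \<longlonglongrightarrow> 0"
    by (intro tendsto_0_le[OF _ l2n_nonneg]) auto
qed

lemma hat_cmult:
  assumes "is_hat f F"
  shows "is_hat (\<lambda>X. c * f X) (\<lambda>\<xi>. of_real c * F \<xi>)"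
  unfolding is_hat_def
proof
  show "sqint freq_meas (\<lambda>\<xi>. of_real c * F \<xi>)"
    using sqint_scaleR[OF is_hat_sqint[OF assms], of c] by (simp add: scaleR_conv_of_real)
  have "l2n freq_meas (\<lambda>\<xi>. lfourier (cutoff n) 1 (\<lambda>X. c * f X) \<xi> - of_real c * F \<xi>) = \<bar>c\<bar> * l2n freq_meas (\<lambda>\<xi>. lfourier (cutoff n) 1 f \<xi> - F \<xi>)" for n
    using l2n_scaleR[of freq_meas c "\<lambda>\<xi>. lfourier (cutoff n) 1 f \<xi> - F \<xi>"]
    by (simp add: lfourier_cmult scaleR_conv_of_real right_diff_distrib)
  moreover have "(\<lambda>n. \<bar>c\<bar> * l2n freq_meas (\<lambda>\<xi>. lfourier (cutoff n) 1 f \<xi> - F \<xi>)) \<longlonglongrightarrow> \<bar>c\<bar> * 0"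
    using assms unfolding is_hat_def by (intro tendsto_mult_left) simp
  ultimately show "(\<lambda>n. l2n freq_meas (\<lambda>\<xi>. lfourier (cutoff n) 1 (\<lambda>X. c * f X) \<xi> - of_real c * F \<xi>)) \<longlonglongrightarrow> 0"
    by simp
qed

lemma hat_diff:
  assumes "is_hat f F" "is_hat g H" "sqint cell_meas f" "sqint cell_meas g"
  shows "is_hat (\<lambda>X. f X - g X) (\<lambda>\<xi>. F \<xi> - H \<xi>)"
  using hat_add[OF assms(1) hat_cmult[OF assms(2), of "-1"] assms(3)] sqint_minus[OF assms(4)] by simp

lemma hat_zero: "is_hat (\<lambda>X. 0) (\<lambda>\<xi>. 0)"
  by (simp add: is_hat_def lfourier_def fourier_def modulate_def l2n_def)

lemma hat_sum:
  assumes "\<And>i. i \<in> I \<Longrightarrow> is_hat (f i) (F i)" "\<And>i. i \<in> I \<Longrightarrow> sqint cell_meas (f i)"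
  shows "is_hat (\<lambda>X. \<Sum>i\<in>I. f i X) (\<lambda>\<xi>. \<Sum>i\<in>I. F i \<xi>)"
  using assms by (induction I rule: infinite_finite_induct) (auto intro!: hat_zero hat_add sqint_sum)

text \<open>Plancherel for the difference of the two functions. This is how identities between
  transforms return to the domain.\<close>

lemma hat_inject:
  assumes "is_hat f F" "is_hat g H" "sqint cell_meas f" "sqint cell_meas g" "AE \<xi> in freq_meas. F \<xi> = H \<xi>"
  shows "AE X in cell_meas. f X = g X"
proof -
  have h: "is_hat (\<lambda>X. f X - g X) (\<lambda>\<xi>. F \<xi> - H \<xi>)" by (rule hat_diff[OF assms(1-4)])
  have s: "sqint cell_meas (\<lambda>X. f X - g X)" by (rule sqint_diff[OF assms(3,4)])
  have "l2n freq_meas (\<lambda>\<xi>. F \<xi> - H \<xi>) = 0"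
    using assms(5) l2n_eq_0_iff[OF is_hat_sqint[OF h]] by simp
  then have "l2n cell_meas (\<lambda>X. f X - g X) = 0" using hat_norm[OF h s] parseval_const_pos by simp
  then show ?thesis using l2n_eq_0_iff[OF s] by simp
qed

definition symbol :: "multi_index \<Rightarrow> frequency \<Rightarrow> complex" where
  "symbol = (\<lambda>(a, b, c) (k, \<eta>, l). (\<i> * of_int k) ^ a * (\<i> * of_real \<eta>) ^ b * (\<i> * of_int l) ^ c)"

definition damp :: "multi_index \<Rightarrow> frequency \<Rightarrow> real" where
  "damp = (\<lambda>(a, b, c) (k, \<eta>, l). 1 / ((1 + \<bar>of_int k\<bar>) ^ a * (1 + \<bar>\<eta>\<bar>) ^ b * (1 + \<bar>of_int l\<bar>) ^ c))"

lemma freq_proj_measurable [measurable]: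
  "fst \<in> measurable freq_meas (count_space UNIV)"
  "(\<lambda>\<xi>. fst (snd \<xi>)) \<in> borel_measurable freq_meas"
  "(\<lambda>\<xi>. snd (snd \<xi>)) \<in> measurable freq_meas (count_space UNIV)"
  unfolding freq_meas_def by measurable

lemma symbol_measurable [measurable]: "symbol \<alpha> \<in> borel_measurable freq_meas"
  unfolding symbol_def split_beta by measurable

lemma damp_measurable [measurable]: "damp \<alpha> \<in> borel_measurable freq_meas"
  unfolding damp_def split_beta by measurable

lemma damp_pos: "damp \<alpha> \<xi> > 0"
  unfolding damp_def split_beta by (intro divide_pos_pos mult_pos_pos zero_less_power) auto

lemma damp_le_1: "damp \<alpha> \<xi> \<le> 1"
proof -
  obtain a b c where \<alpha>: "\<alpha> = (a, b, c)" by (cases \<alpha>)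
  obtain k \<eta> l where \<xi>: "\<xi> = (k, \<eta>, l)" by (cases \<xi>)
  have "1 \<le> (1 + \<bar>real_of_int k\<bar>) ^ a * (1 + \<bar>\<eta>\<bar>) ^ b * (1 + \<bar>real_of_int l\<bar>) ^ c"
    using mult_mono[OF mult_mono[OF one_le_power[of "1 + \<bar>real_of_int k\<bar>" a] one_le_power[of "1 + \<bar>\<eta>\<bar>" b]] one_le_power[of "1 + \<bar>real_of_int l\<bar>" c]]
    by simp
  then show ?thesis unfolding damp_def \<alpha> \<xi> by simp
qed

text \<open>Reduces a general polynomial to the constant 1, at the price of replacing the bump by
  its derivatives, which are bumps again.\<close>

lemma lfourier_expand:
  assumes "bump b" "sqint cell_meas f" "degree p \<le> N"
  shows "lfourier b p f \<xi> = (\<Sum>j\<le>N. coeff p j * lfourier (\<lambda>i. b (i + j)) 1 f \<xi>)"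
proof -
  have "modulate b p f X * wave \<xi> X = (\<Sum>j\<le>N. coeff p j * (modulate (\<lambda>i. b (i + j)) 1 f X * wave \<xi> X))" for X
    by (simp add: modulate_def bump_comb_upto[OF assms(3)] bump_comb_one sum_distrib_left sum_distrib_right mult_ac)
  then have "lfourier b p f \<xi> = (\<integral>X. (\<Sum>j\<le>N. coeff p j * (modulate (\<lambda>i. b (i + j)) 1 f X * wave \<xi> X)) \<partial>cell_meas)"
    unfolding lfourier_def fourier_def by (simp only:)
  also have "\<dots> = (\<Sum>j\<le>N. \<integral>X. coeff p j * (modulate (\<lambda>i. b (i + j)) 1 f X * wave \<xi> X) \<partial>cell_meas)"
    by (intro Bochner_Integration.integral_sum integrable_mult_right integrable_modulate_wave bump_shift assms)
  finally show ?thesis unfolding lfourier_def fourier_def by (simp only: integral_mult_right_zero)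
qed

text \<open>Every derivative of the cutoff of order at least 1 carries a factor 1/(n + 1).\<close>

lemma l2n_cut_shift_tendsto:
  assumes "sqint cell_meas f"
  shows "(\<lambda>n. l2n freq_meas (lfourier (\<lambda>i. cutoff n (i + Suc j)) 1 f)) \<longlonglongrightarrow> 0"
proof -
  obtain B where B: "\<And>y. \<bar>std_bump (Suc j) y\<bar> \<le> B" "B \<ge> 0" using bump_bounded[OF bump_std, of "Suc j"] by blast
  have b: "bump (\<lambda>i. cutoff n (i + Suc j))" for n by (rule bump_shift[OF bump_cut])
  have "l2n freq_meas (lfourier (\<lambda>i. cutoff n (i + Suc j)) 1 f) \<le> parseval_const * (1 / real (Suc n) * B * l2n cell_meas f)" for n
    unfolding l2n_lfourier[OF b assms]
  proof (rule mult_left_mono)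
    have bd: "\<bar>cutoff n (Suc j) y\<bar> \<le> 1 / real (Suc n) * B" for y
    proof -
      have "\<bar>cutoff n (Suc j) y\<bar> = 1 / real (Suc n) * ((1 / real (Suc n)) ^ j * \<bar>std_bump (Suc j) (1 / real (Suc n) * y)\<bar>)"
        by (simp add: cutoff_def abs_mult)
      also have "(1 / real (Suc n)) ^ j * \<bar>std_bump (Suc j) (1 / real (Suc n) * y)\<bar> \<le> 1 * B"
        by (intro mult_mono B power_le_one) auto
      finally show ?thesis by (simp add: mult_left_mono divide_right_mono)
    qed
    have "AE X in cell_meas. norm (modulate (\<lambda>i. cutoff n (i + Suc j)) 1 f X) \<le> 1 / real (Suc n) * B * norm (f X)"
    proof (intro AE_I2)
      fix X :: point
      have "norm (modulate (\<lambda>i. cutoff n (i + Suc j)) 1 f X) = \<bar>cutoff n (Suc j) (fst (snd X))\<bar> * norm (f X)"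
        by (simp add: modulate_def bump_comb_one norm_mult)
      also have "\<dots> \<le> 1 / real (Suc n) * B * norm (f X)" by (rule mult_right_mono[OF bd]) simp
      finally show "norm (modulate (\<lambda>i. cutoff n (i + Suc j)) 1 f X) \<le> 1 / real (Suc n) * B * norm (f X)" .
    qed
    then show "l2n cell_meas (modulate (\<lambda>i. cutoff n (i + Suc j)) 1 f) \<le> 1 / real (Suc n) * B * l2n cell_meas f"
      by (intro l2n_bound[OF assms sqint_measurable[OF sqint_modulate[OF b assms]]]) (use B in auto)
  qed simp
  moreover have "(\<lambda>n. parseval_const * (1 / real (Suc n) * B * l2n cell_meas f)) \<longlonglongrightarrow> parseval_const * (0 * B * l2n cell_meas f)"
    using LIMSEQ_inverse_real_of_nat by (intro tendsto_intros) (simp add: inverse_eq_divide)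
  ultimately show ?thesis
    by (intro tendsto_0_le[OF _ l2n_nonneg]) auto
qed

lemma l2n_sum_le:
  assumes "\<And>i. i \<in> I \<Longrightarrow> sqint M (f i)"
  shows "l2n M (\<lambda>x. \<Sum>i\<in>I. f i x) \<le> (\<Sum>i\<in>I. l2n M (f i))"
  using assms
proof (induction I rule: infinite_finite_induct)
  case (insert i I)
  have "l2n M (\<lambda>x. f i x + (\<Sum>i\<in>I. f i x)) \<le> l2n M (f i) + l2n M (\<lambda>x. \<Sum>i\<in>I. f i x)"
    using insert by (intro l2n_triangle sqint_sum) auto
  then show ?case using insert by auto
qed (simp_all add: l2n_def)

text \<open>The factor \<open>damp \<alpha>\<close> makes the polynomial multiplier bounded, so that the \<open>L\<^sup>2\<close> limit can be taken.\<close>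

lemma hat_weak_deriv:
  assumes f: "f \<in> L2_space" and h: "h \<in> L2_space" and w: "has_weak_deriv f \<alpha> h"
    and F: "is_hat f F" and H: "is_hat h H"
  shows "AE \<xi> in freq_meas. H \<xi> = symbol \<alpha> \<xi> * F \<xi>"
proof -
  obtain a m c where \<alpha>: "\<alpha> = (a, m, c)" by (cases \<alpha>)
  note f' = L2_space_sqint[OF f] and h' = L2_space_sqint[OF h]
  note [measurable] = sqint_measurable[OF is_hat_sqint[OF F]] sqint_measurable[OF is_hat_sqint[OF H]]
    sqint_measurable[OF sqint_lfourier[OF bump_cut f', of _ 1]] sqint_measurable[OF sqint_lfourier[OF bump_cut h', of _ 1]]
  let ?B = "\<lambda>n j. lfourier (\<lambda>i. cutoff n (i + Suc j)) 1 f"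
  have sB: "sqint freq_meas (?B n j)" for n j by (rule sqint_lfourier[OF bump_shift[OF bump_cut] f'])
  \<comment> \<open>The damped defect of the multiplier rule for the cut off functions. In the
    binomial expansion of the symbol the term without derivatives of the cutoff is exactly
    \<open>symbol \<alpha> \<xi>\<close>, so only terms with a derivative on the cutoff
    remain.\<close>
  define D where "D n \<xi> = of_real (damp \<alpha> \<xi>) * (lfourier (cutoff n) 1 h \<xi> - symbol \<alpha> \<xi> * lfourier (cutoff n) 1 f \<xi>)" for n \<xi>
  have [measurable]: "D n \<in> borel_measurable freq_meas" for n unfolding D_def[abs_def] by measurable
  have mono_bd: "norm (of_real (damp \<alpha> \<xi>) * symbol \<alpha> \<xi>) \<le> 1" for \<xi>
  proof -
    obtain k \<eta> l where \<xi>: "\<xi> = (k, \<eta>, l)" by (cases \<xi>)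
    have "norm (of_real (damp \<alpha> \<xi>) * symbol \<alpha> \<xi>) = (\<bar>of_int k\<bar> ^ a * \<bar>\<eta>\<bar> ^ m * \<bar>of_int l\<bar> ^ c) / ((1 + \<bar>of_int k\<bar>) ^ a * (1 + \<bar>\<eta>\<bar>) ^ m * (1 + \<bar>of_int l\<bar>) ^ c)"
    proof -
      have "norm (of_real (damp \<alpha> \<xi>) * symbol \<alpha> \<xi>) = damp \<alpha> \<xi> * norm (symbol \<alpha> \<xi>)"
        by (simp only: norm_mult norm_of_real abs_of_pos[OF damp_pos])
      also have "norm (symbol \<alpha> \<xi>) = \<bar>of_int k\<bar> ^ a * \<bar>\<eta>\<bar> ^ m * \<bar>of_int l\<bar> ^ c"
        by (simp add: symbol_def \<alpha> \<xi> norm_mult norm_power)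
      finally show ?thesis by (simp add: damp_def \<alpha> \<xi>)
    qed
    also have "\<dots> \<le> 1"
      by (rule divide_le_eq_1_pos[THEN iffD2]) (auto intro!: mult_mono power_mono mult_pos_pos zero_less_power)
    finally show ?thesis .
  qed
  \<comment> \<open>Binomial coefficients are at most 2^m, and \<open>damp\<close> cancels the
    powers of the frequencies, so the bound is uniform in \<xi>.\<close>
  have Dbd: "norm (D n \<xi>) \<le> norm (\<Sum>j<m. 2 ^ m * norm (?B n j \<xi>))" for n \<xi>
  proof -
    obtain k \<eta> l where \<xi>: "\<xi> = (k, \<eta>, l)" by (cases \<xi>)
    define q where "q = bump_wave_symbol \<alpha> \<xi> 1"
    define c0 where "c0 = (- (\<i> * of_int k)) ^ a * (- (\<i> * complex_of_int l)) ^ c"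
    have q: "q = smult c0 ([:- (\<i> * of_real \<eta>), 1:] ^ m)" by (simp add: q_def bump_wave_symbol_def \<alpha> \<xi> c0_def)
    have deg: "degree q \<le> m"
      unfolding q using degree_power_le[of "[:- (\<i> * of_real \<eta>), 1:]" m] degree_smult_le[of c0] by (auto intro: order_trans)
    have cf: "coeff q j = c0 * (of_nat (m choose j) * (- (\<i> * of_real \<eta>)) ^ (m - j))" if "j \<le> m" for j
      unfolding q by (simp add: coeff_linear_poly_power[OF that])
    have sgn: "(-1) ^ order_of \<alpha> * coeff q 0 = symbol \<alpha> \<xi>"
      unfolding cf[OF le0] c0_def symbol_def \<alpha> \<xi> order_of_def
      by (simp add: power_add power_minus[of "\<i> * _"] mult_ac)
    have exp: "lfourier (cutoff n) 1 h \<xi> = (-1) ^ order_of \<alpha> * (\<Sum>j\<le>m. coeff q j * lfourier (\<lambda>i. cutoff n (i + j)) 1 f \<xi>)"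
      unfolding weak_deriv_lfourier[OF bump_cut f h w, of n 1 \<xi>] q_def[symmetric] lfourier_expand[OF bump_cut f' deg] ..
    have "(\<Sum>j\<le>m. coeff q j * lfourier (\<lambda>i. cutoff n (i + j)) 1 f \<xi>) = coeff q 0 * lfourier (cutoff n) 1 f \<xi> + (\<Sum>j<m. coeff q (Suc j) * ?B n j \<xi>)"
      by (subst lessThan_Suc_atMost[symmetric], subst sum.lessThan_Suc_shift) simp
    then have "lfourier (cutoff n) 1 h \<xi> - symbol \<alpha> \<xi> * lfourier (cutoff n) 1 f \<xi> = (-1) ^ order_of \<alpha> * (\<Sum>j<m. coeff q (Suc j) * ?B n j \<xi>)"
      unfolding exp sgn[symmetric] by (simp add: algebra_simps)
    then have "norm (D n \<xi>) = damp \<alpha> \<xi> * norm (\<Sum>j<m. coeff q (Suc j) * ?B n j \<xi>)"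
      using damp_pos[of \<alpha> \<xi>] by (simp add: D_def norm_mult norm_power)
    also have "\<dots> \<le> damp \<alpha> \<xi> * (\<Sum>j<m. norm (coeff q (Suc j)) * norm (?B n j \<xi>))"
      using damp_pos[of \<alpha> \<xi>] by (intro mult_left_mono) (auto intro!: sum_norm_le simp: norm_mult)
    also have "\<dots> = (\<Sum>j<m. (damp \<alpha> \<xi> * norm (coeff q (Suc j))) * norm (?B n j \<xi>))"
      by (simp add: sum_distrib_left mult.assoc)
    also have "\<dots> \<le> (\<Sum>j<m. 2 ^ m * norm (?B n j \<xi>))"
    proof (intro sum_mono mult_right_mono)
      fix j assume "j \<in> {..<m}"
      then have j: "Suc j \<le> m" by simp
      have ch: "real (m choose Suc j) \<le> 2 ^ m"
        using binomial_le_pow2[of m "Suc j"] by (metis of_nat_le_iff of_nat_numeral of_nat_power)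
      have et: "\<bar>\<eta>\<bar> ^ (m - Suc j) \<le> (1 + \<bar>\<eta>\<bar>) ^ m"
      proof -
        have "\<bar>\<eta>\<bar> ^ (m - Suc j) \<le> (1 + \<bar>\<eta>\<bar>) ^ (m - Suc j)" by (intro power_mono) auto
        also have "\<dots> \<le> (1 + \<bar>\<eta>\<bar>) ^ m" by (intro power_increasing) auto
        finally show ?thesis .
      qed
      have "norm (coeff q (Suc j)) = (\<bar>of_int k\<bar> ^ a * \<bar>of_int l\<bar> ^ c) * (real (m choose Suc j) * \<bar>\<eta>\<bar> ^ (m - Suc j))"
        unfolding cf[OF j] c0_def by (simp add: norm_mult norm_power)
      also have "\<dots> \<le> ((1 + \<bar>of_int k\<bar>) ^ a * (1 + \<bar>of_int l\<bar>) ^ c) * (2 ^ m * (1 + \<bar>\<eta>\<bar>) ^ m)"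
        by (intro mult_mono ch et power_mono) auto
      also have "\<dots> = 2 ^ m / damp \<alpha> \<xi>"
        by (simp add: damp_def \<alpha> \<xi>)
      finally show "damp \<alpha> \<xi> * norm (coeff q (Suc j)) \<le> 2 ^ m"
        using damp_pos[of \<alpha> \<xi>] by (simp add: field_simps)
    qed auto
    also have "\<dots> \<le> norm (\<Sum>j<m. 2 ^ m * norm (?B n j \<xi>))" by simp
    finally show ?thesis .
  qed
  have sB': "sqint freq_meas (\<lambda>\<xi>. 2 ^ m * norm (?B n j \<xi>))" for n j
    by (rule sqint_bound[OF sB[of n j], where C="2^m"]) (use sqint_measurable[OF sB[of n j]] in auto)
  have sS: "sqint freq_meas (\<lambda>\<xi>. \<Sum>j<m. 2 ^ m * norm (?B n j \<xi>))" for n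
    by (intro sqint_sum sB')
  have sD: "sqint freq_meas (D n)" for n
    by (rule sqint_bound[OF sS[of n], where C=1]) (use Dbd in auto)
  have "l2n freq_meas (D n) \<le> (\<Sum>j<m. 2 ^ m * l2n freq_meas (?B n j))" for n
  proof -
    have "l2n freq_meas (D n) \<le> 1 * l2n freq_meas (\<lambda>\<xi>. \<Sum>j<m. 2 ^ m * norm (?B n j \<xi>))"
      by (rule l2n_bound[OF sS[of n]]) (use Dbd in auto)
    also have "\<dots> \<le> 1 * (\<Sum>j<m. l2n freq_meas (\<lambda>\<xi>. 2 ^ m * norm (?B n j \<xi>)))"
      by (intro mult_left_mono l2n_sum_le sB') auto
    also have "\<dots> = (\<Sum>j<m. 2 ^ m * l2n freq_meas (?B n j))"
      using l2n_scaleR[of freq_meas "2^m" "\<lambda>\<xi>. norm (?B n _ \<xi>)"] by (simp add: l2n_def)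
    finally show ?thesis .
  qed
  moreover have "(\<lambda>n. \<Sum>j<m. 2 ^ m * l2n freq_meas (?B n j)) \<longlonglongrightarrow> (\<Sum>j<m. 2 ^ m * 0)"
    by (intro tendsto_sum tendsto_mult_left l2n_cut_shift_tendsto f')
  ultimately have Dlim: "(\<lambda>n. l2n freq_meas (D n)) \<longlonglongrightarrow> 0"
    by (intro tendsto_0_le[OF _ l2n_nonneg]) auto
  \<comment> \<open>The damped identity for the limits. It splits into two approximation errors and
    the defect \<open>D n\<close>; all three tend to 0 while \<open>E\<close> does not depend on
    n.\<close>
  define E where "E \<xi> = of_real (damp \<alpha> \<xi>) * (H \<xi> - symbol \<alpha> \<xi> * F \<xi>)" for \<xi>
  define E1 where "E1 n \<xi> = of_real (damp \<alpha> \<xi>) * (H \<xi> - lfourier (cutoff n) 1 h \<xi>)" for n \<xi>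
  define E2 where "E2 n \<xi> = (of_real (damp \<alpha> \<xi>) * symbol \<alpha> \<xi>) * (lfourier (cutoff n) 1 f \<xi> - F \<xi>)" for n \<xi>
  have s1: "sqint freq_meas (\<lambda>\<xi>. H \<xi> - lfourier (cutoff n) 1 h \<xi>)" and s2: "sqint freq_meas (\<lambda>\<xi>. lfourier (cutoff n) 1 f \<xi> - F \<xi>)" for n
    by (intro sqint_diff is_hat_sqint[OF F] is_hat_sqint[OF H] sqint_lfourier bump_cut f' h')+
  have b1: "norm (E1 n \<xi>) \<le> 1 * norm (H \<xi> - lfourier (cutoff n) 1 h \<xi>)" for n \<xi>
    using damp_pos[of \<alpha> \<xi>] damp_le_1[of \<alpha> \<xi>] unfolding E1_def norm_mult by (intro mult_right_mono) auto
  have b2: "norm (E2 n \<xi>) \<le> 1 * norm (lfourier (cutoff n) 1 f \<xi> - F \<xi>)" for n \<xi>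
    unfolding E2_def norm_mult[of "_ * _" "_ - _"] by (intro mult_right_mono mono_bd) auto
  have [measurable]: "E1 n \<in> borel_measurable freq_meas" "E2 n \<in> borel_measurable freq_meas" for n
    unfolding E1_def[abs_def] E2_def[abs_def] by measurable
  have sE1: "sqint freq_meas (E1 n)" and lE1: "l2n freq_meas (E1 n) \<le> 1 * l2n freq_meas (\<lambda>\<xi>. H \<xi> - lfourier (cutoff n) 1 h \<xi>)" for n
    using sqint_bound[OF s1[of n], of "E1 n" 1] l2n_bound[OF s1[of n], of "E1 n" 1] b1 by auto
  have sE2: "sqint freq_meas (E2 n)" and lE2: "l2n freq_meas (E2 n) \<le> 1 * l2n freq_meas (\<lambda>\<xi>. lfourier (cutoff n) 1 f \<xi> - F \<xi>)" for n
    using sqint_bound[OF s2[of n], of "E2 n" 1] l2n_bound[OF s2[of n], of "E2 n" 1] b2 by auto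
  have Eeq: "E = (\<lambda>\<xi>. (E1 n \<xi> + D n \<xi>) + E2 n \<xi>)" for n
    by (auto simp: E_def E1_def E2_def D_def algebra_simps)
  have sE: "sqint freq_meas E" unfolding Eeq[of 0] by (intro sqint_add sE1 sE2 sD)
  have "l2n freq_meas E \<le> l2n freq_meas (\<lambda>\<xi>. lfourier (cutoff n) 1 h \<xi> - H \<xi>) + l2n freq_meas (D n) + l2n freq_meas (\<lambda>\<xi>. lfourier (cutoff n) 1 f \<xi> - F \<xi>)" for n
  proof -
    have "l2n freq_meas E \<le> l2n freq_meas (\<lambda>\<xi>. E1 n \<xi> + D n \<xi>) + l2n freq_meas (E2 n)"
      unfolding Eeq[of n] by (intro l2n_triangle sqint_add sE1 sE2 sD)
    also have "l2n freq_meas (\<lambda>\<xi>. E1 n \<xi> + D n \<xi>) \<le> l2n freq_meas (E1 n) + l2n freq_meas (D n)"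
      by (intro l2n_triangle sE1 sD)
    finally show ?thesis using lE1[of n] lE2[of n] l2n_minus_commute[of freq_meas H "lfourier (cutoff n) 1 h"] by linarith
  qed
  moreover have "(\<lambda>n. l2n freq_meas (\<lambda>\<xi>. lfourier (cutoff n) 1 h \<xi> - H \<xi>) + l2n freq_meas (D n) + l2n freq_meas (\<lambda>\<xi>. lfourier (cutoff n) 1 f \<xi> - F \<xi>)) \<longlonglongrightarrow> 0 + 0 + 0"
    using F H Dlim by (intro tendsto_add) (auto simp: is_hat_def)
  ultimately have "l2n freq_meas E \<le> 0" by (intro LIMSEQ_le_const[where X="\<lambda>n. l2n freq_meas (\<lambda>\<xi>. lfourier (cutoff n) 1 h \<xi> - H \<xi>) + l2n freq_meas (D n) + l2n freq_meas (\<lambda>\<xi>. lfourier (cutoff n) 1 f \<xi> - F \<xi>)"]) auto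
  then have "l2n freq_meas E = 0" using l2n_nonneg[of freq_meas E] by linarith
  then have "AE \<xi> in freq_meas. E \<xi> = 0" using l2n_eq_0_iff[OF sE] by simp
  then show ?thesis
  proof eventually_elim
    case (elim \<xi>)
    then show ?case using damp_pos[of \<alpha> \<xi>] by (simp add: E_def)
  qed
qed

section \<open>Sobolev spaces in Fourier variables\<close>

lemma integral_deriv_per_meas:
  fixes g g' :: "real \<Rightarrow> complex"
  assumes "\<And>x. (g has_vector_derivative g' x) (at x)" "continuous_on UNIV g'" "g (2 * pi) = g 0"
  shows "(\<integral>x. g' x \<partial>per_meas) = 0"
proof -
  have "(\<integral>x. indicator {0..2 * pi} x *\<^sub>R g' x \<partial>lborel) = g (2 * pi) - g 0"
    by (rule integral_FTC_Icc) (use assms in \<open>auto intro: has_vector_derivative_at_within continuous_on_subset\<close>)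
  then show ?thesis
    using assms borel_measurable_continuous_onI[OF assms(2)]
    by (simp add: per_meas_def integral_density_indicator)
qed

lemma integral_deriv_line:
  fixes g g' :: "real \<Rightarrow> complex"
  assumes "\<And>x. (g has_vector_derivative g' x) (at x)" "continuous_on UNIV g'"
    and R: "\<And>x. \<bar>x\<bar> > R \<Longrightarrow> g x = 0" "\<And>x. \<bar>x\<bar> > R \<Longrightarrow> g' x = 0"
  shows "(\<integral>x. g' x \<partial>lborel) = 0"
proof -
  let ?S = "max 0 R + 1"
  have "(\<integral>x. indicator {- ?S..?S} x *\<^sub>R g' x \<partial>lborel) = g ?S - g (- ?S)"
    by (rule integral_FTC_Icc) (use assms in \<open>auto intro: has_vector_derivative_at_within continuous_on_subset\<close>)
  also have "\<dots> = 0" using R(1)[of ?S] R(1)[of "- ?S"] by simp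
  also have "(\<lambda>x. indicator {- ?S..?S} x *\<^sub>R g' x) = g'"
    using R(2) by (fastforce simp: fun_eq_iff indicator_def)
  finally show ?thesis .
qed

text \<open>Fubini if \<open>F\<close> is integrable; otherwise the integral is 0 by
  convention.\<close>

lemma cell_integral_x_0:
  fixes F :: "point \<Rightarrow> complex"
  assumes "\<And>y z. (\<integral>x. F (x, y, z) \<partial>per_meas) = 0"
  shows "(\<integral>X. F X \<partial>cell_meas) = 0"
proof (cases "integrable cell_meas F")
  case True
  interpret P: sigma_finite_measure per_meas using finite_per_meas by (rule finite_measure.axioms)
  interpret LP: pair_sigma_finite lborel per_meas ..
  interpret Q: pair_sigma_finite per_meas "lborel \<Otimes>\<^sub>M per_meas" ..
  have "(\<integral>x. F (x, Y) \<partial>per_meas) = 0" for Y by (cases Y) (simp add: assms)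
  then show ?thesis using Q.integral_snd[of "\<lambda>x Y. F (x, Y)"] True
    unfolding cell_meas_eq by (simp add: split_beta')
qed (simp add: not_integrable_integral_eq)

lemma cell_integral_y_0:
  fixes F :: "point \<Rightarrow> complex"
  assumes "\<And>x z. (\<integral>y. F (x, y, z) \<partial>lborel) = 0"
  shows "(\<integral>X. F X \<partial>cell_meas) = 0"
proof (cases "integrable cell_meas F")
  case True
  interpret P: sigma_finite_measure per_meas using finite_per_meas by (rule finite_measure.axioms)
  interpret LP: pair_sigma_finite lborel per_meas ..
  interpret Q: pair_sigma_finite per_meas "lborel \<Otimes>\<^sub>M per_meas" ..
  have "(\<integral>Y. F (x, Y) \<partial>(lborel \<Otimes>\<^sub>M per_meas)) = 0" for x
  proof (cases "integrable (lborel \<Otimes>\<^sub>M per_meas) (\<lambda>Y. F (x, Y))")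
    case True
    then show ?thesis using LP.integral_snd[of "\<lambda>y z. F (x, y, z)"] assms by (simp add: split_beta')
  qed (simp add: not_integrable_integral_eq)
  then show ?thesis using Q.integral_fst[of "\<lambda>x Y. F (x, Y)"] True
    unfolding cell_meas_eq by (simp add: split_beta')
qed (simp add: not_integrable_integral_eq)

lemma cell_integral_z_0:
  fixes F :: "point \<Rightarrow> complex"
  assumes "\<And>x y. (\<integral>z. F (x, y, z) \<partial>per_meas) = 0"
  shows "(\<integral>X. F X \<partial>cell_meas) = 0"
proof (cases "integrable cell_meas F")
  case True
  interpret P: sigma_finite_measure per_meas using finite_per_meas by (rule finite_measure.axioms)
  interpret LP: pair_sigma_finite lborel per_meas ..
  interpret Q: pair_sigma_finite per_meas "lborel \<Otimes>\<^sub>M per_meas" ..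
  have "(\<integral>Y. F (x, Y) \<partial>(lborel \<Otimes>\<^sub>M per_meas)) = 0" for x
  proof (cases "integrable (lborel \<Otimes>\<^sub>M per_meas) (\<lambda>Y. F (x, Y))")
    case True
    then show ?thesis using LP.integral_fst[of "\<lambda>y z. F (x, y, z)"] assms by (simp add: split_beta')
  qed (simp add: not_integrable_integral_eq)
  then show ?thesis using Q.integral_fst[of "\<lambda>x Y. F (x, Y)"] True
    unfolding cell_meas_eq by (simp add: split_beta')
qed (simp add: not_integrable_integral_eq)

lemma sqint_cont_supp:
  fixes f :: "point \<Rightarrow> real"
  assumes c: "continuous_on UNIV f" and s: "y_supp R f"
  shows "sqint cell_meas f"
proof -
  let ?K = "{0..2 * pi} \<times> {-R..R} \<times> {0..2 * pi}"
  have K: "compact ?K" by (intro compact_Times) auto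
  have "integrable lborel (\<lambda>X. indicator ?K X *\<^sub>R (norm (f X))\<^sup>2)"
    by (rule borel_integrable_compact[OF K]) (intro continuous_intros continuous_on_subset[OF c] subset_UNIV)
  also have "(\<lambda>X. indicator ?K X *\<^sub>R (norm (f X))\<^sup>2) = (\<lambda>X. indicator cell X *\<^sub>R (norm (f X))\<^sup>2)"
  proof
    fix X :: point
    obtain x y z where X: "X = (x, y, z)" by (cases X)
    show "indicator ?K X *\<^sub>R (norm (f X))\<^sup>2 = indicator cell X *\<^sub>R (norm (f X))\<^sup>2"
    proof (cases "\<bar>y\<bar> > R")
      case True
      then show ?thesis using s X by (simp add: y_supp_def)
    next
      case False
      then have "y \<in> {-R..R}" by auto
      then show ?thesis unfolding X cell_def by (simp add: indicator_def)
    qed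
  qed
  finally have "integrable cell_meas (\<lambda>X. (norm (f X))\<^sup>2)"
    unfolding cell_meas_def
    by (subst integrable_density_indicator) (use borel_measurable_continuous_onI[OF c] in auto)
  then show ?thesis using borel_measurable_continuous_onI[OF c] by (simp add: sqint_def)
qed

lemma pd_supp:
  assumes "y_supp R f"
  shows "y_supp R (pd i f)"
  unfolding y_supp_def
proof (intro allI impI)
  fix x y z :: real assume y: "\<bar>y\<bar> > R"
  have z: "f (s, y, t) = 0" for s t using assms y by (simp add: y_supp_def)
  have "deriv (\<lambda>s. f (x, s, z)) y = 0"
  proof (rule DERIV_imp_deriv, rule has_field_derivative_transform_within_open[where f="\<lambda>_. 0" and S="{s. \<bar>s\<bar> > R}"])
    show "open {s. R < \<bar>s\<bar>}" by (intro open_Collect_less continuous_intros)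
    show "0 = f (x, s, z)" if "s \<in> {s. R < \<bar>s\<bar>}" for s
      using assms that by (simp add: y_supp_def)
  qed (use y in auto)
  then show "pd i f (x, y, z) = 0" by (simp add: pd_def z)
qed

lemma slice_deriv:
  fixes f :: scalar_field
  assumes "f differentiable_on UNIV"
  shows "((\<lambda>s. f (s, y, z)) has_real_derivative pd 1 f (x, y, z)) (at x)"
    and "((\<lambda>s. f (x, s, z)) has_real_derivative pd 2 f (x, y, z)) (at y)"
    and "((\<lambda>s. f (x, y, s)) has_real_derivative pd 3 f (x, y, z)) (at z)"
proof -
  have d: "f differentiable at X" for X using assms unfolding differentiable_on_def by blast
  have a: "(\<lambda>s::real. (s, y, z)) differentiable at s" "(\<lambda>s::real. (x, s, z)) differentiable at s" "(\<lambda>s::real. (x, y, s)) differentiable at s" for s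
    unfolding differentiable_def
    by (rule exI, (rule has_derivative_Pair has_derivative_ident has_derivative_const)+)+
  have "(\<lambda>s. f (s, y, z)) differentiable at x" "(\<lambda>s. f (x, s, z)) differentiable at y" "(\<lambda>s. f (x, y, s)) differentiable at z"
    by (rule differentiable_compose[OF d a(1)], rule differentiable_compose[OF d a(2)], rule differentiable_compose[OF d a(3)])
  then show "((\<lambda>s. f (s, y, z)) has_real_derivative pd 1 f (x, y, z)) (at x)"
    "((\<lambda>s. f (x, s, z)) has_real_derivative pd 2 f (x, y, z)) (at y)"
    "((\<lambda>s. f (x, y, s)) has_real_derivative pd 3 f (x, y, z)) (at z)"
    by (simp_all add: pd_def index3_neq DERIV_deriv_iff_real_differentiable)
qed

definition freq_comp :: "3 \<Rightarrow> frequency \<Rightarrow> real" where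
  "freq_comp i \<xi> = (if i = 1 then of_int (fst \<xi>) else if i = 2 then fst (snd \<xi>) else of_int (snd (snd \<xi>)))"

text \<open>Integration by parts: the difference of the two integrands is the partial derivative of
  \<open>f\<close> times the wave, which integrates to 0 over a period in x or z and over the
  bounded support in y.\<close>

lemma fourier_pd:
  fixes f :: scalar_field
  assumes d: "f differentiable_on UNIV" and c: "continuous_on UNIV (pd i f)"
    and per: "periodic_xz f" and s: "y_supp R f"
  shows "fourier (\<lambda>X. of_real (pd i f X)) \<xi> = \<i> * of_real (freq_comp i \<xi>) * fourier (\<lambda>X. of_real (f X)) \<xi>"
proof -
  obtain k \<eta> l where \<xi>: "\<xi> = (k, \<eta>, l)" by (cases \<xi>)
  let ?w = "freq_comp i \<xi>"
  define F where "F X = of_real (pd i f X) * wave \<xi> X - \<i> * of_real ?w * (of_real (f X) * wave \<xi> X)" for X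
  have fc: "continuous_on UNIV f" using d by (rule differentiable_imp_continuous_on)
  have wc: "continuous_on UNIV (wave \<xi>)"
    unfolding \<xi> wave_def split_beta by (intro continuous_intros)
  have Fc: "continuous_on UNIV F" unfolding F_def[abs_def] by (intro continuous_intros c fc wc)
  have Fs: "F (x, y, z) = 0" if "\<bar>y\<bar> > R" for x y z
    using s pd_supp[OF s, of i] that by (simp add: F_def y_supp_def)
  have Fslice: "continuous_on UNIV (\<lambda>s. F (s, y, z))" "continuous_on UNIV (\<lambda>s. F (x, s, z))" "continuous_on UNIV (\<lambda>s. F (x, y, s))" for x y z
    by (rule continuous_on_compose2[OF Fc]; auto intro!: continuous_intros)+
  have ofr: "((\<lambda>s. complex_of_real (g s)) has_vector_derivative complex_of_real g') (at a)" if "(g has_real_derivative g') (at a)" for g g' a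
    using that has_real_derivative_iff_has_vector_derivative
    by (auto intro!: bounded_linear.has_vector_derivative[OF bounded_linear_of_real])
  have perx: "f (2 * pi, y, z) = f (0, y, z)" "f (x, y, 2 * pi) = f (x, y, 0)" for x y z
    using per[unfolded periodic_xz_def, rule_format, of 0 y z] per[unfolded periodic_xz_def, rule_format, of x y 0] by simp_all
  have perw: "wave \<xi> (2 * pi, y, z) = wave \<xi> (0, y, z)" "wave \<xi> (x, y, 2 * pi) = wave \<xi> (x, y, 0)" for x y z
    using wave_periodic(1)[of \<xi> 0 y z] wave_periodic(2)[of \<xi> x y 0] by simp_all
  have w1: "((\<lambda>s. wave \<xi> (s, y, z)) has_vector_derivative (- (\<i> * of_int k) * wave \<xi> (x, y, z))) (at x)" for x y z
    using has_vector_derivative_cis[of "- of_int k" "- (\<eta> * y + of_int l * z)" x UNIV] by (simp add: algebra_simps wave_def \<xi>)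
  have w2: "((\<lambda>s. wave \<xi> (x, s, z)) has_vector_derivative (- (\<i> * of_real \<eta>) * wave \<xi> (x, y, z))) (at y)" for x y z
    using has_vector_derivative_cis[of "- \<eta>" "- (of_int k * x + of_int l * z)" y UNIV] by (simp add: algebra_simps wave_def \<xi>)
  have w3: "((\<lambda>s. wave \<xi> (x, y, s)) has_vector_derivative (- (\<i> * of_int l) * wave \<xi> (x, y, z))) (at z)" for x y z
    using has_vector_derivative_cis[of "- of_int l" "- (of_int k * x + \<eta> * y)" z UNIV] by (simp add: algebra_simps wave_def \<xi>)
  consider "i = 1" | "i = 2" | "i = 3" using exhaust_3 by blast
  then have "(\<integral>X. F X \<partial>cell_meas) = 0"
  proof cases
    case 1
    show ?thesis
    proof (rule cell_integral_x_0, rule integral_deriv_per_meas)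
      show "((\<lambda>s. of_real (f (s, y, z)) * wave \<xi> (s, y, z)) has_vector_derivative F (x, y, z)) (at x)" for x y z
        by (rule has_vector_derivative_eq_rhs[OF has_vector_derivative_mult[OF ofr[OF slice_deriv(1)[OF d]] w1]])
           (simp add: F_def 1 freq_comp_def \<xi> algebra_simps)
    qed (simp_all add: Fslice perx perw)
  next
    case 2
    show ?thesis
    proof (rule cell_integral_y_0, rule integral_deriv_line)
      show "((\<lambda>s. of_real (f (x, s, z)) * wave \<xi> (x, s, z)) has_vector_derivative F (x, y, z)) (at y)" for x y z
        by (rule has_vector_derivative_eq_rhs[OF has_vector_derivative_mult[OF ofr[OF slice_deriv(2)[OF d]] w2]])
           (simp add: F_def 2 freq_comp_def \<xi> algebra_simps index3_neq)
      show "of_real (f (x, y, z)) * wave \<xi> (x, y, z) = 0" if "\<bar>y\<bar> > R" for x y z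
        using s that by (simp add: y_supp_def)
    qed (simp_all add: Fslice Fs)
  next
    case 3
    show ?thesis
    proof (rule cell_integral_z_0, rule integral_deriv_per_meas)
      show "((\<lambda>s. of_real (f (x, y, s)) * wave \<xi> (x, y, s)) has_vector_derivative F (x, y, z)) (at z)" for x y z
        by (rule has_vector_derivative_eq_rhs[OF has_vector_derivative_mult[OF ofr[OF slice_deriv(3)[OF d]] w3]])
           (simp add: F_def 3 freq_comp_def \<xi> algebra_simps index3_neq)
    qed (simp_all add: Fslice perx perw)
  qed
  moreover have "integrable cell_meas (\<lambda>X. of_real (pd i f X) * wave \<xi> X)"
  proof (rule integrable_bounded_mult_left[where C=1])
    have "y_supp R (\<lambda>X. complex_of_real (pd i f X))" using pd_supp[OF s, of i] by (simp add: y_supp_def)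
    then show "integrable cell_meas (\<lambda>X. complex_of_real (pd i f X))"
      by (rule integrable_y_supp) (rule sqint_of_real[OF sqint_cont_supp[OF c pd_supp[OF s]]])
  qed auto
  moreover have "integrable cell_meas (\<lambda>X. of_real (f X) * wave \<xi> X)"
  proof (rule integrable_bounded_mult_left[where C=1])
    have "y_supp R (\<lambda>X. complex_of_real (f X))" using s by (simp add: y_supp_def)
    then show "integrable cell_meas (\<lambda>X. complex_of_real (f X))"
      by (rule integrable_y_supp) (rule sqint_of_real[OF sqint_cont_supp[OF fc s]])
  qed auto
  ultimately show ?thesis
    unfolding F_def fourier_def by (simp add: Bochner_Integration.integral_diff)
qed

lemma periodic_pd: "periodic_xz f \<Longrightarrow> periodic_xz (pd i f)"
proof -
  assume p: "periodic_xz f"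
  have sh: "deriv (\<lambda>s. g (s + a)) x = deriv g (x + a)" for g :: "real \<Rightarrow> real" and a x
    unfolding deriv_def using DERIV_shift[of g _ x a] by (simp add: add.commute)
  have e: "f (x + 2 * pi, y, z) = f (x, y, z)" "f (x, y, z + 2 * pi) = f (x, y, z)" for x y z
    using p by (auto simp: periodic_xz_def)
  show ?thesis
    unfolding periodic_xz_def pd_def
    using sh[of "\<lambda>s. f (s, _, _)" "2 * pi"] sh[of "\<lambda>s. f (_, _, s)" "2 * pi"] by (auto simp: e)
qed

lemma test_function_pd_multi:
  assumes "test_function \<phi>"
  shows "pd_multi \<alpha> \<phi> differentiable_on UNIV" "periodic_xz (pd_multi \<alpha> \<phi>)" "\<exists>R. y_supp R (pd_multi \<alpha> \<phi>)"
proof -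
  show "pd_multi \<alpha> \<phi> differentiable_on UNIV" using assms unfolding test_function_def by blast
  obtain a b c where \<alpha>: "\<alpha> = (a, b, c)" by (cases \<alpha>)
  have 1: "periodic_xz f \<Longrightarrow> periodic_xz ((pd i ^^ n) f)" for f i n
    by (induction n) (auto intro: periodic_pd)
  show "periodic_xz (pd_multi \<alpha> \<phi>)" using assms unfolding pd_multi_def \<alpha> by (simp add: test_function_def 1)
  have 2: "y_supp R f \<Longrightarrow> y_supp R ((pd i ^^ n) f)" for R f i n
    by (induction n) (auto intro: pd_supp)
  obtain R where "y_supp R \<phi>" using assms unfolding test_function_def y_supp_def by blast
  then show "\<exists>R. y_supp R (pd_multi \<alpha> \<phi>)" unfolding pd_multi_def \<alpha> by (auto intro: 2)
qed

lemma test_function_L2: "test_function \<phi> \<Longrightarrow> pd_multi \<alpha> \<phi> \<in> L2_space"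
  using test_function_pd_multi[of \<phi> \<alpha>] sqint_cont_supp L2_spaceI differentiable_imp_continuous_on by metis

lemma pd_multi_0: "pd_multi (0, 0, 0) \<phi> = \<phi>"
  by (simp add: pd_multi_def)

text \<open>The derivatives are peeled off in the order in which \<open>pd_multi\<close> nests them,
  x outermost, since these iterated derivatives are the ones that \<open>test_function\<close>
  declares differentiable.\<close>

lemma fourier_pd_multi:
  assumes t: "test_function \<phi>"
  shows "fourier (\<lambda>X. of_real (pd_multi \<alpha> \<phi> X)) \<xi> = symbol \<alpha> \<xi> * fourier (\<lambda>X. of_real (\<phi> X)) \<xi>"
proof -
  obtain a b c where \<alpha>: "\<alpha> = (a, b, c)" by (cases \<alpha>)
  obtain k \<eta> l where \<xi>: "\<xi> = (k, \<eta>, l)" by (cases \<xi>)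
  have step: "fourier (\<lambda>X. of_real (pd_multi \<beta> \<phi> X)) \<xi> = \<i> * of_real (freq_comp i \<xi>) * fourier (\<lambda>X. of_real (pd_multi \<gamma> \<phi> X)) \<xi>"
    if "pd_multi \<beta> \<phi> = pd i (pd_multi \<gamma> \<phi>)" for \<beta> \<gamma> i
  proof -
    obtain R where R: "y_supp R (pd_multi \<gamma> \<phi>)" using test_function_pd_multi(3)[OF t] by blast
    have "continuous_on UNIV (pd i (pd_multi \<gamma> \<phi>))"
      unfolding that[symmetric] by (rule differentiable_imp_continuous_on[OF test_function_pd_multi(1)[OF t]])
    from fourier_pd[OF test_function_pd_multi(1)[OF t] this test_function_pd_multi(2)[OF t] R] show ?thesis
      unfolding that .
  qed
  have z: "fourier (\<lambda>X. of_real (pd_multi (0, 0, n) \<phi> X)) \<xi> = (\<i> * of_int l) ^ n * fourier (\<lambda>X. of_real (\<phi> X)) \<xi>" for n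
  proof (induction n)
    case (Suc n)
    have "pd_multi (0, 0, Suc n) \<phi> = pd 3 (pd_multi (0, 0, n) \<phi>)" by (simp add: pd_multi_def)
    from step[OF this] Suc show ?case by (simp add: freq_comp_def \<xi> index3_neq)
  qed (simp add: pd_multi_0)
  have y: "fourier (\<lambda>X. of_real (pd_multi (0, m, n) \<phi> X)) \<xi> = (\<i> * of_real \<eta>) ^ m * (\<i> * of_int l) ^ n * fourier (\<lambda>X. of_real (\<phi> X)) \<xi>" for m n
  proof (induction m)
    case (Suc m)
    have "pd_multi (0, Suc m, n) \<phi> = pd 2 (pd_multi (0, m, n) \<phi>)" by (simp add: pd_multi_def)
    from step[OF this] Suc show ?case by (simp add: freq_comp_def \<xi> index3_neq)
  qed (simp add: z)
  have x: "fourier (\<lambda>X. of_real (pd_multi (r, m, n) \<phi> X)) \<xi> = (\<i> * of_int k) ^ r * (\<i> * of_real \<eta>) ^ m * (\<i> * of_int l) ^ n * fourier (\<lambda>X. of_real (\<phi> X)) \<xi>" for r m n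
  proof (induction r)
    case (Suc r)
    have "pd_multi (Suc r, m, n) \<phi> = pd 1 (pd_multi (r, m, n) \<phi>)" by (simp add: pd_multi_def)
    from step[OF this] Suc show ?case by (simp add: freq_comp_def \<xi> mult.assoc)
  qed (simp add: y)
  show ?thesis unfolding \<alpha> x by (simp add: symbol_def \<xi>)
qed

lemma hat_supported:
  assumes "sqint cell_meas f" "y_supp R f"
  shows "is_hat f (fourier (\<lambda>X. of_real (f X)))"
  unfolding is_hat_def
proof
  have s: "y_supp R (\<lambda>X. complex_of_real (f X))" using assms(2) by (simp add: y_supp_def)
  show "sqint freq_meas (fourier (\<lambda>X. of_real (f X)))" by (rule plancherel(1)[OF s sqint_of_real[OF assms(1)]])
  have "l2n freq_meas (\<lambda>\<xi>. lfourier (cutoff n) 1 f \<xi> - fourier (\<lambda>X. of_real (f X)) \<xi>) =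
      parseval_const * l2n cell_meas (\<lambda>X. modulate (cutoff n) 1 f X - of_real (f X))" for n
  proof -
    obtain S where "y_supp S (modulate (cutoff n) 1 f)" using y_supp_modulate[OF bump_cut] by blast
    then show ?thesis unfolding lfourier_def
      by (rule l2n_fourier_diff[OF _ s sqint_modulate[OF bump_cut assms(1)] sqint_of_real[OF assms(1)]])
  qed
  then show "(\<lambda>n. l2n freq_meas (\<lambda>\<xi>. lfourier (cutoff n) 1 f \<xi> - fourier (\<lambda>X. of_real (f X)) \<xi>)) \<longlonglongrightarrow> 0"
    using tendsto_mult_left[OF cut_tendsto_l2[OF assms(1)], of parseval_const] by simp
qed

lemma sqint_cnj: "sqint M F \<Longrightarrow> sqint M (\<lambda>x. cnj (F x))"
  by (rule sqint_bound[where C=1]) (auto dest: sqint_measurable)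

lemma l2n_add_sq:
  fixes F H :: "'a \<Rightarrow> complex"
  assumes "sqint M F" "sqint M H"
  shows "(l2n M (\<lambda>x. F x + H x))\<^sup>2 = (l2n M F)\<^sup>2 + 2 * Re (\<integral>x. F x * cnj (H x) \<partial>M) + (l2n M H)\<^sup>2"
proof -
  note i = integrable_mult_sqint'[OF assms(1) sqint_cnj[OF assms(2)]]
  have e: "(norm (F x + H x))\<^sup>2 = ((norm (F x))\<^sup>2 + 2 * Re (F x * cnj (H x))) + (norm (H x))\<^sup>2" for x
    unfolding cmod_power2 by (simp add: power2_eq_square algebra_simps)
  have "(l2n M (\<lambda>x. F x + H x))\<^sup>2 = (\<integral>x. (norm (F x))\<^sup>2 + 2 * Re (F x * cnj (H x)) \<partial>M) + (\<integral>x. (norm (H x))\<^sup>2 \<partial>M)"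
    unfolding l2n_sq e
    by (intro Bochner_Integration.integral_add Bochner_Integration.integrable_add integrable_mult_right integrable_Re i sqint_integrable assms)
  also have "(\<integral>x. (norm (F x))\<^sup>2 + 2 * Re (F x * cnj (H x)) \<partial>M) = (\<integral>x. (norm (F x))\<^sup>2 \<partial>M) + (\<integral>x. 2 * Re (F x * cnj (H x)) \<partial>M)"
    by (intro Bochner_Integration.integral_add integrable_mult_right integrable_Re i sqint_integrable assms)
  also have "(\<integral>x. 2 * Re (F x * cnj (H x)) \<partial>M) = 2 * Re (\<integral>x. F x * cnj (H x) \<partial>M)"
    by (simp only: integral_mult_right_zero integral_Re[OF i])
  finally show ?thesis by (simp only: l2n_sq)
qed

text \<open>Polarisation of \<open>hat_norm\<close>. For real fields only the real part of the
  frequency integral is compared.\<close>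

lemma hat_inner:
  assumes "is_hat f F" "is_hat g H" "sqint cell_meas f" "sqint cell_meas g"
  shows "(2 * pi) ^ 3 * (\<integral>X. f X * g X \<partial>cell_meas) = Re (\<integral>\<xi>. F \<xi> * cnj (H \<xi>) \<partial>freq_meas)"
proof -
  have "l2n cell_meas (\<lambda>X. f X + g X) = l2n cell_meas (\<lambda>X. complex_of_real (f X) + complex_of_real (g X))"
    using l2n_of_real[of cell_meas "\<lambda>X. f X + g X"] by simp
  then have a: "(l2n cell_meas (\<lambda>X. f X + g X))\<^sup>2 = (l2n cell_meas f)\<^sup>2 + 2 * (\<integral>X. f X * g X \<partial>cell_meas) + (l2n cell_meas g)\<^sup>2"
    using l2n_add_sq[OF sqint_of_real[OF assms(3)] sqint_of_real[OF assms(4)]]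
    by (simp add: l2n_of_real flip: of_real_mult)
  have b: "(l2n freq_meas (\<lambda>\<xi>. F \<xi> + H \<xi>))\<^sup>2 = (l2n freq_meas F)\<^sup>2 + 2 * Re (\<integral>\<xi>. F \<xi> * cnj (H \<xi>) \<partial>freq_meas) + (l2n freq_meas H)\<^sup>2"
    by (rule l2n_add_sq[OF is_hat_sqint[OF assms(1)] is_hat_sqint[OF assms(2)]])
  have K: "parseval_const\<^sup>2 = (2 * pi) ^ 3" by simp
  have "(2 * pi) ^ 3 * (l2n cell_meas (\<lambda>X. f X + g X))\<^sup>2 = (l2n freq_meas (\<lambda>\<xi>. F \<xi> + H \<xi>))\<^sup>2"
    "(2 * pi) ^ 3 * (l2n cell_meas f)\<^sup>2 = (l2n freq_meas F)\<^sup>2" "(2 * pi) ^ 3 * (l2n cell_meas g)\<^sup>2 = (l2n freq_meas H)\<^sup>2"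
    unfolding hat_norm[OF hat_add[OF assms] sqint_add[OF assms(3,4)]] hat_norm[OF assms(1,3)] hat_norm[OF assms(2,4)]
    by (simp_all only: power_mult_distrib[of parseval_const] K)
  then show ?thesis unfolding a b by (simp add: distrib_left)
qed

lemma cnj_symbol: "cnj (symbol \<alpha> \<xi>) = (-1) ^ order_of \<alpha> * symbol \<alpha> \<xi>"
proof -
  obtain a b c where \<alpha>: "\<alpha> = (a, b, c)" by (cases \<alpha>)
  obtain k \<eta> l where \<xi>: "\<xi> = (k, \<eta>, l)" by (cases \<xi>)
  show ?thesis unfolding \<alpha> \<xi> symbol_def order_of_def
    by (simp add: power_add power_minus[of "\<i> * _"] mult_ac)
qed

text \<open>Converse of \<open>hat_weak_deriv\<close>, by Parseval against a test function:
  conjugating the symbol supplies the sign of the integration by parts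
  (\<open>cnj_symbol\<close>).\<close>

lemma has_weak_derivI:
  assumes f: "f \<in> L2_space" and g: "g \<in> L2_space" and F: "is_hat f F" and H: "is_hat g H"
    and eq: "AE \<xi> in freq_meas. H \<xi> = symbol \<alpha> \<xi> * F \<xi>"
  shows "has_weak_deriv f \<alpha> g"
  unfolding has_weak_deriv_def
proof (intro allI impI)
  fix \<phi> assume t: "test_function \<phi>"
  note f' = L2_space_sqint[OF f] note g' = L2_space_sqint[OF g]
  have p: "pd_multi \<beta> \<phi> \<in> L2_space" for \<beta> by (rule test_function_L2[OF t])
  note p' = L2_space_sqint[OF p]
  have P: "is_hat (pd_multi \<beta> \<phi>) (\<lambda>\<xi>. symbol \<beta> \<xi> * fourier (\<lambda>X. of_real (\<phi> X)) \<xi>)" for \<beta>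
  proof -
    obtain R where "y_supp R (pd_multi \<beta> \<phi>)" using test_function_pd_multi(3)[OF t] by blast
    moreover have "fourier (\<lambda>X. of_real (pd_multi \<beta> \<phi> X)) = (\<lambda>\<xi>. symbol \<beta> \<xi> * fourier (\<lambda>X. of_real (\<phi> X)) \<xi>)"
      by (rule ext) (rule fourier_pd_multi[OF t])
    ultimately show ?thesis using hat_supported[OF p'[of \<beta>]] by (simp only:)
  qed
  have P0: "is_hat \<phi> (fourier (\<lambda>X. of_real (\<phi> X)))" and p0: "sqint cell_meas \<phi>"
    using P[of "(0,0,0)"] p'[of "(0,0,0)"] by (simp_all add: pd_multi_0 symbol_def split_beta)
  define s :: real where "s = (-1) ^ order_of \<alpha>"
  have "(2 * pi) ^ 3 * (\<integral>X. f X * pd_multi \<alpha> \<phi> X \<partial>cell_meas) =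
      Re (\<integral>\<xi>. F \<xi> * cnj (symbol \<alpha> \<xi> * fourier (\<lambda>X. of_real (\<phi> X)) \<xi>) \<partial>freq_meas)"
    by (rule hat_inner[OF F P f' p'])
  also have "(\<integral>\<xi>. F \<xi> * cnj (symbol \<alpha> \<xi> * fourier (\<lambda>X. of_real (\<phi> X)) \<xi>) \<partial>freq_meas) =
      (\<integral>\<xi>. of_real s * (H \<xi> * cnj (fourier (\<lambda>X. of_real (\<phi> X)) \<xi>)) \<partial>freq_meas)"
  proof (rule integral_cong_AE)
    show "AE \<xi> in freq_meas. F \<xi> * cnj (symbol \<alpha> \<xi> * fourier (\<lambda>X. of_real (\<phi> X)) \<xi>) =
        of_real s * (H \<xi> * cnj (fourier (\<lambda>X. of_real (\<phi> X)) \<xi>))"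
      using eq by eventually_elim (simp add: cnj_symbol s_def mult_ac)
  qed (use sqint_measurable[OF is_hat_sqint[OF F]] sqint_measurable[OF is_hat_sqint[OF H]] sqint_measurable[OF is_hat_sqint[OF P0]] in measurable)
  also have "Re \<dots> = s * Re (\<integral>\<xi>. H \<xi> * cnj (fourier (\<lambda>X. of_real (\<phi> X)) \<xi>) \<partial>freq_meas)"
    by (subst integral_mult_right_zero) simp
  also have "\<dots> = s * ((2 * pi) ^ 3 * (\<integral>X. g X * \<phi> X \<partial>cell_meas))"
    by (simp only: hat_inner[OF H P0 g' p0])
  finally have "(2 * pi) ^ 3 * (\<integral>X. f X * pd_multi \<alpha> \<phi> X \<partial>cell_meas) = (2 * pi) ^ 3 * (s * (\<integral>X. g X * \<phi> X \<partial>cell_meas))"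
    by (simp only: mult.left_commute)
  moreover have "(2 * pi) ^ 3 \<noteq> (0 :: real)" by simp
  ultimately have "(\<integral>X. f X * pd_multi \<alpha> \<phi> X \<partial>cell_meas) = s * (\<integral>X. g X * \<phi> X \<partial>cell_meas)"
    by (simp only: mult_cancel_left) simp
  moreover have "f \<in> borel_measurable borel" "g \<in> borel_measurable borel" "\<phi> \<in> borel_measurable borel" "pd_multi \<alpha> \<phi> \<in> borel_measurable borel"
    using f g p[of \<alpha>] p[of "(0,0,0)"] by (auto simp: pd_multi_0 dest: L2_space_measurable)
  ultimately show "(LINT X:cell|lborel. f X * pd_multi \<alpha> \<phi> X) = (-1) ^ order_of \<alpha> * (LINT X:cell|lborel. g X * \<phi> X)"
    by (simp add: set_integral_cell s_def)
qed

definition hat :: "scalar_field \<Rightarrow> frequency \<Rightarrow> complex" where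
  "hat f = (SOME F. is_hat f F)"

lemma is_hat_hat: "f \<in> L2_space \<Longrightarrow> is_hat f (hat f)"
  unfolding hat_def using hat_exists[OF L2_space_sqint] by (rule someI_ex)

lemma weak_deriv_AE_unique:
  assumes "f \<in> L2_space" "g \<in> L2_space" "h \<in> L2_space" "has_weak_deriv f \<alpha> g" "has_weak_deriv f \<alpha> h"
  shows "AE X in cell_meas. g X = h X"
proof (rule hat_inject[OF is_hat_hat[OF assms(2)] is_hat_hat[OF assms(3)] L2_space_sqint[OF assms(2)] L2_space_sqint[OF assms(3)]])
  show "AE \<xi> in freq_meas. hat g \<xi> = hat h \<xi>"
    using hat_weak_deriv[OF assms(1,2,4) is_hat_hat[OF assms(1)] is_hat_hat[OF assms(2)]]
      hat_weak_deriv[OF assms(1,3,5) is_hat_hat[OF assms(1)] is_hat_hat[OF assms(3)]]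
    by eventually_elim simp
qed

lemma weak_deriv_sobolev:
  assumes "f \<in> sobolev m" "order_of \<alpha> \<le> m"
  shows "weak_deriv \<alpha> f \<in> L2_space" "has_weak_deriv f \<alpha> (weak_deriv \<alpha> f)"
proof -
  have "\<exists>g. g \<in> L2_space \<and> has_weak_deriv f \<alpha> g" using assms unfolding sobolev_def by blast
  then have "weak_deriv \<alpha> f \<in> L2_space \<and> has_weak_deriv f \<alpha> (weak_deriv \<alpha> f)"
    unfolding weak_deriv_def by (rule someI_ex)
  then show "weak_deriv \<alpha> f \<in> L2_space" "has_weak_deriv f \<alpha> (weak_deriv \<alpha> f)" by auto
qed

lemma sobolev_L2: "f \<in> sobolev m \<Longrightarrow> f \<in> L2_space"
  by (simp add: sobolev_def)

lemma hat_weak_deriv_sobolev: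
  assumes f: "f \<in> sobolev m" and a: "order_of \<alpha> \<le> m" and F: "is_hat f F"
  shows "is_hat (weak_deriv \<alpha> f) (\<lambda>\<xi>. symbol \<alpha> \<xi> * F \<xi>)"
proof (rule hat_cong_AE[OF is_hat_hat[OF weak_deriv_sobolev(1)[OF f a]]])
  show "AE \<xi> in freq_meas. hat (weak_deriv \<alpha> f) \<xi> = symbol \<alpha> \<xi> * F \<xi>"
    by (rule hat_weak_deriv[OF sobolev_L2[OF f] weak_deriv_sobolev[OF f a] F is_hat_hat[OF weak_deriv_sobolev(1)[OF f a]]])
  show "(\<lambda>\<xi>. symbol \<alpha> \<xi> * F \<xi>) \<in> borel_measurable freq_meas"
    using sqint_measurable[OF is_hat_sqint[OF F]] by measurable
  show "sqint cell_meas (weak_deriv \<alpha> f)" by (rule L2_space_sqint[OF weak_deriv_sobolev(1)[OF f a]])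
qed

text \<open>Membership is obtained by exhibiting real L2 fields whose transforms are the symbol
  times \<open>F\<close>; decay of \<open>F\<close> alone would still leave an inverse transform to
  be constructed.\<close>

lemma sobolevI_hat:
  assumes f: "f \<in> L2_space" and F: "is_hat f F"
    and g: "\<And>\<alpha>. order_of \<alpha> \<le> m \<Longrightarrow> \<exists>g\<in>L2_space. is_hat g (\<lambda>\<xi>. symbol \<alpha> \<xi> * F \<xi>)"
  shows "f \<in> sobolev m"
proof -
  have "\<exists>h\<in>L2_space. has_weak_deriv f \<alpha> h" if a: "order_of \<alpha> \<le> m" for \<alpha>
  proof -
    obtain h where h: "h \<in> L2_space" "is_hat h (\<lambda>\<xi>. symbol \<alpha> \<xi> * F \<xi>)" using g[OF a] by blast
    have "has_weak_deriv f \<alpha> h" by (rule has_weak_derivI[OF f h(1) F h(2)]) simp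
    then show ?thesis using h(1) by blast
  qed
  then show ?thesis using f by (auto simp: sobolev_def)
qed

lemma L2_norm_weak_deriv:
  assumes "f \<in> sobolev m" "order_of \<alpha> \<le> m" "is_hat f F"
  shows "parseval_const * L2_norm (weak_deriv \<alpha> f) = l2n freq_meas (\<lambda>\<xi>. symbol \<alpha> \<xi> * F \<xi>)"
    and "sqint freq_meas (\<lambda>\<xi>. symbol \<alpha> \<xi> * F \<xi>)"
  using hat_norm[OF hat_weak_deriv_sobolev[OF assms] L2_space_sqint[OF weak_deriv_sobolev(1)[OF assms(1,2)]]]
    L2_norm_eq[OF weak_deriv_sobolev(1)[OF assms(1,2)]] is_hat_sqint[OF hat_weak_deriv_sobolev[OF assms]] by auto

text \<open>The Fourier multiplier that reproduces \<open>sobolev_norm\<close> exactly;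
  \<open>weight_le\<close> and \<open>weight_ge\<close> compare it with powers of 1 +
  |\<xi>|^2.\<close>

definition weight :: "nat \<Rightarrow> frequency \<Rightarrow> real" where
  "weight m \<xi> = (\<Sum>\<alpha> | order_of \<alpha> \<le> m. (norm (symbol \<alpha> \<xi>))\<^sup>2)"

lemma sobolev_norm_hat:
  assumes "f \<in> sobolev m" "is_hat f F"
  shows "(parseval_const * sobolev_norm m f)\<^sup>2 = (\<integral>\<xi>. weight m \<xi> * (norm (F \<xi>))\<^sup>2 \<partial>freq_meas)"
    and "integrable freq_meas (\<lambda>\<xi>. weight m \<xi> * (norm (F \<xi>))\<^sup>2)"
proof -
  have e: "weight m \<xi> * (norm (F \<xi>))\<^sup>2 = (\<Sum>\<alpha> | order_of \<alpha> \<le> m. (norm (symbol \<alpha> \<xi> * F \<xi>))\<^sup>2)" for \<xi>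
    by (simp add: weight_def sum_distrib_right norm_mult power_mult_distrib)
  have i: "integrable freq_meas (\<lambda>\<xi>. (norm (symbol \<alpha> \<xi> * F \<xi>))\<^sup>2)" if "order_of \<alpha> \<le> m" for \<alpha>
    by (rule sqint_integrable[OF L2_norm_weak_deriv(2)[OF assms(1) that assms(2)]])
  show "integrable freq_meas (\<lambda>\<xi>. weight m \<xi> * (norm (F \<xi>))\<^sup>2)"
    unfolding e using i by (intro Bochner_Integration.integrable_sum) simp
  have "(parseval_const * sobolev_norm m f)\<^sup>2 = (\<Sum>\<alpha> | order_of \<alpha> \<le> m. (parseval_const * L2_norm (weak_deriv \<alpha> f))\<^sup>2)"
    unfolding sobolev_norm_def power_mult_distrib by (subst real_sqrt_pow2) (auto intro: sum_nonneg simp: sum_distrib_left)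
  also have "\<dots> = (\<Sum>\<alpha> | order_of \<alpha> \<le> m. \<integral>\<xi>. (norm (symbol \<alpha> \<xi> * F \<xi>))\<^sup>2 \<partial>freq_meas)"
    by (intro sum.cong refl) (simp only: mem_Collect_eq L2_norm_weak_deriv(1)[OF assms(1) _ assms(2)] l2n_sq)
  also have "\<dots> = (\<integral>\<xi>. weight m \<xi> * (norm (F \<xi>))\<^sup>2 \<partial>freq_meas)"
    unfolding e using i by (intro Bochner_Integration.integral_sum[symmetric]) simp
  finally show "(parseval_const * sobolev_norm m f)\<^sup>2 = (\<integral>\<xi>. weight m \<xi> * (norm (F \<xi>))\<^sup>2 \<partial>freq_meas)" .
qed

lemma sobolev_norm_nonneg: "0 \<le> sobolev_norm m f"
  unfolding sobolev_norm_def by (intro real_sqrt_ge_zero sum_nonneg) simp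

lemma sobolev_norm_le:
  assumes "f \<in> sobolev m" "is_hat f F" "g \<in> sobolev n" "is_hat g H" "0 \<le> C"
    and "AE \<xi> in freq_meas. weight m \<xi> * (norm (F \<xi>))\<^sup>2 \<le> C\<^sup>2 * (weight n \<xi> * (norm (H \<xi>))\<^sup>2)"
  shows "sobolev_norm m f \<le> C * sobolev_norm n g"
proof -
  have "(parseval_const * sobolev_norm m f)\<^sup>2 \<le> (\<integral>\<xi>. C\<^sup>2 * (weight n \<xi> * (norm (H \<xi>))\<^sup>2) \<partial>freq_meas)"
    unfolding sobolev_norm_hat(1)[OF assms(1,2)]
    by (rule integral_mono_AE) (use sobolev_norm_hat(2)[OF assms(1,2)] sobolev_norm_hat(2)[OF assms(3,4)] assms(6) in auto)
  also have "\<dots> = C\<^sup>2 * (parseval_const * sobolev_norm n g)\<^sup>2"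
    unfolding sobolev_norm_hat(1)[OF assms(3,4)] by (rule integral_mult_right_zero)
  also have "\<dots> = (parseval_const * (C * sobolev_norm n g))\<^sup>2"
    unfolding power_mult_distrib[symmetric] by (simp only: mult_ac)
  finally have "parseval_const * sobolev_norm m f \<le> parseval_const * (C * sobolev_norm n g)"
    by (rule power2_le_imp_le) (use assms(5) sobolev_norm_nonneg[of n g] in auto)
  then show ?thesis using parseval_const_pos by (simp only: mult_le_cancel_left_pos)
qed

section \<open>Moving frame and \<open>x\<close>-average\<close>

text \<open>The representative modulo 2 pi in the half-open period from 0.\<close>

definition wrap :: "real \<Rightarrow> real" where
  "wrap x = x - 2 * pi * of_int \<lfloor>x / (2 * pi)\<rfloor>"

lemma wrap_measurable [measurable]: "wrap \<in> borel_measurable borel"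
  unfolding wrap_def by measurable

lemma wrap_periodic: "wrap (x + 2 * pi) = wrap x"
proof -
  have "(x + 2 * pi) / (2 * pi) = x / (2 * pi) + 1" by (simp add: add_divide_distrib)
  then show ?thesis unfolding wrap_def by (simp add: algebra_simps)
qed

lemma periodic_int:
  assumes "\<And>x::real. f (x + 2 * pi) = f x"
  shows "f (x + 2 * pi * of_int n) = f x"
proof (induction n rule: int_induct[where k=0])
  case (step1 i)
  have "f (x + 2 * pi * of_int (i + 1)) = f ((x + 2 * pi * of_int i) + 2 * pi)" by (simp add: algebra_simps)
  then show ?case using assms step1 by simp
next
  case (step2 i)
  have "f (x + 2 * pi * of_int i) = f ((x + 2 * pi * of_int (i - 1)) + 2 * pi)" by (simp add: algebra_simps)
  then show ?case using assms step2 by simp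
qed simp

lemma periodic_wrap:
  assumes "\<And>x::real. f (x + 2 * pi) = f x"
  shows "f (wrap x) = f x"
  using periodic_int[of f "wrap x" "\<lfloor>x / (2 * pi)\<rfloor>"] assms by (simp add: wrap_def)

lemma nn_integral_per_meas:
  assumes [measurable]: "h \<in> borel_measurable borel"
  shows "(\<integral>\<^sup>+x. h x \<partial>per_meas) = (\<integral>\<^sup>+x. indicator {0..<2 * pi} x * h x \<partial>lborel)"
  unfolding per_meas_def
proof (subst nn_integral_density_indicator)
  show "(\<integral>\<^sup>+x. indicator {0..2 * pi} x * h x \<partial>lborel) = (\<integral>\<^sup>+x. indicator {0..<2 * pi} x * h x \<partial>lborel)"
  proof (rule nn_integral_cong_AE)
    show "AE x in lborel. indicator {0..2 * pi} x * h x = indicator {0..<2 * pi} x * h x"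
      using AE_lborel_singleton[of "2 * pi"] by eventually_elim (auto simp: indicator_def)
  qed
qed auto

text \<open>Both [0, 2 pi) and [a, a + 2 pi) tile the line. Inserting the tiling by one window into
  the integral over the other, and moving each piece by a multiple of 2 pi, exchanges the two
  windows.\<close>

lemma nn_integral_periodic_shift:
  fixes h :: "real \<Rightarrow> ennreal"
  assumes [measurable]: "h \<in> borel_measurable borel" and per: "\<And>x. h (x + 2 * pi) = h x"
  shows "(\<integral>\<^sup>+x. h (x + a) \<partial>per_meas) = (\<integral>\<^sup>+x. h x \<partial>per_meas)"
proof -
  interpret C: sigma_finite_measure "count_space (UNIV :: int set)" by (rule sigma_finite_count_int)
  interpret CL: pair_sigma_finite lborel "count_space (UNIV :: int set)" ..
  let ?I = "\<lambda>c x. indicator {c..<c + 2 * pi} x :: ennreal"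
  have tile: "(\<integral>\<^sup>+k. ?I c (x + 2 * pi * of_int k) * v \<partial>count_space (UNIV :: int set)) = v" for c x v
  proof -
    have "?I c (x + 2 * pi * of_int k) = indicator {\<lceil>(c - x) / (2 * pi)\<rceil>} k" for k
    proof -
      define q where "q = (c - x) / (2 * pi)"
      have q: "2 * pi * q = c - x" by (simp add: q_def)
      have tp: "0 < 2 * pi" by simp
      have "x + 2 * pi * of_int k \<in> {c..<c + 2 * pi} \<longleftrightarrow> 2 * pi * q \<le> 2 * pi * of_int k \<and> 2 * pi * of_int k < 2 * pi * (q + 1)"
        unfolding distrib_left q by auto
      also have "\<dots> \<longleftrightarrow> of_int k - 1 < q \<and> q \<le> of_int k"
        unfolding mult_le_cancel_left_pos[OF tp] mult_less_cancel_left_pos[OF tp] by auto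
      finally have "x + 2 * pi * of_int k \<in> {c..<c + 2 * pi} \<longleftrightarrow> of_int k - 1 < (c - x) / (2 * pi) \<and> (c - x) / (2 * pi) \<le> of_int k"
        unfolding q_def .
      also have "\<dots> \<longleftrightarrow> k = \<lceil>(c - x) / (2 * pi)\<rceil>" using ceiling_eq_iff by metis
      finally show ?thesis by (auto simp: indicator_def)
    qed
    then show ?thesis by (simp add: nn_integral_multc)
  qed
  have hk: "h (x + 2 * pi * of_int k) = h x" for x and k :: int by (rule periodic_int[of h, OF per])
  have "(\<integral>\<^sup>+x. h (x + a) \<partial>per_meas) = (\<integral>\<^sup>+x. ?I 0 x * h (x + a) \<partial>lborel)"
    by (subst nn_integral_per_meas) auto
  also have "\<dots> = (\<integral>\<^sup>+x. ?I a x * h x \<partial>lborel)"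
  proof -
    have "?I 0 x = ?I a (a + x)" for x by (auto simp: indicator_def)
    then show ?thesis using nn_integral_real_affine[of "\<lambda>x. ?I a x * h x" 1 a] by (simp add: add.commute)
  qed
  also have "\<dots> = (\<integral>\<^sup>+x. (\<integral>\<^sup>+k. ?I 0 (x + 2 * pi * of_int k) * (?I a x * h x) \<partial>count_space (UNIV :: int set)) \<partial>lborel)"
    by (simp only: tile)
  also have "\<dots> = (\<integral>\<^sup>+k. (\<integral>\<^sup>+x. ?I 0 (x + 2 * pi * of_int k) * (?I a x * h x) \<partial>lborel) \<partial>count_space (UNIV :: int set))"
    by (rule CL.Fubini'[symmetric]) measurable
  also have "\<dots> = (\<integral>\<^sup>+k. (\<integral>\<^sup>+x. ?I 0 x * (?I a (x + 2 * pi * of_int (- k)) * h x) \<partial>lborel) \<partial>count_space (UNIV :: int set))"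
  proof (rule nn_integral_cong)
    fix k :: int
    have "(\<integral>\<^sup>+x. ?I 0 (x + 2 * pi * of_int k) * (?I a x * h x) \<partial>lborel) =
        (\<integral>\<^sup>+x. ?I 0 ((2 * pi * of_int (- k) + 1 * x) + 2 * pi * of_int k) * (?I a (2 * pi * of_int (- k) + 1 * x) * h (2 * pi * of_int (- k) + 1 * x)) \<partial>lborel)"
      using nn_integral_real_affine[of "\<lambda>x. ?I 0 (x + 2 * pi * of_int k) * (?I a x * h x)" 1 "2 * pi * of_int (- k)"] by simp
    also have "\<dots> = (\<integral>\<^sup>+x. ?I 0 x * (?I a (x + 2 * pi * of_int (- k)) * h x) \<partial>lborel)"
    proof (rule nn_integral_cong)
      fix x :: real
      have "h (2 * pi * of_int (- k) + 1 * x) = h x" using hk[of x "- k"] by (simp add: add.commute)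
      moreover have "(2 * pi * of_int (- k) + 1 * x) + 2 * pi * of_int k = x" "2 * pi * of_int (- k) + 1 * x = x + 2 * pi * of_int (- k)" by simp_all
      ultimately show "?I 0 ((2 * pi * of_int (- k) + 1 * x) + 2 * pi * of_int k) * (?I a (2 * pi * of_int (- k) + 1 * x) * h (2 * pi * of_int (- k) + 1 * x)) =
         ?I 0 x * (?I a (x + 2 * pi * of_int (- k)) * h x)" by (simp only:)
    qed
    finally show "(\<integral>\<^sup>+x. ?I 0 (x + 2 * pi * of_int k) * (?I a x * h x) \<partial>lborel) = (\<integral>\<^sup>+x. ?I 0 x * (?I a (x + 2 * pi * of_int (- k)) * h x) \<partial>lborel)" .
  qed
  also have "\<dots> = (\<integral>\<^sup>+x. (\<integral>\<^sup>+k. ?I 0 x * (?I a (x + 2 * pi * of_int (- k)) * h x) \<partial>count_space (UNIV :: int set)) \<partial>lborel)"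
    by (rule CL.Fubini') measurable
  also have "\<dots> = (\<integral>\<^sup>+x. ?I 0 x * h x \<partial>lborel)"
  proof (rule nn_integral_cong)
    fix x :: real
    have "(\<integral>\<^sup>+k. ?I 0 x * (?I a (x + 2 * pi * of_int (- k)) * h x) \<partial>count_space (UNIV :: int set)) =
        (\<integral>\<^sup>+k. ?I a (x + 2 * pi * of_int (- k)) * (?I 0 x * h x) \<partial>count_space (UNIV :: int set))"
      by (simp only: mult_ac)
    also have "\<dots> = (\<integral>\<^sup>+k. ?I a (x + 2 * pi * of_int k) * (?I 0 x * h x) \<partial>count_space (UNIV :: int set))"
      using nn_integral_bij_count_space[of uminus "UNIV :: int set" UNIV "\<lambda>k. ?I a (x + 2 * pi * of_int k) * (?I 0 x * h x)"]
      by (simp add: bij_uminus)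
    also have "\<dots> = ?I 0 x * h x" by (rule tile)
    finally show "(\<integral>\<^sup>+k. ?I 0 x * (?I a (x + 2 * pi * of_int (- k)) * h x) \<partial>count_space (UNIV :: int set)) = ?I 0 x * h x" .
  qed
  also have "\<dots> = (\<integral>\<^sup>+x. h x \<partial>per_meas)"
    by (subst nn_integral_per_meas) auto
  finally show ?thesis .
qed

lemma nn_integral_cell:
  assumes "F \<in> borel_measurable borel"
  shows "(\<integral>\<^sup>+X. F X \<partial>cell_meas) = (\<integral>\<^sup>+Y. (\<integral>\<^sup>+x. F (x, Y) \<partial>per_meas) \<partial>(lborel \<Otimes>\<^sub>M per_meas))"
proof -
  interpret P: sigma_finite_measure per_meas using finite_per_meas by (rule finite_measure.axioms)
  interpret LP: pair_sigma_finite lborel per_meas ..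
  interpret Q: pair_sigma_finite per_meas "lborel \<Otimes>\<^sub>M per_meas" ..
  have "F \<in> borel_measurable (per_meas \<Otimes>\<^sub>M (lborel \<Otimes>\<^sub>M per_meas))"
    using assms borel_measurable_cell cell_meas_eq by auto
  then show ?thesis unfolding cell_meas_eq by (rule Q.nn_integral_snd[symmetric])
qed

definition shear :: "real \<Rightarrow> point \<Rightarrow> point" where
  "shear t X = (fst X + t * fst (snd X), snd X)"

definition wrapx :: "point \<Rightarrow> point" where
  "wrapx X = (wrap (fst X), snd X)"

lemma moving_frame_shear: "moving_frame t f = (\<lambda>X. f (shear t X))"
  by (auto simp: moving_frame_def shear_def)

lemma pair_borel_measurable [measurable (raw)]:
  fixes f :: "'a \<Rightarrow> 'b::second_countable_topology" and g :: "'a \<Rightarrow> 'c::second_countable_topology"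
  shows "f \<in> borel_measurable M \<Longrightarrow> g \<in> borel_measurable M \<Longrightarrow> (\<lambda>x. (f x, g x)) \<in> borel_measurable M"
  by (rule borel_measurable_Pair)

lemma shear_measurable [measurable]: "shear t \<in> borel_measurable borel"
  unfolding shear_def[abs_def] by (intro borel_measurable_continuous_onI continuous_intros)

lemma fst_wrap_measurable: "(\<lambda>X::point. wrap (fst X)) \<in> borel_measurable borel"
  by (rule measurable_compose[OF fst_borel_measurable wrap_measurable])

lemma wrapx_measurable [measurable]: "wrapx \<in> borel_measurable borel"
  unfolding wrapx_def[abs_def] by (rule borel_measurable_Pair[OF fst_wrap_measurable snd_borel_measurable])

text \<open>The shear moves \<open>cell\<close> off itself, so the image measures are compared only
  after x has been wrapped back. For fixed y and z the shear is a translation in x, which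
  \<open>nn_integral_periodic_shift\<close> absorbs.\<close>

lemma distr_shear: "distr cell_meas borel (\<lambda>X. wrapx (shear t X)) = distr cell_meas borel wrapx"
proof (rule measure_eqI)
  fix A :: "point set" assume "A \<in> sets (distr cell_meas borel (\<lambda>X. wrapx (shear t X)))"
  then have A [measurable]: "A \<in> sets borel" by simp
  have e: "emeasure (distr cell_meas borel T) A = (\<integral>\<^sup>+X. indicator A (T X) \<partial>cell_meas)" if [measurable]: "T \<in> borel_measurable borel" for T
  proof -
    have "emeasure (distr cell_meas borel T) A = (\<integral>\<^sup>+X. indicator A X \<partial>distr cell_meas borel T)" by simp
    also have "\<dots> = (\<integral>\<^sup>+X. indicator A (T X) \<partial>cell_meas)" by (rule nn_integral_distr) (use that in auto)
    finally show ?thesis .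
  qed
  have m1: "(\<lambda>X. wrapx (shear t X)) \<in> borel_measurable borel"
    by (rule measurable_compose[OF shear_measurable wrapx_measurable])
  have ind: "(\<lambda>X. indicator A (T X) :: ennreal) \<in> borel_measurable borel" if "T \<in> borel_measurable borel" for T :: "point \<Rightarrow> point"
    by (rule measurable_compose[OF that]) simp
  have "(\<integral>\<^sup>+x. indicator A (wrapx (shear t (x, Y))) \<partial>per_meas) = (\<integral>\<^sup>+x. indicator A (wrapx (x, Y)) \<partial>per_meas)" for Y
  proof -
    have "(\<lambda>x::real. (x, Y)) \<in> borel_measurable borel" by (intro borel_measurable_continuous_onI continuous_intros)
    then have "(\<lambda>x. indicator A (wrapx (x, Y)) :: ennreal) \<in> borel_measurable borel"
      by (rule measurable_compose[OF _ ind[OF wrapx_measurable]])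
    from nn_integral_periodic_shift[OF this, of "t * fst Y"] show ?thesis
      by (simp add: shear_def wrapx_def wrap_periodic)
  qed
  then show "emeasure (distr cell_meas borel (\<lambda>X. wrapx (shear t X))) A = emeasure (distr cell_meas borel wrapx) A"
    unfolding e[OF m1] e[OF wrapx_measurable] nn_integral_cell[OF ind[OF m1]] nn_integral_cell[OF ind[OF wrapx_measurable]]
    by simp
qed simp

lemma cell_shear:
  fixes F :: "point \<Rightarrow> 'b::{banach,second_countable_topology}"
  assumes F: "F \<in> borel_measurable borel" and per: "\<And>x Y. F (x + 2 * pi, Y) = F (x, Y)"
  shows "(\<integral>X. F (shear t X) \<partial>cell_meas) = (\<integral>X. F X \<partial>cell_meas)"
    and "integrable cell_meas (\<lambda>X. F (shear t X)) \<longleftrightarrow> integrable cell_meas F"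
proof -
  have w: "F (wrapx X) = F X" for X
    using periodic_wrap[of "\<lambda>x. F (x, snd X)" "fst X"] per by (simp add: wrapx_def)
  have m1: "(\<lambda>X. wrapx (shear t X)) \<in> measurable cell_meas borel"
    using measurable_compose[OF shear_measurable wrapx_measurable] by simp
  have m2: "wrapx \<in> measurable cell_meas borel" using wrapx_measurable by simp
  have "(\<integral>X. F (wrapx (shear t X)) \<partial>cell_meas) = (\<integral>X. F (wrapx X) \<partial>cell_meas)"
    using integral_distr[OF m1 F] integral_distr[OF m2 F] by (simp add: distr_shear)
  then show "(\<integral>X. F (shear t X) \<partial>cell_meas) = (\<integral>X. F X \<partial>cell_meas)" by (simp add: w)
  have "integrable cell_meas (\<lambda>X. F (wrapx (shear t X))) \<longleftrightarrow> integrable cell_meas (\<lambda>X. F (wrapx X))"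
    using integrable_distr_eq[OF m1 F] integrable_distr_eq[OF m2 F] by (simp add: distr_shear)
  then show "integrable cell_meas (\<lambda>X. F (shear t X)) \<longleftrightarrow> integrable cell_meas F" by (simp add: w)
qed

lemma periodic_xz_x: "periodic_xz f \<Longrightarrow> f (x + 2 * pi, Y) = f (x, Y)"
  by (cases Y) (simp add: periodic_xz_def)

lemma moving_frame_L2:
  assumes "f \<in> L2_space"
  shows "moving_frame t f \<in> L2_space" and "l2n cell_meas (moving_frame t f) = l2n cell_meas f"
proof -
  have m: "f \<in> borel_measurable borel" and p: "periodic_xz f" using assms by (auto simp: L2_space_def)
  have p2: "(norm (f (x + 2 * pi, Y)))\<^sup>2 = (norm (f (x, Y)))\<^sup>2" for x Y by (simp add: periodic_xz_x[OF p])
  have "(\<lambda>X. f (shear t X)) \<in> borel_measurable borel" by (rule measurable_compose[OF shear_measurable m])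
  moreover have "integrable cell_meas (\<lambda>X. (norm (f (shear t X)))\<^sup>2)"
    using cell_shear(2)[of "\<lambda>X. (norm (f X))\<^sup>2" t] m p2 L2_space_sqint[OF assms] by (simp add: sqint_def)
  ultimately have "sqint cell_meas (moving_frame t f)" by (simp add: sqint_def moving_frame_shear)
  moreover have "periodic_xz (moving_frame t f)"
    using p unfolding periodic_xz_def moving_frame_def by (simp add: algebra_simps) (metis add.commute add.assoc)
  ultimately show "moving_frame t f \<in> L2_space" by (rule L2_spaceI)
  show "l2n cell_meas (moving_frame t f) = l2n cell_meas f"
    unfolding l2n_def moving_frame_shear using cell_shear(1)[of "\<lambda>X. (norm (f X))\<^sup>2" t] m p2 by simp
qed

section \<open>The shear on the frequency side\<close>

definition freq_shear :: "real \<Rightarrow> frequency \<Rightarrow> frequency" where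
  "freq_shear t = (\<lambda>(k, \<eta>, l). (k, \<eta> - of_int k * t, l))"

lemma wave_shear: "wave (freq_shear t \<xi>) (shear t X) = wave \<xi> X"
  unfolding wave_def freq_shear_def shear_def split_beta by (simp add: algebra_simps)

lemma wave_periodic_x: "wave \<xi> (x + 2 * pi, Y) = wave \<xi> (x, Y)"
  using wave_periodic(1)[of \<xi> x "fst Y" "snd Y"] by simp

text \<open>An exact identity for every bump: the shear fixes y and therefore leaves the localising
  factor alone.\<close>

lemma lfourier_moving_frame:
  assumes "bump b" "f \<in> L2_space"
  shows "lfourier b p (moving_frame t f) \<xi> = lfourier b p f (freq_shear t \<xi>)"
proof -
  have m: "f \<in> borel_measurable borel" and p: "periodic_xz f" using assms(2) by (auto simp: L2_space_def)
  let ?F = "\<lambda>X. modulate b p f X * wave (freq_shear t \<xi>) X"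
  have "?F \<in> borel_measurable borel"
    using borel_measurable_integrable[OF integrable_modulate_wave[OF assms(1) L2_space_sqint[OF assms(2)]]] by simp
  moreover have "?F (x + 2 * pi, Y) = ?F (x, Y)" for x Y
    by (simp add: modulate_def periodic_xz_x[OF p] wave_periodic_x)
  ultimately have "(\<integral>X. ?F (shear t X) \<partial>cell_meas) = (\<integral>X. ?F X \<partial>cell_meas)" by (rule cell_shear(1))
  then show ?thesis unfolding lfourier_def fourier_def
    by (simp add: wave_shear modulate_def moving_frame_shear) (simp add: shear_def)
qed

lemma freq_shear_measurable [measurable]: "freq_shear t \<in> measurable freq_meas freq_meas"
  unfolding freq_shear_def freq_meas_def split_beta by measurable

lemma nn_integral_freq:
  assumes "F \<in> borel_measurable freq_meas"
  shows "(\<integral>\<^sup>+\<xi>. F \<xi> \<partial>freq_meas) = (\<integral>\<^sup>+k. (\<integral>\<^sup>+l. (\<integral>\<^sup>+\<eta>. F (k, \<eta>, l) \<partial>lborel) \<partial>count_space UNIV) \<partial>count_space UNIV)"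
proof -
  interpret C: sigma_finite_measure "count_space (UNIV :: int set)" by (rule sigma_finite_count_int)
  interpret LC: pair_sigma_finite lborel "count_space (UNIV :: int set)" ..
  have "(\<integral>\<^sup>+\<xi>. F \<xi> \<partial>freq_meas) = (\<integral>\<^sup>+k. (\<integral>\<^sup>+Y. F (k, Y) \<partial>(lborel \<Otimes>\<^sub>M count_space UNIV)) \<partial>count_space UNIV)"
    using assms unfolding freq_meas_def by (rule LC.P.nn_integral_fst[symmetric])
  also have "\<dots> = (\<integral>\<^sup>+k. (\<integral>\<^sup>+l. (\<integral>\<^sup>+\<eta>. F (k, \<eta>, l) \<partial>lborel) \<partial>count_space UNIV) \<partial>count_space UNIV)"
  proof (rule nn_integral_cong)
    fix k :: int
    have "(\<lambda>Y. F (k, Y)) \<in> borel_measurable (lborel \<Otimes>\<^sub>M count_space UNIV)"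
      using assms unfolding freq_meas_def by (intro measurable_compose[OF measurable_Pair1']) auto
    then show "(\<integral>\<^sup>+Y. F (k, Y) \<partial>(lborel \<Otimes>\<^sub>M count_space UNIV)) = (\<integral>\<^sup>+l. (\<integral>\<^sup>+\<eta>. F (k, \<eta>, l) \<partial>lborel) \<partial>count_space UNIV)"
      by (rule LC.nn_integral_snd[symmetric])
  qed
  finally show ?thesis .
qed

text \<open>For fixed k and l the map is a translation in \<eta>.\<close>

lemma distr_freq_shear: "distr freq_meas freq_meas (freq_shear t) = freq_meas"
proof (rule measure_eqI)
  fix A assume "A \<in> sets (distr freq_meas freq_meas (freq_shear t))"
  then have A [measurable]: "A \<in> sets freq_meas" by simp
  have "emeasure (distr freq_meas freq_meas (freq_shear t)) A = (\<integral>\<^sup>+\<xi>. indicator A \<xi> \<partial>distr freq_meas freq_meas (freq_shear t))" by simp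
  also have "\<dots> = (\<integral>\<^sup>+\<xi>. indicator A (freq_shear t \<xi>) \<partial>freq_meas)" by (rule nn_integral_distr) auto
  also have "\<dots> = (\<integral>\<^sup>+k. (\<integral>\<^sup>+l. (\<integral>\<^sup>+\<eta>. indicator A (k, \<eta> - of_int k * t, l) \<partial>lborel) \<partial>count_space UNIV) \<partial>count_space UNIV)"
    by (subst nn_integral_freq, measurable, simp add: freq_shear_def)
  also have "\<dots> = (\<integral>\<^sup>+k. (\<integral>\<^sup>+l. (\<integral>\<^sup>+\<eta>. indicator A (k, \<eta>, l) \<partial>lborel) \<partial>count_space UNIV) \<partial>count_space UNIV)"
  proof (rule nn_integral_cong, rule nn_integral_cong)
    fix k l :: int
    have "(\<lambda>\<eta>. (k, \<eta>, l)) \<in> measurable lborel freq_meas" unfolding freq_meas_def by measurable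
    then have "(\<lambda>\<eta>. indicator A (k, \<eta>, l) :: ennreal) \<in> borel_measurable borel"
      using measurable_compose[OF _ borel_measurable_indicator[OF A]] by simp
    from nn_integral_real_affine[OF this, of 1 "- (of_int k * t)"]
    show "(\<integral>\<^sup>+\<eta>. indicator A (k, \<eta> - of_int k * t, l) \<partial>lborel) = (\<integral>\<^sup>+\<eta>. indicator A (k, \<eta>, l) \<partial>lborel)"
      by simp
  qed
  also have "\<dots> = emeasure freq_meas A" by (subst nn_integral_freq[symmetric]) auto
  finally show "emeasure (distr freq_meas freq_meas (freq_shear t)) A = emeasure freq_meas A" .
qed simp

lemma l2n_freq_shear:
  fixes F :: "frequency \<Rightarrow> complex"
  assumes "F \<in> borel_measurable freq_meas"
  shows "l2n freq_meas (\<lambda>\<xi>. F (freq_shear t \<xi>)) = l2n freq_meas F"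
    and "sqint freq_meas F \<Longrightarrow> sqint freq_meas (\<lambda>\<xi>. F (freq_shear t \<xi>))"
proof -
  have m: "(\<lambda>\<xi>. (norm (F \<xi>))\<^sup>2) \<in> borel_measurable freq_meas" using assms by simp
  show "l2n freq_meas (\<lambda>\<xi>. F (freq_shear t \<xi>)) = l2n freq_meas F"
    unfolding l2n_def using integral_distr[OF freq_shear_measurable m, of t] by (simp add: distr_freq_shear)
  show "sqint freq_meas F \<Longrightarrow> sqint freq_meas (\<lambda>\<xi>. F (freq_shear t \<xi>))"
    using integrable_distr_eq[OF freq_shear_measurable m, of t] measurable_compose[OF freq_shear_measurable assms]
    by (simp add: sqint_def distr_freq_shear)
qed

lemma AE_freq_shear: "AE \<xi> in freq_meas. P \<xi> \<Longrightarrow> AE \<xi> in freq_meas. P (freq_shear t \<xi>)"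
proof -
  assume "AE \<xi> in freq_meas. P \<xi>"
  then have "AE \<xi> in distr freq_meas freq_meas (freq_shear t). P \<xi>" unfolding distr_freq_shear .
  then show ?thesis by (rule AE_distrD[OF freq_shear_measurable])
qed

lemma hat_moving_frame:
  assumes "f \<in> L2_space" "is_hat f F"
  shows "is_hat (moving_frame t f) (\<lambda>\<xi>. F (freq_shear t \<xi>))"
  unfolding is_hat_def
proof
  have F: "sqint freq_meas F" by (rule is_hat_sqint[OF assms(2)])
  show "sqint freq_meas (\<lambda>\<xi>. F (freq_shear t \<xi>))" by (rule l2n_freq_shear(2)[OF sqint_measurable[OF F] F])
  have "l2n freq_meas (\<lambda>\<xi>. lfourier (cutoff n) 1 (moving_frame t f) \<xi> - F (freq_shear t \<xi>)) = l2n freq_meas (\<lambda>\<xi>. lfourier (cutoff n) 1 f \<xi> - F \<xi>)" for n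
    unfolding lfourier_moving_frame[OF bump_cut assms(1)]
    by (rule l2n_freq_shear(1)[of "\<lambda>\<xi>. lfourier (cutoff n) 1 f \<xi> - F \<xi>"])
       (intro borel_measurable_diff sqint_measurable[OF F] sqint_measurable[OF sqint_lfourier[OF bump_cut L2_space_sqint[OF assms(1)]]])
  then show "(\<lambda>n. l2n freq_meas (\<lambda>\<xi>. lfourier (cutoff n) 1 (moving_frame t f) \<xi> - F (freq_shear t \<xi>))) \<longlonglongrightarrow> 0"
    using assms(2) by (simp add: is_hat_def)
qed

section \<open>The average in x\<close>

definition x_mean :: "scalar_field \<Rightarrow> scalar_field" where
  "x_mean f X = x_average f (snd X)"

lemma x_nonzero_eq: "x_nonzero f = (\<lambda>X. f X - x_mean f X)"
  by (auto simp: x_nonzero_def x_mean_def)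

lemma slice_x_measurable: "f \<in> borel_measurable borel \<Longrightarrow> (\<lambda>x. f (x, Y)) \<in> borel_measurable borel"
  for f :: "point \<Rightarrow> 'b::topological_space"
  by (rule measurable_compose[where N=borel]) (intro borel_measurable_continuous_onI continuous_intros)

lemma x_average_eq:
  assumes "f \<in> borel_measurable borel"
  shows "x_average f Y = (1 / (2 * pi)) * (\<integral>x. f (x, Y) \<partial>per_meas)"
proof (cases Y)
  case (Pair y z)
  show ?thesis
    unfolding Pair x_average_def per_meas_def using slice_x_measurable[OF assms, of "(y, z)"]
    by (simp add: integral_density_indicator set_lebesgue_integral_def)
qed

lemma x_average_measurable:
  assumes "f \<in> borel_measurable borel"
  shows "x_average f \<in> borel_measurable borel"
proof -
  interpret P: sigma_finite_measure per_meas using finite_per_meas by (rule finite_measure.axioms)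
  interpret LP: pair_sigma_finite lborel per_meas ..
  have "f \<in> borel_measurable (per_meas \<Otimes>\<^sub>M (borel :: (real \<times> real) measure))"
    using assms by (simp add: borel_prod[symmetric] cong: measurable_cong_sets)
  then have "(\<lambda>(Y, x). f (x, Y)) \<in> borel_measurable ((borel :: (real \<times> real) measure) \<Otimes>\<^sub>M per_meas)"
    by (rule measurable_pair_swap)
  then have "(\<lambda>Y. \<integral>x. f (x, Y) \<partial>per_meas) \<in> borel_measurable borel"
    by (intro P.borel_measurable_lebesgue_integral) simp
  then show ?thesis unfolding x_average_eq[OF assms, abs_def] by (intro borel_measurable_times) auto
qed

lemma x_mean_measurable: "f \<in> borel_measurable borel \<Longrightarrow> x_mean f \<in> borel_measurable borel"
  unfolding x_mean_def[abs_def] by (rule measurable_compose[OF snd_borel_measurable x_average_measurable])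

text \<open>Cauchy-Schwarz against the constant 1 on each line in the x direction.\<close>

lemma x_mean_L2:
  assumes "f \<in> L2_space"
  shows "x_mean f \<in> L2_space"
proof (rule L2_spaceI)
  have m: "f \<in> borel_measurable borel" and p: "periodic_xz f" using assms by (auto simp: L2_space_def)
  interpret P: finite_measure per_meas by (rule finite_per_meas)
  have e: "emeasure per_meas UNIV = ennreal (2 * pi)"
    using measure_per_meas by (simp add: P.emeasure_eq_measure)
  have le: "ennreal ((norm (x_average f Y))\<^sup>2) * ennreal (2 * pi) \<le> (\<integral>\<^sup>+x. ennreal ((norm (f (x, Y)))\<^sup>2) \<partial>per_meas)" for Y
  proof (cases "sqint per_meas (\<lambda>x. f (x, Y))")
    case True
    have one: "sqint per_meas (\<lambda>x. 1 :: real)" by (simp add: sqint_def)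
    have l1: "(l2n per_meas (\<lambda>x. 1 :: real))\<^sup>2 = 2 * pi" by (simp add: l2n_sq measure_per_meas)
    have "\<bar>\<integral>x. f (x, Y) \<partial>per_meas\<bar> \<le> l2n per_meas (\<lambda>x. f (x, Y)) * l2n per_meas (\<lambda>x. 1 :: real)"
      using cauchy_schwarz_l2n'[OF True one] by simp
    then have "\<bar>\<integral>x. f (x, Y) \<partial>per_meas\<bar>\<^sup>2 \<le> (l2n per_meas (\<lambda>x. f (x, Y)) * l2n per_meas (\<lambda>x. 1 :: real))\<^sup>2"
      by (rule power_mono) simp
    then have "(\<integral>x. f (x, Y) \<partial>per_meas)\<^sup>2 \<le> (l2n per_meas (\<lambda>x. f (x, Y)))\<^sup>2 * (2 * pi)"
      by (simp add: power_mult_distrib l1)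
    then have "(x_average f Y)\<^sup>2 * (2 * pi) \<le> (l2n per_meas (\<lambda>x. f (x, Y)))\<^sup>2"
      unfolding x_average_eq[OF m] by (simp add: power_mult_distrib power2_eq_square[of pi] power_divide field_simps)
    then show ?thesis unfolding nn_l2n[OF True] by (simp add: ennreal_mult[symmetric] ennreal_leI)
  next
    \<comment> \<open>Whatever value the average takes on such a slice, the right-hand side is
      infinite.\<close>
    case False
    have "(\<integral>\<^sup>+x. ennreal ((norm (f (x, Y)))\<^sup>2) \<partial>per_meas) = \<infinity>"
    proof (rule ccontr)
      assume "(\<integral>\<^sup>+x. ennreal ((norm (f (x, Y)))\<^sup>2) \<partial>per_meas) \<noteq> \<infinity>"
      then have "sqint per_meas (\<lambda>x. f (x, Y))"
        using slice_x_measurable[OF m, of Y]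
        by (intro sqintI_nn) (auto simp: less_top cong: measurable_cong_sets)
      then show False using False by simp
    qed
    then show ?thesis by simp
  qed
  have mm: "(\<lambda>X. ennreal ((norm (x_mean f X))\<^sup>2)) \<in> borel_measurable borel" "(\<lambda>X. ennreal ((norm (f X))\<^sup>2)) \<in> borel_measurable borel"
    using x_mean_measurable[OF m] m by auto
  have "(\<integral>\<^sup>+X. ennreal ((norm (x_mean f X))\<^sup>2) \<partial>cell_meas) = (\<integral>\<^sup>+Y. ennreal ((norm (x_average f Y))\<^sup>2) * ennreal (2 * pi) \<partial>(lborel \<Otimes>\<^sub>M per_meas))"
    unfolding nn_integral_cell[OF mm(1)] by (simp add: x_mean_def e)
  also have "\<dots> \<le> (\<integral>\<^sup>+Y. (\<integral>\<^sup>+x. ennreal ((norm (f (x, Y)))\<^sup>2) \<partial>per_meas) \<partial>(lborel \<Otimes>\<^sub>M per_meas))"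
    by (intro nn_integral_mono le)
  also have "\<dots> = (\<integral>\<^sup>+X. ennreal ((norm (f X))\<^sup>2) \<partial>cell_meas)" by (rule nn_integral_cell[OF mm(2), symmetric])
  also have "\<dots> < \<infinity>" using nn_l2n[OF L2_space_sqint[OF assms]] by simp
  finally show "sqint cell_meas (x_mean f)" using x_mean_measurable[OF m] by (intro sqintI_nn) auto
  have "f (x, y, z + 2 * pi) = f (x, y, z)" for x y z using p by (simp add: periodic_xz_def)
  then show "periodic_xz (x_mean f)" unfolding periodic_xz_def x_mean_def by (simp add: x_average_def)
qed

lemma x_nonzero_L2: "f \<in> L2_space \<Longrightarrow> x_nonzero f \<in> L2_space"
  unfolding x_nonzero_eq using x_mean_L2[of f]
  by (auto simp: L2_space_iff periodic_xz_def intro!: sqint_diff)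

text \<open>The bump depends on y alone, so the integral in x factors out and meets e^(-ikx), which
  has mean 0 unless k = 0.\<close>

lemma lfourier_x_mean:
  assumes "bump b" "f \<in> L2_space"
  shows "lfourier b p (x_mean f) \<xi> = (if fst \<xi> = 0 then lfourier b p f \<xi> else 0)"
proof -
  obtain k \<eta> l where \<xi>: "\<xi> = (k, \<eta>, l)" by (cases \<xi>)
  have m: "f \<in> borel_measurable borel" using assms by (simp add: L2_space_def)
  interpret P: sigma_finite_measure per_meas using finite_per_meas by (rule finite_measure.axioms)
  interpret LP: pair_sigma_finite lborel per_meas ..
  interpret Q: pair_sigma_finite per_meas "lborel \<Otimes>\<^sub>M per_meas" ..
  define w where "w Y = bump_comb b p (fst Y) * cis (- (\<eta> * fst Y + of_int l * snd Y))" for Y :: "real \<times> real"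
  have wv: "wave \<xi> (x, Y) = cis (- (of_int k * x)) * cis (- (\<eta> * fst Y + of_int l * snd Y))" for x Y
    unfolding \<xi> wave_def split_beta by (simp add: cis_mult algebra_simps)
  have it: "lfourier b p g \<xi> = (\<integral>Y. (\<integral>x. (of_real (g (x, Y)) * cis (- (of_int k * x))) * w Y \<partial>per_meas) \<partial>(lborel \<Otimes>\<^sub>M per_meas))"
    if g: "sqint cell_meas g" for g
  proof -
    have i: "integrable (per_meas \<Otimes>\<^sub>M (lborel \<Otimes>\<^sub>M per_meas)) (\<lambda>(x, Y). modulate b p g (x, Y) * wave \<xi> (x, Y))"
      using integrable_modulate_wave[OF assms(1) g, of p \<xi>] unfolding cell_meas_eq by (simp add: split_beta')
    have "lfourier b p g \<xi> = (\<integral>Y. (\<integral>x. modulate b p g (x, Y) * wave \<xi> (x, Y) \<partial>per_meas) \<partial>(lborel \<Otimes>\<^sub>M per_meas))"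
      unfolding lfourier_def fourier_def cell_meas_eq using Q.integral_snd[OF i] by (simp add: split_beta')
    moreover have "modulate b p g (x, Y) * wave \<xi> (x, Y) = (of_real (g (x, Y)) * cis (- (of_int k * x))) * w Y" for x Y
      by (simp only: modulate_def wv w_def snd_conv mult_ac)
    ultimately show ?thesis by (simp only:)
  qed
  have ck: "(\<integral>x. cis (- (of_int k * x)) \<partial>per_meas) = (if k = 0 then 2 * pi else 0)"
    using integral_cis_per_meas[of "- k"] by simp
  have A: "lfourier b p (x_mean f) \<xi> = (\<integral>Y. of_real (x_average f Y) * (if k = 0 then 2 * pi else 0) * w Y \<partial>(lborel \<Otimes>\<^sub>M per_meas))"
    unfolding it[OF L2_space_sqint[OF x_mean_L2[OF assms(2)]]] integral_mult_left_zero
    by (simp add: x_mean_def ck)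
  show ?thesis
  proof (cases "k = 0")
    case True
    have "lfourier b p f \<xi> = (\<integral>Y. (\<integral>x. of_real (f (x, Y)) \<partial>per_meas) * w Y \<partial>(lborel \<Otimes>\<^sub>M per_meas))"
      unfolding it[OF L2_space_sqint[OF assms(2)]] integral_mult_left_zero by (simp add: True)
    also have "\<dots> = (\<integral>Y. of_real (x_average f Y) * (2 * pi) * w Y \<partial>(lborel \<Otimes>\<^sub>M per_meas))"
      unfolding x_average_eq[OF m] by simp
    finally show ?thesis using A True \<xi> by simp
  next
    case False
    then show ?thesis using A \<xi> by simp
  qed
qed

lemma lfourier_diff:
  assumes "bump b" "sqint cell_meas f" "sqint cell_meas g"
  shows "lfourier b p (\<lambda>X. f X - g X) \<xi> = lfourier b p f \<xi> - lfourier b p g \<xi>"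
  using lfourier_add[OF assms(1,2) sqint_minus[OF assms(3)], of p \<xi>] lfourier_cmult[of b p "-1" g \<xi>] by simp

lemma lfourier_x_nonzero:
  assumes "bump b" "f \<in> L2_space"
  shows "lfourier b p (x_nonzero f) \<xi> = (if fst \<xi> = 0 then 0 else lfourier b p f \<xi>)"
  unfolding x_nonzero_eq lfourier_diff[OF assms(1) L2_space_sqint[OF assms(2)] L2_space_sqint[OF x_mean_L2[OF assms(2)]]]
    lfourier_x_mean[OF assms] by simp

text \<open>Multiplication by the indicator of a set of k is an L2 contraction, so a restriction
  valid for every cutoff passes to the limit.\<close>

lemma hat_restrict:
  assumes "is_hat f F" "sqint cell_meas f" "\<And>n \<xi>. lfourier (cutoff n) 1 g \<xi> = (if P (fst \<xi>) then lfourier (cutoff n) 1 f \<xi> else 0)"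
  shows "is_hat g (\<lambda>\<xi>. if P (fst \<xi>) then F \<xi> else 0)"
  unfolding is_hat_def
proof
  have F: "sqint freq_meas F" by (rule is_hat_sqint[OF assms(1)])
  note [measurable] = sqint_measurable[OF F]
  have s: "sqint freq_meas (\<lambda>\<xi>. if P (fst \<xi>) then D \<xi> else 0)" "l2n freq_meas (\<lambda>\<xi>. if P (fst \<xi>) then D \<xi> else 0) \<le> 1 * l2n freq_meas D"
    if D: "sqint freq_meas D" for D :: "frequency \<Rightarrow> complex"
  proof -
    have [measurable]: "D \<in> borel_measurable freq_meas" by (rule sqint_measurable[OF D])
    have [measurable]: "Measurable.pred freq_meas (\<lambda>\<xi>. P (fst \<xi>))"
      by (rule measurable_compose[OF freq_proj_measurable(1)]) simp
    have "(\<lambda>\<xi>. if P (fst \<xi>) then D \<xi> else 0) \<in> borel_measurable freq_meas" by measurable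
    then show "sqint freq_meas (\<lambda>\<xi>. if P (fst \<xi>) then D \<xi> else 0)" "l2n freq_meas (\<lambda>\<xi>. if P (fst \<xi>) then D \<xi> else 0) \<le> 1 * l2n freq_meas D"
      by (intro sqint_bound[OF D, where C=1] l2n_bound[OF D]; auto)+
  qed
  show "sqint freq_meas (\<lambda>\<xi>. if P (fst \<xi>) then F \<xi> else 0)" by (rule s(1)[OF F])
  have "l2n freq_meas (\<lambda>\<xi>. lfourier (cutoff n) 1 g \<xi> - (if P (fst \<xi>) then F \<xi> else 0)) \<le> l2n freq_meas (\<lambda>\<xi>. lfourier (cutoff n) 1 f \<xi> - F \<xi>)" for n
  proof -
    have "(\<lambda>\<xi>. lfourier (cutoff n) 1 g \<xi> - (if P (fst \<xi>) then F \<xi> else 0)) = (\<lambda>\<xi>. if P (fst \<xi>) then lfourier (cutoff n) 1 f \<xi> - F \<xi> else 0)"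
      by (auto simp: assms(3))
    then show ?thesis using s(2)[OF sqint_diff[OF sqint_lfourier[OF bump_cut assms(2)] F], of n 1] by simp
  qed
  then show "(\<lambda>n. l2n freq_meas (\<lambda>\<xi>. lfourier (cutoff n) 1 g \<xi> - (if P (fst \<xi>) then F \<xi> else 0))) \<longlonglongrightarrow> 0"
    by (rule tendsto_0_le[OF _ l2n_nonneg]) (use assms(1) in \<open>simp add: is_hat_def\<close>)
qed

lemma hat_x_mean: "f \<in> L2_space \<Longrightarrow> is_hat f F \<Longrightarrow> is_hat (x_mean f) (\<lambda>\<xi>. if fst \<xi> = 0 then F \<xi> else 0)"
  by (rule hat_restrict[where P="\<lambda>k. k = 0"]) (auto simp: lfourier_x_mean[OF bump_cut] intro: L2_space_sqint)

lemma hat_x_nonzero: "f \<in> L2_space \<Longrightarrow> is_hat f F \<Longrightarrow> is_hat (x_nonzero f) (\<lambda>\<xi>. if fst \<xi> \<noteq> 0 then F \<xi> else 0)"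
  by (rule hat_restrict[where P="\<lambda>k. k \<noteq> 0"]) (auto simp: lfourier_x_nonzero[OF bump_cut] intro: L2_space_sqint)

section \<open>Transport in sheared frequencies\<close>

text \<open>Taylor bounds of first and second order from the mean value inequality; the first bounds
  the derivative in the second. The factor 1/2 of the second is dropped, and negative arguments
  follow by conjugation.\<close>

lemma norm_cis_minus_1_le: "norm (cis a - 1) \<le> \<bar>a\<bar>"
  and norm_cis_taylor_le: "norm (cis a - 1 - \<i> * of_real a) \<le> a\<^sup>2"
proof -
  have d: "(cis has_vector_derivative \<i> * cis x) (at x)" for x
    using has_vector_derivative_cis[of 1 0 x UNIV] by simp
  have 1: "norm (cis a - 1) \<le> a" if "a > 0" for a
  proof -
    have "norm (cis a - cis 0) \<le> a - 0"
      by (rule differentiable_bound_general[OF that, where f'="\<lambda>x. \<i> * cis x" and \<phi>'="\<lambda>_. 1"])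
         (auto intro!: continuous_intros d derivative_eq_intros simp: norm_mult)
    then show ?thesis by simp
  qed
  have 2: "norm (cis a - 1 - \<i> * of_real a) \<le> a\<^sup>2" if "a > 0" for a
  proof -
    have "norm ((cis a - \<i> * of_real a) - (cis 0 - \<i> * of_real 0)) \<le> a\<^sup>2 / 2 - 0\<^sup>2 / 2"
    proof (rule differentiable_bound_general[OF that, where f'="\<lambda>x. \<i> * cis x - \<i>" and \<phi>'="\<lambda>x. x"])
      show "((\<lambda>x. cis x - \<i> * of_real x) has_vector_derivative \<i> * cis x - \<i>) (at x)" for x
        by (auto intro!: derivative_eq_intros d)
      show "((\<lambda>x. x\<^sup>2 / 2) has_vector_derivative x) (at x)" for x :: real
        by (auto intro!: derivative_eq_intros simp flip: has_real_derivative_iff_has_vector_derivative)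
      show "norm (\<i> * cis x - \<i>) \<le> x" if "0 < x" for x
      proof -
        have "norm (\<i> * cis x - \<i>) = norm (\<i> * (cis x - 1))" by (simp add: algebra_simps)
        then show ?thesis using 1[OF that] by (simp add: norm_mult)
      qed
    qed (auto intro!: continuous_intros)
    moreover have "(cis a - \<i> * of_real a) - (cis 0 - \<i> * of_real 0) = cis a - 1 - \<i> * of_real a" by simp
    moreover have "a\<^sup>2 / 2 - 0\<^sup>2 / 2 \<le> a\<^sup>2" by simp
    ultimately show ?thesis by (metis order_trans)
  qed
  have c1: "norm (cis (- a) - 1) = norm (cis a - 1)" for a
    using complex_mod_cnj[of "cis a - 1"] by (simp add: cis_cnj)
  have c2: "norm (cis (- a) - 1 - \<i> * of_real (- a)) = norm (cis a - 1 - \<i> * of_real a)" for a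
    using complex_mod_cnj[of "cis a - 1 - \<i> * of_real a"] by (simp add: cis_cnj)
  show "norm (cis a - 1) \<le> \<bar>a\<bar>"
    using 1[of a] 1[of "- a"] c1[of a] by (cases "a = 0"; cases "a > 0") auto
  show "norm (cis a - 1 - \<i> * of_real a) \<le> a\<^sup>2"
    using 2[of a] 2[of "- a"] c2[of a] by (cases "a = 0"; cases "a > 0") auto
qed

text \<open>Moving the frequency in time amounts to a phase that depends on y only; its derivative
  in s brings down the factor \<i>ky that meets the transport term.\<close>

lemma wave_freq_shear: "wave (freq_shear s \<xi>) X = wave (freq_shear t \<xi>) X * cis (of_int (fst \<xi>) * (s - t) * fst (snd X))"
  unfolding wave_def freq_shear_def split_beta by (simp add: cis_mult algebra_simps)

lemma fst_freq_shear [simp]: "fst (freq_shear t \<xi>) = fst \<xi>"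
  by (simp add: freq_shear_def split_beta)

lemma lfourier_const: "lfourier b [:c:] f \<xi> = c * lfourier b 1 f \<xi>"
proof -
  have "[:c:] = smult c 1" by simp
  then show ?thesis by (simp only: lfourier_smult_poly)
qed

lemma lfourier_x_weak_deriv:
  assumes "bump b" "f \<in> L2_space" "h \<in> L2_space" "has_weak_deriv f (1, 0, 0) h"
  shows "lfourier b 1 h \<xi> = \<i> * of_int (fst \<xi>) * lfourier b 1 f \<xi>"
  using weak_deriv_lfourier[OF assms, of 1 \<xi>]
  by (cases \<xi>) (simp add: order_of_def bump_wave_symbol_def lfourier_const)

lemma norm_integral_le:
  fixes F :: "'a \<Rightarrow> complex"
  assumes "integrable M F" "integrable M h" "\<And>x. norm (F x) \<le> h x"
  shows "norm (\<integral>x. F x \<partial>M) \<le> (\<integral>x. h x \<partial>M)"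
proof -
  have "norm (\<integral>x. F x \<partial>M) \<le> (\<integral>x. norm (F x) \<partial>M)" by (rule integral_norm_bound)
  also have "\<dots> \<le> (\<integral>x. h x \<partial>M)" by (rule integral_mono[OF integrable_norm[OF assms(1)] assms(2)]) (rule assms(3))
  finally show ?thesis .
qed

text \<open>In the sheared frequencies \<open>freq_shear s \<xi>\<close> the transport term \<open>y \<partial>\<^sub>x\<close> cancels.\<close>

lemma transport_lfourier:
  fixes f :: "real \<Rightarrow> scalar_field"
  assumes b: "bump b" and t: "0 \<le> t" and f: "\<And>s. 0 \<le> s \<Longrightarrow> f s \<in> L2_space"
    and wx: "wx \<in> L2_space" "has_weak_deriv (f t) (1, 0, 0) wx" and r: "r \<in> L2_space"
    and td: "has_time_deriv f (\<lambda>(x, y, z). - y * wx (x, y, z) + r (x, y, z)) t"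
  shows "((\<lambda>s. lfourier b 1 (f s) (freq_shear s \<xi>)) has_vector_derivative lfourier b 1 r (freq_shear t \<xi>)) (at t within {0..})"
proof -
  define k :: real where "k = of_int (fst \<xi>)"
  define yy :: "point \<Rightarrow> real" where "yy X = fst (snd X)" for X
  define g where "g X = - yy X * wx X + r X" for X
  define e where "e s = wave (freq_shear s \<xi>)" for s
  \<comment> \<open>The bump y b(y) with its derivatives absorbs the unbounded factor y, both in the
    transport term and in the time derivative of the wave.\<close>
  define c where "c = (\<lambda>j y. y * b j y + real j * b (j - 1) y)"
  have cb: "bump c" unfolding c_def by (rule bump_mult_y[OF b])
  obtain R where R: "R > 0" "\<And>j y. \<bar>y\<bar> > R \<Longrightarrow> b j y = 0" using bump_supp[OF b] by blast
  define b0 where "b0 X = b 0 (yy X)" for X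
  note sf = L2_space_sqint[OF f] and swx = L2_space_sqint[OF wx(1)] and sr = L2_space_sqint[OF r]
  have [measurable]: "yy \<in> borel_measurable borel"
    unfolding yy_def[abs_def] by (intro borel_measurable_continuous_onI continuous_intros)
  have b0c: "continuous_on UNIV b0"
    unfolding b0_def[abs_def] yy_def by (rule continuous_on_compose2[OF bump_cont[OF b, of UNIV]]) (auto intro!: continuous_intros)
  have b0s: "y_supp R b0" using R by (simp add: y_supp_def b0_def yy_def)
  have [measurable]: "b0 \<in> borel_measurable borel" by (rule borel_measurable_continuous_onI[OF b0c])
  have sb0: "sqint cell_meas b0" by (rule sqint_cont_supp[OF b0c b0s])
  have [measurable]: "wx \<in> borel_measurable borel" "r \<in> borel_measurable borel" using wx r by (auto dest: L2_space_measurable)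
  have fm: "f s \<in> borel_measurable borel" if "0 \<le> s" for s using f[OF that] by (rule L2_space_measurable)
  have [measurable]: "g \<in> borel_measurable borel" unfolding g_def[abs_def] by measurable
  have [measurable]: "e s \<in> borel_measurable borel" for s unfolding e_def by measurable
  have mb: "modulate b 1 h X = of_real (h X) * of_real (b0 X)" for h X
    by (simp add: modulate_def bump_comb_one b0_def yy_def)
  have mc: "modulate c 1 h X = of_real (h X) * of_real (yy X * b0 X)" for h X
    by (simp add: modulate_def bump_comb_one b0_def yy_def c_def)
  define gb where "gb X = complex_of_real (g X) * of_real (b0 X)" for X
  have gb: "gb = (\<lambda>X. modulate b 1 r X - modulate c 1 wx X)"
    unfolding gb_def g_def mb mc by (rule ext) (simp add: algebra_simps)
  have igb: "integrable cell_meas gb"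
    unfolding gb by (intro Bochner_Integration.integrable_diff integrable_modulate b cb sr swx)
  have ift: "integrable cell_meas (modulate b 1 (f t))" by (rule integrable_modulate[OF b sf[OF t]])
  have b0y: "\<bar>b0 X\<bar> * \<bar>yy X\<bar> \<le> R * \<bar>b0 X\<bar>" for X
    using R(2)[of "yy X" 0] by (cases "\<bar>yy X\<bar> > R") (auto simp: b0_def mult.commute[of R] intro!: mult_left_mono)
  \<comment> \<open>Two contributions to the derivative: the equation tested with the wave frozen at
    time t, and the factor \<i>ky from the moving wave. Since the coefficient of \<open>wx\<close>
    is \<i>k times that of \<open>f t\<close>, the terms with y cancel and only \<open>r\<close> is
    left.\<close>
  define L where "L = (\<integral>X. gb X * e t X \<partial>cell_meas) + \<i> * k * lfourier c 1 (f t) (freq_shear t \<xi>)"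
  have iwt: "integrable cell_meas (\<lambda>X. F X * e s X)" if "integrable cell_meas F" for F s
    by (rule integrable_bounded_mult_left[OF that, where C=1]) (simp_all add: e_def)
  have L: "L = lfourier b 1 r (freq_shear t \<xi>)"
  proof -
    have "(\<integral>X. gb X * e t X \<partial>cell_meas) = lfourier b 1 r (freq_shear t \<xi>) - lfourier c 1 wx (freq_shear t \<xi>)"
      unfolding gb left_diff_distrib lfourier_def fourier_def e_def[symmetric]
      by (intro Bochner_Integration.integral_diff iwt integrable_modulate b cb sr swx)
    then show ?thesis unfolding L_def lfourier_x_weak_deriv[OF cb f[OF t] wx] by (simp add: k_def)
  qed
  \<comment> \<open>Restriction to the strip that carries the bump. There y is bounded, so
    \<open>D s\<close> is square integrable, and \<open>has_time_deriv\<close> makes it tend to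
    0.\<close>
  define chi where "chi X = (indicator {X. \<bar>yy X\<bar> \<le> R} X :: real)" for X
  have [measurable]: "chi \<in> borel_measurable borel" unfolding chi_def[abs_def] by measurable
  define D where "D s X = chi X * ((f s X - f t X) / (s - t) - g X)" for s X
  have sD: "sqint cell_meas (D s)" if "0 \<le> s" for s
  proof -
    have bd: "sqint cell_meas (\<lambda>X. h X * w X)" if "sqint cell_meas w" "h \<in> borel_measurable borel" "\<And>X. \<bar>h X\<bar> \<le> C" for h w :: "point \<Rightarrow> real" and C
      by (rule sqint_bound[OF that(1), where C=C])
         (use that sqint_measurable[OF that(1)] in \<open>auto simp: abs_mult intro!: mult_right_mono\<close>)
    have "sqint cell_meas (\<lambda>X. (1 / (s - t)) *\<^sub>R (chi X * (f s X - f t X)) + ((chi X * yy X) * wx X - chi X * r X))"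
      by (intro sqint_add sqint_diff sqint_scaleR bd[where C=1] bd[where C=R] sf that t swx sr)
         (auto simp: chi_def indicator_def less_imp_le[OF R(1)])
    then show ?thesis
      by (simp add: D_def[abs_def] g_def algebra_simps diff_divide_distrib)
  qed
  have lD: "((\<lambda>s. l2n cell_meas (D s)) \<longlongrightarrow> 0) (at t within {0..})"
  proof -
    have "(LINT X:(cell \<inter> {(x, y, z). \<bar>y\<bar> \<le> R})|lborel. ((f s X - f t X) / (s - t) - g X)\<^sup>2) = (\<integral>X. (norm (D s X))\<^sup>2 \<partial>cell_meas)" if "0 \<le> s" for s
    proof -
      have [measurable]: "f s \<in> borel_measurable borel" "f t \<in> borel_measurable borel" using fm that t by auto
      have "(\<lambda>X. (norm (D s X))\<^sup>2) \<in> borel_measurable borel" unfolding D_def[abs_def] by measurable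
      then have "(\<integral>X. (norm (D s X))\<^sup>2 \<partial>cell_meas) = (\<integral>X. indicator cell X *\<^sub>R (norm (D s X))\<^sup>2 \<partial>lborel)"
        unfolding cell_meas_def by (intro integral_density_indicator) auto
      also have "\<dots> = (LINT X:(cell \<inter> {(x, y, z). \<bar>y\<bar> \<le> R})|lborel. ((f s X - f t X) / (s - t) - g X)\<^sup>2)"
        unfolding set_lebesgue_integral_def
        by (intro Bochner_Integration.integral_cong refl) (auto simp: D_def chi_def yy_def indicator_def split: if_splits)
      finally show ?thesis ..
    qed
    moreover have "((\<lambda>s. LINT X:(cell \<inter> {(x, y, z). \<bar>y\<bar> \<le> R})|lborel. ((f s X - f t X) / (s - t) - g X)\<^sup>2) \<longlongrightarrow> 0) (at t within {0..})"
    proof -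
      have "g = (\<lambda>(x, y, z). - y * wx (x, y, z) + r (x, y, z))" by (auto simp: g_def yy_def)
      then show ?thesis using td unfolding has_time_deriv_def by (simp only:)
    qed
    ultimately have "((\<lambda>s. \<integral>X. (norm (D s X))\<^sup>2 \<partial>cell_meas) \<longlongrightarrow> 0) (at t within {0..})"
      by (rule_tac Lim_transform_eventually) (auto simp: eventually_at_filter)
    then have "((\<lambda>s. sqrt (\<integral>X. (norm (D s X))\<^sup>2 \<partial>cell_meas)) \<longlongrightarrow> sqrt 0) (at t within {0..})" by (rule tendsto_real_sqrt)
    then show ?thesis by (simp add: l2n_def)
  qed
  let ?H = "\<lambda>s. lfourier b 1 (f s) (freq_shear s \<xi>)"
  define c2 where "c2 = \<bar>k\<bar> * R * (\<integral>X. norm (gb X) \<partial>cell_meas) + k\<^sup>2 * R\<^sup>2 * (\<integral>X. norm (modulate b 1 (f t) X) \<partial>cell_meas)"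
  have key: "norm (?H s - ?H t - of_real (s - t) * L) \<le> \<bar>s - t\<bar> * (l2n cell_meas (D s) * l2n cell_meas b0 + c2 * \<bar>s - t\<bar>)"
    if s: "0 \<le> s" "s \<noteq> t" for s
  proof -
    \<comment> \<open>Three errors: \<open>T1\<close> is the difference quotient against its limit,
      \<open>T2\<close> the motion of the wave tested with the time derivative, \<open>T3\<close>
      the Taylor remainder of the wave tested with \<open>f t\<close>. With the prefactor s - t the
      contributions of \<open>T2\<close> and \<open>T3\<close> are of second order.\<close>
    define T1 where "T1 X = complex_of_real (D s X * b0 X) * e s X" for X
    define T2 where "T2 X = gb X * e s X - gb X * e t X" for X
    define T3 where "T3 X = modulate b 1 (f t) X * e s X - modulate b 1 (f t) X * e t X - of_real (s - t) * (\<i> * k * (modulate c 1 (f t) X * e t X))" for X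
    have es: "e s X = e t X * cis (k * (s - t) * yy X)" for X unfolding e_def k_def yy_def by (rule wave_freq_shear)
    have iT1: "integrable cell_meas T1"
    proof -
      have "integrable cell_meas (\<lambda>X. complex_of_real (D s X * b0 X))"
        using integrable_mult_sqint'[OF sD[OF s(1)] sb0] by (rule integrable_of_real)
      then show ?thesis unfolding T1_def[abs_def] by (rule iwt)
    qed
    have iT2: "integrable cell_meas T2" unfolding T2_def[abs_def] by (intro Bochner_Integration.integrable_diff iwt igb)
    have iT3: "integrable cell_meas T3" unfolding T3_def[abs_def]
      by (intro Bochner_Integration.integrable_diff integrable_mult_right iwt integrable_modulate b cb sf t)
    have chib: "D s X * b0 X = ((f s X - f t X) / (s - t) - g X) * b0 X" for X
      using R(2)[of "yy X" 0] by (auto simp: D_def chi_def b0_def indicator_def)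
    have stD: "of_real (s - t) * complex_of_real (D s X * b0 X) = complex_of_real ((f s X - f t X - (s - t) * g X) * b0 X)" for X
      unfolding chib of_real_mult[symmetric] using s(2) by (intro arg_cong[where f=complex_of_real]) (simp add: field_simps)
    have pw: "modulate b 1 (f s) X * e s X - modulate b 1 (f t) X * e t X = of_real (s - t) * T1 X + of_real (s - t) * T2 X + T3 X
        + of_real (s - t) * (gb X * e t X + \<i> * k * (modulate c 1 (f t) X * e t X))" for X
    proof -
      have "of_real (s - t) * T1 X = complex_of_real ((f s X - f t X - (s - t) * g X) * b0 X) * e s X"
        unfolding T1_def mult.assoc[symmetric] stD ..
      then show ?thesis unfolding T2_def T3_def gb_def mb by (simp add: algebra_simps)
    qed
    have "?H s - ?H t = (\<integral>X. modulate b 1 (f s) X * e s X - modulate b 1 (f t) X * e t X \<partial>cell_meas)"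
      unfolding lfourier_def fourier_def e_def[symmetric]
      by (intro Bochner_Integration.integral_diff[symmetric] iwt integrable_modulate b sf s t)
    also have "\<dots> = of_real (s - t) * (\<integral>X. T1 X \<partial>cell_meas) + of_real (s - t) * (\<integral>X. T2 X \<partial>cell_meas) + (\<integral>X. T3 X \<partial>cell_meas)
        + of_real (s - t) * (\<integral>X. gb X * e t X + \<i> * k * (modulate c 1 (f t) X * e t X) \<partial>cell_meas)"
    proof -
      have i4: "integrable cell_meas (\<lambda>X. gb X * e t X + \<i> * k * (modulate c 1 (f t) X * e t X))"
        by (intro Bochner_Integration.integrable_add integrable_mult_right iwt igb integrable_modulate cb sf t)
      show ?thesis unfolding pw
        by (subst Bochner_Integration.integral_add, intro Bochner_Integration.integrable_add integrable_mult_right iT1 iT2 iT3,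
            intro integrable_mult_right i4, subst Bochner_Integration.integral_add, intro Bochner_Integration.integrable_add integrable_mult_right iT1 iT2,
            rule iT3, subst Bochner_Integration.integral_add, intro integrable_mult_right iT1, intro integrable_mult_right iT2) (simp only: integral_mult_right_zero)
    qed
    also have "(\<integral>X. gb X * e t X + \<i> * k * (modulate c 1 (f t) X * e t X) \<partial>cell_meas) = L"
      unfolding L_def lfourier_def fourier_def e_def[symmetric]
      by (subst Bochner_Integration.integral_add) (auto intro!: iwt igb integrable_mult_right integrable_modulate cb sf t)
    finally have "?H s - ?H t - of_real (s - t) * L = of_real (s - t) * (\<integral>X. T1 X \<partial>cell_meas) + of_real (s - t) * (\<integral>X. T2 X \<partial>cell_meas) + (\<integral>X. T3 X \<partial>cell_meas)"
      by simp
    then have "norm (?H s - ?H t - of_real (s - t) * L) \<le> norm (of_real (s - t) * (\<integral>X. T1 X \<partial>cell_meas)) + norm (of_real (s - t) * (\<integral>X. T2 X \<partial>cell_meas)) + norm (\<integral>X. T3 X \<partial>cell_meas)"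
      by (metis (no_types, lifting) add_mono norm_triangle_ineq order_refl order_trans)
    also have "\<dots> \<le> \<bar>s - t\<bar> * (l2n cell_meas (D s) * l2n cell_meas b0) + \<bar>s - t\<bar> * (\<bar>k\<bar> * R * \<bar>s - t\<bar> * (\<integral>X. norm (gb X) \<partial>cell_meas))
        + k\<^sup>2 * R\<^sup>2 * (s - t)\<^sup>2 * (\<integral>X. norm (modulate b 1 (f t) X) \<partial>cell_meas)"
    proof (intro add_mono)
      have "norm (\<integral>X. T1 X \<partial>cell_meas) \<le> (\<integral>X. norm (D s X) * norm (b0 X) \<partial>cell_meas)"
        by (rule norm_integral_le[OF iT1 integrable_mult_sqint[OF sD[OF s(1)] sb0]]) (simp add: T1_def e_def norm_mult)
      also have "\<dots> \<le> l2n cell_meas (D s) * l2n cell_meas b0" by (rule cauchy_schwarz_l2n[OF sD[OF s(1)] sb0])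
      finally show "norm (of_real (s - t) * (\<integral>X. T1 X \<partial>cell_meas)) \<le> \<bar>s - t\<bar> * (l2n cell_meas (D s) * l2n cell_meas b0)"
        unfolding norm_mult norm_of_real by (rule mult_left_mono) simp
      have "norm (\<integral>X. T2 X \<partial>cell_meas) \<le> (\<integral>X. \<bar>k\<bar> * R * \<bar>s - t\<bar> * norm (gb X) \<partial>cell_meas)"
      proof (rule norm_integral_le[OF iT2 integrable_mult_right[OF integrable_norm[OF igb]]])
        fix X
        have "T2 X = gb X * (e t X * (cis (k * (s - t) * yy X) - 1))" unfolding T2_def es by (simp add: algebra_simps)
        then have "norm (T2 X) = norm (gb X) * norm (cis (k * (s - t) * yy X) - 1)" by (simp add: norm_mult e_def)
        also have "\<dots> \<le> norm (gb X) * \<bar>k * (s - t) * yy X\<bar>" by (intro mult_left_mono norm_cis_minus_1_le) simp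
        also have "\<dots> = \<bar>g X\<bar> * (\<bar>k\<bar> * \<bar>s - t\<bar>) * (\<bar>b0 X\<bar> * \<bar>yy X\<bar>)" by (simp add: gb_def norm_mult abs_mult)
        also have "\<dots> \<le> \<bar>g X\<bar> * (\<bar>k\<bar> * \<bar>s - t\<bar>) * (R * \<bar>b0 X\<bar>)" by (intro mult_left_mono b0y) auto
        also have "\<dots> = \<bar>k\<bar> * R * \<bar>s - t\<bar> * norm (gb X)" by (simp add: gb_def norm_mult)
        finally show "norm (T2 X) \<le> \<bar>k\<bar> * R * \<bar>s - t\<bar> * norm (gb X)" .
      qed
      then have "norm (\<integral>X. T2 X \<partial>cell_meas) \<le> \<bar>k\<bar> * R * \<bar>s - t\<bar> * (\<integral>X. norm (gb X) \<partial>cell_meas)" by simp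
      then show "norm (of_real (s - t) * (\<integral>X. T2 X \<partial>cell_meas)) \<le> \<bar>s - t\<bar> * (\<bar>k\<bar> * R * \<bar>s - t\<bar> * (\<integral>X. norm (gb X) \<partial>cell_meas))"
        unfolding norm_mult norm_of_real by (rule mult_left_mono) simp
      have "norm (\<integral>X. T3 X \<partial>cell_meas) \<le> (\<integral>X. k\<^sup>2 * R\<^sup>2 * (s - t)\<^sup>2 * norm (modulate b 1 (f t) X) \<partial>cell_meas)"
      proof (rule norm_integral_le[OF iT3 integrable_mult_right[OF integrable_norm[OF ift]]])
        fix X
        have "T3 X = modulate b 1 (f t) X * (e t X * (cis (k * (s - t) * yy X) - 1 - \<i> * of_real (k * (s - t) * yy X)))"
          unfolding T3_def es mc mb by (simp add: algebra_simps)
        then have "norm (T3 X) = norm (modulate b 1 (f t) X) * norm (cis (k * (s - t) * yy X) - 1 - \<i> * of_real (k * (s - t) * yy X))"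
          by (simp only: norm_mult e_def norm_wave mult_1)
        also have "\<dots> \<le> norm (modulate b 1 (f t) X) * (k * (s - t) * yy X)\<^sup>2" by (intro mult_left_mono norm_cis_taylor_le) simp
        also have "\<dots> \<le> norm (modulate b 1 (f t) X) * (k\<^sup>2 * R\<^sup>2 * (s - t)\<^sup>2)"
        proof (cases "\<bar>yy X\<bar> > R")
          case True
          then show ?thesis using R(2)[of "yy X" 0] by (simp add: mb b0_def)
        next
          case False
          then have "\<bar>yy X\<bar>\<^sup>2 \<le> R\<^sup>2" by (intro power_mono) auto
          then have "(k * (s - t))\<^sup>2 * (yy X)\<^sup>2 \<le> (k * (s - t))\<^sup>2 * R\<^sup>2" by (intro mult_left_mono) auto
          then have "(k * (s - t) * yy X)\<^sup>2 \<le> k\<^sup>2 * R\<^sup>2 * (s - t)\<^sup>2" unfolding power_mult_distrib by (simp only: mult_ac)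
          then show ?thesis by (rule mult_left_mono) simp
        qed
        finally show "norm (T3 X) \<le> k\<^sup>2 * R\<^sup>2 * (s - t)\<^sup>2 * norm (modulate b 1 (f t) X)" by (simp only: mult_ac)
      qed
      then show "norm (\<integral>X. T3 X \<partial>cell_meas) \<le> k\<^sup>2 * R\<^sup>2 * (s - t)\<^sup>2 * (\<integral>X. norm (modulate b 1 (f t) X) \<partial>cell_meas)" by simp
    qed
    also have "\<dots> = \<bar>s - t\<bar> * (l2n cell_meas (D s) * l2n cell_meas b0 + c2 * \<bar>s - t\<bar>)"
    proof -
      have "(s - t)\<^sup>2 = \<bar>s - t\<bar> * \<bar>s - t\<bar>" by (simp add: power2_eq_square)
      then show ?thesis unfolding c2_def by (simp only: algebra_simps)
    qed
    finally show ?thesis .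
  qed
  have "((\<lambda>s. (1 / norm (s - t)) *\<^sub>R (?H s - (?H t + (s - t) *\<^sub>R L))) \<longlongrightarrow> 0) (at t within {0..})"
  proof (rule Lim_null_comparison)
    show "\<forall>\<^sub>F s in at t within {0..}. norm ((1 / norm (s - t)) *\<^sub>R (?H s - (?H t + (s - t) *\<^sub>R L))) \<le> l2n cell_meas (D s) * l2n cell_meas b0 + c2 * \<bar>s - t\<bar>"
      unfolding eventually_at_filter
    proof (rule always_eventually, intro allI impI)
      fix s assume s: "s \<noteq> t" "s \<in> {0..}"
      have "norm ((1 / norm (s - t)) *\<^sub>R (?H s - (?H t + (s - t) *\<^sub>R L))) = norm (?H s - ?H t - of_real (s - t) * L) / \<bar>s - t\<bar>"
        by (simp add: scaleR_conv_of_real diff_diff_add norm_divide)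
      also have "\<dots> \<le> (\<bar>s - t\<bar> * (l2n cell_meas (D s) * l2n cell_meas b0 + c2 * \<bar>s - t\<bar>)) / \<bar>s - t\<bar>"
        by (intro divide_right_mono key) (use s in auto)
      also have "\<dots> = l2n cell_meas (D s) * l2n cell_meas b0 + c2 * \<bar>s - t\<bar>" using s by simp
      finally show "norm ((1 / norm (s - t)) *\<^sub>R (?H s - (?H t + (s - t) *\<^sub>R L))) \<le> l2n cell_meas (D s) * l2n cell_meas b0 + c2 * \<bar>s - t\<bar>" .
    qed
    have "((\<lambda>s. l2n cell_meas (D s) * l2n cell_meas b0 + c2 * \<bar>s - t\<bar>) \<longlongrightarrow> 0 * l2n cell_meas b0 + c2 * \<bar>t - t\<bar>) (at t within {0..})"
      by (intro tendsto_intros lD)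
    then show "((\<lambda>s. l2n cell_meas (D s) * l2n cell_meas b0 + c2 * \<bar>s - t\<bar>) \<longlongrightarrow> 0) (at t within {0..})" by simp
  qed
  then show ?thesis
    unfolding has_vector_derivative_def has_derivative_within L[symmetric] by (auto intro: bounded_linear_scaleR_left)
qed

section \<open>The linearized Euler equations in Fourier variables\<close>

lemma AE_cell_of_lborel: "AE X in lborel. P X \<Longrightarrow> AE X in cell_meas. P X"
  unfolding cell_meas_def by (subst AE_density) (auto elim: eventually_mono)

lemma lfourier_linear_poly:
  assumes "bump b" "sqint cell_meas f"
  shows "lfourier b [:c, 1:] f \<xi> = c * lfourier b 1 f \<xi> + lfourier (\<lambda>i. b (i + 1)) 1 f \<xi>"
  using lfourier_expand[OF assms, of "[:c, 1:]" 1 \<xi>] by simp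

lemma lfourier_quad_poly:
  assumes "bump b" "sqint cell_meas f"
  shows "lfourier b ([:c, 1:] ^ 2) f \<xi> = c\<^sup>2 * lfourier b 1 f \<xi> + 2 * c * lfourier (\<lambda>i. b (i + 1)) 1 f \<xi> + lfourier (\<lambda>i. b (i + 2)) 1 f \<xi>"
proof -
  have e: "[:c, 1:] ^ 2 = [:c\<^sup>2, 2 * c, 1:]" by (simp add: power2_eq_square)
  show ?thesis unfolding e using lfourier_expand[OF assms, of "[:c\<^sup>2, 2 * c, 1:]" 2 \<xi>]
    by (simp add: numeral_2_eq_2)
qed

text \<open>Integration by parts. A derivative in x passes through the bump, whereas a derivative in
  y also falls on it, whence the term with the next bump derivative.\<close>

lemma lfourier_unit_deriv:
  assumes b: "bump b" and f: "f \<in> sobolev m" "1 \<le> m"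
  shows "lfourier b 1 (weak_deriv (1, 0, 0) f) \<xi> = \<i> * of_int (fst \<xi>) * lfourier b 1 f \<xi>"
    and "lfourier b 1 (weak_deriv (0, 1, 0) f) \<xi> = \<i> * of_real (fst (snd \<xi>)) * lfourier b 1 f \<xi> - lfourier (\<lambda>i. b (i + 1)) 1 f \<xi>"
proof -
  note f' = sobolev_L2[OF f(1)]
  have o: "order_of (1, 0, 0) \<le> m" "order_of (0, 1, 0) \<le> m" using f(2) by (auto simp: order_of_def)
  note w = weak_deriv_sobolev[OF f(1)]
  show "lfourier b 1 (weak_deriv (1, 0, 0) f) \<xi> = \<i> * of_int (fst \<xi>) * lfourier b 1 f \<xi>"
    by (rule lfourier_x_weak_deriv[OF b f' w[OF o(1)]])
  have "lfourier b 1 (weak_deriv (0, 1, 0) f) \<xi> = - lfourier b [:- (\<i> * of_real (fst (snd \<xi>))), 1:] f \<xi>"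
    using weak_deriv_lfourier[OF b f' w[OF o(2)], of 1 \<xi>] by (cases \<xi>) (simp add: order_of_def bump_wave_symbol_def one_pCons)
  then show "lfourier b 1 (weak_deriv (0, 1, 0) f) \<xi> = \<i> * of_real (fst (snd \<xi>)) * lfourier b 1 f \<xi> - lfourier (\<lambda>i. b (i + 1)) 1 f \<xi>"
    unfolding lfourier_linear_poly[OF b L2_space_sqint[OF f']] by simp
qed

definition laplace :: "scalar_field \<Rightarrow> scalar_field" where
  "laplace f X = weak_deriv (2, 0, 0) f X + weak_deriv (0, 2, 0) f X + weak_deriv (0, 0, 2) f X"

lemma laplace_L2:
  assumes "f \<in> sobolev m" "2 \<le> m"
  shows "laplace f \<in> L2_space"
proof -
  have "weak_deriv (2, 0, 0) f \<in> L2_space" "weak_deriv (0, 2, 0) f \<in> L2_space" "weak_deriv (0, 0, 2) f \<in> L2_space"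
    by (rule weak_deriv_sobolev(1)[OF assms(1)]; use assms(2) in \<open>simp add: order_of_def\<close>)+
  then show ?thesis unfolding L2_space_iff laplace_def[abs_def]
    by (auto intro!: sqint_add simp: periodic_xz_def)
qed

text \<open>The multiplier -|\<xi>|^2, corrected by the commutator of the second derivative in y
  with the bump: one term with the first and one with the second bump derivative.\<close>

lemma lfourier_laplace:
  assumes b: "bump b" and f: "f \<in> sobolev m" "2 \<le> m"
  shows "lfourier b 1 (laplace f) \<xi> = - (of_real ((of_int (fst \<xi>))\<^sup>2 + (fst (snd \<xi>))\<^sup>2 + (of_int (snd (snd \<xi>)))\<^sup>2)) * lfourier b 1 f \<xi>
     - 2 * \<i> * of_real (fst (snd \<xi>)) * lfourier (\<lambda>i. b (i + 1)) 1 f \<xi> + lfourier (\<lambda>i. b (i + 2)) 1 f \<xi>"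
proof -
  obtain k \<eta> l where \<xi>: "\<xi> = (k, \<eta>, l)" by (cases \<xi>)
  note f' = sobolev_L2[OF f(1)]
  have o: "order_of (2, 0, 0) \<le> m" "order_of (0, 2, 0) \<le> m" "order_of (0, 0, 2) \<le> m"
    using f(2) by (auto simp: order_of_def)
  note w = weak_deriv_sobolev[OF f(1)]
  note s = L2_space_sqint[OF w(1)[OF o(1)]] L2_space_sqint[OF w(1)[OF o(2)]] L2_space_sqint[OF w(1)[OF o(3)]]
  have "lfourier b 1 (laplace f) \<xi> = lfourier b 1 (weak_deriv (2, 0, 0) f) \<xi> + lfourier b 1 (weak_deriv (0, 2, 0) f) \<xi> + lfourier b 1 (weak_deriv (0, 0, 2) f) \<xi>"
    unfolding laplace_def[abs_def] using lfourier_add[OF b sqint_add[OF s(1,2)] s(3)] lfourier_add[OF b s(1,2)] by simp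
  moreover have "lfourier b 1 (weak_deriv (2, 0, 0) f) \<xi> = (\<i> * of_int k)\<^sup>2 * lfourier b 1 f \<xi>"
    using weak_deriv_lfourier[OF b f' w[OF o(1)], of 1 \<xi>] by (simp add: order_of_def bump_wave_symbol_def \<xi> lfourier_const)
  moreover have "lfourier b 1 (weak_deriv (0, 0, 2) f) \<xi> = (\<i> * of_int l)\<^sup>2 * lfourier b 1 f \<xi>"
    using weak_deriv_lfourier[OF b f' w[OF o(3)], of 1 \<xi>] by (simp add: order_of_def bump_wave_symbol_def \<xi> lfourier_const)
  moreover have "lfourier b 1 (weak_deriv (0, 2, 0) f) \<xi> = lfourier b ([:- (\<i> * of_real \<eta>), 1:] ^ 2) f \<xi>"
    using weak_deriv_lfourier[OF b f' w[OF o(2)], of 1 \<xi>] by (simp add: order_of_def bump_wave_symbol_def \<xi>)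
  ultimately show ?thesis
    unfolding lfourier_quad_poly[OF b L2_space_sqint[OF f']] \<xi> by (simp add: power_mult_distrib algebra_simps)
qed

definition nsq :: "frequency \<Rightarrow> real" where
  "nsq \<xi> = (of_int (fst \<xi>))\<^sup>2 + (fst (snd \<xi>))\<^sup>2 + (of_int (snd (snd \<xi>)))\<^sup>2"

lemma hat_laplace:
  assumes f: "f \<in> sobolev m" "2 \<le> m" and F: "is_hat f F"
  shows "is_hat (laplace f) (\<lambda>\<xi>. - of_real (nsq \<xi>) * F \<xi>)"
proof -
  have o: "order_of (2, 0, 0) \<le> m" "order_of (0, 2, 0) \<le> m" "order_of (0, 0, 2) \<le> m"
    using f(2) by (auto simp: order_of_def)
  note h = hat_weak_deriv_sobolev[OF f(1) _ F]
  note s = L2_space_sqint[OF weak_deriv_sobolev(1)[OF f(1) o(1)]] L2_space_sqint[OF weak_deriv_sobolev(1)[OF f(1) o(2)]]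
    L2_space_sqint[OF weak_deriv_sobolev(1)[OF f(1) o(3)]]
  have "is_hat (laplace f) (\<lambda>\<xi>. symbol (2, 0, 0) \<xi> * F \<xi> + symbol (0, 2, 0) \<xi> * F \<xi> + symbol (0, 0, 2) \<xi> * F \<xi>)"
    unfolding laplace_def[abs_def]
    by (intro hat_add sqint_add h[OF o(1)] h[OF o(2)] h[OF o(3)] s)
  moreover have "(\<lambda>\<xi>. symbol (2, 0, 0) \<xi> * F \<xi> + symbol (0, 2, 0) \<xi> * F \<xi> + symbol (0, 0, 2) \<xi> * F \<xi>) = (\<lambda>\<xi>. - of_real (nsq \<xi>) * F \<xi>)"
    by (auto simp: symbol_def nsq_def power_mult_distrib algebra_simps)
  ultimately show ?thesis by simp
qed

locale linear_euler =
  fixes u_in :: vector_field and u :: "real \<Rightarrow> vector_field" and p :: "real \<Rightarrow> scalar_field"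
  assumes in_sobolev: "u_in \<in> sobolev_vec 7" and sol: "linearized_euler_solution u_in u p"
begin

abbreviation uc :: "3 \<Rightarrow> real \<Rightarrow> scalar_field" where
  "uc i t \<equiv> component (u t) i"

lemma u_sobolev: "0 \<le> t \<Longrightarrow> uc i t \<in> sobolev 7"
  using sol unfolding linearized_euler_solution_def sobolev_vec_def by blast

lemma p_sobolev: "0 \<le> t \<Longrightarrow> p t \<in> sobolev 2"
  using sol unfolding linearized_euler_solution_def by blast

lemma u_L2: "0 \<le> t \<Longrightarrow> uc i t \<in> L2_space"
  using u_sobolev sobolev_L2 by blast

lemma p_L2: "0 \<le> t \<Longrightarrow> p t \<in> L2_space"
  using p_sobolev sobolev_L2 by blast

lemma dp_L2: "0 \<le> t \<Longrightarrow> weak_deriv (unit_index i) (p t) \<in> L2_space"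
  by (rule weak_deriv_sobolev(1)[OF p_sobolev]) (auto simp: order_of_def unit_index_def)

lemma initial_AE: "AE X in cell_meas. uc i 0 X = u_in X $ i"
proof -
  have "AE X in lborel. u 0 X = u_in X" using sol unfolding linearized_euler_solution_def by blast
  then have "AE X in cell_meas. u 0 X = u_in X" by (rule AE_cell_of_lborel)
  then show ?thesis by eventually_elim simp
qed

lemma u_in_sobolev: "component u_in i \<in> sobolev 7"
  using in_sobolev by (simp add: sobolev_vec_def)

lemma lfourier_initial: "bump b \<Longrightarrow> lfourier b q (uc i 0) \<xi> = lfourier b q (component u_in i) \<xi>"
  by (rule lfourier_cong_AE) (auto intro: initial_AE L2_space_measurable u_L2 sobolev_L2[OF u_in_sobolev])

text \<open>What drives a component once the transport term has been removed.\<close>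

definition force :: "3 \<Rightarrow> real \<Rightarrow> scalar_field" where
  "force i t X = - (if i = 1 then uc 2 t X else 0) - weak_deriv (unit_index i) (p t) X"

lemma force_L2: "0 \<le> t \<Longrightarrow> force i t \<in> L2_space"
  using u_L2[of t 2] dp_L2[of t i]
  unfolding L2_space_iff force_def[abs_def] periodic_xz_def
  by (cases "i = 1") (auto intro!: sqint_diff sqint_minus)

lemma ode_lfourier:
  assumes b: "bump b" and t: "0 \<le> t"
  shows "((\<lambda>s. lfourier b 1 (uc i s) (freq_shear s \<xi>)) has_vector_derivative lfourier b 1 (force i t) (freq_shear t \<xi>)) (at t within {0..})"
proof (rule transport_lfourier[OF b t u_L2 _ _ force_L2[OF t]])
  have o: "order_of (1, 0, 0) \<le> 7" by (simp add: order_of_def)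
  show "weak_deriv (1, 0, 0) (uc i t) \<in> L2_space" "has_weak_deriv (uc i t) (1, 0, 0) (weak_deriv (1, 0, 0) (uc i t))"
    using weak_deriv_sobolev[OF u_sobolev[OF t] o] by auto
  have "has_time_deriv (\<lambda>s. uc i s)
          (\<lambda>(x, y, z). - y * weak_deriv (unit_index 1) (uc i t) (x, y, z)
                       - (if i = 1 then u t (x, y, z) $ 2 else 0)
                       - weak_deriv (unit_index i) (p t) (x, y, z)) t"
    using sol t unfolding linearized_euler_solution_def by blast
  moreover have "(\<lambda>(x, y, z). - y * weak_deriv (unit_index 1) (uc i t) (x, y, z)
                       - (if i = 1 then u t (x, y, z) $ 2 else 0)
                       - weak_deriv (unit_index i) (p t) (x, y, z)) =
      (\<lambda>(x, y, z). - y * weak_deriv (1, 0, 0) (uc i t) (x, y, z) + force i t (x, y, z))"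
    by (auto simp: force_def unit_index_def)
  ultimately show "has_time_deriv (uc i) (\<lambda>(x, y, z). - y * weak_deriv (1, 0, 0) (uc i t) (x, y, z) + force i t (x, y, z)) t"
    by simp
qed

lemma poisson_AE:
  assumes "0 \<le> t"
  shows "AE X in cell_meas. laplace (p t) X = - 2 * weak_deriv (1, 0, 0) (uc 2 t) X"
proof -
  have "AE X in lborel. (\<Sum>i\<in>UNIV. weak_deriv (double_index i) (p t) X) = - 2 * weak_deriv (unit_index 1) (uc 2 t) X"
    using sol assms unfolding linearized_euler_solution_def by blast
  from AE_cell_of_lborel[OF this] show ?thesis
    by eventually_elim (simp add: sum_3 double_index_def unit_index_def laplace_def index3_neq)
qed

lemma du_L2: "0 \<le> t \<Longrightarrow> weak_deriv (1, 0, 0) (uc i t) \<in> L2_space"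
  by (rule weak_deriv_sobolev(1)[OF u_sobolev]) (auto simp: order_of_def)

lemma lfourier_poisson:
  assumes b: "bump b" and t: "0 \<le> t"
  shows "lfourier b 1 (laplace (p t)) \<xi> = - 2 * \<i> * of_int (fst \<xi>) * lfourier b 1 (uc 2 t) \<xi>"
proof -
  have "lfourier b 1 (laplace (p t)) \<xi> = lfourier b 1 (\<lambda>X. - 2 * weak_deriv (1, 0, 0) (uc 2 t) X) \<xi>"
    using L2_space_measurable[OF laplace_L2[OF p_sobolev[OF t]]] L2_space_measurable[OF du_L2[OF t]]
    by (intro lfourier_cong_AE[OF b _ _ poisson_AE[OF t]]) auto
  also have "\<dots> = - 2 * lfourier b 1 (weak_deriv (1, 0, 0) (uc 2 t)) \<xi>"
    using lfourier_cmult[of b 1 "- 2"] by simp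
  finally show ?thesis using lfourier_unit_deriv(1)[OF b u_sobolev[OF t, of 2], of \<xi>] by simp
qed

text \<open>In the moving frame the Laplacian of \<open>u\<^sup>2\<close> is conserved: the commutator of \<open>\<Delta>\<close> with \<open>y \<partial>\<^sub>x\<close>
  produces \<open>2 \<partial>\<^sub>x \<partial>\<^sub>y u\<^sup>2\<close>, which cancels \<open>- \<partial>\<^sub>y \<Delta> p\<close>.\<close>

lemma lfourier_laplace_conserved:
  assumes b: "bump b" and t: "0 \<le> t"
  shows "lfourier b 1 (laplace (uc 2 t)) (freq_shear t \<xi>) = lfourier b 1 (laplace (uc 2 0)) \<xi>"
proof -
  obtain k \<eta> l where \<xi>: "\<xi> = (k, \<eta>, l)" by (cases \<xi>)
  \<comment> \<open>Coefficients of u2 for the bump and its derivatives. The localised Laplacian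
    \<open>Q\<close> involves j = 0, 1, 2, so its time derivative involves pressure coefficients up
    to j = 3; these are tied together by the Poisson identities for j = 0 and j = 1.\<close>
  define g where "g j s = lfourier (\<lambda>i. b (i + j)) 1 (uc 2 s) (freq_shear s \<xi>)" for j :: nat and s
  define e where "e s = \<eta> - of_int k * s" for s
  define Q where "Q s = - (of_real ((of_int k)\<^sup>2 + (e s)\<^sup>2 + (of_int l)\<^sup>2)) * g 0 s - 2 * \<i> * of_real (e s) * g 1 s + g 2 s" for s
  have bj: "bump (\<lambda>i. b (i + j))" for j by (rule bump_shift[OF b])
  have Q: "lfourier b 1 (laplace (uc 2 s)) (freq_shear s \<xi>) = Q s" if "0 \<le> s" for s
    unfolding lfourier_laplace[OF b u_sobolev[OF that], of 2, simplified] Q_def g_def e_def \<xi> freq_shear_def by simp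
  have dz: "(Q has_vector_derivative 0) (at s within {0..})" if s: "0 \<le> s" for s
  proof -
    define P where "P j = lfourier (\<lambda>i. b (i + j)) 1 (p s) (freq_shear s \<xi>)" for j
    have dg: "(g j has_vector_derivative (P (j + 1) - \<i> * of_real (e s) * P j)) (at s within {0..})" for j
    proof -
      have "lfourier (\<lambda>i. b (i + j)) 1 (force 2 s) (freq_shear s \<xi>) = - lfourier (\<lambda>i. b (i + j)) 1 (weak_deriv (0, 1, 0) (p s)) (freq_shear s \<xi>)"
        using lfourier_cmult[of "\<lambda>i. b (i + j)" 1 "- 1" "weak_deriv (0, 1, 0) (p s)" "freq_shear s \<xi>"]
        by (simp add: force_def[abs_def] unit_index_def index3_neq)
      also have "\<dots> = P (j + 1) - \<i> * of_real (e s) * P j"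
        unfolding lfourier_unit_deriv(2)[OF bj p_sobolev[OF s] one_le_numeral] P_def e_def \<xi> freq_shear_def
        by (simp add: add.assoc add.commute[of 1])
      finally show ?thesis using ode_lfourier[OF bj s, of j 2 \<xi>] unfolding g_def[abs_def] by simp
    qed
    have po: "- (of_real ((of_int k)\<^sup>2 + (e s)\<^sup>2 + (of_int l)\<^sup>2)) * P j - 2 * \<i> * of_real (e s) * P (j + 1) + P (j + 2) = - 2 * \<i> * of_int k * g j s" for j
      using lfourier_poisson[OF bj s, of j "freq_shear s \<xi>"]
      unfolding lfourier_laplace[OF bj p_sobolev[OF s] order_refl] P_def g_def e_def \<xi> freq_shear_def
      by (simp add: add.assoc add.commute[of 1] add.commute[of 2])
    have de: "((\<lambda>s. complex_of_real (e s)) has_vector_derivative - of_int k) (at s within {0..})"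
      unfolding e_def by (auto intro!: derivative_eq_intros)
    have d2: "((\<lambda>s. complex_of_real ((of_int k)\<^sup>2 + (e s)\<^sup>2 + (of_int l)\<^sup>2)) has_vector_derivative - 2 * of_real (e s) * of_int k) (at s within {0..})"
    proof -
      have "((\<lambda>s. (of_int k)\<^sup>2 + (e s)\<^sup>2 + (of_int l)\<^sup>2) has_real_derivative - 2 * e s * of_int k) (at s within {0..})"
        unfolding e_def by (auto intro!: derivative_eq_intros simp: algebra_simps)
      then have "((\<lambda>s. (of_int k)\<^sup>2 + (e s)\<^sup>2 + (of_int l)\<^sup>2) has_vector_derivative - 2 * e s * of_int k) (at s within {0..})"
        by (simp only: has_real_derivative_iff_has_vector_derivative)
      from bounded_linear.has_vector_derivative[OF bounded_linear_of_real this] show ?thesis by simp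
    qed
    have "(Q has_vector_derivative
        (- (of_real ((of_int k)\<^sup>2 + (e s)\<^sup>2 + (of_int l)\<^sup>2)) * (P (0 + 1) - \<i> * of_real (e s) * P 0) + - (- 2 * of_real (e s) * of_int k) * g 0 s
         - (2 * \<i> * of_real (e s) * (P (1 + 1) - \<i> * of_real (e s) * P 1) + 2 * \<i> * (- of_int k) * g 1 s)
         + (P (2 + 1) - \<i> * of_real (e s) * P 2))) (at s within {0..})"
      unfolding Q_def[abs_def]
      by (intro has_vector_derivative_add has_vector_derivative_diff has_vector_derivative_mult has_vector_derivative_minus
          has_vector_derivative_mult_right dg d2 de)
    moreover have "(- (of_real ((of_int k)\<^sup>2 + (e s)\<^sup>2 + (of_int l)\<^sup>2)) * (P (0 + 1) - \<i> * of_real (e s) * P 0) + - (- 2 * of_real (e s) * of_int k) * g 0 s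
         - (2 * \<i> * of_real (e s) * (P (1 + 1) - \<i> * of_real (e s) * P 1) + 2 * \<i> * (- of_int k) * g 1 s)
         + (P (2 + 1) - \<i> * of_real (e s) * P 2)) = 0" (is "?lhs = 0")
    proof -
      define m where "m = complex_of_real ((of_int k)\<^sup>2 + (e s)\<^sup>2 + (of_int l)\<^sup>2)"
      have p0: "- m * P 0 - 2 * \<i> * of_real (e s) * P 1 + P 2 = - 2 * \<i> * of_int k * g 0 s"
        using po[of 0] by (simp add: m_def numeral_2_eq_2)
      have p1: "- m * P 1 - 2 * \<i> * of_real (e s) * P 2 + P 3 = - 2 * \<i> * of_int k * g 1 s"
        using po[of 1] by (simp add: m_def numeral_2_eq_2 numeral_3_eq_3)
      \<comment> \<open>The derivative collapses to the Poisson identity for j = 1 minus \<i> e(s)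
        times the one for j = 0; their right-hand sides cancel the two terms that come from the
        moving frequency.\<close>
      have "?lhs = (- m * P 1 - 2 * \<i> * of_real (e s) * P 2 + P 3) - \<i> * of_real (e s) * (- m * P 0 - 2 * \<i> * of_real (e s) * P 1 + P 2)
          + 2 * of_real (e s) * of_int k * g 0 s + 2 * \<i> * of_int k * g 1 s"
        unfolding m_def[symmetric] by (simp add: numeral_2_eq_2[symmetric] numeral_3_eq_3[symmetric] algebra_simps)
      also have "\<dots> = 0" unfolding p0 p1 by (simp add: algebra_simps)
      finally show ?thesis .
    qed
    ultimately show ?thesis by simp
  qed
  obtain c where "\<And>s. s \<in> {0..} \<Longrightarrow> Q s = c"
    by (rule has_vector_derivative_zero_constant[of "{0..}" Q]) (use dz in auto)
  then have "Q t = Q 0" using t by simp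
  then show ?thesis using Q[OF t] Q[of 0] by (simp add: freq_shear_def \<xi>)
qed

text \<open>The conservation law holds for each cutoff at the fixed time t, so both sides are limits
  of the same sequence. The factors |\<xi>|^2 are not divided out because they vanish at frequency
  0.\<close>

lemma hat_u2_relation:
  assumes t: "0 \<le> t" and U: "is_hat (uc 2 t) U" and V: "is_hat (component u_in 2) V"
  shows "AE \<xi> in freq_meas. of_real (nsq (freq_shear t \<xi>)) * U (freq_shear t \<xi>) = of_real (nsq \<xi>) * V \<xi>"
proof -
  have V0: "is_hat (uc 2 0) V"
    using V lfourier_initial[OF bump_cut] by (simp add: is_hat_def)
  have h0: "is_hat (laplace (uc 2 0)) (\<lambda>\<xi>. - of_real (nsq \<xi>) * V \<xi>)"
    by (rule hat_laplace[OF u_sobolev _ V0]) auto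
  have L: "laplace (uc 2 t) \<in> L2_space" by (rule laplace_L2[OF u_sobolev[OF t]]) simp
  have ht: "is_hat (moving_frame t (laplace (uc 2 t))) (\<lambda>\<xi>. - of_real (nsq (freq_shear t \<xi>)) * U (freq_shear t \<xi>))"
    by (rule hat_moving_frame[OF L hat_laplace[OF u_sobolev[OF t] _ U]]) simp
  have "is_hat (moving_frame t (laplace (uc 2 t))) (\<lambda>\<xi>. - of_real (nsq \<xi>) * V \<xi>)"
    using h0 by (simp add: is_hat_def lfourier_moving_frame[OF bump_cut L] lfourier_laplace_conserved[OF bump_cut t])
  from hat_unique[OF ht this L2_space_sqint[OF moving_frame_L2(1)[OF L]]]
  show ?thesis by eventually_elim simp
qed

lemma hat_p_relation:
  assumes t: "0 \<le> t" and U: "is_hat (uc 2 t) U" and P: "is_hat (p t) P"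
  shows "AE \<xi> in freq_meas. of_real (nsq \<xi>) * P \<xi> = 2 * \<i> * of_int (fst \<xi>) * U \<xi>"
proof -
  have L: "laplace (p t) \<in> L2_space" by (rule laplace_L2[OF p_sobolev[OF t]]) simp
  have 1: "is_hat (laplace (p t)) (\<lambda>\<xi>. - of_real (nsq \<xi>) * P \<xi>)"
    by (rule hat_laplace[OF p_sobolev[OF t] _ P]) simp
  have "is_hat (weak_deriv (1, 0, 0) (uc 2 t)) (\<lambda>\<xi>. symbol (1, 0, 0) \<xi> * U \<xi>)"
    by (rule hat_weak_deriv_sobolev[OF u_sobolev[OF t] _ U]) (simp add: order_of_def)
  from hat_cmult[OF this, of "- 2"]
  have 2: "is_hat (\<lambda>X. - 2 * weak_deriv (1, 0, 0) (uc 2 t) X) (\<lambda>\<xi>. - (2 * \<i> * of_int (fst \<xi>) * U \<xi>))"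
    by (simp add: symbol_def split_beta mult_ac)
  have "is_hat (laplace (p t)) (\<lambda>\<xi>. - (2 * \<i> * of_int (fst \<xi>) * U \<xi>))"
    using 2 lfourier_cmult[of _ _ "- 2" "weak_deriv (1, 0, 0) (uc 2 t)"] lfourier_unit_deriv(1)[OF bump_cut u_sobolev[OF t]]
    by (simp add: is_hat_def lfourier_poisson[OF bump_cut t] mult.assoc)
  from hat_unique[OF 1 this L2_space_sqint[OF L]]
  show ?thesis by eventually_elim simp
qed

end

section \<open>Sobolev weights and gains from the shear\<close>

lemma norm_symbol_sq:
  "(norm (symbol (a, b, c) \<xi>))\<^sup>2 = ((of_int (fst \<xi>))\<^sup>2) ^ a * ((fst (snd \<xi>))\<^sup>2) ^ b * ((of_int (snd (snd \<xi>)))\<^sup>2) ^ c"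
  by (simp add: symbol_def split_beta norm_mult norm_power power_mult_distrib power_even_abs flip: power_mult)
     (simp add: power_mult mult.commute[of _ 2] power_even_abs)

lemma weight_mono: "m \<le> n \<Longrightarrow> weight m \<xi> \<le> weight n \<xi>"
  unfolding weight_def by (rule sum_mono2) (auto simp: finite_multi_indices)

lemma nsq_nonneg: "0 \<le> nsq \<xi>"
  by (simp add: nsq_def)

definition index_count :: "nat \<Rightarrow> real" where
  "index_count m = real (card {\<alpha>. order_of \<alpha> \<le> m})"

lemma weight_le: "weight m \<xi> \<le> index_count m * (1 + nsq \<xi>) ^ m"
proof -
  have "(norm (symbol \<alpha> \<xi>))\<^sup>2 \<le> (1 + nsq \<xi>) ^ m" if "\<alpha> \<in> {\<alpha>. order_of \<alpha> \<le> m}" for \<alpha>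
  proof -
    obtain a b c where \<alpha>: "\<alpha> = (a, b, c)" by (cases \<alpha>)
    have abc: "a + b + c \<le> m" using that by (simp add: \<alpha> order_of_def)
    let ?E = "1 + nsq \<xi>"
    have "(norm (symbol \<alpha> \<xi>))\<^sup>2 \<le> ?E ^ a * ?E ^ b * ?E ^ c"
      unfolding \<alpha> norm_symbol_sq
      by (intro mult_mono power_mono) (auto simp: nsq_def intro!: add_nonneg_nonneg)
    also have "\<dots> = ?E ^ (a + b + c)" by (simp add: power_add)
    also have "\<dots> \<le> ?E ^ m" using nsq_nonneg[of \<xi>] abc by (intro power_increasing) auto
    finally show ?thesis .
  qed
  then have "weight m \<xi> \<le> of_nat (card {\<alpha>. order_of \<alpha> \<le> m}) * (1 + nsq \<xi>) ^ m"
    unfolding weight_def by (rule sum_bounded_above)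
  then show ?thesis by (simp add: index_count_def)
qed

text \<open>Multiplying by 1 + k^2 + \<eta>^2 + l^2 leaves a multi-index alone or raises it in one
  of three directions. Each of the four resulting sums is part of the next weight, hence a factor 4
  per step.\<close>

lemma weight_ge: "(1 + nsq \<xi>) ^ m \<le> 4 ^ m * weight m \<xi>"
proof (induction m)
  case 0
  have "{\<alpha>. order_of \<alpha> \<le> 0} = {(0, 0, 0)}" by (auto simp: order_of_def)
  then show ?case by (simp add: weight_def symbol_def split_beta)
next
  case (Suc m)
  let ?A = "{\<alpha>. order_of \<alpha> \<le> m}"
  have shift: "(\<Sum>\<alpha>\<in>?A. (norm (symbol (f \<alpha>) \<xi>))\<^sup>2) \<le> weight (Suc m) \<xi>"
    if "inj_on f ?A" "\<And>\<alpha>. order_of \<alpha> \<le> m \<Longrightarrow> order_of (f \<alpha>) \<le> Suc m" for f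
  proof -
    have "(\<Sum>\<alpha>\<in>?A. (norm (symbol (f \<alpha>) \<xi>))\<^sup>2) = (\<Sum>\<alpha>\<in>f ` ?A. (norm (symbol \<alpha> \<xi>))\<^sup>2)"
      using that(1) by (simp add: sum.reindex)
    also have "\<dots> \<le> weight (Suc m) \<xi>"
      unfolding weight_def by (rule sum_mono2) (use that(2) in \<open>auto simp: finite_multi_indices\<close>)
    finally show ?thesis .
  qed
  let ?f1 = "\<lambda>(a, b, c). (Suc a, b, c)" and ?f2 = "\<lambda>(a, b, c). (a, Suc b, c)" and ?f3 = "\<lambda>(a, b, c). (a, b, Suc c)"
  have eq: "(1 + nsq \<xi>) * (norm (symbol \<alpha> \<xi>))\<^sup>2 = (norm (symbol \<alpha> \<xi>))\<^sup>2 + (norm (symbol (?f1 \<alpha>) \<xi>))\<^sup>2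
      + (norm (symbol (?f2 \<alpha>) \<xi>))\<^sup>2 + (norm (symbol (?f3 \<alpha>) \<xi>))\<^sup>2" for \<alpha>
    by (cases \<alpha>) (simp add: norm_symbol_sq nsq_def algebra_simps)
  have "(1 + nsq \<xi>) * weight m \<xi> = weight m \<xi> + (\<Sum>\<alpha>\<in>?A. (norm (symbol (?f1 \<alpha>) \<xi>))\<^sup>2)
      + (\<Sum>\<alpha>\<in>?A. (norm (symbol (?f2 \<alpha>) \<xi>))\<^sup>2) + (\<Sum>\<alpha>\<in>?A. (norm (symbol (?f3 \<alpha>) \<xi>))\<^sup>2)"
    unfolding weight_def sum_distrib_left eq sum.distrib ..
  also have "\<dots> \<le> weight (Suc m) \<xi> + weight (Suc m) \<xi> + weight (Suc m) \<xi> + weight (Suc m) \<xi>"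
    by (intro add_mono weight_mono shift) (auto simp: inj_on_def order_of_def)
  finally have *: "(1 + nsq \<xi>) * weight m \<xi> \<le> 4 * weight (Suc m) \<xi>" by simp
  have "(1 + nsq \<xi>) ^ Suc m \<le> (1 + nsq \<xi>) * (4 ^ m * weight m \<xi>)"
    using Suc nsq_nonneg[of \<xi>] by (simp add: mult_left_mono)
  also have "\<dots> \<le> 4 ^ m * (4 * weight (Suc m) \<xi>)"
    using mult_left_mono[OF *, of "4 ^ m"] by (simp add: mult_ac)
  finally show ?case by (simp add: mult_ac)
qed

text \<open>\<open>E\<close> and \<open>D\<close> are |\<xi>|^2 before and after the shear, and a is
  the sheared vertical frequency. As kt = \<eta> - a, a large t makes \<eta> or a large, so D and E
  cannot both be small. The first bound is the decay of u2; the other two serve the pressure, which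
  has one more inverse Laplacian and a factor k, and is differentiated in z or in x.\<close>

lemma shear_gain:
  fixes k \<eta> l t :: real
  assumes k: "1 \<le> k\<^sup>2"
  defines "D \<equiv> k\<^sup>2 + (\<eta> - k * t)\<^sup>2 + l\<^sup>2" and "E \<equiv> k\<^sup>2 + \<eta>\<^sup>2 + l\<^sup>2"
  shows "1 + t\<^sup>2 \<le> 2 * (D * E)"
    and "(1 + t\<^sup>2)\<^sup>2 * \<bar>k * l\<bar> \<le> 14 * (E\<^sup>2 * D\<^sup>2)"
    and "(1 + t\<^sup>2)\<^sup>2 * k\<^sup>2 \<le> 14 * (E\<^sup>2 * D\<^sup>2)"
proof -
  define a where "a = \<eta> - k * t"
  have kt: "k * t = \<eta> - a" by (simp add: a_def)
  have D: "D = k\<^sup>2 + a\<^sup>2 + l\<^sup>2" by (simp add: D_def a_def)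
  have E1: "1 \<le> E" and D1: "1 \<le> D" 
    using k zero_le_power2[of \<eta>] zero_le_power2[of l] zero_le_power2[of a] unfolding E_def D by linarith+
  have sq: "k\<^sup>2 * t\<^sup>2 \<le> 2 * \<eta>\<^sup>2 + 2 * a\<^sup>2"
  proof -
    have "k\<^sup>2 * t\<^sup>2 = (\<eta> - a)\<^sup>2" by (simp add: kt[symmetric] power_mult_distrib)
    also have "\<dots> \<le> 2 * \<eta>\<^sup>2 + 2 * a\<^sup>2"
      using zero_le_power2[of "\<eta> + a"] by (simp add: power2_eq_square algebra_simps)
    finally show ?thesis .
  qed
  have main: "k\<^sup>2 * k\<^sup>2 * (1 + t\<^sup>2) \<le> 2 * (D * E)"
  proof -
    have "k\<^sup>2 * k\<^sup>2 * (1 + t\<^sup>2) = k\<^sup>2 * k\<^sup>2 + k\<^sup>2 * (k\<^sup>2 * t\<^sup>2)" by (simp add: algebra_simps)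
    also have "\<dots> \<le> k\<^sup>2 * k\<^sup>2 + k\<^sup>2 * (2 * \<eta>\<^sup>2 + 2 * a\<^sup>2)" by (intro add_left_mono mult_left_mono sq) simp
    also have "\<dots> \<le> 2 * ((k\<^sup>2 + a\<^sup>2) * (k\<^sup>2 + \<eta>\<^sup>2))"
    proof -
      have "2 * ((k\<^sup>2 + a\<^sup>2) * (k\<^sup>2 + \<eta>\<^sup>2)) = (k\<^sup>2 * k\<^sup>2 + k\<^sup>2 * (2 * \<eta>\<^sup>2 + 2 * a\<^sup>2)) + (k\<^sup>2 * k\<^sup>2 + 2 * (a\<^sup>2 * \<eta>\<^sup>2))"
        by (simp add: algebra_simps)
      then show ?thesis by simp
    qed
    also have "(k\<^sup>2 + a\<^sup>2) * (k\<^sup>2 + \<eta>\<^sup>2) \<le> D * E" unfolding D E_def by (intro mult_mono) auto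
    finally show ?thesis by simp
  qed
  have k4: "1 \<le> k\<^sup>2 * k\<^sup>2" using mult_mono[OF k k] by simp
  have t1: "0 \<le> 1 + t\<^sup>2" by simp
  show "1 + t\<^sup>2 \<le> 2 * (D * E)"
    using mult_right_mono[OF k4 t1] main by simp
  have ek: "k\<^sup>2 \<le> E" "k\<^sup>2 \<le> D" "\<eta>\<^sup>2 \<le> E" "a\<^sup>2 \<le> D" by (auto simp: E_def D)
  have kl: "\<bar>k * l\<bar> \<le> D" "\<bar>k * l\<bar> \<le> E"
  proof -
    have "2 * \<bar>k * l\<bar> \<le> k\<^sup>2 + l\<^sup>2"
      using zero_le_power2[of "\<bar>k\<bar> - \<bar>l\<bar>"] by (simp add: power2_diff abs_mult)
    moreover have "0 \<le> \<bar>k * l\<bar>" "0 \<le> a\<^sup>2" "0 \<le> \<eta>\<^sup>2" by auto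
    ultimately show "\<bar>k * l\<bar> \<le> D" "\<bar>k * l\<bar> \<le> E" unfolding D E_def by linarith+
  qed
  \<comment> \<open>The halves determine the final constant: 3 (1/2 + 2 + 2) = 27/2, rounded up to
    14.\<close>
  have kl2: "\<bar>k * l\<bar> \<le> D / 2" "\<bar>k * l\<bar> \<le> E / 2"
  proof -
    have kl': "2 * \<bar>k * l\<bar> \<le> k\<^sup>2 + l\<^sup>2"
      using zero_le_power2[of "\<bar>k\<bar> - \<bar>l\<bar>"] by (simp add: power2_diff abs_mult)
    have "k\<^sup>2 + l\<^sup>2 \<le> D" "k\<^sup>2 + l\<^sup>2 \<le> E" unfolding D E_def by auto
    with kl' have "2 * \<bar>k * l\<bar> \<le> D" "2 * \<bar>k * l\<bar> \<le> E" by linarith+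
    then show "\<bar>k * l\<bar> \<le> D / 2" "\<bar>k * l\<bar> \<le> E / 2" by linarith+
  qed
  have DE0: "0 \<le> D" "0 \<le> E" using D1 E1 by auto
  define T where "T = (1 + t\<^sup>2)\<^sup>2"
  have T0: "0 \<le> T" by (simp add: T_def)
  \<comment> \<open>The square of k^2 (1 + t^2) \<le> k^2 + 2 \<eta>^2 + 2 a^2, with the square of a
    sum of three terms at most three times the sum of their squares.\<close>
  have kT: "k\<^sup>2 * k\<^sup>2 * T \<le> 3 * (k\<^sup>2 * k\<^sup>2 + 4 * (\<eta>\<^sup>2 * \<eta>\<^sup>2) + 4 * (a\<^sup>2 * a\<^sup>2))"
  proof -
    have "k\<^sup>2 * k\<^sup>2 * T = (k\<^sup>2 + k\<^sup>2 * t\<^sup>2)\<^sup>2" by (simp add: T_def power2_eq_square algebra_simps)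
    also have "\<dots> \<le> (k\<^sup>2 + 2 * \<eta>\<^sup>2 + 2 * a\<^sup>2)\<^sup>2" using sq by (intro power_mono) auto
    also have "\<dots> \<le> 3 * (k\<^sup>2 * k\<^sup>2 + 4 * (\<eta>\<^sup>2 * \<eta>\<^sup>2) + 4 * (a\<^sup>2 * a\<^sup>2))"
    proof -
      have "0 \<le> (k\<^sup>2 - 2 * \<eta>\<^sup>2)\<^sup>2 + (k\<^sup>2 - 2 * a\<^sup>2)\<^sup>2 + (2 * \<eta>\<^sup>2 - 2 * a\<^sup>2)\<^sup>2" by simp
      then show ?thesis by (simp add: power2_eq_square algebra_simps)
    qed
    finally show ?thesis .
  qed
  have Tle: "T \<le> k\<^sup>2 * k\<^sup>2 * T" using mult_right_mono[OF k4 T0] by simp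
  have "T * \<bar>k * l\<bar> \<le> (k\<^sup>2 * k\<^sup>2 * T) * \<bar>k * l\<bar>" by (rule mult_right_mono[OF Tle]) simp
  also have "\<dots> \<le> 3 * (k\<^sup>2 * k\<^sup>2 + 4 * (\<eta>\<^sup>2 * \<eta>\<^sup>2) + 4 * (a\<^sup>2 * a\<^sup>2)) * \<bar>k * l\<bar>" by (rule mult_right_mono[OF kT]) simp
  also have "\<dots> = 3 * (k\<^sup>2 * k\<^sup>2 * \<bar>k * l\<bar> + 4 * (\<eta>\<^sup>2 * \<eta>\<^sup>2 * \<bar>k * l\<bar>) + 4 * (a\<^sup>2 * a\<^sup>2 * \<bar>k * l\<bar>))" by (simp add: algebra_simps)
  also have "\<dots> \<le> 3 * (D * E * (D / 2) * E + 4 * (E * E * (D / 2) * D) + 4 * (D * D * (E / 2) * E))"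
  proof (intro mult_left_mono add_mono)
    have i1: "k\<^sup>2 * k\<^sup>2 * \<bar>k * l\<bar> \<le> D * E * (D / 2)" by (intro mult_mono ek kl2) (use DE0 in auto)
    also have "\<dots> \<le> D * E * (D / 2) * E" using mult_left_mono[OF E1, of "D * E * (D / 2)"] DE0 by simp
    finally show "k\<^sup>2 * k\<^sup>2 * \<bar>k * l\<bar> \<le> D * E * (D / 2) * E" .
    have "\<eta>\<^sup>2 * \<eta>\<^sup>2 * \<bar>k * l\<bar> \<le> E * E * (D / 2)" by (intro mult_mono ek kl2) (use DE0 in auto)
    also have "\<dots> \<le> E * E * (D / 2) * D" using mult_left_mono[OF D1, of "E * E * (D / 2)"] DE0 by simp
    finally show "\<eta>\<^sup>2 * \<eta>\<^sup>2 * \<bar>k * l\<bar> \<le> E * E * (D / 2) * D" .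
    have "a\<^sup>2 * a\<^sup>2 * \<bar>k * l\<bar> \<le> D * D * (E / 2)" by (intro mult_mono ek kl2) (use DE0 in auto)
    also have "\<dots> \<le> D * D * (E / 2) * E" using mult_left_mono[OF E1, of "D * D * (E / 2)"] DE0 by simp
    finally show "a\<^sup>2 * a\<^sup>2 * \<bar>k * l\<bar> \<le> D * D * (E / 2) * E" .
  qed auto
  also have "\<dots> = (27 / 2) * (E\<^sup>2 * D\<^sup>2)" by (simp add: power2_eq_square algebra_simps)
  also have "\<dots> \<le> 14 * (E\<^sup>2 * D\<^sup>2)" by (rule mult_right_mono) auto
  finally show "(1 + t\<^sup>2)\<^sup>2 * \<bar>k * l\<bar> \<le> 14 * (E\<^sup>2 * D\<^sup>2)" by (simp add: T_def)
  \<comment> \<open>The last bound is the square of \<open>main\<close>, whose spare factor k^4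
    becomes k^8 and covers k^2. Its constant 4 is relaxed to the common 14.\<close>
  have "k\<^sup>2 \<le> (k\<^sup>2 * k\<^sup>2) * (k\<^sup>2 * k\<^sup>2)"
  proof -
    have "k\<^sup>2 * 1 \<le> k\<^sup>2 * (k\<^sup>2 * (k\<^sup>2 * k\<^sup>2))"
      by (intro mult_left_mono) (use mult_mono[OF k k4] in auto)
    then show ?thesis by (simp add: mult_ac)
  qed
  then have "T * k\<^sup>2 \<le> T * ((k\<^sup>2 * k\<^sup>2) * (k\<^sup>2 * k\<^sup>2))" by (rule mult_left_mono[OF _ T0])
  also have "\<dots> = (k\<^sup>2 * k\<^sup>2 * (1 + t\<^sup>2))\<^sup>2" by (simp add: T_def power2_eq_square algebra_simps)
  also have "\<dots> \<le> (2 * (D * E))\<^sup>2" by (rule power_mono[OF main]) simp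
  also have "\<dots> = 4 * (E\<^sup>2 * D\<^sup>2)" by (simp add: power_mult_distrib mult_ac)
  also have "\<dots> \<le> 14 * (E\<^sup>2 * D\<^sup>2)" by (rule mult_right_mono) auto
  finally show "(1 + t\<^sup>2)\<^sup>2 * k\<^sup>2 \<le> 14 * (E\<^sup>2 * D\<^sup>2)" by (simp add: T_def)
qed

section \<open>Operations under which the Sobolev spaces are stable\<close>

lemma L2_space_add: "f \<in> L2_space \<Longrightarrow> g \<in> L2_space \<Longrightarrow> (\<lambda>X. f X + g X) \<in> L2_space"
  and L2_space_diff: "f \<in> L2_space \<Longrightarrow> g \<in> L2_space \<Longrightarrow> (\<lambda>X. f X - g X) \<in> L2_space"
  and L2_space_cmult: "f \<in> L2_space \<Longrightarrow> (\<lambda>X. c * f X) \<in> L2_space"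
  using sqint_scaleR[of cell_meas f c]
  by (auto simp: L2_space_iff periodic_xz_def intro!: sqint_add sqint_diff)

lemma L2_space_zero: "(\<lambda>X. 0) \<in> L2_space"
  by (simp add: L2_space_iff periodic_xz_def)

lemma L2_space_sum: "(\<And>i. i \<in> I \<Longrightarrow> f i \<in> L2_space) \<Longrightarrow> (\<lambda>X. \<Sum>i\<in>I. f i X) \<in> L2_space"
  by (induction I rule: infinite_finite_induct) (auto intro: L2_space_add L2_space_zero)

lemma sobolev_diff:
  assumes "f \<in> sobolev m" "g \<in> sobolev m"
  shows "(\<lambda>X. f X - g X) \<in> sobolev m"
proof -
  note f = sobolev_L2[OF assms(1)] and g = sobolev_L2[OF assms(2)]
  note hf = is_hat_hat[OF f] and hg = is_hat_hat[OF g]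
  show ?thesis
  proof (rule sobolevI_hat[OF L2_space_diff[OF f g] hat_diff[OF hf hg L2_space_sqint[OF f] L2_space_sqint[OF g]]])
    fix \<alpha> assume a: "order_of \<alpha> \<le> m"
    note wf = weak_deriv_sobolev(1)[OF assms(1) a] and wg = weak_deriv_sobolev(1)[OF assms(2) a]
    have "is_hat (\<lambda>X. weak_deriv \<alpha> f X - weak_deriv \<alpha> g X) (\<lambda>\<xi>. symbol \<alpha> \<xi> * (hat f \<xi> - hat g \<xi>))"
      using hat_diff[OF hat_weak_deriv_sobolev[OF assms(1) a hf] hat_weak_deriv_sobolev[OF assms(2) a hg] L2_space_sqint[OF wf] L2_space_sqint[OF wg]]
      by (simp add: right_diff_distrib)
    then show "\<exists>h\<in>L2_space. is_hat h (\<lambda>\<xi>. symbol \<alpha> \<xi> * (hat f \<xi> - hat g \<xi>))"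
      using L2_space_diff[OF wf wg] by blast
  qed
qed

lemma sobolev_cmult:
  assumes "f \<in> sobolev m"
  shows "(\<lambda>X. c * f X) \<in> sobolev m"
proof -
  note f = sobolev_L2[OF assms]
  note hf = is_hat_hat[OF f]
  show ?thesis
  proof (rule sobolevI_hat[OF L2_space_cmult[OF f] hat_cmult[OF hf]])
    fix \<alpha> assume a: "order_of \<alpha> \<le> m"
    have "is_hat (\<lambda>X. c * weak_deriv \<alpha> f X) (\<lambda>\<xi>. symbol \<alpha> \<xi> * (of_real c * hat f \<xi>))"
      using hat_cmult[OF hat_weak_deriv_sobolev[OF assms a hf], of c] by (simp add: mult_ac)
    then show "\<exists>h\<in>L2_space. is_hat h (\<lambda>\<xi>. symbol \<alpha> \<xi> * (of_real c * hat f \<xi>))"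
      using L2_space_cmult[OF weak_deriv_sobolev(1)[OF assms a]] by blast
  qed
qed

lemma sobolev_mono: "m \<le> n \<Longrightarrow> f \<in> sobolev n \<Longrightarrow> f \<in> sobolev m"
  by (auto simp: sobolev_def)

lemma symbol_add: "symbol (a + a', b + b', c + c') \<xi> = symbol (a, b, c) \<xi> * symbol (a', b', c') \<xi>"
  by (simp add: symbol_def split_beta power_add mult_ac)

lemma sobolev_unit_deriv:
  assumes f: "f \<in> sobolev (Suc m)"
  shows "weak_deriv (unit_index i) f \<in> sobolev m"
proof -
  have o: "order_of (unit_index i) = 1" by (simp add: unit_index_def order_of_def)
  then have o': "order_of (unit_index i) \<le> Suc m" by simp
  note hf = is_hat_hat[OF sobolev_L2[OF f]]
  show ?thesis
  proof (rule sobolevI_hat[OF weak_deriv_sobolev(1)[OF f o'] hat_weak_deriv_sobolev[OF f o' hf]])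
    fix \<alpha> assume a: "order_of \<alpha> \<le> m"
    obtain a b c where \<alpha>: "\<alpha> = (a, b, c)" by (cases \<alpha>)
    obtain a' b' c' where u: "unit_index i = (a', b', c')" by (cases "unit_index i")
    let ?\<beta> = "(a + a', b + b', c + c')"
    have ob: "order_of ?\<beta> \<le> Suc m" using a o unfolding \<alpha> u by (simp add: order_of_def)
    have "is_hat (weak_deriv ?\<beta> f) (\<lambda>\<xi>. symbol \<alpha> \<xi> * (symbol (unit_index i) \<xi> * hat f \<xi>))"
      using hat_weak_deriv_sobolev[OF f ob hf] unfolding symbol_add \<alpha> u by (simp add: mult.assoc)
    then show "\<exists>h\<in>L2_space. is_hat h (\<lambda>\<xi>. symbol \<alpha> \<xi> * (symbol (unit_index i) \<xi> * hat f \<xi>))"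
      using weak_deriv_sobolev(1)[OF f ob] by blast
  qed
qed

lemma sobolev_x_nonzero:
  assumes f: "f \<in> sobolev m"
  shows "x_nonzero f \<in> sobolev m"
proof -
  note f' = sobolev_L2[OF f]
  note hf = is_hat_hat[OF f']
  show ?thesis
  proof (rule sobolevI_hat[OF x_nonzero_L2[OF f'] hat_x_nonzero[OF f' hf]])
    fix \<alpha> assume a: "order_of \<alpha> \<le> m"
    note w = weak_deriv_sobolev(1)[OF f a]
    have "(\<lambda>\<xi>. if fst \<xi> \<noteq> 0 then symbol \<alpha> \<xi> * hat f \<xi> else 0) = (\<lambda>\<xi>. symbol \<alpha> \<xi> * (if fst \<xi> \<noteq> 0 then hat f \<xi> else 0))"
      by auto
    then show "\<exists>h\<in>L2_space. is_hat h (\<lambda>\<xi>. symbol \<alpha> \<xi> * (if fst \<xi> \<noteq> 0 then hat f \<xi> else 0))"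
      using hat_x_nonzero[OF w hat_weak_deriv_sobolev[OF f a hf]] x_nonzero_L2[OF w] by auto
  qed
qed

text \<open>Chain rule: in the moving frame a derivative in y is that of \<open>f\<close> plus t
  times the derivative in x, so b of them form a binomial sum of weak derivatives of the same total
  order. On the Fourier side this is \<i>\<eta> = \<i>(\<eta> - kt) + t \<i>k.\<close>

lemma sobolev_moving_frame:
  assumes f: "f \<in> sobolev m"
  shows "moving_frame t f \<in> sobolev m"
proof -
  note f' = sobolev_L2[OF f]
  note hf = is_hat_hat[OF f']
  show ?thesis
  proof (rule sobolevI_hat[OF moving_frame_L2(1)[OF f'] hat_moving_frame[OF f' hf]])
    fix \<alpha> assume a: "order_of \<alpha> \<le> m"
    obtain a b c where \<alpha>: "\<alpha> = (a, b, c)" by (cases \<alpha>)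
    have o: "order_of (a + j, b - j, c) \<le> m" if "j \<le> b" for j
      using a that by (simp add: \<alpha> order_of_def)
    define h where "h j = (\<lambda>X. (of_nat (b choose j) * t ^ j) * moving_frame t (weak_deriv (a + j, b - j, c) f) X)" for j
    have hL: "h j \<in> L2_space" if "j \<le> b" for j
      unfolding h_def by (intro L2_space_cmult moving_frame_L2(1) weak_deriv_sobolev(1)[OF f o[OF that]])
    have hh: "is_hat (h j) (\<lambda>\<xi>. of_real (of_nat (b choose j) * t ^ j) * (symbol (a + j, b - j, c) (freq_shear t \<xi>) * hat f (freq_shear t \<xi>)))" if "j \<le> b" for j
      unfolding h_def
      by (rule hat_cmult[OF hat_moving_frame[OF weak_deriv_sobolev(1)[OF f o[OF that]] hat_weak_deriv_sobolev[OF f o[OF that] hf]]])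
    have sum: "is_hat (\<lambda>X. \<Sum>j\<in>{..b}. h j X) (\<lambda>\<xi>. \<Sum>j\<in>{..b}. of_real (of_nat (b choose j) * t ^ j) * (symbol (a + j, b - j, c) (freq_shear t \<xi>) * hat f (freq_shear t \<xi>)))"
      using hh hL by (intro hat_sum) (auto intro: L2_space_sqint)
    have "(\<Sum>j\<in>{..b}. of_real (of_nat (b choose j) * t ^ j) * (symbol (a + j, b - j, c) (freq_shear t \<xi>) * hat f (freq_shear t \<xi>))) = symbol \<alpha> \<xi> * hat f (freq_shear t \<xi>)" for \<xi>
    proof -
      obtain k \<eta> l where \<xi>: "\<xi> = (k, \<eta>, l)" by (cases \<xi>)
      define r where "r = (\<i> * of_int k) ^ a * (\<i> * complex_of_int l) ^ c * hat f (freq_shear t \<xi>)"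
      have "(\<Sum>j\<in>{..b}. of_real (of_nat (b choose j) * t ^ j) * (symbol (a + j, b - j, c) (freq_shear t \<xi>) * hat f (freq_shear t \<xi>)))
         = r * (\<Sum>j\<le>b. of_nat (b choose j) * (of_real t * (\<i> * of_int k)) ^ j * (\<i> * of_real (\<eta> - of_int k * t)) ^ (b - j))"
        unfolding sum_distrib_left
        by (intro sum.cong refl) (simp add: r_def symbol_def freq_shear_def \<xi> power_add power_mult_distrib mult_ac)
      also have "\<dots> = r * (of_real t * (\<i> * of_int k) + \<i> * of_real (\<eta> - of_int k * t)) ^ b"
        by (simp only: binomial_ring)
      also have "of_real t * (\<i> * of_int k) + \<i> * of_real (\<eta> - of_int k * t) = \<i> * of_real \<eta>" by (simp add: algebra_simps)
      finally show ?thesis by (simp add: r_def symbol_def \<alpha> \<xi> mult_ac)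
    qed
    with sum have "is_hat (\<lambda>X. \<Sum>j\<in>{..b}. h j X) (\<lambda>\<xi>. symbol \<alpha> \<xi> * hat f (freq_shear t \<xi>))" by (simp only:)
    then show "\<exists>h\<in>L2_space. is_hat h (\<lambda>\<xi>. symbol \<alpha> \<xi> * hat f (freq_shear t \<xi>))"
      using L2_space_sum[of "{..b}" h] hL by blast
  qed
qed

section \<open>Limits of weak derivatives, and L2 norms by duality\<close>

lemma has_weak_deriv_limit:
  assumes "\<And>n. f n \<in> L2_space" "\<And>n. g n \<in> L2_space" "f' \<in> L2_space" "g' \<in> L2_space"
    and "(\<lambda>n. l2n cell_meas (\<lambda>X. f n X - f' X)) \<longlonglongrightarrow> 0" "(\<lambda>n. l2n cell_meas (\<lambda>X. g n X - g' X)) \<longlonglongrightarrow> 0"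
    and "\<And>n. has_weak_deriv (f n) \<alpha> (g n)"
  shows "has_weak_deriv f' \<alpha> g'"
  unfolding has_weak_deriv_def
proof (intro allI impI)
  fix \<phi> assume t: "test_function \<phi>"
  have p: "pd_multi \<alpha> \<phi> \<in> L2_space" "\<phi> \<in> L2_space"
    using test_function_L2[OF t] test_function_L2[OF t, of "(0,0,0)"] by (auto simp: pd_multi_0)
  have lim: "(\<lambda>n. LINT X:cell|lborel. h n X * \<psi> X) \<longlonglongrightarrow> (LINT X:cell|lborel. h' X * \<psi> X)"
    if h: "\<And>n. h n \<in> L2_space" "h' \<in> L2_space" "\<psi> \<in> L2_space" "(\<lambda>n. l2n cell_meas (\<lambda>X. h n X - h' X)) \<longlonglongrightarrow> 0" for h h' \<psi>
  proof -
    note s = L2_space_sqint[OF h(1)] L2_space_sqint[OF h(2)] L2_space_sqint[OF h(3)]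
    have e: "(LINT X:cell|lborel. v X * \<psi> X) = (\<integral>X. v X * \<psi> X \<partial>cell_meas)" if "v \<in> L2_space" for v
      using that h(3) by (intro set_integral_cell borel_measurable_times L2_space_measurable)
    have "norm ((\<integral>X. h n X * \<psi> X \<partial>cell_meas) - (\<integral>X. h' X * \<psi> X \<partial>cell_meas)) \<le> l2n cell_meas (\<lambda>X. h n X - h' X) * l2n cell_meas \<psi>" for n
      using cauchy_schwarz_l2n'[OF sqint_diff[OF s(1)[of n] s(2)] s(3)] integrable_mult_sqint'[OF s(1)[of n] s(3)] integrable_mult_sqint'[OF s(2) s(3)]
      by (simp add: left_diff_distrib)
    moreover have "(\<lambda>n. l2n cell_meas (\<lambda>X. h n X - h' X) * l2n cell_meas \<psi>) \<longlonglongrightarrow> 0"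
      using tendsto_mult_right[OF h(4), of "l2n cell_meas \<psi>"] by simp
    ultimately have "(\<lambda>n. (\<integral>X. h n X * \<psi> X \<partial>cell_meas) - (\<integral>X. h' X * \<psi> X \<partial>cell_meas)) \<longlonglongrightarrow> 0"
      by (rule Lim_null_comparison[OF always_eventually[OF allI]])
    then show ?thesis unfolding e[OF h(1)] e[OF h(2)] by (simp add: LIM_zero_iff)
  qed
  have 1: "(\<lambda>n. LINT X:cell|lborel. f n X * pd_multi \<alpha> \<phi> X) \<longlonglongrightarrow> (LINT X:cell|lborel. f' X * pd_multi \<alpha> \<phi> X)"
    by (rule lim[OF assms(1,3) p(1) assms(5)])
  have 2: "(\<lambda>n. (-1) ^ order_of \<alpha> * (LINT X:cell|lborel. g n X * \<phi> X)) \<longlonglongrightarrow> (-1) ^ order_of \<alpha> * (LINT X:cell|lborel. g' X * \<phi> X)"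
    by (rule tendsto_mult_left[OF lim[OF assms(2,4) p(2) assms(6)]])
  have "(LINT X:cell|lborel. f n X * pd_multi \<alpha> \<phi> X) = (-1) ^ order_of \<alpha> * (LINT X:cell|lborel. g n X * \<phi> X)" for n
    using assms(7)[of n] t unfolding has_weak_deriv_def by blast
  with 1 have "(\<lambda>n. (-1) ^ order_of \<alpha> * (LINT X:cell|lborel. g n X * \<phi> X)) \<longlonglongrightarrow> (LINT X:cell|lborel. f' X * pd_multi \<alpha> \<phi> X)"
    by (simp only:)
  then show "(LINT X:cell|lborel. f' X * pd_multi \<alpha> \<phi> X) = (-1) ^ order_of \<alpha> * (LINT X:cell|lborel. g' X * \<phi> X)"
    by (rule LIMSEQ_unique[OF _ 2])
qed

text \<open>Finite sums, so that time derivatives pass through them; the complex amplitudes enter as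
  constant polynomials.\<close>

definition trig_test :: "nat \<Rightarrow> ('i \<Rightarrow> frequency) \<Rightarrow> ('i \<Rightarrow> complex) \<Rightarrow> 'i set \<Rightarrow> scalar_field" where
  "trig_test n \<zeta> a J X = (\<Sum>i\<in>J. bump_wave (cutoff n) (\<zeta> i) [:a i:] X)"

lemma bump_wave_L2: "bump b \<Longrightarrow> bump_wave b \<xi> q \<in> L2_space"
  using test_function_L2[OF test_function_bump_wave, where \<alpha>="(0, 0, 0)"] by (simp add: pd_multi_0)

lemma trig_test_L2: "trig_test n \<zeta> a J \<in> L2_space"
  unfolding trig_test_def[abs_def] by (intro L2_space_sum bump_wave_L2 bump_cut)

text \<open>Reduces pairings to localised coefficients, the quantities whose time derivatives are
  known.\<close>

lemma integral_trig_test: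
  assumes "f \<in> L2_space"
  shows "(\<integral>X. f X * trig_test n \<zeta> a J X \<partial>cell_meas) = (\<Sum>i\<in>J. Re (a i * lfourier (cutoff n) 1 f (\<zeta> i)))"
proof -
  note s = L2_space_sqint[OF assms]
  have "(\<integral>X. f X * trig_test n \<zeta> a J X \<partial>cell_meas) = (\<integral>X. (\<Sum>i\<in>J. f X * bump_wave (cutoff n) (\<zeta> i) [:a i:] X) \<partial>cell_meas)"
    by (simp add: trig_test_def sum_distrib_left)
  also have "\<dots> = (\<Sum>i\<in>J. \<integral>X. f X * bump_wave (cutoff n) (\<zeta> i) [:a i:] X \<partial>cell_meas)"
    by (intro Bochner_Integration.integral_sum integrable_mult_sqint' s L2_space_sqint bump_wave_L2 bump_cut)
  also have "\<dots> = (\<Sum>i\<in>J. Re (a i * lfourier (cutoff n) 1 f (\<zeta> i)))"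
  proof (rule sum.cong[OF refl])
    fix i
    have "(\<integral>X. f X * bump_wave (cutoff n) (\<zeta> i) [:a i:] X \<partial>cell_meas) = (LINT X:cell|lborel. f X * bump_wave (cutoff n) (\<zeta> i) [:a i:] X)"
      by (intro set_integral_cell[symmetric] borel_measurable_times L2_space_measurable assms bump_wave_L2 bump_cut)
    also have "\<dots> = Re (a i * lfourier (cutoff n) 1 f (\<zeta> i))"
      unfolding Re_lfourier[OF bump_cut s, symmetric] lfourier_const ..
    finally show "(\<integral>X. f X * bump_wave (cutoff n) (\<zeta> i) [:a i:] X \<partial>cell_meas) = Re (a i * lfourier (cutoff n) 1 f (\<zeta> i))" .
  qed
  finally show ?thesis .
qed

text \<open>The n-th cutoff lives in |y| \<le> n + 1, inside the slab of half-height pi (n + 1) on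
  which the lattice of spacing 1/(n + 1) satisfies Parseval.\<close>

lemma cutoff_lattice:
  assumes "sqint cell_meas f"
  shows "(\<integral>\<^sup>+\<zeta>. ennreal ((norm (lfourier (cutoff n) 1 f (lattice (real (Suc n)) \<zeta>)))\<^sup>2) \<partial>count_space UNIV) =
    ennreal ((2 * pi) ^ 3 * real (Suc n) * (l2n cell_meas (modulate (cutoff n) 1 f))\<^sup>2)"
  unfolding lfourier_def
proof (rule plancherel_lattice)
  show "y_supp (pi * real (Suc n)) (modulate (cutoff n) 1 f)"
    unfolding y_supp_def
  proof (intro allI impI)
    fix x y z :: real assume "\<bar>y\<bar> > pi * real (Suc n)"
    moreover have "1 * real (Suc n) \<le> pi * real (Suc n)" using pi_ge_two by (intro mult_right_mono) auto
    ultimately have "\<bar>y\<bar> > 1 * real (Suc n)" by (rule le_less_trans[rotated])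
    then have "\<bar>y\<bar> > real (Suc n)" by (simp only: mult_1)
    then show "modulate (cutoff n) 1 f (x, y, z) = 0" by (simp add: modulate_def bump_comb_one cut_supp)
  qed
qed (use sqint_modulate[OF bump_cut assms] in auto)

lemma l2n_modulate_cutoff_le:
  assumes "sqint cell_meas f"
  shows "l2n cell_meas (modulate (cutoff n) 1 f) \<le> l2n cell_meas f"
proof -
  have "AE X in cell_meas. norm (modulate (cutoff n) 1 f X) \<le> 1 * norm (f X)"
  proof (intro AE_I2)
    fix X :: point
    have "\<bar>cutoff n 0 (fst (snd X))\<bar> \<le> 1" using cut_0_nonneg[of n] cut_0_le[of n] by simp
    then show "norm (modulate (cutoff n) 1 f X) \<le> 1 * norm (f X)"
      by (simp add: modulate_def bump_comb_one norm_mult mult_left_le)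
  qed
  from l2n_bound[OF assms sqint_measurable[OF sqint_modulate[OF bump_cut assms]] this] show ?thesis by simp
qed

lemma sum_le_nn_integral_count_space:
  fixes f :: "'i \<Rightarrow> real"
  assumes "finite J" "\<And>i. 0 \<le> f i" "(\<integral>\<^sup>+i. ennreal (f i) \<partial>count_space UNIV) = ennreal C" "0 \<le> C"
  shows "(\<Sum>i\<in>J. f i) \<le> C"
proof -
  have "ennreal (\<Sum>i\<in>J. f i) = (\<integral>\<^sup>+i. ennreal (f i) \<partial>count_space J)"
    using assms(1,2) by (simp add: nn_integral_count_space_finite)
  also have "\<dots> = (\<integral>\<^sup>+i. ennreal (f i) * indicator J i \<partial>count_space UNIV)"
    by (simp add: nn_integral_count_space_indicator)
  also have "\<dots> \<le> ennreal C" unfolding assms(3)[symmetric] by (intro nn_integral_mono) (auto simp: indicator_def)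
  finally show ?thesis using assms(4) by (simp add: ennreal_le_iff)
qed

lemma nn_integral_count_space_le:
  fixes f :: "'i :: countable \<Rightarrow> real"
  assumes "infinite (UNIV :: 'i set)" "\<And>i. 0 \<le> f i" "\<And>J. finite J \<Longrightarrow> (\<Sum>i\<in>J. f i) \<le> C"
  shows "(\<integral>\<^sup>+i. ennreal (f i) \<partial>count_space UNIV) \<le> ennreal C"
proof -
  let ?e = "from_nat_into (UNIV :: 'i set)"
  have e: "bij_betw ?e UNIV UNIV" using bij_betw_from_nat_into[OF _ assms(1)] by simp
  have "(\<integral>\<^sup>+i. ennreal (f i) \<partial>count_space UNIV) = (\<integral>\<^sup>+n. ennreal (f (?e n)) \<partial>count_space UNIV)"
    by (rule nn_integral_bij_count_space[OF e, symmetric])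
  also have "\<dots> = (\<Sum>n. ennreal (f (?e n)))" by (rule nn_integral_count_space_nat)
  also have "\<dots> \<le> ennreal C"
  proof (rule suminf_le_const)
    show "summable (\<lambda>n. ennreal (f (?e n)))" by (rule summableI)
    fix N
    have "(\<Sum>n<N. ennreal (f (?e n))) = ennreal (\<Sum>n<N. f (?e n))" using assms(2) by simp
    also have "(\<Sum>n<N. f (?e n)) = (\<Sum>i\<in>?e ` {..<N}. f i)"
      using e by (subst sum.reindex) (auto simp: bij_betw_def intro: inj_on_subset)
    also have "ennreal \<dots> \<le> ennreal C" by (intro ennreal_leI assms(3)) simp
    finally show "(\<Sum>n<N. ennreal (f (?e n))) \<le> ennreal C" .
  qed
  finally show ?thesis .
qed

text \<open>Truncated Fourier series of \<open>w\<close> on a period cell containing the support of the cutoff serve as test functions.\<close>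

lemma l2n_le_by_trig_tests:
  assumes w: "w \<in> L2_space" and K: "0 \<le> K"
    and test: "\<And>n (\<zeta> :: int \<times> int \<times> int \<Rightarrow> frequency) a J. finite J \<Longrightarrow>
      \<bar>\<integral>X. w X * trig_test n \<zeta> a J X \<partial>cell_meas\<bar> \<le> K * l2n cell_meas (trig_test n \<zeta> a J)"
  shows "l2n cell_meas w \<le> K"
proof -
  note sw = L2_space_sqint[OF w]
  have bound: "l2n cell_meas (modulate (cutoff n) 1 w) \<le> K" for n
  proof -
    define c where "c = (2 * pi) ^ 3 * real (Suc n)"
    have c: "c > 0" by (simp add: c_def)
    define \<zeta> where "\<zeta> = lattice (real (Suc n))"
    define W where "W i = lfourier (cutoff n) 1 w (\<zeta> i)" for i
    have fin: "(\<Sum>i\<in>J. (norm (W i))\<^sup>2) \<le> K\<^sup>2 * c" if J: "finite J" for J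
    proof -
      define A where "A = (\<Sum>i\<in>J. (norm (W i))\<^sup>2)"
      \<comment> \<open>The conjugated coefficients of \<open>w\<close> turn the pairing with
        \<open>w\<close> into their sum of squares \<open>A\<close>.\<close>
      define \<phi> where "\<phi> = trig_test n \<zeta> (\<lambda>i. cnj (W i)) J"
      have p: "\<phi> \<in> L2_space" unfolding \<phi>_def by (rule trig_test_L2)
      note sp = L2_space_sqint[OF p]
      have A0: "0 \<le> A" unfolding A_def by (intro sum_nonneg) simp
      have "(\<integral>X. w X * \<phi> X \<partial>cell_meas) = A"
        unfolding \<phi>_def integral_trig_test[OF w] A_def W_def[symmetric]
        unfolding cmod_power2 by (intro sum.cong refl) (simp add: power2_eq_square)
      then have A1: "A \<le> K * l2n cell_meas \<phi>" using test[OF J, of n \<zeta> "\<lambda>i. cnj (W i)"] A0 by (simp add: \<phi>_def)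
      \<comment> \<open>The norm of \<open>\<phi>\<close> is estimated through itself: its square is
        a sum against its own lattice coefficients, whose square sum Parseval bounds by c times that
        square. This leaves a norm of at most sqrt (A c), hence A \<le> K sqrt (A c), that is A
        \<le> K^2 c.\<close>
      have "(l2n cell_meas \<phi>)\<^sup>2 = (\<integral>X. \<phi> X * \<phi> X \<partial>cell_meas)"
        by (subst l2n_sq) (simp add: power2_eq_square)
      also have "\<dots> = (\<Sum>i\<in>J. Re (cnj (W i) * lfourier (cutoff n) 1 \<phi> (\<zeta> i)))"
        using integral_trig_test[OF p, of n \<zeta> "\<lambda>i. cnj (W i)" J] unfolding \<phi>_def[symmetric] .
      also have "\<dots> \<le> (\<Sum>i\<in>J. norm (W i) * norm (lfourier (cutoff n) 1 \<phi> (\<zeta> i)))"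
        by (intro sum_mono) (metis complex_Re_le_cmod complex_mod_cnj norm_mult)
      also have "\<dots> \<le> L2_set (\<lambda>i. norm (W i)) J * L2_set (\<lambda>i. norm (lfourier (cutoff n) 1 \<phi> (\<zeta> i))) J"
        using L2_set_mult_ineq[of "\<lambda>i. norm (W i)" "\<lambda>i. norm (lfourier (cutoff n) 1 \<phi> (\<zeta> i))" J] by simp
      also have "\<dots> \<le> sqrt A * (sqrt c * l2n cell_meas \<phi>)"
      proof (rule mult_mono)
        show "L2_set (\<lambda>i. norm (W i)) J \<le> sqrt A" by (simp add: L2_set_def A_def)
        have "(\<Sum>i\<in>J. (norm (lfourier (cutoff n) 1 \<phi> (\<zeta> i)))\<^sup>2) \<le> c * (l2n cell_meas (modulate (cutoff n) 1 \<phi>))\<^sup>2"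
          by (rule sum_le_nn_integral_count_space[OF J]) (use cutoff_lattice[OF sp, of n] c in \<open>auto simp: \<zeta>_def c_def\<close>)
        also have "\<dots> \<le> c * (l2n cell_meas \<phi>)\<^sup>2"
          by (intro mult_left_mono power_mono l2n_modulate_cutoff_le sp) (use c in auto)
        finally have "L2_set (\<lambda>i. norm (lfourier (cutoff n) 1 \<phi> (\<zeta> i))) J \<le> sqrt (c * (l2n cell_meas \<phi>)\<^sup>2)"
          unfolding L2_set_def by (rule real_sqrt_le_mono)
        then show "L2_set (\<lambda>i. norm (lfourier (cutoff n) 1 \<phi> (\<zeta> i))) J \<le> sqrt c * l2n cell_meas \<phi>"
          by (simp add: real_sqrt_mult)
      qed (auto simp: A0 L2_set_nonneg)
      finally have q: "(l2n cell_meas \<phi>)\<^sup>2 \<le> (sqrt A * sqrt c) * l2n cell_meas \<phi>" by (simp add: mult.assoc)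
      have \<phi>le: "l2n cell_meas \<phi> \<le> sqrt A * sqrt c"
      proof (cases "l2n cell_meas \<phi> = 0")
        case True
        then show ?thesis using A0 c by simp
      next
        case False
        then have "l2n cell_meas \<phi> > 0" using l2n_nonneg[of cell_meas \<phi>] by linarith
        then show ?thesis using q unfolding power2_eq_square by (simp only: mult_le_cancel_right_pos)
      qed
      have "A \<le> K * (sqrt A * sqrt c)" using A1 mult_left_mono[OF \<phi>le K] by linarith
      then have "sqrt A * sqrt A \<le> (K * sqrt c) * sqrt A" using A0 by (simp add: mult_ac)
      then have "sqrt A \<le> K * sqrt c"
      proof (cases "A = 0")
        case True
        then show ?thesis using K c by simp
      next
        case False
        then have "sqrt A > 0" using A0 by simp
        then show "sqrt A * sqrt A \<le> (K * sqrt c) * sqrt A \<Longrightarrow> ?thesis" by (simp only: mult_le_cancel_right_pos)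
      qed
      then have "(sqrt A)\<^sup>2 \<le> (K * sqrt c)\<^sup>2" by (rule power_mono) (use A0 in simp)
      then show ?thesis using A0 c by (simp add: A_def[symmetric] power_mult_distrib)
    qed
    have inf: "infinite (UNIV :: (int \<times> int \<times> int) set)" by (simp add: finite_prod)
    have "ennreal (c * (l2n cell_meas (modulate (cutoff n) 1 w))\<^sup>2) \<le> ennreal (K\<^sup>2 * c)"
      using nn_integral_count_space_le[OF inf, of "\<lambda>i. (norm (W i))\<^sup>2", OF _ fin] cutoff_lattice[OF sw, of n]
      by (simp add: W_def \<zeta>_def c_def)
    then have "c * (l2n cell_meas (modulate (cutoff n) 1 w))\<^sup>2 \<le> c * K\<^sup>2"
      using c by (simp add: ennreal_le_iff mult.commute)
    then have "(l2n cell_meas (modulate (cutoff n) 1 w))\<^sup>2 \<le> K\<^sup>2" using c by (simp only: mult_le_cancel_left_pos)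
    then show ?thesis by (rule power2_le_imp_le) (rule K)
  qed
  have "(\<lambda>n. l2n cell_meas (modulate (cutoff n) 1 w)) \<longlonglongrightarrow> l2n cell_meas (\<lambda>X. complex_of_real (w X))"
    by (intro l2n_tendsto sqint_modulate bump_cut sw sqint_of_real cut_tendsto_l2)
  then show ?thesis unfolding l2n_of_real by (rule LIMSEQ_le_const2) (use bound in auto)
qed

section \<open>Decay estimates\<close>

text \<open>Each factor 1 + |\<xi>|^2 costs two derivatives, because the weight of order m is
  comparable to (1 + |\<xi>|^2)^m.\<close>

lemma sobolev_norm_le_multiplier:
  assumes "f \<in> sobolev m" "is_hat f F" "g \<in> sobolev n" "is_hat g H" "0 \<le> C" "m + 2 * q \<le> n"
    and le: "AE \<xi> in freq_meas. norm (F \<xi>) \<le> C * (1 + nsq \<xi>) ^ q * norm (H \<xi>)"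
  shows "sobolev_norm m f \<le> C * sqrt (index_count m * 4 ^ n) * sobolev_norm n g"
proof (rule sobolev_norm_le[OF assms(1-4)])
  have ic: "0 \<le> index_count m" by (simp add: index_count_def)
  show "0 \<le> C * sqrt (index_count m * 4 ^ n)" using ic assms(5) by simp
  show "AE \<xi> in freq_meas. weight m \<xi> * (norm (F \<xi>))\<^sup>2
      \<le> (C * sqrt (index_count m * 4 ^ n))\<^sup>2 * (weight n \<xi> * (norm (H \<xi>))\<^sup>2)"
    using le
  proof (rule AE_mp[OF _ always_eventually], intro allI impI)
    fix \<xi> assume "norm (F \<xi>) \<le> C * (1 + nsq \<xi>) ^ q * norm (H \<xi>)"
    then have sq: "(norm (F \<xi>))\<^sup>2 \<le> (C * (1 + nsq \<xi>) ^ q * norm (H \<xi>))\<^sup>2" by (rule power_mono) simp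
    have N: "1 \<le> 1 + nsq \<xi>" using nsq_nonneg[of \<xi>] by simp
    have "weight m \<xi> * (norm (F \<xi>))\<^sup>2
        \<le> (index_count m * (1 + nsq \<xi>) ^ m) * (C * (1 + nsq \<xi>) ^ q * norm (H \<xi>))\<^sup>2"
      by (rule mult_mono[OF weight_le sq]) (use ic N in auto)
    also have "\<dots> = C\<^sup>2 * index_count m * (norm (H \<xi>))\<^sup>2 * (1 + nsq \<xi>) ^ (m + 2 * q)"
      unfolding power_add power_even_eq power_mult_distrib by (simp only: mult_ac)
    also have "\<dots> \<le> C\<^sup>2 * index_count m * (norm (H \<xi>))\<^sup>2 * (4 ^ n * weight n \<xi>)"
      by (rule mult_left_mono[OF order_trans[OF power_increasing[OF assms(6) N] weight_ge]]) (use ic in auto)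
    also have "\<dots> = (C * sqrt (index_count m * 4 ^ n))\<^sup>2 * (weight n \<xi> * (norm (H \<xi>))\<^sup>2)"
      using ic by (simp only: power_mult_distrib real_sqrt_pow2[OF mult_nonneg_nonneg[OF ic zero_le_power[OF zero_le_numeral]]] mult_ac)
    finally show "weight m \<xi> * (norm (F \<xi>))\<^sup>2
      \<le> (C * sqrt (index_count m * 4 ^ n))\<^sup>2 * (weight n \<xi> * (norm (H \<xi>))\<^sup>2)" .
  qed
qed

lemma L2_norm_le_sobolev_norm:
  assumes f: "f \<in> sobolev m"
  shows "L2_norm f \<le> sobolev_norm m f"
proof -
  note hf = is_hat_hat[OF sobolev_L2[OF f]]
  have o: "order_of (0, 0, 0) \<le> m" by (simp add: order_of_def)
  have s: "symbol (0, 0, 0) \<xi> = 1" for \<xi> by (cases \<xi>) (simp add: symbol_def)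
  have "parseval_const * L2_norm (weak_deriv (0, 0, 0) f) = parseval_const * L2_norm f"
    using L2_norm_weak_deriv(1)[OF f o hf] hat_norm[OF hf L2_space_sqint[OF sobolev_L2[OF f]]]
    by (simp add: s L2_norm_eq[OF sobolev_L2[OF f]])
  then have e: "L2_norm f = L2_norm (weak_deriv (0, 0, 0) f)" using parseval_const_pos by simp
  have "(L2_norm (weak_deriv (0, 0, 0) f))\<^sup>2 \<le> (\<Sum>\<alpha> | order_of \<alpha> \<le> m. (L2_norm (weak_deriv \<alpha> f))\<^sup>2)"
    by (rule member_le_sum[OF _ _ finite_multi_indices]) (use o in auto)
  then show ?thesis unfolding e sobolev_norm_def by (rule real_le_rsqrt)
qed

lemma weak_deriv_le_sobolev_norm:
  assumes f: "f \<in> sobolev m" and a: "order_of \<alpha> \<le> m"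
  shows "l2n cell_meas (weak_deriv \<alpha> f) \<le> sobolev_norm m f"
proof -
  have "(L2_norm (weak_deriv \<alpha> f))\<^sup>2 \<le> (\<Sum>\<alpha> | order_of \<alpha> \<le> m. (L2_norm (weak_deriv \<alpha> f))\<^sup>2)"
    by (rule member_le_sum[OF _ _ finite_multi_indices]) (use a in auto)
  then show ?thesis unfolding sobolev_norm_def L2_norm_eq[OF weak_deriv_sobolev(1)[OF f a], symmetric]
    by (rule real_le_rsqrt)
qed

lemma nsq_eq:
  "nsq (k, \<eta>, l) = (of_int k)\<^sup>2 + \<eta>\<^sup>2 + (of_int l)\<^sup>2"
  "nsq (freq_shear t (k, \<eta>, l)) = (of_int k)\<^sup>2 + (\<eta> - of_int k * t)\<^sup>2 + (of_int l)\<^sup>2"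
  by (simp_all add: nsq_def freq_shear_def)

lemma int_sq_ge_1: "k \<noteq> 0 \<Longrightarrow> 1 \<le> (of_int k :: real)\<^sup>2"
proof -
  assume "k \<noteq> 0"
  then have "1 \<le> k\<^sup>2" by (metis int_one_le_iff_zero_less zero_less_power2)
  then have "of_int 1 \<le> (of_int (k\<^sup>2) :: real)" by (simp only: of_int_le_iff)
  then show ?thesis by simp
qed

lemma nsq_ge_1:
  assumes "fst \<xi> \<noteq> 0"
  shows "1 \<le> nsq \<xi>"
  unfolding nsq_def using int_sq_ge_1[OF assms] by (smt (verit) zero_le_power2)

lemma nsq_gains:
  fixes t :: real
  assumes k: "fst \<xi> \<noteq> 0"
  defines "D \<equiv> nsq (freq_shear t \<xi>)" and "E \<equiv> nsq \<xi>"
  shows "1 + t\<^sup>2 \<le> 2 * (D * E)"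
    "(1 + t\<^sup>2)\<^sup>2 * \<bar>of_int (fst \<xi>) * of_int (snd (snd \<xi>))\<bar> \<le> 14 * (E\<^sup>2 * D\<^sup>2)"
    "(1 + t\<^sup>2)\<^sup>2 * (of_int (fst \<xi>))\<^sup>2 \<le> 14 * (E\<^sup>2 * D\<^sup>2)"
proof -
  obtain k \<eta> l where \<xi>: "\<xi> = (k, \<eta>, l)" by (cases \<xi>) auto
  have k1: "1 \<le> (of_int k :: real)\<^sup>2" using k \<xi> by (intro int_sq_ge_1) simp
  note g = shear_gain[OF k1, where t = t and \<eta> = \<eta> and l = "of_int l"]
  show "1 + t\<^sup>2 \<le> 2 * (D * E)"
    "(1 + t\<^sup>2)\<^sup>2 * \<bar>of_int (fst \<xi>) * of_int (snd (snd \<xi>))\<bar> \<le> 14 * (E\<^sup>2 * D\<^sup>2)"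
    "(1 + t\<^sup>2)\<^sup>2 * (of_int (fst \<xi>))\<^sup>2 \<le> 14 * (E\<^sup>2 * D\<^sup>2)"
    using g unfolding D_def E_def \<xi> nsq_eq by auto
qed

context linear_euler
begin

text \<open>The profile in the sense of scattering theory: with the transport undone,
  \<open>prof_force\<close> is its whole time derivative.\<close>

definition prof :: "3 \<Rightarrow> real \<Rightarrow> scalar_field" where
  "prof i t = moving_frame t (x_nonzero (uc i t))"

definition prof_force :: "3 \<Rightarrow> real \<Rightarrow> scalar_field" where
  "prof_force i t = moving_frame t (x_nonzero (force i t))"

lemma prof_sobolev: "0 \<le> t \<Longrightarrow> prof i t \<in> sobolev 7"
  unfolding prof_def by (intro sobolev_moving_frame sobolev_x_nonzero u_sobolev)

lemma force_eq: "force i t = (\<lambda>X. (if i = 1 then - 1 else 0) * uc 2 t X - weak_deriv (unit_index i) (p t) X)"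
  by (auto simp: force_def)

lemma force_sobolev: "0 \<le> t \<Longrightarrow> force i t \<in> sobolev 1"
  unfolding force_eq
  by (intro sobolev_diff sobolev_cmult sobolev_mono[OF _ u_sobolev, of 1] sobolev_unit_deriv)
    (use p_sobolev[of t] in \<open>auto simp: numeral_2_eq_2\<close>)

lemma prof_force_sobolev: "0 \<le> t \<Longrightarrow> prof_force i t \<in> sobolev 1"
  unfolding prof_force_def by (intro sobolev_moving_frame sobolev_x_nonzero force_sobolev)

abbreviation in_hat :: "frequency \<Rightarrow> complex" where
  "in_hat \<equiv> hat (component u_in 2)"

lemma is_hat_in: "is_hat (component u_in 2) in_hat"
  by (rule is_hat_hat[OF sobolev_L2[OF u_in_sobolev]])

text \<open>With D and E for |\<xi>|^2 after and before the shear, conservation reads D U = E V, and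
  1 + t^2 \<le> 2 D E replaces 1/D by 2 E / (1 + t^2). For k nonzero both D and E are at least
  1.\<close>

lemma u2_hat_bound:
  assumes t: "0 \<le> t"
  shows "AE \<xi> in freq_meas. fst \<xi> \<noteq> 0 \<longrightarrow>
    norm (hat (uc 2 t) (freq_shear t \<xi>)) \<le> 2 / (1 + t\<^sup>2) * (1 + nsq \<xi>) ^ 2 * norm (in_hat \<xi>)"
  using hat_u2_relation[OF t is_hat_hat[OF u_L2[OF t]] is_hat_in]
proof (rule AE_mp[OF _ always_eventually], intro allI impI)
  fix \<xi> assume r: "of_real (nsq (freq_shear t \<xi>)) * hat (uc 2 t) (freq_shear t \<xi>) = of_real (nsq \<xi>) * in_hat \<xi>"
    and k: "fst \<xi> \<noteq> 0"
  define D E where "D = nsq (freq_shear t \<xi>)" and "E = nsq \<xi>"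
  note g' = nsq_gains[OF k, of t, folded D_def E_def]
  have g: "1 \<le> D" "1 \<le> E" unfolding D_def E_def using k by (auto intro: nsq_ge_1)
  define U V where "U = norm (hat (uc 2 t) (freq_shear t \<xi>))" and "V = norm (in_hat \<xi>)"
  have T: "0 < 1 + t\<^sup>2" by (simp add: add_pos_nonneg)
  have UV: "D * U = E * V" using arg_cong[OF r, of norm] g(1,2) by (simp add: norm_mult D_def E_def U_def V_def)
  have U0: "0 \<le> U" "0 \<le> V" by (auto simp: U_def V_def)
  have "(1 + t\<^sup>2) * U \<le> 2 * (D * E) * U" by (rule mult_right_mono[OF g'(1) U0(1)])
  also have "\<dots> = 2 * E * (D * U)" by simp
  also have "\<dots> = 2 * E ^ 2 * V" unfolding UV by (simp add: power2_eq_square)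
  also have "\<dots> \<le> 2 * (1 + E) ^ 2 * V" using g(2) U0 by (intro mult_right_mono mult_left_mono power_mono) auto
  finally show "norm (hat (uc 2 t) (freq_shear t \<xi>)) \<le> 2 / (1 + t\<^sup>2) * (1 + nsq \<xi>) ^ 2 * norm (in_hat \<xi>)"
    using T unfolding U_def[symmetric] V_def[symmetric] E_def[symmetric] by (simp add: field_simps)
qed

lemma u2_decay:
  assumes t: "0 \<le> t"
  shows "sobolev_norm 3 (prof 2 t) \<le> 2 / (1 + t\<^sup>2) * sqrt (index_count 3 * 4 ^ 7) * sobolev_norm 7 (component u_in 2)"
proof (rule sobolev_norm_le_multiplier[OF sobolev_mono[OF _ prof_sobolev[OF t]] _ u_in_sobolev is_hat_in, where q = 2])
  show "is_hat (prof 2 t) (\<lambda>\<xi>. if fst (freq_shear t \<xi>) \<noteq> 0 then hat (uc 2 t) (freq_shear t \<xi>) else 0)"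
    unfolding prof_def
    by (rule hat_moving_frame[OF x_nonzero_L2 hat_x_nonzero[OF _ is_hat_hat]]) (intro u_L2 t)+
  show "AE \<xi> in freq_meas. norm (if fst (freq_shear t \<xi>) \<noteq> 0 then hat (uc 2 t) (freq_shear t \<xi>) else 0)
      \<le> 2 / (1 + t\<^sup>2) * (1 + nsq \<xi>) ^ 2 * norm (in_hat \<xi>)"
    using u2_hat_bound[OF t] by (rule AE_mp[OF _ always_eventually]) auto
qed auto

text \<open>The Poisson equation divides by D once more: D^2 |P| = 2 |k| E V. The last two bounds of
  \<open>nsq_gains\<close> then absorb D^2 together with the factor k or l of the gradient; 28 is 2
  times 14.\<close>

lemma p_hat_bound:
  assumes t: "0 \<le> t" and P: "is_hat (p t) P"
  shows "AE \<xi> in freq_meas. fst \<xi> \<noteq> 0 \<longrightarrow>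
    norm (of_int (fst \<xi>) * P (freq_shear t \<xi>)) \<le> 28 / (1 + t\<^sup>2)\<^sup>2 * (1 + nsq \<xi>) ^ 3 * norm (in_hat \<xi>) \<and>
    norm (of_int (snd (snd \<xi>)) * P (freq_shear t \<xi>)) \<le> 28 / (1 + t\<^sup>2)\<^sup>2 * (1 + nsq \<xi>) ^ 3 * norm (in_hat \<xi>)"
proof -
  note U = is_hat_hat[OF u_L2[OF t], of 2]
  show ?thesis
    using hat_u2_relation[OF t U is_hat_in] AE_freq_shear[OF hat_p_relation[OF t U P], of t]
  proof eventually_elim
    case (elim \<xi>)
    show ?case
    proof (intro impI)
      assume k: "fst \<xi> \<noteq> 0"
      define D E where "D = nsq (freq_shear t \<xi>)" and "E = nsq \<xi>"
      note g' = nsq_gains[OF k, of t, folded D_def E_def]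
      have g: "1 \<le> D" "1 \<le> E" unfolding D_def E_def using k by (auto intro: nsq_ge_1)
      define \<kappa> :: real where "\<kappa> = of_int (fst \<xi>)"
      define W V Q where "W = norm (hat (uc 2 t) (freq_shear t \<xi>))" and "V = norm (in_hat \<xi>)"
        and "Q = norm (P (freq_shear t \<xi>))"
      have UV: "D * W = E * V" using arg_cong[OF elim(1), of norm] g(1,2)
        by (simp add: norm_mult D_def E_def W_def V_def)
      have PU: "D * Q = 2 * \<bar>\<kappa>\<bar> * W" using arg_cong[OF elim(2), of norm] g(1,2)
        by (simp add: norm_mult D_def E_def W_def V_def Q_def \<kappa>_def)
      have V0: "0 \<le> V" by (simp add: V_def)
      have D2: "0 < D\<^sup>2" using g(1) by simp
      have PV: "D\<^sup>2 * Q = 2 * \<bar>\<kappa>\<bar> * (E * V)"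
      proof -
        have "D\<^sup>2 * Q = D * (D * Q)" by (simp add: power2_eq_square)
        also have "\<dots> = 2 * \<bar>\<kappa>\<bar> * (D * W)" unfolding PU by simp
        finally show ?thesis unfolding UV .
      qed
      have main: "\<mu> * Q \<le> 28 / (1 + t\<^sup>2)\<^sup>2 * (1 + E) ^ 3 * V"
        if \<mu>: "(1 + t\<^sup>2)\<^sup>2 * (\<bar>\<kappa>\<bar> * \<mu>) \<le> 14 * (E\<^sup>2 * D\<^sup>2)" for \<mu>
      proof -
        have T: "0 < (1 + t\<^sup>2)\<^sup>2" by (rule zero_less_power) (simp add: add_pos_nonneg)
        have EV: "0 \<le> 2 * (E * V)" using g(2) V0 by simp
        have "D\<^sup>2 * ((1 + t\<^sup>2)\<^sup>2 * (\<mu> * Q)) = (1 + t\<^sup>2)\<^sup>2 * \<mu> * (D\<^sup>2 * Q)" by simp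
        also have "\<dots> = (1 + t\<^sup>2)\<^sup>2 * (\<bar>\<kappa>\<bar> * \<mu>) * (2 * (E * V))" unfolding PV by simp
        also have "\<dots> \<le> 14 * (E\<^sup>2 * D\<^sup>2) * (2 * (E * V))" by (rule mult_right_mono[OF \<mu> EV])
        also have "\<dots> = D\<^sup>2 * (28 * E ^ 3 * V)" by (simp add: power2_eq_square power3_eq_cube)
        finally have "(1 + t\<^sup>2)\<^sup>2 * (\<mu> * Q) \<le> 28 * E ^ 3 * V" using D2 by (simp only: mult_le_cancel_left_pos)
        also have "\<dots> \<le> 28 * (1 + E) ^ 3 * V" using g(2) V0 by (intro mult_right_mono mult_left_mono power_mono) auto
        finally have "\<mu> * Q \<le> 28 * (1 + E) ^ 3 * V / (1 + t\<^sup>2)\<^sup>2"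
          using T by (simp only: pos_le_divide_eq mult.commute[of _ "(1 + t\<^sup>2)\<^sup>2"])
        then show ?thesis by simp
      qed
      have "\<bar>\<kappa>\<bar> * Q \<le> 28 / (1 + t\<^sup>2)\<^sup>2 * (1 + E) ^ 3 * V"
        by (rule main) (use g'(3) in \<open>simp add: \<kappa>_def power2_eq_square\<close>)
      moreover have "\<bar>of_int (snd (snd \<xi>))\<bar> * Q \<le> 28 / (1 + t\<^sup>2)\<^sup>2 * (1 + E) ^ 3 * V"
        by (rule main) (use g'(2) in \<open>simp add: \<kappa>_def abs_mult\<close>)
      ultimately show "norm (of_int (fst \<xi>) * P (freq_shear t \<xi>)) \<le> 28 / (1 + t\<^sup>2)\<^sup>2 * (1 + nsq \<xi>) ^ 3 * norm (in_hat \<xi>) \<and>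
        norm (of_int (snd (snd \<xi>)) * P (freq_shear t \<xi>)) \<le> 28 / (1 + t\<^sup>2)\<^sup>2 * (1 + nsq \<xi>) ^ 3 * norm (in_hat \<xi>)"
        by (simp add: norm_mult \<kappa>_def Q_def V_def E_def)
    qed
  qed
qed

lemma is_hat_prof_force:
  assumes t: "0 \<le> t" and P: "is_hat (p t) P"
  shows "is_hat (prof_force i t) (\<lambda>\<xi>. if fst \<xi> \<noteq> 0 then
    of_real (if i = 1 then - 1 else 0) * hat (uc 2 t) (freq_shear t \<xi>) - symbol (unit_index i) (freq_shear t \<xi>) * P (freq_shear t \<xi>) else 0)"
proof -
  have o: "order_of (unit_index i) \<le> 2" by (simp add: unit_index_def order_of_def)
  have "is_hat (force i t) (\<lambda>\<xi>. of_real (if i = 1 then - 1 else 0) * hat (uc 2 t) \<xi> - symbol (unit_index i) \<xi> * P \<xi>)"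
    unfolding force_eq
    by (rule hat_diff[OF hat_cmult[OF is_hat_hat[OF u_L2[OF t]]] hat_weak_deriv_sobolev[OF p_sobolev[OF t] o P]])
      (rule L2_space_sqint, intro L2_space_cmult u_L2 t dp_L2)+
  from hat_moving_frame[OF x_nonzero_L2[OF force_L2[OF t]] hat_x_nonzero[OF force_L2[OF t] this], of t]
  show ?thesis unfolding prof_force_def by simp
qed

text \<open>Only the z derivative of the pressure drives u3, whence the full rate t^(-4).\<close>

lemma force3_decay:
  assumes t: "0 \<le> t"
  shows "sobolev_norm 1 (prof_force 3 t) \<le> 28 / (1 + t\<^sup>2)\<^sup>2 * sqrt (index_count 1 * 4 ^ 7) * sobolev_norm 7 (component u_in 2)"
proof (rule sobolev_norm_le_multiplier[OF prof_force_sobolev[OF t] is_hat_prof_force[OF t is_hat_hat[OF p_L2[OF t]]] u_in_sobolev is_hat_in, where q = 3])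
  have s: "symbol (unit_index 3) (freq_shear t \<xi>) = \<i> * of_int (snd (snd \<xi>))" for \<xi>
    by (cases \<xi>) (simp add: symbol_def unit_index_def freq_shear_def)
  show "AE \<xi> in freq_meas. norm (if fst \<xi> \<noteq> 0 then of_real (if (3::3) = 1 then - 1 else 0) * hat (uc 2 t) (freq_shear t \<xi>)
      - symbol (unit_index 3) (freq_shear t \<xi>) * hat (p t) (freq_shear t \<xi>) else 0)
      \<le> 28 / (1 + t\<^sup>2)\<^sup>2 * (1 + nsq \<xi>) ^ 3 * norm (in_hat \<xi>)"
    using p_hat_bound[OF t is_hat_hat[OF p_L2[OF t]]]
  proof eventually_elim
    case (elim \<xi>)
    have "0 \<le> 28 / (1 + t\<^sup>2)\<^sup>2 * (1 + nsq \<xi>) ^ 3 * norm (in_hat \<xi>)" using nsq_nonneg[of \<xi>] by simp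
    with elim show ?case by (auto simp: s norm_mult)
  qed
qed auto

text \<open>The term -u2 decays only like t^(-2) and dictates the rate. The constant is 2 from u2
  plus 28 from the pressure, whose faster decay is given away.\<close>

lemma force1_decay:
  assumes t: "0 \<le> t"
  shows "sobolev_norm 1 (prof_force 1 t) \<le> 30 / (1 + t\<^sup>2) * sqrt (index_count 1 * 4 ^ 7) * sobolev_norm 7 (component u_in 2)"
proof (rule sobolev_norm_le_multiplier[OF prof_force_sobolev[OF t] is_hat_prof_force[OF t is_hat_hat[OF p_L2[OF t]]] u_in_sobolev is_hat_in, where q = 3])
  have s: "symbol (unit_index 1) (freq_shear t \<xi>) = \<i> * of_int (fst \<xi>)" for \<xi>
    by (cases \<xi>) (simp add: symbol_def unit_index_def freq_shear_def)
  show "AE \<xi> in freq_meas. norm (if fst \<xi> \<noteq> 0 then of_real (if (1::3) = 1 then - 1 else 0) * hat (uc 2 t) (freq_shear t \<xi>)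
      - symbol (unit_index 1) (freq_shear t \<xi>) * hat (p t) (freq_shear t \<xi>) else 0)
      \<le> 30 / (1 + t\<^sup>2) * (1 + nsq \<xi>) ^ 3 * norm (in_hat \<xi>)"
    using p_hat_bound[OF t is_hat_hat[OF p_L2[OF t]]] u2_hat_bound[OF t]
  proof eventually_elim
    case (elim \<xi>)
    have T: "1 \<le> 1 + t\<^sup>2" "0 < 1 + t\<^sup>2" by (simp_all add: add_pos_nonneg)
    have N: "1 \<le> 1 + nsq \<xi>" using nsq_nonneg[of \<xi>] by simp
    have V0: "0 \<le> norm (in_hat \<xi>)" by simp
    show ?case
    proof (cases "fst \<xi> = 0")
      case True
      then show ?thesis using N by simp
    next
      case False
      have "norm (- hat (uc 2 t) (freq_shear t \<xi>) - \<i> * of_int (fst \<xi>) * hat (p t) (freq_shear t \<xi>))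
          \<le> norm (hat (uc 2 t) (freq_shear t \<xi>)) + norm (of_int (fst \<xi>) * hat (p t) (freq_shear t \<xi>))"
        by (rule order_trans[OF norm_triangle_ineq4]) (simp add: norm_mult)
      also have "norm (hat (uc 2 t) (freq_shear t \<xi>)) \<le> 2 / (1 + t\<^sup>2) * (1 + nsq \<xi>) ^ 2 * norm (in_hat \<xi>)"
        using elim(2) False by simp
      also have "\<dots> \<le> 2 / (1 + t\<^sup>2) * (1 + nsq \<xi>) ^ 3 * norm (in_hat \<xi>)"
        using N by (intro mult_right_mono mult_left_mono power_increasing) auto
      also have "norm (of_int (fst \<xi>) * hat (p t) (freq_shear t \<xi>)) \<le> 28 / (1 + t\<^sup>2)\<^sup>2 * (1 + nsq \<xi>) ^ 3 * norm (in_hat \<xi>)"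
        using elim(1) False by simp
      also have "\<dots> \<le> 28 / (1 + t\<^sup>2) * (1 + nsq \<xi>) ^ 3 * norm (in_hat \<xi>)"
        using N T self_le_power[OF T(1), of 2] by (intro mult_right_mono frac_le) auto
      finally show ?thesis using False by (simp add: s algebra_simps add_divide_distrib[symmetric])
    qed
  qed
qed auto

text \<open>Weak derivative, moving frame and removal of the average together become a finite
  combination of localised coefficients at sheared frequencies. Its coefficients are independent of
  time, and each term obeys \<open>ode_lfourier\<close>.\<close>

lemma evolution_lfourier:
  assumes b: "bump b" and t: "0 \<le> t" and a: "order_of \<alpha> \<le> 1"
  shows "((\<lambda>s. lfourier b 1 (weak_deriv \<alpha> (prof i s)) \<xi>) has_vector_derivative lfourier b 1 (weak_deriv \<alpha> (prof_force i t)) \<xi>) (at t within {0..})"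
proof -
  define q where "q = bump_wave_symbol \<alpha> \<xi> 1"
  \<comment> \<open>The coefficients vanish at k = 0, which encodes \<open>x_nonzero\<close>;
    elsewhere they come from expanding the symbol in derivatives of the bump.\<close>
  define c where "c j = (if fst \<xi> = 0 then 0 else (-1) ^ order_of \<alpha> * coeff q j)" for j
  have e: "lfourier b 1 (weak_deriv \<alpha> (moving_frame s (x_nonzero f))) \<xi> = (\<Sum>j\<le>degree q. c j * lfourier (\<lambda>i. b (i + j)) 1 f (freq_shear s \<xi>))"
    if f: "f \<in> sobolev 1" for f s
  proof -
    note m = sobolev_moving_frame[OF sobolev_x_nonzero[OF f], of s]
    have "lfourier b 1 (weak_deriv \<alpha> (moving_frame s (x_nonzero f))) \<xi> = (-1) ^ order_of \<alpha> * lfourier b q (moving_frame s (x_nonzero f)) \<xi>"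
      unfolding q_def by (rule weak_deriv_lfourier[OF b sobolev_L2[OF m] weak_deriv_sobolev[OF m a]])
    also have "\<dots> = (\<Sum>j\<le>degree q. (-1) ^ order_of \<alpha> * (coeff q j * lfourier (\<lambda>i. b (i + j)) 1 (moving_frame s (x_nonzero f)) \<xi>))"
      unfolding lfourier_expand[OF b L2_space_sqint[OF sobolev_L2[OF m]] order_refl] by (rule sum_distrib_left)
    also have "\<dots> = (\<Sum>j\<le>degree q. c j * lfourier (\<lambda>i. b (i + j)) 1 f (freq_shear s \<xi>))"
      by (intro sum.cong refl)
        (simp add: c_def lfourier_moving_frame[OF bump_shift[OF b] sobolev_L2[OF sobolev_x_nonzero[OF f]]]
          lfourier_x_nonzero[OF bump_shift[OF b] sobolev_L2[OF f]])
    finally show ?thesis .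
  qed
  have "((\<lambda>s. \<Sum>j\<le>degree q. c j * lfourier (\<lambda>i. b (i + j)) 1 (uc i s) (freq_shear s \<xi>)) has_vector_derivative
      (\<Sum>j\<le>degree q. c j * lfourier (\<lambda>i. b (i + j)) 1 (force i t) (freq_shear t \<xi>))) (at t within {0..})"
    by (intro has_vector_derivative_sum has_vector_derivative_mult_right ode_lfourier bump_shift b t)
  then show ?thesis
    unfolding prof_force_def e[OF force_sobolev[OF t]]
  proof (rule has_vector_derivative_transform[rotated 2])
    show "t \<in> {0..}" using t by simp
    fix s :: real assume "s \<in> {0..}"
    then show "lfourier b 1 (weak_deriv \<alpha> (prof i s)) \<xi> = (\<Sum>j\<le>degree q. c j * lfourier (\<lambda>i. b (i + j)) 1 (uc i s) (freq_shear s \<xi>))"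
      unfolding prof_def by (intro e sobolev_mono[OF _ u_sobolev]) auto
  qed
qed

text \<open>By duality an L2 bound follows from pairings with trigonometric tests, and each pairing
  is a scalar function of time whose derivative is at most K B' times the norm of the test. The mean
  value inequality against the primitive \<open>B\<close> takes the place of a vector-valued time
  integral.\<close>

lemma prof_diff_le:
  assumes a: "order_of \<alpha> \<le> 1" and s: "0 \<le> s" "s < t" and K: "0 \<le> K"
    and le: "\<And>\<tau>. 0 \<le> \<tau> \<Longrightarrow> l2n cell_meas (weak_deriv \<alpha> (prof_force i \<tau>)) \<le> K * B' \<tau>"
    and B: "\<And>\<tau>. 0 \<le> \<tau> \<Longrightarrow> (B has_real_derivative B' \<tau>) (at \<tau>)" and mono: "B s \<le> B t"
  shows "l2n cell_meas (\<lambda>X. weak_deriv \<alpha> (prof i t) X - weak_deriv \<alpha> (prof i s) X) \<le> K * (B t - B s)"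
proof (rule l2n_le_by_trig_tests)
  have w: "weak_deriv \<alpha> (prof i \<tau>) \<in> L2_space" if "0 \<le> \<tau>" for \<tau>
    using weak_deriv_sobolev(1)[OF prof_sobolev[OF that]] a by simp
  have wf: "weak_deriv \<alpha> (prof_force i \<tau>) \<in> L2_space" if "0 \<le> \<tau>" for \<tau>
    using weak_deriv_sobolev(1)[OF prof_force_sobolev[OF that] a] .
  have t: "0 \<le> t" using s by simp
  show "(\<lambda>X. weak_deriv \<alpha> (prof i t) X - weak_deriv \<alpha> (prof i s) X) \<in> L2_space"
    by (intro L2_space_diff w s t)
  show "0 \<le> K * (B t - B s)" using K mono by simp
  fix n and \<zeta> :: "int \<times> int \<times> int \<Rightarrow> frequency" and c :: "int \<times> int \<times> int \<Rightarrow> complex" and J :: "(int \<times> int \<times> int) set" assume J: "finite J"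
  define \<phi> where "\<phi> = trig_test n \<zeta> c J"
  have p: "\<phi> \<in> L2_space" unfolding \<phi>_def by (rule trig_test_L2)
  note sp = L2_space_sqint[OF p]
  define h where "h \<tau> = (\<Sum>j\<in>J. Re (c j * lfourier (cutoff n) 1 (weak_deriv \<alpha> (prof i \<tau>)) (\<zeta> j)))" for \<tau>
  define h' where "h' \<tau> = (\<Sum>j\<in>J. Re (c j * lfourier (cutoff n) 1 (weak_deriv \<alpha> (prof_force i \<tau>)) (\<zeta> j)))" for \<tau>
  have hI: "h \<tau> = (\<integral>X. weak_deriv \<alpha> (prof i \<tau>) X * \<phi> X \<partial>cell_meas)" if "0 \<le> \<tau>" for \<tau>
    unfolding h_def \<phi>_def integral_trig_test[OF w[OF that]] ..
  have dh: "(h has_vector_derivative h' \<tau>) (at \<tau> within {0..})" if "0 \<le> \<tau>" for \<tau>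
    unfolding h_def[abs_def] h'_def
    by (intro has_vector_derivative_sum bounded_linear.has_vector_derivative[OF bounded_linear_Re]
        has_vector_derivative_mult_right evolution_lfourier bump_cut that a)
  have "norm (h t - h s) \<le> K * l2n cell_meas \<phi> * B t - K * l2n cell_meas \<phi> * B s"
  proof (rule differentiable_bound_general[OF s(2)])
    show "continuous_on {s..t} (\<lambda>\<tau>. K * l2n cell_meas \<phi> * B \<tau>)"
      by (rule continuous_at_imp_continuous_on, intro ballI continuous_intros DERIV_isCont[OF B]) (use s in auto)
    show "continuous_on {s..t} h"
      by (rule continuous_on_subset[of "{0..}"], rule continuous_on_vector_derivative[OF dh]) (use s in auto)
    fix \<tau> assume \<tau>: "s < \<tau>" "\<tau> < t"
    then have \<tau>0: "0 < \<tau>" using s by simp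
    show "(h has_vector_derivative h' \<tau>) (at \<tau>)"
      using dh[of \<tau>] \<tau>0 at_within_interior[of \<tau> "{0..}"] by simp
    show "((\<lambda>\<tau>. K * l2n cell_meas \<phi> * B \<tau>) has_vector_derivative K * l2n cell_meas \<phi> * B' \<tau>) (at \<tau>)"
      using DERIV_cmult[OF B[of \<tau>], of "K * l2n cell_meas \<phi>"] \<tau>0 by (simp add: has_real_derivative_iff_has_vector_derivative)
    have "h' \<tau> = (\<integral>X. weak_deriv \<alpha> (prof_force i \<tau>) X * \<phi> X \<partial>cell_meas)"
      unfolding h'_def \<phi>_def using \<tau>0 by (subst integral_trig_test[OF wf]) auto
    also have "norm \<dots> \<le> l2n cell_meas (weak_deriv \<alpha> (prof_force i \<tau>)) * l2n cell_meas \<phi>"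
      using \<tau>0 by (intro cauchy_schwarz_l2n' sp L2_space_sqint wf) simp
    also have "\<dots> \<le> K * B' \<tau> * l2n cell_meas \<phi>" using \<tau>0 by (intro mult_right_mono le) auto
    finally show "norm (h' \<tau>) \<le> K * l2n cell_meas \<phi> * B' \<tau>" by (simp add: mult_ac)
  qed
  moreover have "h t - h s = (\<integral>X. (weak_deriv \<alpha> (prof i t) X - weak_deriv \<alpha> (prof i s) X) * \<phi> X \<partial>cell_meas)"
    unfolding hI[OF t] hI[OF s(1)] left_diff_distrib
    using integrable_mult_sqint'[OF L2_space_sqint[OF w[OF t]] sp] integrable_mult_sqint'[OF L2_space_sqint[OF w[OF s(1)]] sp]
    by simp
  ultimately show "\<bar>\<integral>X. (weak_deriv \<alpha> (prof i t) X - weak_deriv \<alpha> (prof i s) X) * trig_test n \<zeta> c J X \<partial>cell_meas\<bar>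
      \<le> K * (B t - B s) * l2n cell_meas (trig_test n \<zeta> c J)"
    by (simp add: \<phi>_def algebra_simps)
qed

end

section \<open>Final state and averages\<close>

lemma weak_deriv_diff:
  assumes f: "f \<in> sobolev m" and g: "g \<in> sobolev m" and a: "order_of \<alpha> \<le> m"
  shows "AE X in cell_meas. weak_deriv \<alpha> (\<lambda>X. f X - g X) X = weak_deriv \<alpha> f X - weak_deriv \<alpha> g X"
proof -
  note d = sobolev_diff[OF f g]
  note sf = L2_space_sqint[OF weak_deriv_sobolev(1)[OF f a]] and sg = L2_space_sqint[OF weak_deriv_sobolev(1)[OF g a]]
    and sd = L2_space_sqint[OF weak_deriv_sobolev(1)[OF d a]]
  note F = is_hat_hat[OF sobolev_L2[OF f]] and H = is_hat_hat[OF sobolev_L2[OF g]]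
  show ?thesis
  proof (rule hat_inject[OF _ _ sd sqint_diff[OF sf sg]])
    show "is_hat (weak_deriv \<alpha> (\<lambda>X. f X - g X)) (\<lambda>\<xi>. symbol \<alpha> \<xi> * (hat f \<xi> - hat g \<xi>))"
      by (rule hat_weak_deriv_sobolev[OF d a hat_diff[OF F H L2_space_sqint[OF sobolev_L2[OF f]] L2_space_sqint[OF sobolev_L2[OF g]]]])
    show "is_hat (\<lambda>X. weak_deriv \<alpha> f X - weak_deriv \<alpha> g X) (\<lambda>\<xi>. symbol \<alpha> \<xi> * hat f \<xi> - symbol \<alpha> \<xi> * hat g \<xi>)"
      by (rule hat_diff[OF hat_weak_deriv_sobolev[OF f a F] hat_weak_deriv_sobolev[OF g a H] sf sg])
  qed (simp add: right_diff_distrib)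
qed

lemma weak_deriv_0_AE:
  assumes "f \<in> sobolev m"
  shows "AE X in cell_meas. weak_deriv (0, 0, 0) f X = f X"
proof (rule weak_deriv_AE_unique[OF sobolev_L2[OF assms] weak_deriv_sobolev(1)[OF assms] sobolev_L2[OF assms] weak_deriv_sobolev(2)[OF assms]])
  show "has_weak_deriv f (0, 0, 0) f" by (simp add: has_weak_deriv_def pd_multi_0 order_of_def)
qed (simp_all add: order_of_def)

lemma L2_space_complete:
  assumes f: "\<And>n. f n \<in> L2_space"
    and cauchy: "\<And>e. e > 0 \<Longrightarrow> \<exists>N. \<forall>m\<ge>N. \<forall>n\<ge>N. l2n cell_meas (\<lambda>X. f m X - f n X) < e"
  obtains g where "g \<in> L2_space" "(\<lambda>n. l2n cell_meas (\<lambda>X. f n X - g X)) \<longlonglongrightarrow> 0"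
proof -
  obtain r where r: "sqint cell_meas (\<lambda>X. lim (\<lambda>i. f (r i) X))"
    "(\<lambda>n. l2n cell_meas (\<lambda>X. f n X - lim (\<lambda>i. f (r i) X))) \<longlonglongrightarrow> 0"
    using l2_complete[OF L2_space_sqint[OF f] cauchy] by blast
  have "periodic_xz (f n)" for n using f[of n] by (simp add: L2_space_def)
  then have "periodic_xz (\<lambda>X. lim (\<lambda>i. f (r i) X))" by (simp add: periodic_xz_def)
  from that[OF L2_spaceI[OF r(1) this] r(2)] show ?thesis .
qed

text \<open>Averages are compared on the whole (y, z) plane, while L2 identities hold on one cell.
  Periodicity spreads them, since countably many translates of a null set in z are still
  null.\<close>

lemma AE_lborel_of_cell:
  fixes r :: "real \<times> real \<Rightarrow> real"
  assumes r [measurable]: "r \<in> borel_measurable borel" and per: "\<And>y z. r (y, z + 2 * pi) = r (y, z)"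
    and z: "AE X in cell_meas. r (snd X) = 0"
  shows "AE Y in lborel. r Y = 0"
proof -
  interpret P: sigma_finite_measure per_meas using finite_per_meas by (rule finite_measure.axioms)
  interpret LP: pair_sigma_finite lborel per_meas ..
  have sp: "sets (lborel \<Otimes>\<^sub>M per_meas) = sets (borel :: (real \<times> real) measure)"
    by (subst borel_prod[symmetric]) (rule sets_pair_measure_cong, simp_all)
  have rm [measurable]: "r \<in> borel_measurable (lborel \<Otimes>\<^sub>M per_meas)"
    using r by (simp only: measurable_cong_sets[OF sp refl])
  have F: "(\<lambda>X::point. ennreal \<bar>r (snd X)\<bar>) \<in> borel_measurable borel" by measurable
  have "(\<integral>\<^sup>+Y. ennreal \<bar>r Y\<bar> * emeasure per_meas (space per_meas) \<partial>(lborel \<Otimes>\<^sub>M per_meas)) = (\<integral>\<^sup>+X. ennreal \<bar>r (snd X)\<bar> \<partial>cell_meas)"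
    unfolding nn_integral_cell[OF F] by simp
  also have "\<dots> = (\<integral>\<^sup>+X. 0 \<partial>cell_meas)" by (rule nn_integral_cong_AE) (use z in auto)
  finally have "(\<integral>\<^sup>+Y. ennreal \<bar>r Y\<bar> * emeasure per_meas (space per_meas) \<partial>(lborel \<Otimes>\<^sub>M per_meas)) = 0" by simp
  then have "AE Y in lborel \<Otimes>\<^sub>M per_meas. ennreal \<bar>r Y\<bar> * emeasure per_meas (space per_meas) = 0"
    by (subst (asm) nn_integral_0_iff_AE) simp_all
  moreover have "emeasure per_meas (space per_meas) \<noteq> 0"
    unfolding per_meas_def by (simp add: emeasure_density)
  ultimately have "AE Y in lborel \<Otimes>\<^sub>M per_meas. r Y = 0" by (auto elim!: eventually_mono)
  then have "AE y in lborel. AE z in per_meas. r (y, z) = 0" by (rule LP.AE_pair)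
  then have "AE y in lborel. AE z in lborel. r (y, z) = 0"
  proof (rule AE_mp[OF _ always_eventually], intro allI impI)
    fix y assume "AE z in per_meas. r (y, z) = 0"
    then have 1: "AE z in lborel. z \<in> {0..2 * pi} \<longrightarrow> r (y, z) = 0"
      unfolding per_meas_def by (subst (asm) AE_density) (auto elim!: eventually_mono simp: indicator_def split: if_splits)
    have "AE z in lborel. \<forall>k::int. z - 2 * pi * of_int k \<in> {0..2 * pi} \<longrightarrow> r (y, z - 2 * pi * of_int k) = 0"
      unfolding AE_all_countable
    proof
      fix k :: int
      have "AE z in distr lborel borel (\<lambda>z. - (2 * pi * of_int k) + z). z \<in> {0..2 * pi} \<longrightarrow> r (y, z) = 0"
        using 1 unfolding lborel_distr_plus .
      then show "AE z in lborel. z - 2 * pi * of_int k \<in> {0..2 * pi} \<longrightarrow> r (y, z - 2 * pi * of_int k) = 0"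
        using AE_distrD[where f = "\<lambda>z. z - 2 * pi * of_int k" and M = lborel and M' = borel
            and P = "\<lambda>z. z \<in> {0..2 * pi} \<longrightarrow> r (y, z) = 0"]
        unfolding uminus_add_conv_diff by measurable
    qed
    then show "AE z in lborel. r (y, z) = 0"
    proof (rule AE_mp[OF _ always_eventually], intro allI impI)
      fix z assume a: "\<forall>k::int. z - 2 * pi * of_int k \<in> {0..2 * pi} \<longrightarrow> r (y, z - 2 * pi * of_int k) = 0"
      define k where "k = \<lfloor>z / (2 * pi)\<rfloor>"
      have tp: "0 < 2 * pi" by simp
      have "of_int k \<le> z / (2 * pi)" "z / (2 * pi) < of_int k + 1" unfolding k_def using floor_correct[of "z / (2 * pi)"] by auto
      then have "of_int k * (2 * pi) \<le> z" "z < (of_int k + 1) * (2 * pi)"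
        unfolding pos_le_divide_eq[OF tp] pos_divide_less_eq[OF tp] by auto
      then have "z - 2 * pi * of_int k \<in> {0..2 * pi}" by (simp add: algebra_simps)
      with a have "r (y, z - 2 * pi * of_int k) = 0" by blast
      moreover have "r (y, z - 2 * pi * of_int k) = r (y, z - 2 * pi * of_int k + 2 * pi * of_int k)"
        using periodic_int[of "\<lambda>z. r (y, z)", OF per, of "z - 2 * pi * of_int k" k] by (simp only:)
      ultimately show "r (y, z) = 0" by simp
    qed
  qed
  moreover have "{Y \<in> space (lborel \<Otimes>\<^sub>M lborel). r Y = 0} \<in> sets (lborel \<Otimes>\<^sub>M lborel)"
    unfolding lborel_prod by measurable
  ultimately have "AE Y in lborel \<Otimes>\<^sub>M lborel. r Y = 0"
    by (intro lborel_pair.AE_pair_measure)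
  then show ?thesis unfolding lborel_prod .
qed

text \<open>Seen as a field constant in x, \<open>r\<close> has transform 0, so Plancherel makes it
  vanish on the cell.\<close>

lemma AE_zero_of_lfourier_zero:
  fixes r :: "real \<times> real \<Rightarrow> real"
  assumes f: "(\<lambda>X. r (snd X)) \<in> L2_space" and lfourier: "\<And>n \<xi>. lfourier (cutoff n) 1 (\<lambda>X. r (snd X)) \<xi> = 0"
  shows "AE Y in lborel. r Y = 0"
proof (rule AE_lborel_of_cell)
  have "(\<lambda>X::point. r (snd X)) \<in> borel_measurable borel" by (rule L2_space_measurable[OF f])
  from measurable_compose[OF _ this, of "\<lambda>Y. (0, Y)" borel] show "r \<in> borel_measurable borel" by simp
  have p: "periodic_xz (\<lambda>X. r (snd X))" using f by (simp add: L2_space_def)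
  show "r (y, z + 2 * pi) = r (y, z)" for y z using p by (simp add: periodic_xz_def)
  have "is_hat (\<lambda>X. r (snd X)) (\<lambda>\<xi>. 0)" unfolding is_hat_def by (simp add: lfourier l2n_def)
  from hat_inject[OF this hat_zero L2_space_sqint[OF f] sqint_zero]
  show "AE X in cell_meas. r (snd X) = 0" by simp
qed

lemma vector_derivative_zero_half_line:
  fixes f :: "real \<Rightarrow> complex"
  assumes "\<And>s. 0 \<le> s \<Longrightarrow> (f has_vector_derivative 0) (at s within {0..})" "0 \<le> t"
  shows "f t = f 0"
proof -
  have "convex {0::real..}" by simp
  from has_vector_derivative_zero_constant[OF this, of f] assms(1)
  obtain c where "\<And>x. x \<in> {0..} \<Longrightarrow> f x = c" by force
  then show ?thesis using assms(2) by simp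
qed

lemma one_plus_sq_pos: "0 < 1 + (t::real)\<^sup>2"
  by (simp add: add_pos_nonneg)

lemma sq_one_plus_le: "(1 + t)\<^sup>2 \<le> 2 * (1 + (t::real)\<^sup>2)"
  using zero_le_power2[of "1 - t"] by (simp add: power2_eq_square algebra_simps)

lemma japanese_le: "0 \<le> t \<Longrightarrow> japanese_bracket t \<le> 1 + t"
  unfolding japanese_bracket_def by (rule real_le_lsqrt) (auto simp: power2_eq_square algebra_simps)

lemma japanese_pos: "0 < japanese_bracket t"
  by (simp add: japanese_bracket_def one_plus_sq_pos)

text \<open>The majorant has the elementary primitive -2/(1 + t), which vanishes at
  infinity.\<close>

lemma decay_le:
  fixes t :: real
  assumes "0 \<le> t"
  shows "1 / (1 + t\<^sup>2) \<le> 2 / (1 + t)\<^sup>2"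
proof -
  have "2 / (2 * (1 + t\<^sup>2)) \<le> 2 / (1 + t)\<^sup>2"
    by (rule divide_left_mono[OF sq_one_plus_le]) (use assms one_plus_sq_pos[of t] in \<open>auto intro!: mult_pos_pos zero_less_power\<close>)
  moreover have "1 / (1 + t\<^sup>2) = 2 / (2 * (1 + t\<^sup>2))" by (rule mult_divide_mult_cancel_left[of 2 1, symmetric, unfolded mult_1_right]) simp
  ultimately show ?thesis by (simp only:)
qed

context linear_euler
begin

text \<open>\<open>B\<close> is a primitive of the decay rate normalised to 0 at infinity, so -B(t)
  is the tail integral of the rate. By \<open>prof_diff_le\<close> every weak derivative of order at
  most 1 of the profile converges in L2, and \<open>has_weak_deriv_limit\<close> identifies the
  limits as weak derivatives of the limit of the profile itself.\<close>

lemma final_state: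
  assumes K: "0 \<le> K"
    and force: "\<And>\<tau>. 0 \<le> \<tau> \<Longrightarrow> sobolev_norm 1 (prof_force i \<tau>) \<le> K * B' \<tau>"
    and B: "\<And>\<tau>. 0 \<le> \<tau> \<Longrightarrow> (B has_real_derivative B' \<tau>) (at \<tau>)"
    and mono: "\<And>s t. 0 \<le> s \<Longrightarrow> s \<le> t \<Longrightarrow> B s \<le> B t" and B0: "(\<lambda>n. B (real n)) \<longlonglongrightarrow> 0"
  obtains g where "\<And>t. 0 \<le> t \<Longrightarrow> (\<lambda>X. prof i t X - g X) \<in> sobolev 1"
    "\<And>t. 0 \<le> t \<Longrightarrow> sobolev_norm 1 (\<lambda>X. prof i t X - g X) \<le> sqrt (index_count 1) * (K * - B t)"
proof -
  have neg: "B t \<le> 0" if "0 \<le> t" for t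
  proof (rule LIMSEQ_le_const[OF B0])
    show "\<exists>N. \<forall>n\<ge>N. B t \<le> B (real n)"
      by (rule exI[of _ "nat \<lceil>t\<rceil>"]) (use that in \<open>auto intro!: mono simp: nat_le_iff ceiling_le_iff\<close>)
  qed
  have ps: "prof i t \<in> sobolev 1" if "0 \<le> t" for t using sobolev_mono[OF _ prof_sobolev[OF that]] by simp
  have ex: "\<exists>h\<in>L2_space. \<forall>t\<ge>0. l2n cell_meas (\<lambda>X. weak_deriv \<alpha> (prof i t) X - h X) \<le> K * - B t"
    if a: "order_of \<alpha> \<le> 1" for \<alpha>
  proof -
    define w where "w t = weak_deriv \<alpha> (prof i t)" for t
    have w: "w t \<in> L2_space" if "0 \<le> t" for t unfolding w_def by (rule weak_deriv_sobolev(1)[OF ps[OF that] a])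
    have sw: "sqint cell_meas (w t)" if "0 \<le> t" for t by (rule L2_space_sqint[OF w[OF that]])
    have d: "l2n cell_meas (\<lambda>X. w t X - w s X) \<le> K * (B t - B s)" if "0 \<le> s" "s \<le> t" for s t
    proof (cases "s = t")
      case True
      then show ?thesis by (simp add: l2n_def)
    next
      case False
      then have "s < t" using that by simp
      show ?thesis unfolding w_def
        by (rule prof_diff_le[OF a that(1) \<open>s < t\<close> K order_trans[OF weak_deriv_le_sobolev_norm[OF prof_force_sobolev a] force] B mono[OF that]])
    qed
    have d': "l2n cell_meas (\<lambda>X. w (real m) X - w (real n) X) \<le> K * - B (real N)" if "N \<le> m" "N \<le> n" for N m n
    proof -
      have le: "l2n cell_meas (\<lambda>X. w (real b) X - w (real a) X) \<le> K * - B (real N)" if "N \<le> a" "a \<le> b" for a b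
      proof -
        have "B (real b) - B (real a) \<le> - B (real N)"
          using neg[of "real b"] mono[of "real N" "real a"] that by simp
        then show ?thesis using d[of "real a" "real b"] that mult_left_mono[OF _ K] by force
      qed
      show ?thesis
        using le[of m n] le[of n m] that l2n_minus_commute[of cell_meas "w (real m)" "w (real n)"] by (cases "m \<le> n") auto
    qed
    have KB: "(\<lambda>N. K * - B (real N)) \<longlonglongrightarrow> 0"
      using tendsto_mult_left[OF tendsto_minus[OF B0], of K] by simp
    \<comment> \<open>Completeness is used along integer times; the bound at a real time t then
      follows by comparison with large integers.\<close>
    have "\<exists>h\<in>L2_space. (\<lambda>n. l2n cell_meas (\<lambda>X. w (real n) X - h X)) \<longlonglongrightarrow> 0"
    proof (rule L2_space_complete[of "\<lambda>n. w (real n)"])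
      show "w (real n) \<in> L2_space" for n by (rule w) simp
      fix e :: real assume "e > 0"
      then obtain N where "K * - B (real N) < e"
        using order_tendstoD(2)[OF KB, of e] by (auto simp: eventually_sequentially)
      then show "\<exists>N. \<forall>m\<ge>N. \<forall>n\<ge>N. l2n cell_meas (\<lambda>X. w (real m) X - w (real n) X) < e"
        using d' order_le_less_trans by blast
    qed blast
    then obtain h where h: "h \<in> L2_space" "(\<lambda>n. l2n cell_meas (\<lambda>X. w (real n) X - h X)) \<longlonglongrightarrow> 0" by blast
    have "l2n cell_meas (\<lambda>X. w t X - h X) \<le> K * - B t" if t: "0 \<le> t" for t
    proof (rule LIMSEQ_le_const)
      show "(\<lambda>n. K * - B t + l2n cell_meas (\<lambda>X. w (real n) X - h X)) \<longlonglongrightarrow> K * - B t"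
        using tendsto_add[OF tendsto_const[of "K * - B t"] h(2)] by simp
      show "\<exists>N. \<forall>n\<ge>N. l2n cell_meas (\<lambda>X. w t X - h X) \<le> K * - B t + l2n cell_meas (\<lambda>X. w (real n) X - h X)"
      proof (rule exI[of _ "nat \<lceil>t\<rceil>"], intro allI impI)
        fix n assume "nat \<lceil>t\<rceil> \<le> n"
        then have tn: "t \<le> real n" by (simp add: nat_le_iff ceiling_le_iff)
        have "l2n cell_meas (\<lambda>X. w t X - h X) \<le> l2n cell_meas (\<lambda>X. w t X - w (real n) X) + l2n cell_meas (\<lambda>X. w (real n) X - h X)"
          by (rule l2n_triangle_diff[OF sw sw L2_space_sqint[OF h(1)]]) (use t in auto)
        moreover have "l2n cell_meas (\<lambda>X. w t X - w (real n) X) \<le> K * (B (real n) - B t)"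
          using d[OF t tn] by (subst l2n_minus_commute)
        moreover have "K * (B (real n) - B t) \<le> K * - B t"
          using neg[of "real n"] by (intro mult_left_mono K) simp
        ultimately show "l2n cell_meas (\<lambda>X. w t X - h X) \<le> K * - B t + l2n cell_meas (\<lambda>X. w (real n) X - h X)" by linarith
      qed
    qed
    with h(1) show ?thesis unfolding w_def by blast
  qed
  have "\<forall>\<alpha>. \<exists>h. order_of \<alpha> \<le> 1 \<longrightarrow> h \<in> L2_space \<and> (\<forall>t\<ge>0. l2n cell_meas (\<lambda>X. weak_deriv \<alpha> (prof i t) X - h X) \<le> K * - B t)"
    using ex by blast
  then obtain h where h: "\<And>\<alpha>. order_of \<alpha> \<le> 1 \<Longrightarrow> h \<alpha> \<in> L2_space"
    "\<And>\<alpha> t. order_of \<alpha> \<le> 1 \<Longrightarrow> 0 \<le> t \<Longrightarrow> l2n cell_meas (\<lambda>X. weak_deriv \<alpha> (prof i t) X - h \<alpha> X) \<le> K * - B t"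
    by metis
  \<comment> \<open>The index (0, 0, 0) yields the state itself, because the weak derivative of
    order 0 agrees with the function almost everywhere.\<close>
  define g where "g = h (0, 0, 0)"
  have o0: "order_of (0, 0, 0) \<le> 1" by (simp add: order_of_def)
  have lim: "(\<lambda>n. l2n cell_meas (\<lambda>X. weak_deriv \<alpha> (prof i (real n)) X - h \<alpha> X)) \<longlonglongrightarrow> 0" if a: "order_of \<alpha> \<le> 1" for \<alpha>
  proof (rule tendsto_0_le)
    show "(\<lambda>n. K * - B (real n)) \<longlonglongrightarrow> 0"
      using tendsto_mult_left[OF tendsto_minus[OF B0], of K] by simp
  qed (use h(2)[OF a] in auto)
  have "l2n cell_meas (\<lambda>X. prof i (real n) X - g X) = l2n cell_meas (\<lambda>X. weak_deriv (0, 0, 0) (prof i (real n)) X - h (0, 0, 0) X)" for n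
  proof (rule l2n_cong_AE)
    have n: "prof i (real n) \<in> sobolev 1" by (rule ps) simp
    show "AE X in cell_meas. norm (prof i (real n) X - g X) = norm (weak_deriv (0, 0, 0) (prof i (real n)) X - h (0, 0, 0) X)"
      using weak_deriv_0_AE[OF n] by eventually_elim (simp add: g_def)
    show "(\<lambda>X. prof i (real n) X - g X) \<in> borel_measurable cell_meas"
      "(\<lambda>X. weak_deriv (0, 0, 0) (prof i (real n)) X - h (0, 0, 0) X) \<in> borel_measurable cell_meas"
      unfolding borel_measurable_cell g_def
      by (intro borel_measurable_diff L2_space_measurable sobolev_L2[OF n] h(1) o0 weak_deriv_sobolev(1)[OF n o0])+
  qed
  then have lim0: "(\<lambda>n. l2n cell_meas (\<lambda>X. prof i (real n) X - g X)) \<longlonglongrightarrow> 0" using lim[OF o0] by simp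
  have g: "g \<in> L2_space" unfolding g_def by (rule h(1)[OF o0])
  have wg: "has_weak_deriv g \<alpha> (h \<alpha>)" if a: "order_of \<alpha> \<le> 1" for \<alpha>
  proof (rule has_weak_deriv_limit[OF _ _ g h(1)[OF a] lim0 lim[OF a]])
    fix n
    have n: "prof i (real n) \<in> sobolev 1" by (rule ps) simp
    show "prof i (real n) \<in> L2_space" "weak_deriv \<alpha> (prof i (real n)) \<in> L2_space"
      "has_weak_deriv (prof i (real n)) \<alpha> (weak_deriv \<alpha> (prof i (real n)))"
      by (rule sobolev_L2[OF n], rule weak_deriv_sobolev[OF n a], rule weak_deriv_sobolev[OF n a])
  qed
  have gs: "g \<in> sobolev 1" using g h(1) wg unfolding sobolev_def by blast
  show ?thesis
  proof (rule that[of g])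
    fix t :: real assume t: "0 \<le> t"
    note d = sobolev_diff[OF ps[OF t] gs]
    show "(\<lambda>X. prof i t X - g X) \<in> sobolev 1" by (rule d)
    have Kn: "0 \<le> K * - B t" using K neg[OF t] by (simp add: mult_nonneg_nonpos)
    have "L2_norm (weak_deriv \<alpha> (\<lambda>X. prof i t X - g X)) \<le> K * - B t" if a: "order_of \<alpha> \<le> 1" for \<alpha>
    proof -
      note wd = weak_deriv_sobolev(1)[OF d a] and wp = weak_deriv_sobolev(1)[OF ps[OF t] a]
        and wg' = weak_deriv_sobolev[OF gs a]
      have "L2_norm (weak_deriv \<alpha> (\<lambda>X. prof i t X - g X)) = l2n cell_meas (weak_deriv \<alpha> (\<lambda>X. prof i t X - g X))"
        by (rule L2_norm_eq[OF wd])
      also have "\<dots> = l2n cell_meas (\<lambda>X. weak_deriv \<alpha> (prof i t) X - h \<alpha> X)"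
      proof (rule l2n_cong_AE)
        show "AE X in cell_meas. norm (weak_deriv \<alpha> (\<lambda>X. prof i t X - g X) X) = norm (weak_deriv \<alpha> (prof i t) X - h \<alpha> X)"
          using weak_deriv_diff[OF ps[OF t] gs a] weak_deriv_AE_unique[OF g wg'(1) h(1)[OF a] wg'(2) wg[OF a]]
          by eventually_elim simp
        show "weak_deriv \<alpha> (\<lambda>X. prof i t X - g X) \<in> borel_measurable cell_meas"
          "(\<lambda>X. weak_deriv \<alpha> (prof i t) X - h \<alpha> X) \<in> borel_measurable cell_meas"
          unfolding borel_measurable_cell by (intro borel_measurable_diff L2_space_measurable wd wp h(1)[OF a])+
      qed
      also have "\<dots> \<le> K * - B t" by (rule h(2)[OF a t])
      finally show ?thesis .
    qed
    then have "(\<Sum>\<alpha> | order_of \<alpha> \<le> 1. (L2_norm (weak_deriv \<alpha> (\<lambda>X. prof i t X - g X)))\<^sup>2)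
        \<le> (\<Sum>\<alpha> | order_of \<alpha> \<le> 1. (K * - B t)\<^sup>2)"
      by (intro sum_mono power_mono) (auto simp: L2_norm_def set_lebesgue_integral_def intro!: integral_nonneg_AE)
    also have "\<dots> = index_count 1 * (K * - B t)\<^sup>2" by (simp add: index_count_def)
    finally have "sobolev_norm 1 (\<lambda>X. prof i t X - g X) \<le> sqrt (index_count 1 * (K * - B t)\<^sup>2)"
      unfolding sobolev_norm_def by (rule real_sqrt_le_mono)
    also have "\<dots> = sqrt (index_count 1) * (K * - B t)"
      unfolding real_sqrt_mult real_sqrt_abs abs_of_nonneg[OF Kn] ..
    finally show "sobolev_norm 1 (\<lambda>X. prof i t X - g X) \<le> sqrt (index_count 1) * (K * - B t)" .
  qed
qed

text \<open>At k = 0 the Poisson equation says |\<xi>|^2 P = 0, so P vanishes unless \<xi> = 0,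
  where the symbol of a first derivative vanishes. This holds only almost everywhere in \<xi>; it
  makes the x-mean of the gradient a null function, and hence its localised coefficients vanish at
  every single \<xi>.\<close>

lemma lfourier_pressure_average:
  assumes b: "bump b" and t: "0 \<le> t" and k: "fst \<xi> = 0"
  shows "lfourier b 1 (weak_deriv (unit_index i) (p t)) \<xi> = 0"
proof -
  let ?d = "weak_deriv (unit_index i) (p t)"
  note d = dp_L2[OF t, of i]
  have o: "order_of (unit_index i) \<le> 2" by (simp add: unit_index_def order_of_def)
  note P = is_hat_hat[OF p_L2[OF t]]
  note h = hat_x_mean[OF d hat_weak_deriv_sobolev[OF p_sobolev[OF t] o P]]
  have "AE \<xi> in freq_meas. (if fst \<xi> = 0 then symbol (unit_index i) \<xi> * hat (p t) \<xi> else 0) = 0"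
    using hat_p_relation[OF t is_hat_hat[OF u_L2[OF t]] P]
  proof eventually_elim
    case (elim \<zeta>)
    show ?case
    proof (cases "hat (p t) \<zeta> = 0 \<or> fst \<zeta> \<noteq> 0")
      case False
      then have "nsq \<zeta> = 0" using elim by auto
      then have "fst \<zeta> = 0" "fst (snd \<zeta>) = 0" "snd (snd \<zeta>) = 0"
        unfolding nsq_def by (auto simp: add_nonneg_eq_0_iff)
      then show ?thesis by (cases \<zeta>) (simp add: symbol_def unit_index_def)
    qed auto
  qed
  from hat_inject[OF h hat_zero L2_space_sqint[OF x_mean_L2[OF d]] sqint_zero this]
  have z: "AE X in cell_meas. x_mean ?d X = 0 * (0::real)" by simp
  have "lfourier b 1 ?d \<xi> = lfourier b 1 (x_mean ?d) \<xi>" using lfourier_x_mean[OF b d, of 1 \<xi>] k by simp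
  also have "\<dots> = lfourier b 1 (\<lambda>X. 0 * (0::real)) \<xi>"
    by (rule lfourier_cong_AE[OF b L2_space_measurable[OF x_mean_L2[OF d]] _ z]) simp
  also have "\<dots> = 0" by (subst lfourier_cmult) simp
  finally show ?thesis .
qed

text \<open>At k = 0 the shear acts trivially and the pressure drops out, which leaves only the term
  -u2 in the first component.\<close>

lemma ode_lfourier_average:
  assumes b: "bump b" and t: "0 \<le> t" and k: "fst \<xi> = 0"
  shows "((\<lambda>s. lfourier b 1 (uc i s) \<xi>) has_vector_derivative (if i = 1 then - lfourier b 1 (uc 2 t) \<xi> else 0)) (at t within {0..})"
proof -
  have s: "freq_shear s \<xi> = \<xi>" for s using k by (cases \<xi>) (simp add: freq_shear_def)
  have "lfourier b 1 (force i t) \<xi> = (if i = 1 then - 1 else 0) * lfourier b 1 (uc 2 t) \<xi> - lfourier b 1 (weak_deriv (unit_index i) (p t)) \<xi>"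
    unfolding force_eq
    by (subst lfourier_diff[OF b L2_space_sqint[OF L2_space_cmult[OF u_L2[OF t]]] L2_space_sqint[OF dp_L2[OF t]]]) (simp add: lfourier_cmult)
  then show ?thesis using ode_lfourier[OF b t, of i \<xi>] lfourier_pressure_average[OF b t k] by (cases "i = 1") (simp_all add: s)
qed

lemma lfourier_average_23:
  assumes b: "bump b" and t: "0 \<le> t" and k: "fst \<xi> = 0" and i: "i \<noteq> 1"
  shows "lfourier b 1 (uc i t) \<xi> = lfourier b 1 (component u_in i) \<xi>"
  using vector_derivative_zero_half_line[of "\<lambda>s. lfourier b 1 (uc i s) \<xi>" t] ode_lfourier_average[OF b _ k, of _ i] i t
  by (simp add: lfourier_initial[OF b])

text \<open>The average of u2 is constant in time by \<open>lfourier_average_23\<close>, so adding t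
  times it to the average of u1 gives a function with derivative 0.\<close>

lemma lfourier_average_1:
  assumes b: "bump b" and t: "0 \<le> t" and k: "fst \<xi> = 0"
  shows "lfourier b 1 (uc 1 t) \<xi> = lfourier b 1 (component u_in 1) \<xi> - of_real t * lfourier b 1 (component u_in 2) \<xi>"
proof -
  have "lfourier b 1 (uc 1 t) \<xi> + of_real t * lfourier b 1 (component u_in 2) \<xi> = lfourier b 1 (uc 1 0) \<xi> + of_real 0 * lfourier b 1 (component u_in 2) \<xi>"
  proof (rule vector_derivative_zero_half_line[OF _ t])
    fix s :: real assume s: "0 \<le> s"
    have r: "((\<lambda>s. of_real s * lfourier b 1 (component u_in 2) \<xi>) has_vector_derivative lfourier b 1 (component u_in 2) \<xi>) (at s within {0..})"
      by (auto intro!: derivative_eq_intros)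
    have "((\<lambda>s. lfourier b 1 (uc 1 s) \<xi>) has_vector_derivative - lfourier b 1 (component u_in 2) \<xi>) (at s within {0..})"
      using ode_lfourier_average[OF b s k, of 1] lfourier_average_23[OF b s k, of 2] by simp
    from has_vector_derivative_add[OF this r]
    show "((\<lambda>s. lfourier b 1 (uc 1 s) \<xi> + of_real s * lfourier b 1 (component u_in 2) \<xi>) has_vector_derivative 0) (at s within {0..})"
      by simp
  qed
  then show ?thesis by (simp add: lfourier_initial[OF b] algebra_simps)
qed

lemma average_23:
  assumes t: "0 \<le> t" and i: "i \<noteq> 1"
  shows "AE Y in lborel. x_average (uc i t) Y = x_average (component u_in i) Y"
proof -
  note u = u_L2[OF t, of i] and v = sobolev_L2[OF u_in_sobolev, of i]
  have "AE Y in lborel. x_average (uc i t) Y - x_average (component u_in i) Y = 0"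
  proof (rule AE_zero_of_lfourier_zero)
    show "(\<lambda>X. x_average (uc i t) (snd X) - x_average (component u_in i) (snd X)) \<in> L2_space"
      unfolding x_mean_def[symmetric] by (intro L2_space_diff x_mean_L2 u v)
    show "lfourier (cutoff n) 1 (\<lambda>X. x_average (uc i t) (snd X) - x_average (component u_in i) (snd X)) \<xi> = 0" for n \<xi>
      unfolding x_mean_def[symmetric]
        lfourier_diff[OF bump_cut L2_space_sqint[OF x_mean_L2[OF u]] L2_space_sqint[OF x_mean_L2[OF v]]]
        lfourier_x_mean[OF bump_cut u] lfourier_x_mean[OF bump_cut v]
      using lfourier_average_23[OF bump_cut t _ i] by simp
  qed
  then show ?thesis by eventually_elim simp
qed

lemma average_1:
  assumes t: "0 \<le> t"
  shows "AE Y in lborel. x_average (uc 1 t) Y = x_average (component u_in 1) Y - t * x_average (component u_in 2) Y"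
proof -
  note u = u_L2[OF t, of 1] and v = sobolev_L2[OF u_in_sobolev]
  have d: "(\<lambda>X. x_mean (component u_in 1) X - t * x_mean (component u_in 2) X) \<in> L2_space"
    by (intro L2_space_diff L2_space_cmult x_mean_L2 v)
  have "AE Y in lborel. x_average (uc 1 t) Y - (x_average (component u_in 1) Y - t * x_average (component u_in 2) Y) = 0"
  proof (rule AE_zero_of_lfourier_zero)
    show "(\<lambda>X. x_average (uc 1 t) (snd X) - (x_average (component u_in 1) (snd X) - t * x_average (component u_in 2) (snd X))) \<in> L2_space"
      unfolding x_mean_def[symmetric] by (intro L2_space_diff[OF _ d] x_mean_L2 u)
    show "lfourier (cutoff n) 1 (\<lambda>X. x_average (uc 1 t) (snd X) - (x_average (component u_in 1) (snd X) - t * x_average (component u_in 2) (snd X))) \<xi> = 0" for n \<xi>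
      unfolding x_mean_def[symmetric]
        lfourier_diff[OF bump_cut L2_space_sqint[OF x_mean_L2[OF u]] L2_space_sqint[OF d]]
        lfourier_diff[OF bump_cut L2_space_sqint[OF x_mean_L2[OF v]] L2_space_sqint[OF L2_space_cmult[OF x_mean_L2[OF v]]]]
        lfourier_cmult lfourier_x_mean[OF bump_cut u] lfourier_x_mean[OF bump_cut v]
      using lfourier_average_1[OF bump_cut t] by simp
  qed
  then show ?thesis by eventually_elim simp
qed

lemma u2_in_le: "sobolev_norm 7 (component u_in 2) \<le> sobolev_vec_norm 7 u_in"
proof -
  have "(sobolev_norm 7 (component u_in 2))\<^sup>2 \<le> (\<Sum>i\<in>UNIV. (sobolev_norm 7 (component u_in i))\<^sup>2)"
    by (rule member_le_sum) auto
  then show ?thesis unfolding sobolev_vec_norm_def by (rule real_le_rsqrt)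
qed

text \<open>The rate 2/(1 + t)^2 has the primitive -2/(1 + t), so 60 is the 30 of
  \<open>force1_decay\<close> times 2; \<open>japanese_le\<close> converts 1 + t into the
  bracket.\<close>

lemma final_state_1:
  obtains g where "\<And>t. 0 \<le> t \<Longrightarrow> (\<lambda>X. prof 1 t X - g X) \<in> sobolev 1"
    "\<And>t. 0 \<le> t \<Longrightarrow> sobolev_norm 1 (\<lambda>X. prof 1 t X - g X)
      \<le> 60 * sqrt (index_count 1) * sqrt (index_count 1 * 4 ^ 7) * sobolev_vec_norm 7 u_in / japanese_bracket t"
proof -
  define S where "S = sobolev_norm 7 (component u_in 2)"
  define q where "q = sqrt (index_count 1 * 4 ^ 7)"
  have S: "0 \<le> S" "S \<le> sobolev_vec_norm 7 u_in" unfolding S_def by (rule sobolev_norm_nonneg, rule u2_in_le)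
  have q: "0 \<le> q" "0 \<le> sqrt (index_count 1)" by (simp_all add: q_def index_count_def)
  show ?thesis
  proof (rule final_state[of "30 * q * S" 1 "\<lambda>\<tau>. 2 / (1 + \<tau>)\<^sup>2" "\<lambda>\<tau>. - 2 / (1 + \<tau>)"])
    show "0 \<le> 30 * q * S" using q S by simp
    show "sobolev_norm 1 (prof_force 1 \<tau>) \<le> 30 * q * S * (2 / (1 + \<tau>)\<^sup>2)" if "0 \<le> \<tau>" for \<tau>
    proof -
      from mult_left_mono[OF decay_le[OF that], of "30 * q * S"] q S
      show ?thesis using force1_decay[OF that] unfolding S_def[symmetric] q_def[symmetric] by (simp add: mult_ac)
    qed
    show "((\<lambda>\<tau>. - 2 / (1 + \<tau>)) has_real_derivative 2 / (1 + \<tau>)\<^sup>2) (at \<tau>)" if "0 \<le> \<tau>" for \<tau>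
      using that by (auto intro!: derivative_eq_intros simp: power2_eq_square)
    show "- 2 / (1 + s) \<le> - 2 / (1 + t)" if "0 \<le> s" "s \<le> t" for s t :: real
      using that by (simp add: frac_le)
    show "(\<lambda>n. - 2 / (1 + real n)) \<longlonglongrightarrow> 0"
      using tendsto_mult_left[OF LIMSEQ_inverse_real_of_nat, of "- 2"] by (simp add: divide_inverse)
    fix g assume g: "\<And>t. 0 \<le> t \<Longrightarrow> (\<lambda>X. prof 1 t X - g X) \<in> sobolev 1"
      "\<And>t. 0 \<le> t \<Longrightarrow> sobolev_norm 1 (\<lambda>X. prof 1 t X - g X) \<le> sqrt (index_count 1) * (30 * q * S * - (- 2 / (1 + t)))"
    show ?thesis
    proof (rule that[OF g(1)])
      fix t :: real assume t: "0 \<le> t"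
      have "sobolev_norm 1 (\<lambda>X. prof 1 t X - g X) \<le> sqrt (index_count 1) * (30 * q * S * - (- 2 / (1 + t)))" by (rule g(2)[OF t])
      also have "\<dots> = 60 * sqrt (index_count 1) * q * S / (1 + t)" by simp
      also have "\<dots> \<le> 60 * sqrt (index_count 1) * q * sobolev_vec_norm 7 u_in / japanese_bracket t"
        by (rule frac_le) (use S q japanese_pos japanese_le[OF t] in \<open>auto intro!: mult_left_mono mult_nonneg_nonneg\<close>)
      finally show "sobolev_norm 1 (\<lambda>X. prof 1 t X - g X)
        \<le> 60 * sqrt (index_count 1) * sqrt (index_count 1 * 4 ^ 7) * sobolev_vec_norm 7 u_in / japanese_bracket t"
        unfolding q_def .
    qed
  qed
qed

text \<open>The squared majorant 4/(1 + t)^4 has the primitive -(4/3)/(1 + t)^3. The resulting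
  constant 28 times 4/3, that is 112/3, is relaxed to 60 so that both final states share one
  constant.\<close>

lemma final_state_3:
  obtains g where "\<And>t. 0 \<le> t \<Longrightarrow> (\<lambda>X. prof 3 t X - g X) \<in> sobolev 1"
    "\<And>t. 0 \<le> t \<Longrightarrow> sobolev_norm 1 (\<lambda>X. prof 3 t X - g X)
      \<le> 60 * sqrt (index_count 1) * sqrt (index_count 1 * 4 ^ 7) * sobolev_vec_norm 7 u_in / japanese_bracket t ^ 3"
proof -
  define S where "S = sobolev_norm 7 (component u_in 2)"
  define q where "q = sqrt (index_count 1 * 4 ^ 7)"
  have S: "0 \<le> S" "S \<le> sobolev_vec_norm 7 u_in" unfolding S_def by (rule sobolev_norm_nonneg, rule u2_in_le)
  have q: "0 \<le> q" "0 \<le> sqrt (index_count 1)" by (simp_all add: q_def index_count_def)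
  show ?thesis
  proof (rule final_state[of "28 * q * S" 3 "\<lambda>\<tau>. 4 / (1 + \<tau>) ^ 4" "\<lambda>\<tau>. - (4 / 3) / (1 + \<tau>) ^ 3"])
    show "0 \<le> 28 * q * S" using q S by simp
    show "sobolev_norm 1 (prof_force 3 \<tau>) \<le> 28 * q * S * (4 / (1 + \<tau>) ^ 4)" if "0 \<le> \<tau>" for \<tau>
    proof -
      have "(1 / (1 + \<tau>\<^sup>2))\<^sup>2 \<le> (2 / (1 + \<tau>)\<^sup>2)\<^sup>2" using one_plus_sq_pos[of \<tau>] decay_le[OF that] by (intro power_mono) auto
      then have "1 / (1 + \<tau>\<^sup>2)\<^sup>2 \<le> 4 / (1 + \<tau>) ^ 4" by (simp add: power_divide power_mult[symmetric])
      from mult_left_mono[OF this, of "28 * q * S"] q S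
      show ?thesis using force3_decay[OF that] unfolding S_def[symmetric] q_def[symmetric] by (simp add: mult_ac)
    qed
    show "((\<lambda>\<tau>. - (4 / 3) / (1 + \<tau>) ^ 3) has_real_derivative 4 / (1 + \<tau>) ^ 4) (at \<tau>)" if "0 \<le> \<tau>" for \<tau>
    proof -
      \<comment> \<open>The left-hand side is the product form in which
        \<open>DERIV_inverse'\<close> delivers the derivative.\<close>
      have a: "- (4 / 3) * - (inverse (a ^ 3) * (3 * a\<^sup>2) * inverse (a ^ 3)) = 4 / a ^ 4" if "0 < a" for a :: real
      proof -
        have "inverse (a ^ 3) * a\<^sup>2 * inverse (a ^ 3) = a\<^sup>2 / a ^ (4 + 2)"
          by (simp add: divide_inverse power_add[symmetric] inverse_mult_distrib[symmetric] del: inverse_mult_distrib)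
        also have "\<dots> = 1 / a ^ 4" unfolding power_add using that by (simp only: divide_inverse inverse_mult_distrib) simp
        finally have e: "inverse (a ^ 3) * a\<^sup>2 * inverse (a ^ 3) = 1 / a ^ 4" .
        have "- (4 / 3) * - (inverse (a ^ 3) * (3 * a\<^sup>2) * inverse (a ^ 3)) = 4 * (inverse (a ^ 3) * a\<^sup>2 * inverse (a ^ 3))" by simp
        then show ?thesis unfolding e by simp
      qed
      have d: "((\<lambda>\<tau>. (1 + \<tau>) ^ 3) has_real_derivative 3 * (1 + \<tau>)\<^sup>2) (at \<tau>)" by (auto intro!: derivative_eq_intros)
      have "(1 + \<tau>) ^ 3 \<noteq> 0" using that by auto
      from DERIV_cmult[OF DERIV_inverse'[OF d this], of "- (4 / 3)"] that
      show ?thesis unfolding divide_inverse[of "- (4 / 3)"] by (subst (asm) a) auto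
    qed
    show "- (4 / 3) / (1 + s) ^ 3 \<le> - (4 / 3) / (1 + t) ^ 3" if "0 \<le> s" "s \<le> t" for s t :: real
      using that by (simp add: frac_le power_mono)
    show "(\<lambda>n. - (4 / 3) / (1 + real n) ^ 3) \<longlonglongrightarrow> 0"
    proof -
      have "(\<lambda>n. - (4 / 3) * inverse (real (Suc n)) ^ 3) \<longlonglongrightarrow> - (4 / 3) * 0 ^ 3"
        by (intro tendsto_intros LIMSEQ_inverse_real_of_nat)
      moreover have "(0::real) ^ 3 = 0" by simp
      ultimately show ?thesis by (simp only: divide_inverse power_inverse of_nat_Suc mult_zero_right)
    qed
    fix g assume g: "\<And>t. 0 \<le> t \<Longrightarrow> (\<lambda>X. prof 3 t X - g X) \<in> sobolev 1"
      "\<And>t. 0 \<le> t \<Longrightarrow> sobolev_norm 1 (\<lambda>X. prof 3 t X - g X) \<le> sqrt (index_count 1) * (28 * q * S * - (- (4 / 3) / (1 + t) ^ 3))"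
    show ?thesis
    proof (rule that[OF g(1)])
      fix t :: real assume t: "0 \<le> t"
      have e: "a * (28 * q * S * - (- (4 / 3) / X)) = 112 / 3 * a * q * S / X" for a X :: real by simp
      have "sobolev_norm 1 (\<lambda>X. prof 3 t X - g X) \<le> sqrt (index_count 1) * (28 * q * S * - (- (4 / 3) / (1 + t) ^ 3))" by (rule g(2)[OF t])
      also have "\<dots> = 112 / 3 * sqrt (index_count 1) * q * S / (1 + t) ^ 3" by (rule e)
      also have "\<dots> \<le> 60 * sqrt (index_count 1) * q * sobolev_vec_norm 7 u_in / japanese_bracket t ^ 3"
      proof (rule frac_le)
        show "112 / 3 * sqrt (index_count 1) * q * S \<le> 60 * sqrt (index_count 1) * q * sobolev_vec_norm 7 u_in"
          using S q by (intro mult_mono) auto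
        show "0 \<le> 60 * sqrt (index_count 1) * q * sobolev_vec_norm 7 u_in" using S q by simp
        show "0 < japanese_bracket t ^ 3" by (rule zero_less_power[OF japanese_pos])
        show "japanese_bracket t ^ 3 \<le> (1 + t) ^ 3"
          by (rule power_mono[OF japanese_le[OF t] less_imp_le[OF japanese_pos]])
      qed
      finally show "sobolev_norm 1 (\<lambda>X. prof 3 t X - g X)
        \<le> 60 * sqrt (index_count 1) * sqrt (index_count 1 * 4 ^ 7) * sobolev_vec_norm 7 u_in / japanese_bracket t ^ 3"
        unfolding q_def .
    qed
  qed
qed

text \<open>The moving frame preserves the L2 norm, so the first summand is at most the second. The
  4 is 2 for the two summands times the 2 of \<open>u2_decay\<close>.\<close>

lemma u2_bound:
  assumes t: "0 \<le> t"
  shows "L2_norm (x_nonzero (uc 2 t)) + sobolev_norm 3 (prof 2 t)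
    \<le> 4 * sqrt (index_count 3 * 4 ^ 7) * sobolev_norm 7 (component u_in 2) / (japanese_bracket t)\<^sup>2"
proof -
  have p: "prof 2 t \<in> sobolev 3" using sobolev_mono[OF _ prof_sobolev[OF t]] by simp
  note x = x_nonzero_L2[OF u_L2[OF t, of 2]]
  have "L2_norm (x_nonzero (uc 2 t)) = L2_norm (prof 2 t)"
    unfolding prof_def using moving_frame_L2[OF x, of t] by (simp add: L2_norm_eq x)
  then have "L2_norm (x_nonzero (uc 2 t)) \<le> sobolev_norm 3 (prof 2 t)" using L2_norm_le_sobolev_norm[OF p] by simp
  then have "L2_norm (x_nonzero (uc 2 t)) + sobolev_norm 3 (prof 2 t) \<le> 2 * sobolev_norm 3 (prof 2 t)" by simp
  also have "\<dots> \<le> 2 * (2 / (1 + t\<^sup>2) * sqrt (index_count 3 * 4 ^ 7) * sobolev_norm 7 (component u_in 2))"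
    using u2_decay[OF t] by simp
  also have "\<dots> = 4 * sqrt (index_count 3 * 4 ^ 7) * sobolev_norm 7 (component u_in 2) / (japanese_bracket t)\<^sup>2"
    using one_plus_sq_pos[of t] by (simp add: japanese_bracket_def)
  finally show ?thesis .
qed

end

text \<open>Membership claims accompany the bounds because the norms are meaningful only on the
  respective spaces. The averages agree almost everywhere, as the solution is constrained only up to
  null sets at each time.\<close>

theorem proposition1p1:
  "\<exists>C::real. \<forall>(u_in :: vector_field) (u :: real \<Rightarrow> vector_field) (p :: real \<Rightarrow> scalar_field).
     u_in \<in> sobolev_vec 7 \<longrightarrow> divergence_free u_in \<longrightarrow> linearized_euler_solution u_in u p \<longrightarrow>
     (\<exists>u_inf :: vector_field. (\<forall>X. u_inf X $ 2 = 0) \<and>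
       (\<forall>t\<ge>0.
          x_nonzero (component (u t) 2) \<in> L2_space \<and>
          moving_frame t (x_nonzero (component (u t) 2)) \<in> sobolev 3 \<and>
          L2_norm (x_nonzero (component (u t) 2))
            + sobolev_norm 3 (moving_frame t (x_nonzero (component (u t) 2)))
            \<le> C * japanese_bracket t powi (-2) * sobolev_norm 7 (component u_in 2) \<and>
          (\<lambda>X. moving_frame t (x_nonzero (component (u t) 1)) X - u_inf X $ 1) \<in> sobolev 1 \<and>
          sobolev_norm 1 (\<lambda>X. moving_frame t (x_nonzero (component (u t) 1)) X - u_inf X $ 1)
            \<le> C * japanese_bracket t powi (-1) * sobolev_vec_norm 7 u_in \<and>
          (\<lambda>X. moving_frame t (x_nonzero (component (u t) 3)) X - u_inf X $ 3) \<in> sobolev 1 \<and>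
          sobolev_norm 1 (\<lambda>X. moving_frame t (x_nonzero (component (u t) 3)) X - u_inf X $ 3)
            \<le> C * japanese_bracket t powi (-3) * sobolev_vec_norm 7 u_in)) \<and>
     (\<forall>t\<ge>0. AE Y in lborel.
        x_average (component (u t) 1) Y
          = x_average (component u_in 1) Y - t * x_average (component u_in 2) Y \<and>
        x_average (component (u t) 2) Y = x_average (component u_in 2) Y \<and>
        x_average (component (u t) 3) Y = x_average (component u_in 3) Y)"
proof -
  \<comment> \<open>Both constants depend only on numbers of multi-indices, hence not on the time,
    the data or the solution.\<close>
  define C1 where "C1 = 4 * sqrt (index_count 3 * 4 ^ 7)"
  define C2 where "C2 = 60 * sqrt (index_count 1) * sqrt (index_count 1 * 4 ^ 7)"
  have C: "C1 \<le> max C1 C2" "C2 \<le> max C1 C2" by auto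
  have scale: "a \<le> max C1 C2 * japanese_bracket t powi (- int n) * N"
    if "a \<le> c * N / japanese_bracket t ^ n" "c \<le> max C1 C2" "0 \<le> N" for a c t N n
  proof -
    have "c * N / japanese_bracket t ^ n \<le> max C1 C2 * N / japanese_bracket t ^ n"
      using that japanese_pos[of t] by (intro divide_right_mono mult_right_mono) auto
    then show ?thesis using that(1) by (simp add: power_int_minus field_simps)
  qed
  show ?thesis
  proof (rule exI[of _ "max C1 C2"], intro allI impI)
    fix u_in :: vector_field and u p
    assume "u_in \<in> sobolev_vec 7" "linearized_euler_solution u_in u p"
    then interpret linear_euler u_in u p by unfold_locales
    obtain g1 where g1: "\<And>t. 0 \<le> t \<Longrightarrow> (\<lambda>X. prof 1 t X - g1 X) \<in> sobolev 1"
      "\<And>t. 0 \<le> t \<Longrightarrow> sobolev_norm 1 (\<lambda>X. prof 1 t X - g1 X) \<le> C2 * sobolev_vec_norm 7 u_in / japanese_bracket t"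
      using final_state_1 unfolding C2_def by blast
    obtain g3 where g3: "\<And>t. 0 \<le> t \<Longrightarrow> (\<lambda>X. prof 3 t X - g3 X) \<in> sobolev 1"
      "\<And>t. 0 \<le> t \<Longrightarrow> sobolev_norm 1 (\<lambda>X. prof 3 t X - g3 X) \<le> C2 * sobolev_vec_norm 7 u_in / japanese_bracket t ^ 3"
      using final_state_3 unfolding C2_def by blast
    define u_inf :: vector_field where "u_inf X = vector [g1 X, 0, g3 X]" for X
    have ui: "u_inf X $ 1 = g1 X" "u_inf X $ 2 = 0" "u_inf X $ 3 = g3 X" for X by (simp_all add: u_inf_def)
    have vn: "0 \<le> sobolev_vec_norm 7 u_in" using sobolev_norm_nonneg u2_in_le by (rule order_trans)
    show "(\<exists>u_inf :: vector_field. (\<forall>X. u_inf X $ 2 = 0) \<and>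
       (\<forall>t\<ge>0.
          x_nonzero (component (u t) 2) \<in> L2_space \<and>
          moving_frame t (x_nonzero (component (u t) 2)) \<in> sobolev 3 \<and>
          L2_norm (x_nonzero (component (u t) 2))
            + sobolev_norm 3 (moving_frame t (x_nonzero (component (u t) 2)))
            \<le> max C1 C2 * japanese_bracket t powi (-2) * sobolev_norm 7 (component u_in 2) \<and>
          (\<lambda>X. moving_frame t (x_nonzero (component (u t) 1)) X - u_inf X $ 1) \<in> sobolev 1 \<and>
          sobolev_norm 1 (\<lambda>X. moving_frame t (x_nonzero (component (u t) 1)) X - u_inf X $ 1)
            \<le> max C1 C2 * japanese_bracket t powi (-1) * sobolev_vec_norm 7 u_in \<and>
          (\<lambda>X. moving_frame t (x_nonzero (component (u t) 3)) X - u_inf X $ 3) \<in> sobolev 1 \<and>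
          sobolev_norm 1 (\<lambda>X. moving_frame t (x_nonzero (component (u t) 3)) X - u_inf X $ 3)
            \<le> max C1 C2 * japanese_bracket t powi (-3) * sobolev_vec_norm 7 u_in)) \<and>
     (\<forall>t\<ge>0. AE Y in lborel.
        x_average (component (u t) 1) Y
          = x_average (component u_in 1) Y - t * x_average (component u_in 2) Y \<and>
        x_average (component (u t) 2) Y = x_average (component u_in 2) Y \<and>
        x_average (component (u t) 3) Y = x_average (component u_in 3) Y)"
      unfolding prof_def[symmetric]
    proof (intro conjI exI[of _ u_inf] allI impI)
      fix t :: real assume t: "0 \<le> t"
      show "x_nonzero (uc 2 t) \<in> L2_space" by (intro x_nonzero_L2 u_L2 t)
      show "prof 2 t \<in> sobolev 3" using sobolev_mono[OF _ prof_sobolev[OF t]] by simp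
      show "L2_norm (x_nonzero (uc 2 t)) + sobolev_norm 3 (prof 2 t)
          \<le> max C1 C2 * japanese_bracket t powi (-2) * sobolev_norm 7 (component u_in 2)"
        using scale[OF u2_bound[OF t, folded C1_def] C(1) sobolev_norm_nonneg] by simp
      show "(\<lambda>X. prof 1 t X - u_inf X $ 1) \<in> sobolev 1" "(\<lambda>X. prof 3 t X - u_inf X $ 3) \<in> sobolev 1"
        unfolding ui using g1(1)[OF t] g3(1)[OF t] by auto
      show "sobolev_norm 1 (\<lambda>X. prof 1 t X - u_inf X $ 1) \<le> max C1 C2 * japanese_bracket t powi (-1) * sobolev_vec_norm 7 u_in"
        unfolding ui using scale[of _ C2 _ t 1, OF _ C(2) vn] g1(2)[OF t] by simp
      show "sobolev_norm 1 (\<lambda>X. prof 3 t X - u_inf X $ 3) \<le> max C1 C2 * japanese_bracket t powi (-3) * sobolev_vec_norm 7 u_in"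
        unfolding ui using scale[OF g3(2)[OF t] C(2) vn] by simp
      show "AE Y in lborel.
          x_average (uc 1 t) Y = x_average (component u_in 1) Y - t * x_average (component u_in 2) Y \<and>
          x_average (uc 2 t) Y = x_average (component u_in 2) Y \<and>
          x_average (uc 3 t) Y = x_average (component u_in 3) Y"
        using average_1[OF t] average_23[OF t index3_neq(1)] average_23[OF t index3_neq(2)] by eventually_elim simp
    qed (rule ui)
  qed
qed

end
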